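(* Let $\Omega_x$, $\Omega_t$, $\mu$, $f$ satisfy the standing assumptions given in the context. Then there exists a unique $u\in W$ such that $$(\nabla u,\nabla v)_{\mathcal O}+(\mu u,v)_{\mathcal O}=\langle f,v\rangle_{W'\times W}\qquad\forall v\in W .$$ Moreover, for every integer $k\ge 0$ the solution belongs to $H^k(\Omega_t;H_0^1(\Omega_x))$ and satisfies $$\sum_{|\alpha|\le k}\|\partial_t^{\alpha}u\|_{L^2(\Omega_t;H_0^1(\Omega_x))}\lesssim \sum_{|\alpha|\le \min(k,1)}\|\partial_t^{\alpha}f\|_{L^2(\Omega_t;H^{-1}(\Omega_x))}$$ with a constant independent of $t$. If, in addition, $m\ge 2$, $f\in H^k(\Omega_t;H^{m-2}(\Omega_x))$, $\mu_i\in W^{m-2,\infty}(\Omega_x)$ for $i=0,\dots,N_t$, and the operator $A(t):=-\Delta+\mu(\cdot,t)$ satisfies a uniform elliptic shift property of order $m$, i.e., for all $t\in\Omega_t$ and all $g\in H^{m-2}(\Omega_x)$ the solution $w\in H_0^1(\Omega_x)$ of $A(t)w=g$ satisfies $\|w\|_{H^m(\Omega_x)}\lesssim\|g\|_{H^{m-2}(\Omega_x)}$ with a constant independent of $t$, then for every integer $k\ge 0$ the solution belongs to $H^k(\Omega_t;H^m(\Omega_x))$ and satisfies $$\sum_{|\alpha|\le k}\|\partial_t^{\alpha}u\|_{L^2(\Omega_t;H^m(\Omega_x))}\lesssim \sum_{|\alpha|\le \min(k,1)}\|\partial_t^{\alpha}f\|_{L^2(\Omega_t;H^{m-2}(\Omega_x))}$$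 with a constant independent of $t$.
   Context: Setting. $d\in\{2,3\}$, $N_t\ge 1$ is an integer, $\Omega_t=[0,1]^{N_t}$, $\mathcal O=\Omega_x\times\Omega_t$. Differential operators $\nabla,\Delta$ act in the variable $x\in\Omega_x$; $\partial_t^\alpha$ denotes (weak, Bochner-space-valued) derivatives in $t\in\Omega_t$ for multi-indices $\alpha\in\mathbb N_0^{N_t}$. Standing assumptions. (1) $\Omega_x\subset\mathbb R^d$ is either a convex polygonal/polyhedral domain or a bounded $C^{1,1}$ domain. (2) $\mu(x,t)=\mu_0(x)+\sum_{i=1}^{N_t}t_i\mu_i(x)$ with $\mu_i\in L^\infty(\Omega_x)$ for $i=0,\dots,N_t$, and there are constants $0<\mu_{\min}\le\mu_{\max}<\infty$ with $\mu_{\min}\le\mu(x,t)\le\mu_{\max}$ for a.e. $(x,t)\in\mathcal O$. (3) $f(x,t)=f_0(x)+\sum_{i=1}^{N_t}t_i f_i(x)$ with $f_i\in H^{-1}(\Omega_x)$ for $i=0,\dots,N_t$. Notation. $W=L^2(\Omega_t;H_0^1(\Omega_x))$ with norm $\|v\|_W=\|\nabla v\|_{L^2(\mathcal O)}$, and $W'$ is its dual, identified with $L^2(\Omega_t;H^{-1}(\Omega_x))$; $(v,w)_{\mathcal O}=\int_{\Omega_t}\int_{\Omega_x}vw\,dx\,dt$; $\langle F,v\rangle_{W'\times W}=\int_{\Omega_t}\langle F(\cdot,t),v(\cdot,t)\rangle_{H^{-1}(\Omega_x)\times H_0^1(\Omega_x)}\,dt$. The variational problem is the weak form of $-\Delta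 u+\mu u=f$ in $\mathcal O$ with homogeneous Dirichlet conditions on $\partial\Omega_x$. $a\lesssim b$ means $a\le Cb$ with a generic constant $C>0$ that may depend on the domain geometry and the problem coefficients (here the $\mu_i$, $\mu_{\min}$, $\mu_{\max}$, as well as $N_t$, $k$, $m$), but not on $f$ or $u$. *)

theory Defs
  imports "HOL-Analysis.Analysis"
begin

section \<open>Multi-indices and test functions\<close>

definition multi_indices :: "nat \<Rightarrow> ('n::finite \<Rightarrow> nat) set" where
  "multi_indices k = {\<alpha>. sum \<alpha> UNIV \<le> k}"

lemma finite_multi_indices: "finite (multi_indices k :: ('n::finite \<Rightarrow> nat) set)"
proof (rule finite_subset)
  show "multi_indices k \<subseteq> (UNIV :: 'n set) \<rightarrow>\<^sub>E {..k}"
  proof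
    fix \<alpha> :: "'n \<Rightarrow> nat"
    assume "\<alpha> \<in> multi_indices k"
    then have "sum \<alpha> UNIV \<le> k" by (simp add: multi_indices_def)
    moreover have "\<alpha> i \<le> sum \<alpha> UNIV" for i by (rule member_le_sum) simp_all
    ultimately have "\<alpha> i \<le> k" for i using le_trans by blast
    then show "\<alpha> \<in> (UNIV :: 'n set) \<rightarrow>\<^sub>E {..k}" by (simp add: PiE_iff)
  qed
qed (simp add: finite_PiE)

definition unit_index :: "'n \<Rightarrow> 'n \<Rightarrow> nat" where
  "unit_index i = (\<lambda>j. if j = i then 1 else 0)"

definition partial_deriv :: "'n::finite \<Rightarrow> (real^'n \<Rightarrow> real) \<Rightarrow> real^'n \<Rightarrow> real" where
  "partial_deriv i \<phi> = (\<lambda>x. frechet_derivative \<phi> (at x) (axis i 1))"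

definition iter_partial :: "'n::finite list \<Rightarrow> (real^'n \<Rightarrow> real) \<Rightarrow> real^'n \<Rightarrow> real" where
  "iter_partial is \<phi> = foldr partial_deriv is \<phi>"

text \<open>The chosen list contains each direction \<open>i\<close> exactly \<open>\<alpha> i\<close> times; for smooth functions
  the order of differentiation is irrelevant.\<close>
definition multi_partial :: "('n::finite \<Rightarrow> nat) \<Rightarrow> (real^'n \<Rightarrow> real) \<Rightarrow> real^'n \<Rightarrow> real" where
  "multi_partial \<alpha> \<phi> = iter_partial (SOME is. \<forall>i. count_list is i = \<alpha> i) \<phi>"

definition test_functions :: "(real^'n::finite) set \<Rightarrow> (real^'n \<Rightarrow> real) set" where
  "test_functions U = {\<phi>. (\<forall>is x. iter_partial is \<phi> differentiable (at x)) \<and>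
     compact (closure {x. \<phi> x \<noteq> 0}) \<and> closure {x. \<phi> x \<noteq> 0} \<subseteq> U}"

section \<open>Domains\<close>

definition convex_polyhedral_domain :: "(real^'d::finite) set \<Rightarrow> bool" where
  "convex_polyhedral_domain \<Omega> \<longleftrightarrow> \<Omega> \<noteq> {} \<and> (\<exists>P. polytope P \<and> \<Omega> = interior P)"

definition C11_function :: "(real^'d::finite \<Rightarrow> real) \<Rightarrow> bool" where
  "C11_function \<gamma> \<longleftrightarrow> (\<exists>G L. (\<forall>x. (\<gamma> has_derivative (\<lambda>h. G x \<bullet> h)) (at x)) \<and> L-lipschitz_on UNIV G)"

text \<open>Near each boundary point, \<open>\<Omega>\<close> is the strict epigraph of a \<open>C\<^sup>1\<^sup>,\<^sup>1\<close> function in a rotated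
  coordinate system whose last axis is the unit vector \<open>e\<close>.  A function of the remaining
  \<open>d - 1\<close> coordinates is encoded as a function on the whole space that is constant along \<open>e\<close>.\<close>
definition C11_domain :: "(real^'d::finite) set \<Rightarrow> bool" where
  "C11_domain \<Omega> \<longleftrightarrow> \<Omega> \<noteq> {} \<and> open \<Omega> \<and> connected \<Omega> \<and> bounded \<Omega> \<and>
     (\<forall>p \<in> frontier \<Omega>. \<exists>r>0. \<exists>e \<gamma>. norm e = 1 \<and> C11_function \<gamma> \<and>
        (\<forall>y s. \<gamma> (y + s *\<^sub>R e) = \<gamma> y) \<and>
        \<Omega> \<inter> ball p r = {x \<in> ball p r. \<gamma> x < x \<bullet> e})"

section \<open>Sobolev spaces in the space variable\<close>

text \<open>All function spaces are represented by the everywhere defined representatives of their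
  elements, so that norms are seminorms and equality in the space is equality almost everywhere.\<close>

definition L2 :: "(real^'d::finite) set \<Rightarrow> (real^'d \<Rightarrow> real) set" where
  "L2 \<Omega> = {w \<in> borel_measurable (lebesgue_on \<Omega>). integrable (lebesgue_on \<Omega>) (\<lambda>x. (w x)\<^sup>2)}"

definition Linf :: "(real^'d::finite) set \<Rightarrow> (real^'d \<Rightarrow> real) set" where
  "Linf \<Omega> = {w \<in> borel_measurable (lebesgue_on \<Omega>). \<exists>C. AE x in lebesgue_on \<Omega>. \<bar>w x\<bar> \<le> C}"

definition locally_integrable :: "(real^'d::finite) set \<Rightarrow> (real^'d \<Rightarrow> real) \<Rightarrow> bool" where
  "locally_integrable \<Omega> w \<longleftrightarrow> (\<forall>K. compact K \<and> K \<subseteq> \<Omega> \<longrightarrow> set_integrable lebesgue K w)"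

definition is_weak_deriv ::
  "(real^'d::finite) set \<Rightarrow> ('d \<Rightarrow> nat) \<Rightarrow> (real^'d \<Rightarrow> real) \<Rightarrow> (real^'d \<Rightarrow> real) \<Rightarrow> bool" where
  "is_weak_deriv \<Omega> \<alpha> w g \<longleftrightarrow> locally_integrable \<Omega> w \<and> locally_integrable \<Omega> g \<and>
     (\<forall>\<phi> \<in> test_functions \<Omega>.
        (LINT x|lebesgue_on \<Omega>. w x * multi_partial \<alpha> \<phi> x) =
        (-1) ^ (sum \<alpha> UNIV) * (LINT x|lebesgue_on \<Omega>. g x * \<phi> x))"

definition weak_deriv ::
  "(real^'d::finite) set \<Rightarrow> ('d \<Rightarrow> nat) \<Rightarrow> (real^'d \<Rightarrow> real) \<Rightarrow> real^'d \<Rightarrow> real" where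
  "weak_deriv \<Omega> \<alpha> w = (SOME g. is_weak_deriv \<Omega> \<alpha> w g)"

definition weak_grad :: "(real^'d::finite) set \<Rightarrow> (real^'d \<Rightarrow> real) \<Rightarrow> real^'d \<Rightarrow> real^'d" where
  "weak_grad \<Omega> w = (\<lambda>x. \<chi> i. weak_deriv \<Omega> (unit_index i) w x)"

definition Winf :: "nat \<Rightarrow> (real^'d::finite) set \<Rightarrow> (real^'d \<Rightarrow> real) set" where
  "Winf m \<Omega> = {w \<in> Linf \<Omega>. \<forall>\<alpha> \<in> multi_indices m. \<exists>g \<in> Linf \<Omega>. is_weak_deriv \<Omega> \<alpha> w g}"

text \<open>A seminormed space of functions \<open>'a \<Rightarrow> real\<close> with pointwise operations.  Besides spaces of
  functions on \<open>\<Omega>\<close>, this also covers spaces of functionals.\<close>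
record 'a fun_space =
  elems :: "('a \<Rightarrow> real) set"
  fnorm :: "('a \<Rightarrow> real) \<Rightarrow> real"

definition Hm :: "nat \<Rightarrow> (real^'d::finite) set \<Rightarrow> (real^'d) fun_space" where
  "Hm m \<Omega> = \<lparr> elems = {w \<in> L2 \<Omega>. \<forall>\<alpha> \<in> multi_indices m. \<exists>g \<in> L2 \<Omega>. is_weak_deriv \<Omega> \<alpha> w g},
     fnorm = (\<lambda>w. sqrt (\<Sum>\<alpha> \<in> multi_indices m. LINT x|lebesgue_on \<Omega>. (weak_deriv \<Omega> \<alpha> w x)\<^sup>2)) \<rparr>"

definition H10 :: "(real^'d::finite) set \<Rightarrow> (real^'d) fun_space" where
  "H10 \<Omega> = \<lparr> elems = {w \<in> elems (Hm 1 \<Omega>). \<exists>\<phi>. (\<forall>n. \<phi> n \<in> test_functions \<Omega>) \<and>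
                 (\<lambda>n::nat. fnorm (Hm 1 \<Omega>) (\<lambda>x. \<phi> n x - w x)) \<longlonglongrightarrow> 0},
     fnorm = (\<lambda>w. sqrt (LINT x|lebesgue_on \<Omega>. (norm (weak_grad \<Omega> w x))\<^sup>2)) \<rparr>"

text \<open>Functionals only matter on the elements of \<open>H10 \<Omega>\<close>; their other values are irrelevant.\<close>
definition Hminus1 :: "(real^'d::finite) set \<Rightarrow> (real^'d \<Rightarrow> real) fun_space" where
  "Hminus1 \<Omega> = \<lparr> elems = {F.
       (\<forall>v \<in> elems (H10 \<Omega>). \<forall>w \<in> elems (H10 \<Omega>). F (\<lambda>x. v x + w x) = F v + F w) \<and>
       (\<forall>c. \<forall>v \<in> elems (H10 \<Omega>). F (\<lambda>x. c * v x) = c * F v) \<and>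
       (\<exists>C. \<forall>v \<in> elems (H10 \<Omega>). \<bar>F v\<bar> \<le> C * fnorm (H10 \<Omega>) v)},
     fnorm = (\<lambda>F. SUP v \<in> {v \<in> elems (H10 \<Omega>). fnorm (H10 \<Omega>) v \<le> 1}. \<bar>F v\<bar>) \<rparr>"

text \<open>The functional \<open>F\<close> is the image of the function \<open>g\<close> under the embedding of \<open>L2 \<Omega>\<close> into
  \<open>Hminus1 \<Omega>\<close>.\<close>
definition represents ::
  "(real^'d::finite) set \<Rightarrow> (real^'d \<Rightarrow> real) \<Rightarrow> ((real^'d \<Rightarrow> real) \<Rightarrow> real) \<Rightarrow> bool" where
  "represents \<Omega> g F \<longleftrightarrow> (\<forall>v \<in> elems (H10 \<Omega>). F v = (LINT x|lebesgue_on \<Omega>. g x * v x))"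

section \<open>Bochner spaces in the parameter variable\<close>

text \<open>The library's Bochner integral needs a Banach space given by a type, whereas the spaces
  above depend on the set \<open>\<Omega>\<close>.  The following definitions are its relativisation to a
  \<open>fun_space\<close>.\<close>

definition simple_into :: "'m measure \<Rightarrow> 'a fun_space \<Rightarrow> ('m \<Rightarrow> 'a \<Rightarrow> real) \<Rightarrow> bool" where
  "simple_into M X s \<longleftrightarrow> simple_function M s \<and> s ` space M \<subseteq> elems X"

definition simple_integral :: "'m measure \<Rightarrow> ('m \<Rightarrow> 'a \<Rightarrow> real) \<Rightarrow> 'a \<Rightarrow> real" where
  "simple_integral M s = (\<lambda>x. \<Sum>y \<in> s ` space M. measure M {t \<in> space M. s t = y} * y x)"

definition strongly_measurable ::
  "'m measure \<Rightarrow> 'a fun_space \<Rightarrow> ('m \<Rightarrow> 'a \<Rightarrow> real) \<Rightarrow> bool" where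
  "strongly_measurable M X u \<longleftrightarrow> (AE t in M. u t \<in> elems X) \<and>
     (\<exists>s. (\<forall>n. simple_into M X (s n)) \<and>
          (AE t in M. (\<lambda>n::nat. fnorm X (\<lambda>x. s n t x - u t x)) \<longlonglongrightarrow> 0))"

text \<open>Used for finite complete measures only, so that every simple function is integrable.\<close>
definition has_bochner_integral_in ::
  "'m measure \<Rightarrow> 'a fun_space \<Rightarrow> ('m \<Rightarrow> 'a \<Rightarrow> real) \<Rightarrow> ('a \<Rightarrow> real) \<Rightarrow> bool" where
  "has_bochner_integral_in M X u J \<longleftrightarrow> strongly_measurable M X u \<and> J \<in> elems X \<and>
     (\<exists>s. (\<forall>n. simple_into M X (s n)) \<and>
          (\<lambda>n::nat. \<integral>\<^sup>+t. ennreal (fnorm X (\<lambda>x. s n t x - u t x)) \<partial>M) \<longlonglongrightarrow> 0 \<and>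
          (\<lambda>n. fnorm X (\<lambda>x. simple_integral M (s n) x - J x)) \<longlonglongrightarrow> 0)"

definition param_box :: "(real^'t::finite) set" where
  "param_box = {t. \<forall>i. 0 \<le> t $ i \<and> t $ i \<le> 1}"

definition bochner_L2 :: "'a fun_space \<Rightarrow> (real^'t::finite \<Rightarrow> 'a \<Rightarrow> real) set" where
  "bochner_L2 X = {u. strongly_measurable (lebesgue_on param_box) X u \<and>
     integrable (lebesgue_on param_box) (\<lambda>t. (fnorm X (u t))\<^sup>2)}"

definition bochner_L2_norm :: "'a fun_space \<Rightarrow> (real^'t::finite \<Rightarrow> 'a \<Rightarrow> real) \<Rightarrow> real" where
  "bochner_L2_norm X u = sqrt (LINT t|lebesgue_on param_box. (fnorm X (u t))\<^sup>2)"

definition is_bochner_weak_deriv ::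
  "'a fun_space \<Rightarrow> ('t::finite \<Rightarrow> nat) \<Rightarrow> (real^'t \<Rightarrow> 'a \<Rightarrow> real) \<Rightarrow> (real^'t \<Rightarrow> 'a \<Rightarrow> real) \<Rightarrow> bool" where
  "is_bochner_weak_deriv X \<alpha> u v \<longleftrightarrow> (\<forall>\<phi> \<in> test_functions (interior param_box). \<exists>J.
     has_bochner_integral_in (lebesgue_on param_box) X (\<lambda>t x. multi_partial \<alpha> \<phi> t * u t x) J \<and>
     has_bochner_integral_in (lebesgue_on param_box) X (\<lambda>t x. \<phi> t * v t x)
       (\<lambda>x. (-1) ^ (sum \<alpha> UNIV) * J x))"

definition bochner_weak_deriv ::
  "'a fun_space \<Rightarrow> ('t::finite \<Rightarrow> nat) \<Rightarrow> (real^'t \<Rightarrow> 'a \<Rightarrow> real) \<Rightarrow> real^'t \<Rightarrow> 'a \<Rightarrow> real" where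
  "bochner_weak_deriv X \<alpha> u = (SOME v. is_bochner_weak_deriv X \<alpha> u v)"

definition bochner_Hk :: "nat \<Rightarrow> 'a fun_space \<Rightarrow> (real^'t::finite \<Rightarrow> 'a \<Rightarrow> real) set" where
  "bochner_Hk k X = {u \<in> bochner_L2 X.
     \<forall>\<alpha> \<in> multi_indices k. \<exists>v \<in> bochner_L2 X. is_bochner_weak_deriv X \<alpha> u v}"

definition bochner_deriv_sum :: "nat \<Rightarrow> 'a fun_space \<Rightarrow> (real^'t::finite \<Rightarrow> 'a \<Rightarrow> real) \<Rightarrow> real" where
  "bochner_deriv_sum k X u =
     (\<Sum>\<alpha> \<in> multi_indices k. bochner_L2_norm X (bochner_weak_deriv X \<alpha> u))"

section \<open>The parametric problem\<close>

definition affine_param :: "('a \<Rightarrow> real) \<Rightarrow> ('t::finite \<Rightarrow> 'a \<Rightarrow> real) \<Rightarrow> real^'t \<Rightarrow> 'a \<Rightarrow> real" where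
  "affine_param a0 a t = (\<lambda>y. a0 y + (\<Sum>i\<in>UNIV. t $ i * a i y))"

definition W_space :: "(real^'d::finite) set \<Rightarrow> (real^'t::finite \<Rightarrow> real^'d \<Rightarrow> real) set" where
  "W_space \<Omega> = bochner_L2 (H10 \<Omega>)"

definition weak_solution ::
  "(real^'d::finite) set \<Rightarrow> (real^'t::finite \<Rightarrow> real^'d \<Rightarrow> real) \<Rightarrow>
   (real^'t \<Rightarrow> (real^'d \<Rightarrow> real) \<Rightarrow> real) \<Rightarrow> (real^'t \<Rightarrow> real^'d \<Rightarrow> real) \<Rightarrow> bool" where
  "weak_solution \<Omega> \<mu> f u \<longleftrightarrow> u \<in> W_space \<Omega> \<and> (\<forall>v \<in> W_space \<Omega>.
     (LINT t|lebesgue_on param_box. LINT x|lebesgue_on \<Omega>.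
        weak_grad \<Omega> (u t) x \<bullet> weak_grad \<Omega> (v t) x) +
     (LINT t|lebesgue_on param_box. LINT x|lebesgue_on \<Omega>. \<mu> t x * u t x * v t x) =
     (LINT t|lebesgue_on param_box. f t (v t)))"

text \<open>The weak form of \<open>A(t) w = g\<close> for a single parameter value, where \<open>c\<close> is
  \<open>\<mu>(\<cdot>, t)\<close>.\<close>
definition solves_at ::
  "(real^'d::finite) set \<Rightarrow> (real^'d \<Rightarrow> real) \<Rightarrow> (real^'d \<Rightarrow> real) \<Rightarrow> (real^'d \<Rightarrow> real) \<Rightarrow> bool" where
  "solves_at \<Omega> c g w \<longleftrightarrow> w \<in> elems (H10 \<Omega>) \<and> (\<forall>v \<in> elems (H10 \<Omega>).
     (LINT x|lebesgue_on \<Omega>. weak_grad \<Omega> w x \<bullet> weak_grad \<Omega> v x) +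
     (LINT x|lebesgue_on \<Omega>. c x * w x * v x) = (LINT x|lebesgue_on \<Omega>. g x * v x))"

definition uniform_elliptic_shift ::
  "nat \<Rightarrow> (real^'d::finite) set \<Rightarrow> (real^'t::finite \<Rightarrow> real^'d \<Rightarrow> real) \<Rightarrow> bool" where
  "uniform_elliptic_shift m \<Omega> \<mu> \<longleftrightarrow> (\<exists>C>0. \<forall>t \<in> param_box. \<forall>g \<in> elems (Hm (m - 2) \<Omega>). \<forall>w.
     solves_at \<Omega> (\<mu> t) g w \<longrightarrow>
       w \<in> elems (Hm m \<Omega>) \<and> fnorm (Hm m \<Omega>) w \<le> C * fnorm (Hm (m - 2) \<Omega>) g)"

end

theory Submission
  imports Defs
begin

text \<open>The proof rests on one observation about the abstract situation of the locale \<open>param_solver\<close>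
below: an invertible operator \<open>A(t)\<close> between two normed spaces \<open>X\<close> and \<open>Y\<close> depends on \<open>t\<close> in an
affine way, \<open>A(s) w = A(t) w + (\<Sum>i. (s\<^sub>i - t\<^sub>i) \<mu>\<^sub>i w)\<close>, and \<open>A(t)\<close> has an inverse that is bounded
uniformly in \<open>t\<close>.  If \<open>A(t) u(t) = y(t)\<close>, then subtracting two such equations shows that \<open>u\<close> is Lipschitz
when \<open>y\<close> is, and that \<open>u\<close> is differentiable when \<open>y\<close> is, its partial derivatives being the solutions
of \<open>A(t) (\<partial>\<^sub>i u) = \<partial>\<^sub>i y - \<mu>\<^sub>i u\<close>.  These have the same form, so that \<open>u\<close> has as many derivatives as
\<open>y\<close>, with bounds that only depend on the bounds for \<open>y\<close> (\<open>solution_smooth_curve\<close>).  An affine datum has all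
derivatives, and its size is measured by its coefficients.  These are controlled by the \<open>L\<^sup>2\<close> norms of the
datum and of its first derivatives (\<open>affine_bound_le_deriv_sum\<close>), which explains why the right-hand
side of the estimates contains no derivative of order greater than one.  Both estimates are instances of
the resulting theorem \<open>parametric_regularity\<close>.

In the first one, \<open>A(t)\<close> maps \<open>H10\<close> to its dual.  The energy form
\<open>(\<nabla>v, \<nabla>w) + (\<mu>(t) v, w)\<close> is an inner product on \<open>H10\<close>, equivalent to the inner product of the gradients by
the Poincare inequality and the bounds for \<open>\<mu>\<close>.  The Riesz representation theorem gives the inverse, of norm
at most one (\<open>param_solver_H10\<close>).  The pointwise solution is Lipschitz in \<open>t\<close>, hence lies in \<open>W\<close> and is a weak
solution; testing with the difference of two weak solutions yields uniqueness
(\<open>weak_solution_unique\<close>), so that every weak solution solves the problem for almost every \<open>t\<close>.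

In the second one, \<open>A(t)\<close> maps a subspace of \<open>H\<^sup>m\<close> to \<open>H\<^sup>m\<^sup>-\<^sup>2\<close>; the bounded inverse is the shift property, and
multiplication by \<open>\<mu>\<^sub>i\<close> is bounded on \<open>H\<^sup>m\<^sup>-\<^sup>2\<close> because functions in \<open>W\<^sup>m\<^sup>-\<^sup>2\<^sup>,\<^sup>\<infinity>\<close> are multipliers
(\<open>Winf_multiplier\<close>, by induction from the product rule for weak derivatives).  The functions \<open>g t\<close> that
represent the affine functional \<open>f t\<close> must be affine in \<open>t\<close> as well (\<open>represented_affine\<close>).

A curve with classical derivatives in the above sense is an element of the Bochner-Sobolev space because
all spaces in question have enough bounded functionals to compute the norm (locale \<open>fspace\<close>).
Applying functionals reduces the existence and the uniqueness of Bochner weak derivatives to the scalar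
case, that is, to integration by parts and to the fundamental lemma of the calculus of variations.\<close>

section \<open>Smooth functions and test functions\<close>

definition smooth :: "(real^'n::finite \<Rightarrow> real) \<Rightarrow> bool" where
  "smooth \<phi> \<longleftrightarrow> (\<forall>is x. iter_partial is \<phi> differentiable (at x))"

lemma iter_partial_simps [simp]:
  "iter_partial [] \<phi> = \<phi>" "iter_partial (i # is) \<phi> = partial_deriv i (iter_partial is \<phi>)"
  by (simp_all add: iter_partial_def)

lemma iter_partial_append: "iter_partial (is @ js) \<phi> = iter_partial is (iter_partial js \<phi>)"
  by (simp add: iter_partial_def)

lemma smooth_iter_partial: "smooth \<phi> \<Longrightarrow> smooth (iter_partial is \<phi>)"
  unfolding smooth_def iter_partial_append[symmetric] by blast

lemma smooth_partial_deriv: "smooth \<phi> \<Longrightarrow> smooth (partial_deriv i \<phi>)"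
  using smooth_iter_partial[of \<phi> "[i]"] by simp

lemma smooth_differentiable: "smooth \<phi> \<Longrightarrow> \<phi> differentiable (at x)"
  unfolding smooth_def by (metis iter_partial_simps(1))

lemma smooth_continuous: "smooth \<phi> \<Longrightarrow> continuous_on S \<phi>"
  by (meson continuous_at_imp_continuous_on differentiable_imp_continuous_within smooth_differentiable)

lemma partial_deriv_eqI: "(\<phi> has_derivative D) (at x) \<Longrightarrow> partial_deriv i \<phi> x = D (axis i 1)"
  by (simp add: partial_deriv_def frechet_derivative_at[symmetric])

lemma has_derivative_partial_derivs:
  fixes \<phi> :: "real^'n::finite \<Rightarrow> real"
  assumes "\<phi> differentiable (at x)"
  shows "(\<phi> has_derivative (\<lambda>h. \<Sum>i\<in>UNIV. h $ i * partial_deriv i \<phi> x)) (at x)"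
proof -
  obtain D where D: "(\<phi> has_derivative D) (at x)" using assms by (auto simp: differentiable_def)
  interpret D: bounded_linear D using D by (rule has_derivative_bounded_linear)
  have "D h = (\<Sum>i\<in>UNIV. h $ i * partial_deriv i \<phi> x)" for h
  proof -
    have "D h = D (\<Sum>i\<in>UNIV. (h $ i) *\<^sub>R axis i 1)"
      using basis_expansion[of h] by (simp add: scalar_mult_eq_scaleR)
    also have "\<dots> = (\<Sum>i\<in>UNIV. h $ i * partial_deriv i \<phi> x)"
      by (simp add: D.sum D.scaleR partial_deriv_eqI[OF D])
    finally show ?thesis .
  qed
  then have "D = (\<lambda>h. \<Sum>i\<in>UNIV. h $ i * partial_deriv i \<phi> x)" by blast
  with D show ?thesis by simp
qed

lemma directional_derivative_partial:
  fixes \<phi> :: "real^'n::finite \<Rightarrow> real"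
  assumes "\<phi> differentiable (at x)"
  shows "((\<lambda>s. \<phi> (x + s *\<^sub>R axis i 1)) has_real_derivative partial_deriv i \<phi> x) (at 0)"
proof -
  obtain D where D: "(\<phi> has_derivative D) (at x)" using assms by (auto simp: differentiable_def)
  interpret D: bounded_linear D using D by (rule has_derivative_bounded_linear)
  have "((\<lambda>s::real. x + s *\<^sub>R axis i (1::real)) has_derivative (\<lambda>s. s *\<^sub>R axis i 1)) (at 0)"
    by (auto intro!: derivative_eq_intros)
  then have "((\<lambda>s. \<phi> (x + s *\<^sub>R axis i 1)) has_derivative (\<lambda>s. D (s *\<^sub>R axis i 1))) (at 0)"
    using has_derivative_compose[of "\<lambda>s::real. x + s *\<^sub>R axis i (1::real)" _ 0 UNIV \<phi> D] D by simp
  then show ?thesis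
    unfolding has_field_derivative_def partial_deriv_eqI[OF D]
    by (rule has_derivative_eq_rhs) (auto simp: D.scaleR mult.commute)
qed

lemma smooth_line_derivative:
  assumes "smooth \<phi>"
  shows "((\<lambda>s. \<phi> (x + s *\<^sub>R axis i 1)) has_real_derivative
    partial_deriv i \<phi> (x + s *\<^sub>R axis i 1)) (at s)"
proof -
  have "((\<lambda>r. \<phi> ((x + s *\<^sub>R axis i 1) + r *\<^sub>R axis i 1)) has_real_derivative
     partial_deriv i \<phi> (x + s *\<^sub>R axis i 1)) (at 0)"
    by (rule directional_derivative_partial[OF smooth_differentiable[OF assms]])
  then show ?thesis
    using DERIV_shift[of "\<lambda>s. \<phi> (x + s *\<^sub>R axis i 1)" _ 0 s] by (simp add: algebra_simps)
qed


text \<open>An algebra of differentiable functions whose generators have their first partial derivatives in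
the algebra consists of smooth functions.  This avoids formulas for derivatives of higher order.\<close>

inductive_set function_algebra :: "(real^'n::finite \<Rightarrow> real) set \<Rightarrow> (real^'n \<Rightarrow> real) set" for G where
  base: "g \<in> G \<Longrightarrow> g \<in> function_algebra G"
| add: "f \<in> function_algebra G \<Longrightarrow> g \<in> function_algebra G \<Longrightarrow> (\<lambda>x. f x + g x) \<in> function_algebra G"
| mult: "f \<in> function_algebra G \<Longrightarrow> g \<in> function_algebra G \<Longrightarrow> (\<lambda>x. f x * g x) \<in> function_algebra G"

lemma partial_deriv_add:
  assumes "\<And>x. f differentiable (at x)" "\<And>x. g differentiable (at x)"
  shows "partial_deriv i (\<lambda>x. f x + g x) = (\<lambda>x. partial_deriv i f x + partial_deriv i g x)"
proof
  fix x
  have "((\<lambda>x. f x + g x) has_derivative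
      (\<lambda>h. frechet_derivative f (at x) h + frechet_derivative g (at x) h)) (at x)"
    using assms by (intro has_derivative_add) (simp_all flip: frechet_derivative_works)
  from partial_deriv_eqI[OF this, of i]
  show "partial_deriv i (\<lambda>x. f x + g x) x = partial_deriv i f x + partial_deriv i g x"
    by (simp add: partial_deriv_def)
qed

lemma partial_deriv_mult:
  assumes "\<And>x. f differentiable (at x)" "\<And>x. g differentiable (at x)"
  shows "partial_deriv i (\<lambda>x. f x * g x) = (\<lambda>x. f x * partial_deriv i g x + partial_deriv i f x * g x)"
proof
  fix x
  have "((\<lambda>x. f x * g x) has_derivative
      (\<lambda>h. f x * frechet_derivative g (at x) h + frechet_derivative f (at x) h * g x)) (at x)"
    using assms by (intro has_derivative_mult) (simp_all flip: frechet_derivative_works)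
  from partial_deriv_eqI[OF this, of i]
  show "partial_deriv i (\<lambda>x. f x * g x) x = f x * partial_deriv i g x + partial_deriv i f x * g x"
    by (simp add: partial_deriv_def)
qed

lemma smooth_function_algebra:
  assumes G: "\<And>g x. g \<in> G \<Longrightarrow> g differentiable (at x)"
    "\<And>g i. g \<in> G \<Longrightarrow> partial_deriv i g \<in> function_algebra G"
    and f: "f \<in> function_algebra G"
  shows "smooth f"
proof -
  have *: "(\<forall>x. f differentiable (at x)) \<and> (\<forall>i. partial_deriv i f \<in> function_algebra G)"
    if "f \<in> function_algebra G" for f
    using that
  proof induction
    case (base g)
    then show ?case using G by blast
  next
    case (add f g)
    then show ?case
      by (auto simp: partial_deriv_add intro!: function_algebra.add)
  next
    case (mult f g)
    then show ?case
      by (auto simp: partial_deriv_mult intro!: function_algebra.add function_algebra.mult)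
  qed
  have "iter_partial is f \<in> function_algebra G" for "is"
    by (induction "is") (use f * in auto)
  then show ?thesis unfolding smooth_def using * by blast
qed

lemma smooth_algebra: "f \<in> function_algebra (Collect smooth) \<Longrightarrow> smooth f"
  by (rule smooth_function_algebra[of "Collect smooth"])
     (auto intro: smooth_differentiable smooth_partial_deriv function_algebra.base)

lemma smooth_add: "smooth f \<Longrightarrow> smooth g \<Longrightarrow> smooth (\<lambda>x. f x + g x)"
  by (rule smooth_algebra) (auto intro: function_algebra.intros)

lemma smooth_mult: "smooth f \<Longrightarrow> smooth g \<Longrightarrow> smooth (\<lambda>x. f x * g x)"
  by (rule smooth_algebra) (auto intro: function_algebra.intros)

lemma partial_deriv_const: "partial_deriv i (\<lambda>x. c) = (\<lambda>x. 0)"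
  by (simp add: partial_deriv_def)

lemma smooth_const: "smooth (\<lambda>x. c)"
  by (rule smooth_function_algebra[of "range (\<lambda>c x. c)"])
     (auto simp: partial_deriv_const intro: function_algebra.base)

lemma smooth_cmult: "smooth f \<Longrightarrow> smooth (\<lambda>x. c * f x)"
  by (intro smooth_mult smooth_const)

lemma smooth_component: "smooth (\<lambda>x::real^'n::finite. x $ i)"
proof (rule smooth_function_algebra[of "insert (\<lambda>x. x $ i) (range (\<lambda>c x. c))"])
  have d: "((\<lambda>x::real^'n. x $ i) has_derivative (\<lambda>h. h $ i)) (at x)" for x
    by (rule bounded_linear_imp_has_derivative) (rule bounded_linear_vec_nth)
  show "g differentiable (at x)" if "g \<in> insert (\<lambda>x. x $ i) (range (\<lambda>c x. c))" for g and x :: "real^'n"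
    using that differentiableI[OF d] by auto
  show "partial_deriv j g \<in> function_algebra (insert (\<lambda>x. x $ i) (range (\<lambda>c x. c)))"
    if "g \<in> insert (\<lambda>x. x $ i) (range (\<lambda>c x. c))" for g :: "real^'n \<Rightarrow> real" and j
  proof -
    have "partial_deriv j (\<lambda>x. x $ i) = (\<lambda>x. axis j 1 $ i)"
      using partial_deriv_eqI[OF d, of j] by blast
    then have "partial_deriv j g \<in> range (\<lambda>c x. c)"
      using that by (auto simp: partial_deriv_const)
    then show ?thesis by (blast intro: function_algebra.base)
  qed
qed (auto intro: function_algebra.base)

text \<open>The functions \<open>exp (-1/s) / s\<^sup>k\<close>, extended by zero, have derivatives that are linear combinations
of functions of the same family.\<close>

definition flat :: "nat \<Rightarrow> real \<Rightarrow> real" where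
  "flat k s = (if s \<le> 0 then 0 else exp (- (1 / s)) / s ^ k)"

lemma flat_pos: "0 < s \<Longrightarrow> 0 < flat k s"
  by (simp add: flat_def)

lemma flat_nonpos: "s \<le> 0 \<Longrightarrow> flat k s = 0"
  by (simp add: flat_def)

lemma flat_tendsto_0: "(flat k \<longlongrightarrow> 0) (at 0)"
proof -
  have "((\<lambda>s::real. inverse s ^ k / exp (inverse s)) \<longlongrightarrow> 0) (at_right 0)"
    by (rule filterlim_compose[OF tendsto_power_div_exp_0 filterlim_inverse_at_top_right])
  then have "(flat k \<longlongrightarrow> 0) (at_right 0)"
    by (rule Lim_transform_eventually)
       (auto simp: flat_def eventually_at_filter exp_minus field_simps)
  moreover have "(flat k \<longlongrightarrow> 0) (at_left 0)"
    by (rule Lim_transform_eventually[of "\<lambda>_. 0"]) (auto simp: flat_def eventually_at_filter)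
  ultimately show ?thesis by (simp add: filterlim_split_at)
qed

lemma flat_has_derivative:
  "(flat k has_real_derivative (flat (k + 2) s - real k * flat (k + 1) s)) (at s)"
proof -
  consider "s < 0" | "s = 0" | "s > 0" by linarith
  then show ?thesis
  proof cases
    case 1
    have "((\<lambda>_. 0) has_real_derivative 0) (at s)" by simp
    then have "(flat k has_real_derivative 0) (at s)"
      by (rule has_field_derivative_transform_within_open[where S = "{..<0}"])
         (use 1 in \<open>auto simp: flat_def\<close>)
    then show ?thesis using 1 by (simp add: flat_def)
  next
    case 2
    have "((\<lambda>h. (flat k (0 + h) - flat k 0) / h) \<longlongrightarrow> 0) (at 0)"
      by (rule Lim_transform_eventually[OF flat_tendsto_0[of "k + 1"]])
         (auto simp: flat_def eventually_at_filter)
    then show ?thesis using 2 by (simp add: DERIV_def flat_nonpos)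
  next
    case 3
    have "((\<lambda>s. exp (- (1 / s)) / s ^ k) has_real_derivative
        (flat (k + 2) s - real k * flat (k + 1) s)) (at s)"
      by (rule derivative_eq_intros refl | use 3 in \<open>simp; fail\<close>)+
         (use 3 in \<open>cases k; simp add: flat_def divide_simps power2_eq_square algebra_simps\<close>)
    then show ?thesis
      by (rule has_field_derivative_transform_within_open[where S = "{0<..}"])
         (use 3 in \<open>auto simp: flat_def\<close>)
  qed
qed

definition bump :: "real^'n::finite \<Rightarrow> real \<Rightarrow> real^'n \<Rightarrow> real" where
  "bump c r = (\<lambda>y. flat 0 (r\<^sup>2 - (norm (y - c))\<^sup>2))"

lemma flat_norm_has_derivative:
  fixes c :: "real^'n::finite"
  shows "((\<lambda>y. flat k (r\<^sup>2 - (norm (y - c))\<^sup>2)) has_derivative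
    (\<lambda>h. (flat (k + 2) (r\<^sup>2 - (norm (y - c))\<^sup>2) + (- real k) * flat (k + 1) (r\<^sup>2 - (norm (y - c))\<^sup>2))
       * (- 2 * ((y - c) \<bullet> h)))) (at y)"
proof -
  have "((\<lambda>y. r\<^sup>2 - (y - c) \<bullet> (y - c)) has_derivative (\<lambda>h. - 2 * ((y - c) \<bullet> h))) (at y)"
    by (auto intro!: derivative_eq_intros simp: inner_commute)
  from has_derivative_compose[OF this flat_has_derivative[unfolded has_field_derivative_def]]
  show ?thesis by (simp add: power2_norm_eq_inner)
qed

lemma partial_deriv_flat_norm:
  fixes c :: "real^'n::finite"
  shows "partial_deriv i (\<lambda>y. flat k (r\<^sup>2 - (norm (y - c))\<^sup>2)) =
    (\<lambda>y. (flat (k + 2) (r\<^sup>2 - (norm (y - c))\<^sup>2) + (- real k) * flat (k + 1) (r\<^sup>2 - (norm (y - c))\<^sup>2))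
       * (- 2 * (y $ i + - (c $ i))))"
  by (rule ext, subst partial_deriv_eqI[OF flat_norm_has_derivative]) (simp add: inner_axis)

text \<open>The bump lies in the algebra generated by the coordinates, the constants and the functions
\<open>flat k (r\<^sup>2 - |y - c|\<^sup>2)\<close>.\<close>

lemma smooth_bump: "smooth (bump (c :: real^'n::finite) r)"
proof -
  define q where "q k = (\<lambda>y::real^'n. flat k (r\<^sup>2 - (norm (y - c))\<^sup>2))" for k
  define G where "G = Collect smooth \<union> range q"
  have qG: "q k \<in> function_algebra G" for k by (auto simp: G_def intro: function_algebra.base)
  have sG: "f \<in> function_algebra G" if "smooth f" for f
    using that by (auto simp: G_def intro: function_algebra.base)
  have "smooth (q 0)"
  proof (rule smooth_function_algebra[of G])
    show "g differentiable (at x)" if "g \<in> G" for g x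
      using that differentiableI[OF flat_norm_has_derivative] by (auto simp: G_def q_def smooth_differentiable)
    show "partial_deriv i g \<in> function_algebra G" if "g \<in> G" for g i
    proof (cases "smooth g")
      case False
      with \<open>g \<in> G\<close> obtain k where g: "g = q k" unfolding G_def by blast
      have *: "partial_deriv i g = (\<lambda>y. (q (k + 2) y + (- real k) * q (k + 1) y) * (- 2 * (y $ i + - (c $ i))))"
        unfolding g q_def by (rule partial_deriv_flat_norm)
      show ?thesis unfolding *
        by (rule qG sG[OF smooth_const] sG[OF smooth_component]
          | rule function_algebra.add | rule function_algebra.mult)+
    qed (use sG smooth_partial_deriv in blast)
  qed (rule qG)
  then show ?thesis by (simp add: q_def bump_def)
qed

lemma bump_nonneg: "0 \<le> bump c r y"
  by (simp add: bump_def flat_def)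

lemma bump_pos_iff: "0 < bump c r y \<longleftrightarrow> norm (y - c) < \<bar>r\<bar>"
  using abs_le_square_iff[of "r" "norm (y - c)"] flat_pos[of "r\<^sup>2 - (norm (y - c))\<^sup>2" 0]
  by (auto simp: bump_def flat_def abs_le_square_iff not_le abs_square_less_1)

lemma bump_eq_0_iff: "bump c r y = 0 \<longleftrightarrow> \<bar>r\<bar> \<le> norm (y - c)"
  using bump_pos_iff[of c r y] bump_nonneg[of c r y] by linarith

lemma bump_commute: "bump c r y = bump y r c"
  by (simp add: bump_def norm_minus_commute)

text \<open>Centre and argument of a bump may be exchanged at the cost of a sign, which moves a derivative from the
mollifier to the mollified function.\<close>

lemma partial_deriv_bump_commute: "partial_deriv i (bump c r) y = - partial_deriv i (bump y r) c"
  unfolding bump_def partial_deriv_flat_norm by (simp add: norm_minus_commute algebra_simps)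

lemma test_functions_iff:
  "\<phi> \<in> test_functions U \<longleftrightarrow> smooth \<phi> \<and> (\<exists>K. compact K \<and> K \<subseteq> U \<and> (\<forall>x. x \<notin> K \<longrightarrow> \<phi> x = 0))"
proof
  assume "smooth \<phi> \<and> (\<exists>K. compact K \<and> K \<subseteq> U \<and> (\<forall>x. x \<notin> K \<longrightarrow> \<phi> x = 0))"
  then obtain K where K: "smooth \<phi>" "compact K" "K \<subseteq> U" "\<And>x. x \<notin> K \<Longrightarrow> \<phi> x = 0" by blast
  have "closure {x. \<phi> x \<noteq> 0} \<subseteq> K"
    by (rule closure_minimal) (use K compact_imp_closed in auto)
  then show "\<phi> \<in> test_functions U"
    using K closed_closure compact_Int_closed[of K "closure {x. \<phi> x \<noteq> 0}"]
    by (auto simp: test_functions_def smooth_def Int_absorb1)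
next
  assume "\<phi> \<in> test_functions U"
  then show "smooth \<phi> \<and> (\<exists>K. compact K \<and> K \<subseteq> U \<and> (\<forall>x. x \<notin> K \<longrightarrow> \<phi> x = 0))"
    using closure_subset[of "{x. \<phi> x \<noteq> 0}"] unfolding test_functions_def smooth_def
    by (intro conjI exI[of _ "closure {x. \<phi> x \<noteq> 0}"]) blast+
qed

lemma test_functions_smooth: "\<phi> \<in> test_functions U \<Longrightarrow> smooth \<phi>"
  by (simp add: test_functions_iff)

lemma test_functions_support:
  assumes "\<phi> \<in> test_functions U"
  obtains K where "compact K" "K \<subseteq> U" "\<And>x. x \<notin> K \<Longrightarrow> \<phi> x = 0"
  using assms unfolding test_functions_iff by blast

lemma test_functions_0: "(\<lambda>x. 0) \<in> test_functions U"
  unfolding test_functions_iff using smooth_const[of 0] by (auto intro: exI[of _ "{}"])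

lemma test_functions_mult_smooth:
  "\<phi> \<in> test_functions U \<Longrightarrow> smooth \<psi> \<Longrightarrow> (\<lambda>x. \<phi> x * \<psi> x) \<in> test_functions U"
  unfolding test_functions_iff by (auto intro: smooth_mult)

lemma test_functions_cmult: "\<phi> \<in> test_functions U \<Longrightarrow> (\<lambda>x. c * \<phi> x) \<in> test_functions U"
  unfolding test_functions_iff by (auto intro: smooth_cmult)

lemma test_functions_add:
  assumes "\<phi> \<in> test_functions U" "\<psi> \<in> test_functions U"
  shows "(\<lambda>x. \<phi> x + \<psi> x) \<in> test_functions U"
proof -
  obtain K where K: "compact K" "K \<subseteq> U" "\<And>x. x \<notin> K \<Longrightarrow> \<phi> x = 0"
    using test_functions_support[OF assms(1)] by blast
  obtain L where L: "compact L" "L \<subseteq> U" "\<And>x. x \<notin> L \<Longrightarrow> \<psi> x = 0"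
    using test_functions_support[OF assms(2)] by blast
  show ?thesis unfolding test_functions_iff
    using assms K L by (intro conjI exI[of _ "K \<union> L"] smooth_add) (auto dest: test_functions_smooth)
qed

lemma bump_test_function: "cball c \<bar>r\<bar> \<subseteq> U \<Longrightarrow> bump c r \<in> test_functions U"
  unfolding test_functions_iff
  by (intro conjI exI[of _ "cball c \<bar>r\<bar>"])
     (auto simp: smooth_bump bump_eq_0_iff dist_norm norm_minus_commute)

lemma partial_deriv_zero_outside:
  assumes "closed K" "\<And>x. x \<notin> K \<Longrightarrow> \<phi> x = 0" "x \<notin> K"
  shows "partial_deriv i \<phi> x = 0"
proof -
  have "((\<lambda>_. 0) has_derivative (\<lambda>_. 0)) (at x)" by simp
  then have "(\<phi> has_derivative (\<lambda>_. 0)) (at x)"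
    by (rule has_derivative_transform_within_open[where s = "- K"]) (use assms in auto)
  then show ?thesis by (rule partial_deriv_eqI)
qed

lemma test_functions_partial_deriv:
  "\<phi> \<in> test_functions U \<Longrightarrow> partial_deriv i \<phi> \<in> test_functions U"
  unfolding test_functions_iff
  by (meson compact_imp_closed partial_deriv_zero_outside smooth_partial_deriv)

lemma test_functions_iter_partial:
  "\<phi> \<in> test_functions U \<Longrightarrow> iter_partial is \<phi> \<in> test_functions U"
  by (induction "is") (simp_all add: test_functions_partial_deriv)

lemma test_functions_multi_partial:
  "\<phi> \<in> test_functions U \<Longrightarrow> multi_partial \<alpha> \<phi> \<in> test_functions U"
  unfolding multi_partial_def by (rule test_functions_iter_partial)

lemma test_functions_measurable: "\<phi> \<in> test_functions U \<Longrightarrow> \<phi> \<in> borel_measurable borel"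
  by (intro borel_measurable_continuous_onI smooth_continuous test_functions_smooth)

lemma test_functions_bounded:
  assumes "\<phi> \<in> test_functions U"
  obtains M where "0 \<le> M" "\<And>x. \<bar>\<phi> x\<bar> \<le> M"
proof -
  obtain K where K: "compact K" "K \<subseteq> U" "\<And>x. x \<notin> K \<Longrightarrow> \<phi> x = 0"
    using test_functions_support[OF assms] by blast
  have "bounded (\<phi> ` K)"
    by (intro compact_imp_bounded compact_continuous_image K smooth_continuous test_functions_smooth[OF assms])
  then obtain M where M: "\<And>x. x \<in> K \<Longrightarrow> \<bar>\<phi> x\<bar> \<le> M" by (auto simp: bounded_iff)
  then have "\<bar>\<phi> x\<bar> \<le> max 0 M" for x using K(3)[of x] by (cases "x \<in> K") fastforce+
  then show ?thesis using that[of "max 0 M"] by simp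
qed

lemma test_functions_integrable:
  assumes "\<phi> \<in> test_functions U"
  shows "integrable lborel \<phi>"
proof -
  obtain K where K: "compact K" "K \<subseteq> U" "\<And>x. x \<notin> K \<Longrightarrow> \<phi> x = 0"
    using test_functions_support[OF assms] by blast
  have "integrable lborel (\<lambda>x. indicator K x *\<^sub>R \<phi> x)"
    by (rule borel_integrable_compact) (intro K smooth_continuous test_functions_smooth[OF assms])+
  also have "(\<lambda>x. indicator K x *\<^sub>R \<phi> x) = \<phi>" using K(3) by (auto simp: fun_eq_iff indicator_def)
  finally show ?thesis .
qed

lemma integral_lborel_translate:
  fixes p :: "'a::euclidean_space \<Rightarrow> real"
  assumes [measurable]: "p \<in> borel_measurable borel"
  shows "(\<integral>x. p (x + a) \<partial>lborel) = (\<integral>x. p x \<partial>lborel)"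
    "integrable lborel (\<lambda>x. p (x + a)) \<longleftrightarrow> integrable lborel p"
proof -
  have d: "distr lborel borel (\<lambda>x. x + a) = lborel"
    using lborel_distr_plus[of a] by (simp add: add.commute[of _ a])
  show "(\<integral>x. p (x + a) \<partial>lborel) = (\<integral>x. p x \<partial>lborel)"
    by (subst d[symmetric], subst integral_distr) auto
  show "integrable lborel (\<lambda>x. p (x + a)) \<longleftrightarrow> integrable lborel p"
    by (subst (2) d[symmetric], subst integrable_distr_eq) auto
qed

text \<open>By translation invariance the difference quotients of \<open>p\<close> in the direction \<open>e\<close> have integral zero.  They
are dominated because \<open>p'\<close> is bounded and \<open>p\<close> vanishes off a bounded set.\<close>

lemma integral_directional_derivative_zero:
  fixes p p' :: "'a::euclidean_space \<Rightarrow> real"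
  assumes [measurable]: "p \<in> borel_measurable borel" and p: "integrable lborel p"
    and S: "bounded S" "\<And>x. x \<notin> S \<Longrightarrow> p x = 0"
    and p': "\<And>x s. ((\<lambda>s. p (x + s *\<^sub>R e)) has_real_derivative p' (x + s *\<^sub>R e)) (at s)"
    and M: "\<And>x. \<bar>p' x\<bar> \<le> M"
  shows "(\<integral>x. p' x \<partial>lborel) = 0"
proof -
  obtain R where R: "S \<subseteq> cball 0 R" using S(1) by (auto simp: bounded_iff subset_iff)
  define h where "h n = 1 / real (Suc n)" for n
  have h: "0 < h n" "h n \<le> 1" for n by (auto simp: h_def)
  have h0: "h \<longlonglongrightarrow> 0" unfolding h_def by (rule LIMSEQ_Suc) (rule lim_1_over_n)
  define q where "q n x = (p (x + h n *\<^sub>R e) - p x) / h n" for n x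
  have lim: "(\<lambda>n. q n x) \<longlonglongrightarrow> p' x" for x
  proof -
    have "((\<lambda>k. (p (x + k *\<^sub>R e) - p x) / k) \<longlongrightarrow> p' x) (at 0)"
      using p'[of x 0] by (simp add: DERIV_def)
    moreover have "filterlim h (at 0) sequentially"
      using h0 h(1) by (auto simp: filterlim_at less_imp_neq[symmetric])
    ultimately show ?thesis unfolding q_def by (rule filterlim_compose)
  qed
  have qM: "\<bar>q n x\<bar> \<le> M" for n x
  proof -
    obtain z where "p (x + h n *\<^sub>R e) - p (x + 0 *\<^sub>R e) = (h n - 0) * p' (x + z *\<^sub>R e)"
      using MVT2[of 0 "h n" "\<lambda>s. p (x + s *\<^sub>R e)" "\<lambda>s. p' (x + s *\<^sub>R e)"] h p' by blast
    then have "q n x = p' (x + z *\<^sub>R e)" using h(1)[of n] by (simp add: q_def)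
    then show ?thesis using M by simp
  qed
  have q0: "q n x = 0" if "x \<notin> cball 0 (R + norm e)" for n x
  proof -
    have "norm x > R + norm e" using that by auto
    moreover have "norm (h n *\<^sub>R e) \<le> norm e"
      using h[of n] by (simp add: mult_left_le_one_le)
    moreover have "norm x \<le> norm (x + h n *\<^sub>R e) + norm (h n *\<^sub>R e)"
      by (metis add_diff_cancel_right' norm_triangle_ineq4)
    ultimately have "norm (x + h n *\<^sub>R e) > R" "norm x > R" using norm_ge_zero[of e] by linarith+
    then have "x \<notin> S" "x + h n *\<^sub>R e \<notin> S" using R by auto
    then show ?thesis using S(2) by (simp add: q_def)
  qed
  have [measurable]: "q n \<in> borel_measurable borel" for n unfolding q_def by measurable
  have [measurable]: "p' \<in> borel_measurable borel"
    by (rule borel_measurable_LIMSEQ_real[OF lim]) measurable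
  have "(\<lambda>n. \<integral>x. q n x \<partial>lborel) \<longlonglongrightarrow> (\<integral>x. p' x \<partial>lborel)"
  proof (rule integral_dominated_convergence[where w = "\<lambda>x. M * indicator (cball 0 (R + norm e)) x"])
    show "integrable lborel (\<lambda>x. M * indicator (cball 0 (R + norm e)) x)"
      by (intro integrable_mult_right integrable_real_indicator) (auto intro!: emeasure_bounded_finite[unfolded infinity_ennreal_def])
    show "AE x in lborel. norm (q n x) \<le> M * indicator (cball 0 (R + norm e)) x" for n
      using qM q0 by (auto simp: indicator_def simp del: mem_cball)
  qed (use lim in auto)
  moreover have "(\<integral>x. q n x \<partial>lborel) = 0" for n
    unfolding q_def using p integral_lborel_translate[of p "h n *\<^sub>R e"] by simp
  ultimately show ?thesis by (simp add: LIMSEQ_const_iff)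
qed

lemma integral_partial_deriv_zero:
  assumes \<phi>: "\<phi> \<in> test_functions U"
  shows "(\<integral>x. partial_deriv i \<phi> x \<partial>lborel) = 0"
proof -
  obtain K where K: "compact K" "\<And>x. x \<notin> K \<Longrightarrow> \<phi> x = 0"
    using test_functions_support[OF \<phi>] by metis
  obtain M where M: "\<And>x. \<bar>partial_deriv i \<phi> x\<bar> \<le> M"
    using test_functions_bounded[OF test_functions_partial_deriv[OF \<phi>]] by metis
  show ?thesis
    by (rule integral_directional_derivative_zero[where e = "axis i 1" and p = \<phi> and S = K])
       (use K M \<phi> in \<open>auto intro: test_functions_measurable test_functions_integrable
          compact_imp_bounded smooth_line_derivative test_functions_smooth\<close>)
qed

lemma integration_by_parts_test:
  assumes \<phi>: "\<phi> \<in> test_functions U" and \<psi>: "smooth \<psi>"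
  shows "(\<integral>x. \<psi> x * partial_deriv i \<phi> x \<partial>lborel) = - (\<integral>x. partial_deriv i \<psi> x * \<phi> x \<partial>lborel)"
proof -
  have "partial_deriv i (\<lambda>x. \<phi> x * \<psi> x) = (\<lambda>x. partial_deriv i \<psi> x * \<phi> x + \<psi> x * partial_deriv i \<phi> x)"
    using partial_deriv_mult[of \<phi> \<psi> i] \<phi> \<psi>
    by (auto simp: smooth_differentiable test_functions_smooth mult.commute)
  with integral_partial_deriv_zero[OF test_functions_mult_smooth[OF \<phi> \<psi>], of i]
  have "(\<integral>x. partial_deriv i \<psi> x * \<phi> x + \<psi> x * partial_deriv i \<phi> x \<partial>lborel) = 0" by simp
  moreover have "integrable lborel (\<lambda>x. partial_deriv i \<psi> x * \<phi> x)"
    "integrable lborel (\<lambda>x. \<psi> x * partial_deriv i \<phi> x)"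
    using test_functions_integrable[OF test_functions_mult_smooth[OF \<phi> smooth_partial_deriv[OF \<psi>]], of i]
      test_functions_integrable[OF test_functions_mult_smooth[OF test_functions_partial_deriv[OF \<phi>] \<psi>], of i]
    by (simp_all add: mult.commute)
  ultimately show ?thesis by simp
qed

section \<open>Mollification\<close>

definition clip :: "real \<Rightarrow> real \<Rightarrow> real" where "clip R y = max (- R) (min R y)"

lemma clip_bounds: "0 \<le> R \<Longrightarrow> \<bar>clip R y\<bar> \<le> R" "0 \<le> R \<Longrightarrow> \<bar>clip R y\<bar> \<le> \<bar>y\<bar>"
  by (auto simp: clip_def)

text \<open>A measurable function is a limit almost everywhere of continuous functions.  Truncating the
values and cutting off far away makes the convergence dominated.\<close>

lemma continuous_compact_support_dense_L1:
  fixes h :: "'a::euclidean_space \<Rightarrow> real"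
  assumes h: "integrable lborel h" and e: "0 < e"
  obtains g :: "'a \<Rightarrow> real" and R where "continuous_on UNIV g" "0 \<le> R" "\<And>x. \<bar>g x\<bar> \<le> R * indicator (cball 0 R) x"
    "(\<integral>x. \<bar>h x - g x\<bar> \<partial>lborel) < e"
proof -
  have [measurable]: "h \<in> borel_measurable borel" using borel_measurable_integrable[OF h] by simp
  \<comment> \<open>A continuous cutoff: one on the ball of radius \<open>R - 1\<close>, zero outside the ball of radius \<open>R\<close>.\<close>
  define cut where "cut R x = max 0 (min 1 (R - norm x))" for R and x :: 'a
  have cut: "0 \<le> cut R x" "cut R x \<le> 1" for R x by (auto simp: cut_def)
  have cut0: "cut R x = 0" if "x \<notin> cball 0 R" for R x using that by (auto simp: cut_def)
  have cut_cont: "continuous_on UNIV (cut R)" for R unfolding cut_def by (intro continuous_intros)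
  have clip_cont: "continuous_on UNIV (clip R)" for R unfolding clip_def by (intro continuous_intros)
  have [measurable]: "cut R \<in> borel_measurable borel" "clip R \<in> borel_measurable borel" for R
    by (intro borel_measurable_continuous_onI cut_cont clip_cont)+
  define hR where "hR R x = clip R (h x) * cut R x" for R x
  have hR_le: "\<bar>hR R x\<bar> \<le> \<bar>h x\<bar>" if "0 \<le> R" for R x
    unfolding hR_def abs_mult using cut[of R x] clip_bounds(2)[OF that, of "h x"]
    by (metis abs_ge_zero abs_of_nonneg mult_mono mult.right_neutral)
  have [measurable]: "hR R \<in> borel_measurable borel" for R unfolding hR_def by measurable
  have "(\<lambda>n. \<integral>x. \<bar>h x - hR (real n) x\<bar> \<partial>lborel) \<longlonglongrightarrow> (\<integral>x. 0 \<partial>(lborel :: 'a measure))"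
  proof (rule integral_dominated_convergence[where w = "\<lambda>x. 2 * \<bar>h x\<bar>"])
    have "(\<lambda>n. \<bar>h x - hR (real n) x\<bar>) \<longlonglongrightarrow> 0" for x
    proof (rule tendsto_eventually)
      obtain N :: nat where N: "\<bar>h x\<bar> + norm x + 1 \<le> real N" using real_arch_simple by blast
      show "\<forall>\<^sub>F n in sequentially. \<bar>h x - hR (real n) x\<bar> = 0"
      proof (rule eventually_sequentiallyI[of N])
        fix n assume "N \<le> n"
        then have "real N \<le> real n" by simp
        then have n: "\<bar>h x\<bar> \<le> real n" "norm x + 1 \<le> real n"
          using N norm_ge_zero[of x] abs_ge_zero[of "h x"] by linarith+
        then show "\<bar>h x - hR (real n) x\<bar> = 0" by (auto simp: hR_def clip_def cut_def)
      qed
    qed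
    then show "AE x in lborel. (\<lambda>n. \<bar>h x - hR (real n) x\<bar>) \<longlonglongrightarrow> 0" by simp
    show "AE x in lborel. norm \<bar>h x - hR (real n) x\<bar> \<le> 2 * \<bar>h x\<bar>" for n
      using hR_le[of "real n"] by (intro AE_I2) (smt (verit) of_nat_0_le_iff real_norm_def)
  qed (use h in auto)
  then have "\<forall>\<^sub>F n in sequentially. (\<integral>x. \<bar>h x - hR (real n) x\<bar> \<partial>lborel) < e / 2"
    using e by (auto dest!: order_tendstoD(2)[where a = "e / 2"])
  then obtain R where R: "(\<integral>x. \<bar>h x - hR R x\<bar> \<partial>lborel) < e / 2" "0 \<le> R"
    by (auto simp: eventually_sequentially)
  have "h measurable_on UNIV" by (rule lebesgue_measurable_imp_measurable_on[OF measurable_completion]) simp_all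
  then obtain N g where N: "negligible N" and g: "\<And>n. continuous_on UNIV (g n)"
    and lim: "\<And>x. x \<notin> N \<Longrightarrow> (\<lambda>n. g n x) \<longlonglongrightarrow> h x" unfolding measurable_on_def by auto
  define G where "G n x = clip R (g n x) * cut R x" for n x
  have G_cont: "continuous_on UNIV (G n)" for n
    unfolding G_def by (intro continuous_intros cut_cont continuous_on_compose2[OF clip_cont g]) auto
  then have [measurable]: "G n \<in> borel_measurable borel" for n by (rule borel_measurable_continuous_onI)
  have bd: "\<bar>clip R y * cut R x\<bar> \<le> R * indicator (cball 0 R) x" for x y
  proof (cases "x \<in> cball 0 R")
    case True
    have "\<bar>clip R y * cut R x\<bar> \<le> R * 1"
      unfolding abs_mult using clip_bounds(1)[OF R(2)] cut R(2) by (intro mult_mono) auto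
    then show ?thesis using True by simp
  qed (use cut0 in auto)
  have "AE x in lebesgue. x \<notin> N" using N by (simp add: negligible_iff_null_sets AE_not_in)
  then have aeN: "AE x in lborel. x \<notin> N" by (simp add: AE_completion_iff)
  have "(\<lambda>n. \<integral>x. \<bar>hR R x - G n x\<bar> \<partial>lborel) \<longlonglongrightarrow> (\<integral>x. 0 \<partial>(lborel :: 'a measure))"
  proof (rule integral_dominated_convergence[where w = "\<lambda>x. 2 * (R * indicator (cball 0 R) x)"])
    show "integrable lborel (\<lambda>x. 2 * (R * indicator (cball 0 R) x))"
      by (intro integrable_mult_right integrable_real_indicator)
         (auto intro!: emeasure_bounded_finite[unfolded infinity_ennreal_def])
    show "AE x in lborel. norm \<bar>hR R x - G n x\<bar> \<le> 2 * (R * indicator (cball 0 R) x)" for n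
      unfolding hR_def G_def
    proof (intro AE_I2)
      fix x
      show "norm \<bar>clip R (h x) * cut R x - clip R (g n x) * cut R x\<bar> \<le> 2 * (R * indicator (cball 0 R) x)"
        using bd[of "h x" x] bd[of "g n x" x] by (simp add: abs_le_iff)
    qed
    have "(\<lambda>n. \<bar>hR R x - G n x\<bar>) \<longlonglongrightarrow> 0" if "x \<notin> N" for x
    proof -
      have "(\<lambda>n. clip R (g n x)) \<longlonglongrightarrow> clip R (h x)"
        using clip_cont lim[OF that] by (intro continuous_on_tendsto_compose[of UNIV "clip R"]) auto
      then have "(\<lambda>n. \<bar>hR R x - G n x\<bar>) \<longlonglongrightarrow> \<bar>hR R x - clip R (h x) * cut R x\<bar>"
        unfolding G_def by (intro tendsto_intros)
      then show ?thesis by (simp add: hR_def)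
    qed
    then show "AE x in lborel. (\<lambda>n. \<bar>hR R x - G n x\<bar>) \<longlonglongrightarrow> 0" using aeN by auto
  qed auto
  then have "\<forall>\<^sub>F n in sequentially. (\<integral>x. \<bar>hR R x - G n x\<bar> \<partial>lborel) < e / 2"
    using e by (auto dest!: order_tendstoD(2)[where a = "e / 2"])
  then obtain n where n: "(\<integral>x. \<bar>hR R x - G n x\<bar> \<partial>lborel) < e / 2"
    unfolding eventually_sequentially by blast
  have intR: "integrable lborel (hR R)"
    by (rule Bochner_Integration.integrable_bound[OF h]) (use hR_le R in auto)
  have intG: "integrable lborel (G n)"
  proof (rule Bochner_Integration.integrable_bound)
    show "integrable lborel (\<lambda>x. R * indicator (cball 0 R) x :: real)"
      by (intro integrable_mult_right integrable_real_indicator)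
         (auto intro!: emeasure_bounded_finite[unfolded infinity_ennreal_def])
    show "AE x in lborel. norm (G n x) \<le> norm (R * indicator (cball 0 R) x :: real)"
      unfolding G_def using bd R(2) by (auto simp: abs_mult)
  qed auto
  have "(\<integral>x. \<bar>h x - G n x\<bar> \<partial>lborel) \<le> (\<integral>x. \<bar>h x - hR R x\<bar> + \<bar>hR R x - G n x\<bar> \<partial>lborel)"
    using h intR intG by (intro integral_mono) auto
  also have "\<dots> = (\<integral>x. \<bar>h x - hR R x\<bar> \<partial>lborel) + (\<integral>x. \<bar>hR R x - G n x\<bar> \<partial>lborel)"
    using h intR intG by (intro Bochner_Integration.integral_add) auto
  finally have "(\<integral>x. \<bar>h x - G n x\<bar> \<partial>lborel) < e" using R n by simp
  moreover have "\<bar>G n x\<bar> \<le> R * indicator (cball 0 R) x" for x unfolding G_def by (rule bd)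
  ultimately show ?thesis using that[of "G n" R] G_cont R(2) by blast
qed

text \<open>For continuous functions with compact support this is dominated convergence; the general case
follows by density.\<close>

lemma L1_translation_continuous:
  fixes h :: "'a::euclidean_space \<Rightarrow> real"
  assumes h: "integrable lborel h" and e: "0 < e"
  obtains d where "0 < d" "\<And>z. norm z < d \<Longrightarrow> (\<integral>x. \<bar>h (x + z) - h x\<bar> \<partial>lborel) < e"
proof -
  have [measurable]: "h \<in> borel_measurable borel" using borel_measurable_integrable[OF h] by simp
  obtain g :: "'a \<Rightarrow> real" and R where g: "continuous_on UNIV g" and R: "0 \<le> R"
    and gR: "\<And>x. \<bar>g x\<bar> \<le> R * indicator (cball 0 R) x" and hg: "(\<integral>x. \<bar>h x - g x\<bar> \<partial>lborel) < e / 3"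
    using continuous_compact_support_dense_L1[OF h, of "e / 3"] e by auto
  have [measurable]: "g \<in> borel_measurable borel" using g by (rule borel_measurable_continuous_onI)
  have int_ball: "integrable lborel (\<lambda>x::'a. c * indicator (cball 0 r) x :: real)" for c r
      by (intro integrable_mult_right integrable_real_indicator)
         (auto intro!: emeasure_bounded_finite[unfolded infinity_ennreal_def])
  have intg: "integrable lborel g"
    by (rule Bochner_Integration.integrable_bound[OF int_ball[of R R]])
       (use gR R in \<open>auto simp: abs_mult\<close>)
  have seq: "(\<lambda>n. \<integral>x. \<bar>g (x + z n) - g x\<bar> \<partial>lborel) \<longlonglongrightarrow> 0"
    if z: "z \<longlonglongrightarrow> 0" "\<And>n. norm (z n) \<le> 1" for z :: "nat \<Rightarrow> 'a"
  proof -
    have "(\<lambda>n. \<integral>x. \<bar>g (x + z n) - g x\<bar> \<partial>lborel) \<longlonglongrightarrow> (\<integral>x. 0 \<partial>(lborel :: 'a measure))"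
    proof (rule integral_dominated_convergence[where w = "\<lambda>x. (2 * R) * indicator (cball 0 (R + 1)) x"])
      have "(\<lambda>n. \<bar>g (x + z n) - g x\<bar>) \<longlonglongrightarrow> 0" for x
      proof -
        have "(\<lambda>n. x + z n) \<longlonglongrightarrow> x + 0" by (intro tendsto_intros z)
        then have "(\<lambda>n. g (x + z n)) \<longlonglongrightarrow> g (x + 0)"
          by (intro continuous_on_tendsto_compose[OF g]) auto
        then have "(\<lambda>n. \<bar>g (x + z n) - g x\<bar>) \<longlonglongrightarrow> \<bar>g (x + 0) - g x\<bar>" by (intro tendsto_intros)
        then show ?thesis by simp
      qed
      then show "AE x in lborel. (\<lambda>n. \<bar>g (x + z n) - g x\<bar>) \<longlonglongrightarrow> 0" by simp
      show "AE x in lborel. norm \<bar>g (x + z n) - g x\<bar> \<le> (2 * R) * indicator (cball 0 (R + 1)) x" for n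
      proof (intro AE_I2)
        fix x :: 'a
        have "norm x \<le> norm (x + z n) + norm (z n)" by (metis add_diff_cancel_right' norm_triangle_ineq4)
        then have "norm x \<le> norm (x + z n) + 1" using z(2)[of n] by linarith
        then show "norm \<bar>g (x + z n) - g x\<bar> \<le> (2 * R) * indicator (cball 0 (R + 1)) x"
          using gR[of x] gR[of "x + z n"] R
          by (cases "norm x \<le> R"; cases "norm (x + z n) \<le> R"; cases "norm x \<le> R + 1") auto
      qed
    qed (use int_ball in auto)
    then show ?thesis by simp
  qed
  have "\<exists>d>0. \<forall>z. norm z < d \<longrightarrow> (\<integral>x. \<bar>g (x + z) - g x\<bar> \<partial>lborel) < e / 3"
  proof (rule ccontr)
    assume "\<not> ?thesis"
    then have *: "\<forall>d>0. \<exists>z. norm z < d \<and> \<not> (\<integral>x. \<bar>g (x + z) - g x\<bar> \<partial>lborel) < e / 3" by blast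
    have "\<exists>z. norm z < 1 / real (Suc n) \<and> \<not> (\<integral>x. \<bar>g (x + z) - g x\<bar> \<partial>lborel) < e / 3" for n
      using *[rule_format, of "1 / real (Suc n)"] by simp
    then obtain z where z: "\<And>n. norm (z n) < 1 / real (Suc n)"
      "\<And>n. \<not> (\<integral>x. \<bar>g (x + z n) - g x\<bar> \<partial>lborel) < e / 3" by metis
    have "z \<longlonglongrightarrow> 0"
      by (rule tendsto_norm_zero_cancel, rule tendsto_sandwich[OF _ _ tendsto_const LIMSEQ_Suc[OF lim_1_over_n]])
         (use z(1)[THEN less_imp_le] in auto)
    moreover have "norm (z n) \<le> 1" for n
      using z(1)[of n, THEN less_imp_le] by (rule order_trans) simp
    ultimately have "\<forall>\<^sub>F n in sequentially. (\<integral>x. \<bar>g (x + z n) - g x\<bar> \<partial>lborel) < e / 3"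
      using seq e by (intro order_tendstoD(2)) auto
    then show False using z(2) by (auto simp: eventually_sequentially)
  qed
  then obtain d where d: "0 < d" "\<And>z. norm z < d \<Longrightarrow> (\<integral>x. \<bar>g (x + z) - g x\<bar> \<partial>lborel) < e / 3" by blast
  have "(\<integral>x. \<bar>h (x + z) - h x\<bar> \<partial>lborel) < e" if "norm z < d" for z
  proof -
    have i1: "integrable lborel (\<lambda>x. h (x + z))" "integrable lborel (\<lambda>x. g (x + z))"
      using h intg by (simp_all add: integral_lborel_translate(2))
    have "(\<integral>x. \<bar>h (x + z) - h x\<bar> \<partial>lborel) \<le>
       (\<integral>x. \<bar>h (x + z) - g (x + z)\<bar> + (\<bar>g (x + z) - g x\<bar> + \<bar>h x - g x\<bar>) \<partial>lborel)"
      using h intg i1 by (intro integral_mono) auto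
    also have "\<dots> = (\<integral>x. \<bar>h (x + z) - g (x + z)\<bar> \<partial>lborel) +
        ((\<integral>x. \<bar>g (x + z) - g x\<bar> \<partial>lborel) + (\<integral>x. \<bar>h x - g x\<bar> \<partial>lborel))"
      using h intg i1 by (subst Bochner_Integration.integral_add | simp)+
    also have "(\<integral>x. \<bar>h (x + z) - g (x + z)\<bar> \<partial>lborel) = (\<integral>x. \<bar>h x - g x\<bar> \<partial>lborel)"
      by (rule integral_lborel_translate(1)[of "\<lambda>x. \<bar>h x - g x\<bar>"]) simp
    finally show ?thesis using hg d(2)[OF that] by linarith
  qed
  with d(1) show ?thesis using that by blast
qed

definition bump_mass :: "'n::finite itself \<Rightarrow> real \<Rightarrow> real" where
  "bump_mass _ r = (\<integral>y. bump (0 :: real^'n) r y \<partial>lborel)"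

lemma bump_shift: "bump x r y = bump 0 r (y - x)"
  by (simp add: bump_def)

lemma bump_measurable [measurable]: "(\<lambda>p. bump (fst p) r (snd p)) \<in> borel_measurable (borel :: ((real^'n::finite) \<times> (real^'n)) measure)"
proof -
  have b: "bump (0 :: real^'n) r \<in> borel_measurable borel"
    by (rule borel_measurable_continuous_onI[OF smooth_continuous[OF smooth_bump]])
  have "(\<lambda>p. bump 0 r (snd p - fst p)) \<in> borel_measurable (borel :: ((real^'n) \<times> (real^'n)) measure)"
    by (rule measurable_compose[OF _ b]) (intro borel_measurable_continuous_onI continuous_intros)
  then show ?thesis by (subst bump_shift)
qed

lemma bump_measurable1 [measurable]: "bump c r \<in> borel_measurable borel"
  by (rule borel_measurable_continuous_onI[OF smooth_continuous[OF smooth_bump]])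

lemma bump_integrable: "integrable lborel (bump c r)"
  by (rule test_functions_integrable[OF bump_test_function[OF subset_UNIV]])

lemma bump_mass_pos:
  assumes "0 < r" shows "0 < bump_mass TYPE('n::finite) r"
proof -
  have "bump_mass TYPE('n) r \<noteq> 0"
  proof
    assume "bump_mass TYPE('n) r = 0"
    then have "AE y in lborel. bump (0 :: real^'n) r y = 0"
      unfolding bump_mass_def using bump_integrable by (subst (asm) integral_nonneg_eq_0_iff_AE) (auto simp: bump_nonneg)
    then have "AE y in lborel. y \<notin> ball (0 :: real^'n) r"
      by (rule AE_mp) (use assms in \<open>auto simp: bump_eq_0_iff\<close>)
    then have "ball (0 :: real^'n) r \<in> null_sets lebesgue"
      by (subst AE_iff_null_sets) (auto intro: AE_completion)
    then show False
      using assms open_not_negligible[of "ball (0 :: real^'n) r"] by (simp add: negligible_iff_null_sets)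
  qed
  moreover have "0 \<le> bump_mass TYPE('n) r"
    unfolding bump_mass_def by (simp add: bump_nonneg)
  ultimately show ?thesis by simp
qed

text \<open>After the order of integration is exchanged, the pairing of \<open>a\<close> with the mollified function is an average over
small \<open>z\<close> of the pairings of \<open>a\<close> with the translates \<open>\<lambda>x. h (x + z)\<close>.  These depend continuously on \<open>z\<close>
since translation is continuous in \<open>L\<^sup>1\<close>.\<close>

lemma mollification_weak_limit:
  fixes h a :: "real^'n::finite \<Rightarrow> real"
  assumes h: "integrable lborel h" and [measurable]: "a \<in> borel_measurable borel"
    and M: "\<And>x. \<bar>a x\<bar> \<le> M" and e: "0 < e"
  obtains d where "0 < d" "\<And>r. 0 < r \<Longrightarrow> r < d \<Longrightarrow>
    \<bar>(\<integral>x. a x * (\<integral>y. bump x r y * h y \<partial>lborel) \<partial>lborel) / bump_mass TYPE('n) r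
      - (\<integral>x. a x * h x \<partial>lborel)\<bar> \<le> e"
proof -
  have [measurable]: "h \<in> borel_measurable borel" using borel_measurable_integrable[OF h] by simp
  have M0: "0 \<le> M" using M[of 0] by linarith
  obtain d where d: "0 < d" "\<And>z. norm z < d \<Longrightarrow> (\<integral>x. \<bar>h (x + z) - h x\<bar> \<partial>lborel) < e / (M + 1)"
    using L1_translation_continuous[OF h, of "e / (M + 1)"] e M0 by auto
  define A where "A z = (\<integral>x. a x * h (x + z) \<partial>lborel)" for z
  have hz: "integrable lborel (\<lambda>x. h (x + z))" for z using h by (simp add: integral_lborel_translate(2))
  have ahz: "integrable lborel (\<lambda>x. a x * h (x + z))" for z
    by (rule Bochner_Integration.integrable_bound[OF integrable_mult_right[OF hz[of z], of M]])
       (use M M0 in \<open>auto simp: abs_mult intro!: AE_I2 mult_right_mono\<close>)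
  have hpair [measurable]: "(\<lambda>p. h (fst p + snd p)) \<in> borel_measurable (borel \<Otimes>\<^sub>M borel)"
    "(\<lambda>p. h (snd p + fst p)) \<in> borel_measurable (borel \<Otimes>\<^sub>M borel)"
    by measurable
  have [measurable]: "A \<in> borel_measurable borel" unfolding A_def by measurable
  have absA: "(\<integral>x. \<bar>a x * h (x + z)\<bar> \<partial>lborel) \<le> M * (\<integral>x. \<bar>h x\<bar> \<partial>lborel)" for z
  proof -
    have "(\<integral>x. \<bar>a x * h (x + z)\<bar> \<partial>lborel) \<le> (\<integral>x. M * \<bar>h (x + z)\<bar> \<partial>lborel)"
      using M by (intro integral_mono[OF integrable_abs[OF ahz] integrable_mult_right[OF integrable_abs[OF hz]]])
         (auto simp: abs_mult intro: mult_right_mono)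
    also have "\<dots> = M * (\<integral>x. \<bar>h x\<bar> \<partial>lborel)"
      using integral_lborel_translate(1)[of "\<lambda>x. \<bar>h x\<bar>" z] by simp
    finally show ?thesis .
  qed
  have bA: "\<bar>A z\<bar> \<le> M * (\<integral>x. \<bar>h x\<bar> \<partial>lborel)" for z
    unfolding A_def by (rule order_trans[OF integral_abs_bound absA])
  have "\<bar>(\<integral>x. a x * (\<integral>y. bump x r y * h y \<partial>lborel) \<partial>lborel) / bump_mass TYPE('n) r
      - (\<integral>x. a x * h x \<partial>lborel)\<bar> \<le> e" if r: "0 < r" "r < d" for r
  proof -
    let ?b = "bump (0 :: real^'n) r"
    have inner: "(\<integral>y. bump x r y * h y \<partial>lborel) = (\<integral>z. ?b z * h (z + x) \<partial>lborel)" for x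
      using integral_lborel_translate(1)[of "\<lambda>y. ?b (y - x) * h y" x] by (simp add: bump_shift[of x])
    have bA_int: "integrable lborel (\<lambda>z. ?b z * A z)"
      by (rule Bochner_Integration.integrable_bound[OF integrable_mult_left[OF bump_integrable[of 0 r], of "M * (\<integral>x. \<bar>h x\<bar> \<partial>lborel)"]])
         (use bA M0 bump_nonneg[of 0 r] in \<open>auto simp: abs_mult intro!: AE_I2 mult_left_mono\<close>)
    have "integrable (lborel \<Otimes>\<^sub>M lborel) (\<lambda>(z, x). a x * (?b z * h (z + x)))"
    proof (rule lborel_pair.Fubini_integrable)
      have eq: "(\<integral>x. norm (case (z, x) of (z, x) \<Rightarrow> a x * (?b z * h (z + x))) \<partial>lborel)
          = ?b z * (\<integral>x. \<bar>a x * h (x + z)\<bar> \<partial>lborel)" for z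
        using bump_nonneg[of 0 r z] by (simp add: abs_mult mult_ac add.commute flip: integral_mult_right_zero)
      have "\<bar>\<integral>x. \<bar>a x * h (x + z)\<bar> \<partial>lborel\<bar> \<le> M * (\<integral>x. \<bar>h x\<bar> \<partial>lborel)" for z
        using absA[of z] by simp
      then show "integrable lborel (\<lambda>z. \<integral>x. norm (case (z, x) of (z, x) \<Rightarrow> a x * (?b z * h (z + x))) \<partial>lborel)"
        unfolding eq
        by (intro Bochner_Integration.integrable_bound[OF integrable_mult_left[OF bump_integrable[of 0 r], of "M * (\<integral>x. \<bar>h x\<bar> \<partial>lborel)"]])
           (use M0 bump_nonneg[of 0 r] in \<open>auto simp: abs_mult intro!: AE_I2 mult_left_mono\<close>)
      show "AE z in lborel. integrable lborel (\<lambda>x. case (z, x) of (z, x) \<Rightarrow> a x * (?b z * h (z + x)))"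
      proof (intro AE_I2)
        fix z
        show "integrable lborel (\<lambda>x. case (z, x) of (z, x) \<Rightarrow> a x * (?b z * h (z + x)))"
          using integrable_mult_right[OF ahz[of z], of "?b z"] by (simp only: prod.case mult_ac add.commute)
      qed
    qed measurable
    then have "(\<integral>x. (\<integral>z. a x * (?b z * h (z + x)) \<partial>lborel) \<partial>lborel) = (\<integral>z. (\<integral>x. a x * (?b z * h (z + x)) \<partial>lborel) \<partial>lborel)"
      by (rule lborel_pair.Fubini_integral)
    also have "\<dots> = (\<integral>z. ?b z * A z \<partial>lborel)"
      unfolding A_def by (simp add: mult_ac add.commute flip: integral_mult_right_zero)
    finally have 1: "(\<integral>x. a x * (\<integral>y. bump x r y * h y \<partial>lborel) \<partial>lborel) = (\<integral>z. ?b z * A z \<partial>lborel)"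
      unfolding inner by simp
    have close: "\<bar>A z - A 0\<bar> \<le> e" if z: "norm z < d" for z
    proof -
      have "A z - A 0 = (\<integral>x. a x * (h (x + z) - h x) \<partial>lborel)"
        unfolding A_def using ahz[of z] ahz[of 0]
        by (subst Bochner_Integration.integral_diff[symmetric]) (simp_all add: algebra_simps)
      also have "\<bar>\<dots>\<bar> \<le> (\<integral>x. \<bar>a x * (h (x + z) - h x)\<bar> \<partial>lborel)" by (rule integral_abs_bound)
      also have "\<dots> \<le> (\<integral>x. M * \<bar>h (x + z) - h x\<bar> \<partial>lborel)"
      proof (rule integral_mono)
        show "integrable lborel (\<lambda>x. \<bar>a x * (h (x + z) - h x)\<bar>)"
          using Bochner_Integration.integrable_diff[OF ahz[of z] ahz[of 0]]
          by (intro integrable_abs) (simp add: right_diff_distrib)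
        show "integrable lborel (\<lambda>x. M * \<bar>h (x + z) - h x\<bar>)"
          by (intro integrable_mult_right integrable_abs Bochner_Integration.integrable_diff hz h)
      qed (use M in \<open>auto simp: abs_mult intro: mult_right_mono\<close>)
      also have "\<dots> = M * (\<integral>x. \<bar>h (x + z) - h x\<bar> \<partial>lborel)" by simp
      also have "\<dots> \<le> M * (e / (M + 1))" using d(2)[OF z] M0 by (intro mult_left_mono) auto
      also have "\<dots> \<le> e" using M0 e by (simp add: field_simps)
      finally show ?thesis .
    qed
    have "\<bar>(\<integral>z. ?b z * A z \<partial>lborel) - (\<integral>z. ?b z * A 0 \<partial>lborel)\<bar> = \<bar>\<integral>z. ?b z * (A z - A 0) \<partial>lborel\<bar>"
      using bA_int bump_integrable[of "0 :: real^'n" r]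
      by (subst Bochner_Integration.integral_diff[symmetric]) (simp_all add: right_diff_distrib)
    also have "\<dots> \<le> (\<integral>z. \<bar>?b z * (A z - A 0)\<bar> \<partial>lborel)" by (rule integral_abs_bound)
    also have "\<dots> \<le> (\<integral>z. ?b z * e \<partial>lborel)"
    proof (rule integral_mono)
      show "integrable lborel (\<lambda>z. \<bar>?b z * (A z - A 0)\<bar>)"
        using Bochner_Integration.integrable_diff[OF bA_int integrable_mult_left[OF bump_integrable[of 0 r], of "A 0"]]
        by (intro integrable_abs) (simp add: right_diff_distrib)
      show "\<bar>?b z * (A z - A 0)\<bar> \<le> ?b z * e" for z
      proof (cases "norm z < r")
        case True
        then show ?thesis using close[of z] r bump_nonneg[of 0 r z] by (simp add: abs_mult mult_left_mono)
      next
        case False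
        then have "?b z = 0" using r by (simp add: bump_eq_0_iff)
        then show ?thesis by simp
      qed
    qed (use bump_integrable[of "0 :: real^'n" r] in simp)
    also have "\<dots> = bump_mass TYPE('n) r * e" by (simp add: bump_mass_def)
    finally have "\<bar>(\<integral>z. ?b z * A z \<partial>lborel) - bump_mass TYPE('n) r * A 0\<bar> \<le> bump_mass TYPE('n) r * e"
      by (simp add: bump_mass_def)
    then have "\<bar>(\<integral>z. ?b z * A z \<partial>lborel) / bump_mass TYPE('n) r - A 0\<bar> \<le> e"
      using bump_mass_pos[OF r(1), where 'n = 'n] by (simp add: abs_le_iff field_simps)
    then show ?thesis unfolding 1 by (simp add: A_def)
  qed
  with d(1) show ?thesis using that by blast
qed

section \<open>The fundamental lemma of the calculus of variations\<close>

lemma locally_integrable_times_test: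
  assumes g: "locally_integrable U g" and U: "U \<in> sets lebesgue" and \<phi>: "\<phi> \<in> test_functions U"
  shows "integrable (lebesgue_on U) (\<lambda>x. g x * \<phi> x)"
proof -
  obtain K where K: "compact K" "K \<subseteq> U" "\<And>x. x \<notin> K \<Longrightarrow> \<phi> x = 0"
    using test_functions_support[OF \<phi>] by blast
  obtain M where M: "0 \<le> M" "\<And>x. \<bar>\<phi> x\<bar> \<le> M" using test_functions_bounded[OF \<phi>] by blast
  have i: "integrable lebesgue (\<lambda>x. indicator K x *\<^sub>R g x)"
    using g K by (auto simp: locally_integrable_def set_integrable_def)
  have m: "\<phi> \<in> borel_measurable lebesgue"
    using test_functions_measurable[OF \<phi>] by (intro measurable_completion) simp
  have "integrable lebesgue (\<lambda>x. (indicator K x *\<^sub>R g x) * \<phi> x)"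
  proof (rule Bochner_Integration.integrable_bound[OF integrable_mult_right[OF i, of M]])
    show "(\<lambda>x. (indicator K x *\<^sub>R g x) * \<phi> x) \<in> borel_measurable lebesgue"
      using borel_measurable_integrable[OF i] m by measurable
    show "AE x in lebesgue. norm ((indicator K x *\<^sub>R g x) * \<phi> x) \<le> norm (M * (indicator K x *\<^sub>R g x))"
      using M by (auto simp: abs_mult mult.commute[of _ "\<bar>\<phi> _\<bar>"] intro!: AE_I2 mult_right_mono)
  qed
  also have "(\<lambda>x. (indicator K x *\<^sub>R g x) * \<phi> x) = (\<lambda>x. indicator U x *\<^sub>R (g x * \<phi> x))"
    using K by (force simp: fun_eq_iff indicator_def)
  finally show ?thesis using U by (simp add: integrable_restrict_space)
qed

lemma lebesgue_on_integral_indicator: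
  fixes f :: "real^'n::finite \<Rightarrow> real"
  assumes "U \<in> sets lebesgue"
  shows "(LINT x|lebesgue_on U. f x) = (LINT x|lebesgue. indicator U x * f x)"
  using assms by (simp add: integral_restrict_space)

text \<open>Localisation by the cutoff \<open>\<eta>\<close> gives a function that is integrable on the whole space and all of
whose mollifications vanish, as \<open>\<eta>\<close> times a bump is a test function.  In the limit the function itself is
orthogonal to its sign.\<close>

lemma zero_where_cutoff_nonzero:
  fixes g :: "real^'n::finite \<Rightarrow> real"
  assumes g: "locally_integrable U g" and U: "U \<in> sets lebesgue"
    and zero: "\<And>\<phi>. \<phi> \<in> test_functions U \<Longrightarrow> (LINT x|lebesgue_on U. g x * \<phi> x) = 0"
    and \<eta>: "\<eta> \<in> test_functions U"
  shows "AE x in lebesgue. indicator U x * g x * \<eta> x = 0"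
proof -
  have "integrable lebesgue (\<lambda>x. indicator U x * g x * \<eta> x)"
    using locally_integrable_times_test[OF g U \<eta>] U by (simp add: integrable_restrict_space mult_ac)
  then have m: "(\<lambda>x. indicator U x * g x * \<eta> x) \<in> borel_measurable lebesgue"
    and i: "integrable lebesgue (\<lambda>x. indicator U x * g x * \<eta> x)" by auto
  obtain h where h [measurable]: "h \<in> borel_measurable lborel"
    and ae: "AE x in lborel. indicator U x * g x * \<eta> x = h x"
    using completion_ex_borel_measurable_real[OF m] by blast
  have ae': "AE x in lebesgue. indicator U x * g x * \<eta> x = h x" using ae by (rule AE_completion)
  have ih: "integrable lborel h"
  proof -
    have "integrable lebesgue h"
      by (rule integrable_cong_AE_imp[OF i]) (use ae' h in \<open>auto intro: measurable_completion\<close>)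
    then show ?thesis using h by (simp add: integrable_completion)
  qed
  have conv0: "(\<integral>y. bump x r y * h y \<partial>lborel) = 0" for x r
  proof -
    have "(\<integral>y. bump x r y * h y \<partial>lborel) = (\<integral>y. bump x r y * h y \<partial>lebesgue)"
      by (rule integral_completion[symmetric]) simp
    also have "\<dots> = (\<integral>y. indicator U y * (g y * (\<eta> y * bump x r y)) \<partial>lebesgue)"
    proof (rule integral_cong_AE)
      have "(\<lambda>y. bump x r y * (indicator U y * g y * \<eta> y)) \<in> borel_measurable lebesgue"
        by (intro borel_measurable_times m measurable_completion) simp
      then show "(\<lambda>y. indicator U y * (g y * (\<eta> y * bump x r y))) \<in> borel_measurable lebesgue"
        by (simp add: mult_ac)
    qed (use ae' in \<open>auto intro!: measurable_completion\<close>)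
    also have "\<dots> = 0"
      using zero[OF test_functions_mult_smooth[OF \<eta> smooth_bump]] U
      by (simp add: lebesgue_on_integral_indicator)
    finally show ?thesis .
  qed
  have "(\<integral>x. sgn (h x) * h x \<partial>lborel) = 0"
  proof (rule ccontr)
    assume n: "(\<integral>x. sgn (h x) * h x \<partial>lborel) \<noteq> 0"
    define e where "e = \<bar>\<integral>x. sgn (h x) * h x \<partial>lborel\<bar> / 2"
    have e: "0 < e" using n by (simp add: e_def)
    have b: "\<bar>sgn (h x)\<bar> \<le> 1" for x by (simp add: abs_sgn_eq)
    have sm: "(\<lambda>x. sgn (h x)) \<in> borel_measurable borel" by measurable
    obtain d where d: "0 < d" "\<And>r. 0 < r \<Longrightarrow> r < d \<Longrightarrow>
      \<bar>(\<integral>x. sgn (h x) * (\<integral>y. bump x r y * h y \<partial>lborel) \<partial>lborel) / bump_mass TYPE('n) r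
        - (\<integral>x. sgn (h x) * h x \<partial>lborel)\<bar> \<le> e"
      by (rule mollification_weak_limit[OF ih sm b e]) blast
    from d(2)[of "d/2"] d(1) have "\<bar>\<integral>x. sgn (h x) * h x \<partial>lborel\<bar> \<le> e" by (simp add: conv0)
    then show False using n by (simp add: e_def)
  qed
  then have "(\<integral>x. \<bar>h x\<bar> \<partial>lborel) = 0" by (simp add: abs_sgn mult.commute)
  then have "AE x in lborel. \<bar>h x\<bar> = 0"
    using ih by (subst (asm) integral_nonneg_eq_0_iff_AE) auto
  then have "AE x in lebesgue. \<bar>h x\<bar> = 0" by (rule AE_completion)
  with ae' show ?thesis by eventually_elim simp
qed

text \<open>Countably many balls on which some bump does not vanish cover \<open>U\<close>.\<close>

lemma AE_on_open_local:
  fixes U :: "(real^'n::finite) set"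
  assumes "open U"
    and loc: "\<And>\<eta>. \<eta> \<in> test_functions U \<Longrightarrow> AE x in lebesgue. \<eta> x \<noteq> 0 \<longrightarrow> P x"
  shows "AE x in lebesgue. x \<in> U \<longrightarrow> P x"
proof -
  define F where "F = {ball x r | x r. 0 < r \<and> cball x r \<subseteq> U}"
  obtain F' where F': "F' \<subseteq> F" "countable F'" "\<Union>F' = \<Union>F"
    using Lindelof[of F] by (auto simp: F_def)
  have "U \<subseteq> \<Union>F"
  proof
    fix x assume "x \<in> U"
    then obtain r where "0 < r" "cball x r \<subseteq> U" using \<open>open U\<close> open_contains_cball by blast
    then show "x \<in> \<Union>F" by (auto simp: F_def intro!: exI[of _ "ball x r"] exI[of _ x] exI[of _ r])
  qed
  moreover have "AE x in lebesgue. x \<in> B \<longrightarrow> P x" if "B \<in> F'" for B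
  proof -
    obtain c r where B: "B = ball c r" "0 < r" "cball c r \<subseteq> U" using F'(1) \<open>B \<in> F'\<close> unfolding F_def by blast
    have "AE x in lebesgue. bump c r x \<noteq> 0 \<longrightarrow> P x"
      using B by (intro loc bump_test_function) auto
    then show ?thesis
      by (rule AE_mp) (use B in \<open>auto simp: bump_eq_0_iff dist_norm norm_minus_commute\<close>)
  qed
  then have "AE x in lebesgue. \<forall>B\<in>F'. x \<in> B \<longrightarrow> P x" by (subst AE_ball_countable[OF F'(2)]) blast
  ultimately show ?thesis using F'(3) by (elim AE_mp) (auto intro!: AE_I2)
qed

lemma fundamental_lemma:
  fixes g :: "real^'n::finite \<Rightarrow> real"
  assumes g: "locally_integrable U g" and U: "open U"
    and zero: "\<And>\<phi>. \<phi> \<in> test_functions U \<Longrightarrow> (LINT x|lebesgue_on U. g x * \<phi> x) = 0"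
  shows "AE x in lebesgue_on U. g x = 0"
proof -
  have Us: "U \<in> sets lebesgue" using U by simp
  have "AE x in lebesgue. x \<in> U \<longrightarrow> (x \<in> U \<longrightarrow> g x = 0)"
  proof (rule AE_on_open_local[OF U])
    fix \<eta> assume "\<eta> \<in> test_functions U"
    then have "AE x in lebesgue. indicator U x * g x * \<eta> x = 0"
      by (intro zero_where_cutoff_nonzero[OF g Us]) (auto intro: zero)
    then show "AE x in lebesgue. \<eta> x \<noteq> 0 \<longrightarrow> x \<in> U \<longrightarrow> g x = 0"
      by eventually_elim auto
  qed
  then show ?thesis using Us by (simp add: AE_restrict_space_iff)
qed

section \<open>Semi-inner product spaces\<close>

lemma nonneg_quadratic_discriminant:
  fixes a b c :: real
  assumes q: "\<And>s. 0 \<le> a + 2 * s * b + s\<^sup>2 * c" and c: "0 \<le> c"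
  shows "b\<^sup>2 \<le> a * c"
proof (cases "c = 0")
  case True
  have "b = 0"
  proof (rule ccontr)
    assume b: "b \<noteq> 0"
    have "a + 2 * (- (a + 1) / (2 * b)) * b + (- (a + 1) / (2 * b))\<^sup>2 * c = - 1" using b True by (simp add: field_simps)
    then show False using q[of "- (a + 1) / (2 * b)"] by linarith
  qed
  then show ?thesis using True by simp
next
  case False
  with c have "0 < c" by simp
  moreover have "0 \<le> a - b\<^sup>2 / c"
    using q[of "- b / c"] False by (simp add: power2_eq_square field_simps)
  ultimately show ?thesis by (simp add: field_simps)
qed

text \<open>Since functions are not identified when they agree almost everywhere, \<open>B u u = 0\<close> does not imply \<open>u = 0\<close>.\<close>

locale semi_inner =
  fixes V :: "('a \<Rightarrow> real) set" and B :: "('a \<Rightarrow> real) \<Rightarrow> ('a \<Rightarrow> real) \<Rightarrow> real"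
  assumes zero_mem: "(\<lambda>x. 0) \<in> V"
    and add_mem: "u \<in> V \<Longrightarrow> v \<in> V \<Longrightarrow> (\<lambda>x. u x + v x) \<in> V"
    and cmult_mem: "u \<in> V \<Longrightarrow> (\<lambda>x. c * u x) \<in> V"
    and B_add: "u \<in> V \<Longrightarrow> v \<in> V \<Longrightarrow> w \<in> V \<Longrightarrow> B (\<lambda>x. u x + v x) w = B u w + B v w"
    and B_cmult: "u \<in> V \<Longrightarrow> w \<in> V \<Longrightarrow> B (\<lambda>x. c * u x) w = c * B u w"
    and B_sym: "u \<in> V \<Longrightarrow> w \<in> V \<Longrightarrow> B u w = B w u"
    and B_nonneg: "u \<in> V \<Longrightarrow> 0 \<le> B u u"
begin

lemma B_add_right: "u \<in> V \<Longrightarrow> v \<in> V \<Longrightarrow> w \<in> V \<Longrightarrow> B w (\<lambda>x. u x + v x) = B w u + B w v"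
  using B_add[of u v w] B_sym[of "\<lambda>x. u x + v x" w] B_sym[of u w] B_sym[of v w] add_mem[of u v] by simp

lemma B_cmult_right: "u \<in> V \<Longrightarrow> w \<in> V \<Longrightarrow> B w (\<lambda>x. c * u x) = c * B w u"
  using B_cmult[of u w c] B_sym[of "\<lambda>x. c * u x" w] B_sym[of u w] cmult_mem[of u c] by simp

lemma diff_mem: "u \<in> V \<Longrightarrow> v \<in> V \<Longrightarrow> (\<lambda>x. u x - v x) \<in> V"
  using add_mem[of u "\<lambda>x. (- 1) * v x"] cmult_mem[of v "- 1"] by simp

lemma B_diff: "u \<in> V \<Longrightarrow> v \<in> V \<Longrightarrow> w \<in> V \<Longrightarrow> B (\<lambda>x. u x - v x) w = B u w - B v w"
  using B_add[of u "\<lambda>x. (- 1) * v x" w] B_cmult[of v w "- 1"] cmult_mem[of v "- 1"] by simp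

lemma B_diff_right: "u \<in> V \<Longrightarrow> v \<in> V \<Longrightarrow> w \<in> V \<Longrightarrow> B w (\<lambda>x. u x - v x) = B w u - B w v"
  using B_diff[of u v w] B_sym[of "\<lambda>x. u x - v x" w] B_sym[of u w] B_sym[of v w] diff_mem[of u v] by simp

lemmas mem_intros = zero_mem add_mem cmult_mem diff_mem
lemmas B_simps = B_add B_add_right B_cmult B_cmult_right B_diff B_diff_right

lemma B_expand:
  assumes "u \<in> V" "v \<in> V"
  shows "B (\<lambda>x. u x + s * v x) (\<lambda>x. u x + s * v x) = B u u + 2 * s * B u v + s\<^sup>2 * B v v"
proof -
  have w: "(\<lambda>x. s * v x) \<in> V" "(\<lambda>x. u x + s * v x) \<in> V" by (intro add_mem cmult_mem assms)+
  have "B (\<lambda>x. u x + s * v x) (\<lambda>x. u x + s * v x) =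
      B u (\<lambda>x. u x + s * v x) + s * B v (\<lambda>x. u x + s * v x)"
    using B_add[OF assms(1) w(1) w(2)] B_cmult[OF assms(2) w(2)] by simp
  also have "B u (\<lambda>x. u x + s * v x) = B u u + s * B u v"
    using B_add_right[OF assms(1) w(1) assms(1)] B_cmult_right[OF assms(2) assms(1)] by simp
  also have "B v (\<lambda>x. u x + s * v x) = B u v + s * B v v"
    using B_add_right[OF assms(1) w(1) assms(2)] B_cmult_right[OF assms(2) assms(2)] B_sym assms by simp
  finally show ?thesis by (simp add: algebra_simps power2_eq_square)
qed

lemma Cauchy_Schwarz2: "u \<in> V \<Longrightarrow> v \<in> V \<Longrightarrow> (B u v)\<^sup>2 \<le> B u u * B v v"
  by (rule nonneg_quadratic_discriminant, subst B_expand[symmetric], assumption, assumption, (intro B_nonneg add_mem cmult_mem; assumption)+)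

lemma Cauchy_Schwarz: "u \<in> V \<Longrightarrow> v \<in> V \<Longrightarrow> \<bar>B u v\<bar> \<le> sqrt (B u u) * sqrt (B v v)"
  by (metis Cauchy_Schwarz2 real_sqrt_abs real_sqrt_le_mono real_sqrt_mult)

lemma sqrt_B_triangle:
  assumes "u \<in> V" "v \<in> V"
  shows "sqrt (B (\<lambda>x. u x + v x) (\<lambda>x. u x + v x)) \<le> sqrt (B u u) + sqrt (B v v)"
proof (rule real_le_lsqrt)
  have "B (\<lambda>x. u x + v x) (\<lambda>x. u x + v x) = B u u + 2 * B u v + B v v"
    using B_expand[OF assms, of 1] by simp
  also have "\<dots> \<le> (sqrt (B u u))\<^sup>2 + 2 * (sqrt (B u u) * sqrt (B v v)) + (sqrt (B v v))\<^sup>2"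
    using Cauchy_Schwarz[OF assms] B_nonneg assms by simp
  also have "\<dots> = (sqrt (B u u) + sqrt (B v v))\<^sup>2" by (simp add: power2_sum)
  finally show "B (\<lambda>x. u x + v x) (\<lambda>x. u x + v x) \<le> (sqrt (B u u) + sqrt (B v v))\<^sup>2" .
qed (use assms B_nonneg in auto)

lemma sqrt_B_cmult: "u \<in> V \<Longrightarrow> sqrt (B (\<lambda>x. c * u x) (\<lambda>x. c * u x)) = \<bar>c\<bar> * sqrt (B u u)"
  using B_cmult[of u "\<lambda>x. c * u x" c] B_cmult_right[of u u c] cmult_mem[of u c]
  by (simp add: real_sqrt_mult flip: mult.assoc)

lemma parallelogram:
  assumes "u \<in> V" "v \<in> V"
  shows "B (\<lambda>x. u x - v x) (\<lambda>x. u x - v x) = 2 * B u u + 2 * B v v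
    - 4 * B (\<lambda>x. (1/2) * (u x + v x)) (\<lambda>x. (1/2) * (u x + v x))"
proof -
  let ?w = "\<lambda>x. u x + v x"
  have w: "?w \<in> V" using assms by (rule add_mem)
  have "B (\<lambda>x. (1/2) * ?w x) (\<lambda>x. (1/2) * ?w x) = (1/2) * ((1/2) * B ?w ?w)"
    using B_cmult[OF w cmult_mem[OF w, of "1/2"], of "1/2"] B_cmult_right[OF w w, of "1/2"] by simp
  moreover have "B ?w ?w = B u u + 2 * B u v + B v v" using B_expand[OF assms, of 1] by simp
  moreover have "B (\<lambda>x. u x - v x) (\<lambda>x. u x - v x) = B u u - 2 * B u v + B v v"
    using B_expand[OF assms, of "-1"] by simp
  ultimately show ?thesis by simp
qed

end

locale semi_hilbert = semi_inner +
  assumes complete: "\<And>s :: nat \<Rightarrow> 'a \<Rightarrow> real. (\<And>n. s n \<in> V) \<Longrightarrow>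
     (\<And>e. 0 < e \<Longrightarrow> \<exists>N. \<forall>m\<ge>N. \<forall>n\<ge>N. sqrt (B (\<lambda>x. s m x - s n x) (\<lambda>x. s m x - s n x)) < e) \<Longrightarrow>
     \<exists>w\<in>V. (\<lambda>n. sqrt (B (\<lambda>x. s n x - w x) (\<lambda>x. s n x - w x))) \<longlonglongrightarrow> 0"
begin

text \<open>A minimising sequence of the functional \<open>B v v - 2 F v\<close> is Cauchy by the parallelogram identity, and its
limit \<open>w\<close> is a minimiser.  The quadratic polynomial in \<open>r\<close> obtained from \<open>w + r v\<close> is minimal at \<open>r = 0\<close>.\<close>

theorem Riesz_representation:
  assumes F_add: "\<And>u v. u \<in> V \<Longrightarrow> v \<in> V \<Longrightarrow> F (\<lambda>x. u x + v x) = F u + F v"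
    and F_cmult: "\<And>c u. u \<in> V \<Longrightarrow> F (\<lambda>x. c * u x) = c * F u"
    and F_bd: "\<And>u. u \<in> V \<Longrightarrow> \<bar>F u\<bar> \<le> C * sqrt (B u u)"
  shows "\<exists>w\<in>V. \<forall>v\<in>V. B w v = F v"
proof -
  have F_diff: "F (\<lambda>x. u x - v x) = F u - F v" if "u \<in> V" "v \<in> V" for u v
    using F_add[of u "\<lambda>x. (- 1) * v x"] F_cmult[of v "- 1"] cmult_mem[of v "- 1"] that by simp
  define E where "E v = B v v - 2 * F v" for v
  have low: "- C\<^sup>2 \<le> E v" if "v \<in> V" for v
  proof -
    have "F v \<le> C * sqrt (B v v)" using F_bd[OF that] by linarith
    moreover have "0 \<le> (sqrt (B v v) - C)\<^sup>2" by simp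
    ultimately show ?thesis unfolding E_def using B_nonneg[OF that]
      by (simp add: power2_diff algebra_simps)
  qed
  define m where "m = Inf (E ` V)"
  have bdd: "bdd_below (E ` V)" using low by (auto intro!: bdd_belowI2)
  have m_le: "m \<le> E v" if "v \<in> V" for v unfolding m_def using bdd that by (intro cInf_lower) auto
  have "\<exists>v\<in>V. E v < m + 1 / real (Suc n)" for n
  proof -
    have "Inf (E ` V) < m + 1 / real (Suc n)" by (simp add: m_def)
    then show ?thesis using zero_mem bdd by (subst (asm) cInf_less_iff) auto
  qed
  then obtain s where s: "\<And>n. s n \<in> V" "\<And>n. E (s n) < m + 1 / real (Suc n)" by metis
  have par: "B (\<lambda>x. u x - v x) (\<lambda>x. u x - v x) \<le> 2 * E u + 2 * E v - 4 * m" if "u \<in> V" "v \<in> V" for u v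
  proof -
    have "m \<le> E (\<lambda>x. (1/2) * (u x + v x))" using that by (intro m_le mem_intros)
    moreover have "F (\<lambda>x. (1/2) * (u x + v x)) = (1/2) * (F u + F v)"
      using that by (subst F_cmult) (auto intro: add_mem simp: F_add)
    ultimately show ?thesis using parallelogram[OF that] by (simp add: E_def)
  qed
  have small: "sqrt (B (\<lambda>x. s k x - s n x) (\<lambda>x. s k x - s n x)) < e"
    if e: "0 < e" and N: "4 / real (Suc N) < e\<^sup>2" and k: "N \<le> k" "N \<le> n" for e N k n
  proof -
    have "1 / real (Suc k) \<le> 1 / real (Suc N)" "1 / real (Suc n) \<le> 1 / real (Suc N)"
      using k by (auto intro!: divide_left_mono)
    then have "B (\<lambda>x. s k x - s n x) (\<lambda>x. s k x - s n x) \<le> 4 / real (Suc N)"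
      using par[OF s(1)[of k] s(1)[of n]] s(2)[of k] s(2)[of n] by linarith
    then have "B (\<lambda>x. s k x - s n x) (\<lambda>x. s k x - s n x) < e\<^sup>2" using N by linarith
    then show ?thesis using e by (metis abs_of_pos real_sqrt_abs real_sqrt_less_iff)
  qed
  have Cauchy: "\<exists>N. \<forall>k\<ge>N. \<forall>n\<ge>N. sqrt (B (\<lambda>x. s k x - s n x) (\<lambda>x. s k x - s n x)) < e" if e: "0 < e" for e
  proof -
    obtain N where "4 / e\<^sup>2 < real N" using reals_Archimedean2 by blast
    then have "4 / e\<^sup>2 < real (Suc N)" by simp
    then have "4 / real (Suc N) < e\<^sup>2" using e by (simp add: field_simps)
    then show ?thesis using small[OF e] by blast
  qed
  obtain w where w: "w \<in> V" "(\<lambda>n. sqrt (B (\<lambda>x. s n x - w x) (\<lambda>x. s n x - w x))) \<longlonglongrightarrow> 0"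
    using complete[of s] s Cauchy by blast
  let ?d = "\<lambda>n. sqrt (B (\<lambda>x. s n x - w x) (\<lambda>x. s n x - w x))"
  have Ew: "E w \<le> m"
  proof -
    have "E w \<le> m + 1 / real (Suc n) + (2 * sqrt (B w w) + 2 * C) * ?d n" for n
    proof -
      let ?v = "\<lambda>x. s n x - w x"
      have v: "?v \<in> V" using s w by (intro mem_intros)
      have "B (s n) (s n) = B w w + 2 * B w ?v + B ?v ?v"
        using B_expand[OF w(1) v, of 1] by simp
      then have "E w = E (s n) - 2 * B w ?v - B ?v ?v + 2 * F ?v"
        using s w by (simp add: E_def F_diff)
      also have "\<dots> \<le> E (s n) + 2 * (sqrt (B w w) * ?d n) + 2 * (C * ?d n)"
        using Cauchy_Schwarz[OF w(1) v] F_bd[OF v] B_nonneg[OF v] by linarith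
      also have "\<dots> \<le> m + 1 / real (Suc n) + 2 * (sqrt (B w w) * ?d n) + 2 * (C * ?d n)"
        using s(2)[of n] by linarith
      finally show ?thesis by (simp add: algebra_simps)
    qed
    moreover have "(\<lambda>n. m + 1 / real (Suc n) + (2 * sqrt (B w w) + 2 * C) * ?d n) \<longlonglongrightarrow> m + 0 + (2 * sqrt (B w w) + 2 * C) * 0"
      by (intro tendsto_intros w LIMSEQ_Suc[OF lim_1_over_n])
    ultimately show ?thesis by (intro LIMSEQ_le_const) (auto)
  qed
  have "B w v = F v" if v: "v \<in> V" for v
  proof -
    have "0 \<le> 0 + 2 * r * (B w v - F v) + r\<^sup>2 * B v v" for r
    proof -
      have "E w \<le> E (\<lambda>x. w x + r * v x)" using Ew m_le[of "\<lambda>x. w x + r * v x"] w v by (force intro: mem_intros)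
      then show ?thesis using w v by (simp add: E_def B_expand F_add F_cmult mem_intros algebra_simps)
    qed
    from nonneg_quadratic_discriminant[OF this B_nonneg[OF v]] show ?thesis by simp
  qed
  with w(1) show ?thesis by blast
qed

text \<open>Completeness passes to closed subspaces and to equivalent forms; \<open>H10\<close> with the inner product of
the gradients is obtained from \<open>H\<^sup>1\<close> in this way, and \<open>H10\<close> with the energy form from the former.\<close>

lemma semi_hilbert_of_equivalent:
  assumes B': "semi_inner V' B'" and sub: "V' \<subseteq> V" and c: "0 \<le> c"
    and lower: "\<And>v. v \<in> V' \<Longrightarrow> sqrt (B v v) \<le> c * sqrt (B' v v)"
    and upper: "\<And>v. v \<in> V' \<Longrightarrow> sqrt (B' v v) \<le> c * sqrt (B v v)"
    and closed: "\<And>s w. (\<And>n. s n \<in> V') \<Longrightarrow> w \<in> V \<Longrightarrow>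
      (\<lambda>n::nat. sqrt (B (\<lambda>x. s n x - w x) (\<lambda>x. s n x - w x))) \<longlonglongrightarrow> 0 \<Longrightarrow> w \<in> V'"
  shows "semi_hilbert V' B'"
proof -
  interpret b: semi_inner V' B' by (rule B')
  show ?thesis
  proof
    fix s :: "nat \<Rightarrow> 'a \<Rightarrow> real"
    assume s: "\<And>n. s n \<in> V'"
      and C: "\<And>e. 0 < e \<Longrightarrow> \<exists>N. \<forall>m\<ge>N. \<forall>n\<ge>N. sqrt (B' (\<lambda>x. s m x - s n x) (\<lambda>x. s m x - s n x)) < e"
    have "\<exists>w\<in>V. (\<lambda>n. sqrt (B (\<lambda>x. s n x - w x) (\<lambda>x. s n x - w x))) \<longlonglongrightarrow> 0"
    proof (rule complete)
      fix e :: real assume e: "0 < e"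
      \<comment> \<open>The denominator is \<open>c + 1\<close> because \<open>c\<close> may vanish.\<close>
      then obtain N where N: "\<And>m n. N \<le> m \<Longrightarrow> N \<le> n \<Longrightarrow> sqrt (B' (\<lambda>x. s m x - s n x) (\<lambda>x. s m x - s n x)) < e / (c + 1)"
        using C[of "e / (c + 1)"] c by auto
      have "sqrt (B (\<lambda>x. s m x - s n x) (\<lambda>x. s m x - s n x)) < e" if mn: "N \<le> m" "N \<le> n" for m n
      proof -
        have "sqrt (B (\<lambda>x. s m x - s n x) (\<lambda>x. s m x - s n x)) \<le> c * (e / (c + 1))"
          using lower[OF b.diff_mem[OF s[of m] s[of n]]] mult_left_mono[OF less_imp_le[OF N[OF mn]] c] by linarith
        also have "\<dots> < e" using e c by (simp add: field_simps)
        finally show ?thesis .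
      qed
      then show "\<exists>N. \<forall>m\<ge>N. \<forall>n\<ge>N. sqrt (B (\<lambda>x. s m x - s n x) (\<lambda>x. s m x - s n x)) < e" by blast
    qed (use s sub in blast)
    then obtain w where w: "w \<in> V" "(\<lambda>n. sqrt (B (\<lambda>x. s n x - w x) (\<lambda>x. s n x - w x))) \<longlonglongrightarrow> 0" by blast
    have wV: "w \<in> V'" by (rule closed[OF s w])
    have "(\<lambda>n. sqrt (B' (\<lambda>x. s n x - w x) (\<lambda>x. s n x - w x))) \<longlonglongrightarrow> 0"
      by (rule Lim_null_comparison[OF always_eventually tendsto_mult_right_zero[OF w(2), of c]])
         (use upper[OF b.diff_mem[OF s wV]] b.B_nonneg[OF b.diff_mem[OF s wV]] in auto)
    then show "\<exists>w\<in>V'. (\<lambda>n. sqrt (B' (\<lambda>x. s n x - w x) (\<lambda>x. s n x - w x))) \<longlonglongrightarrow> 0" using wV by blast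
  qed
qed

end

section \<open>Seminormed function spaces\<close>

definition dual_ball :: "'a fun_space \<Rightarrow> (('a \<Rightarrow> real) \<Rightarrow> real) set" where
  "dual_ball X = {l. (\<forall>u\<in>elems X. \<forall>v\<in>elems X. l (\<lambda>x. u x + v x) = l u + l v) \<and>
     (\<forall>c. \<forall>u\<in>elems X. l (\<lambda>x. c * u x) = c * l u) \<and> (\<forall>u\<in>elems X. \<bar>l u\<bar> \<le> fnorm X u)}"

text \<open>The assumption \<open>norming\<close> takes the place of the Hahn-Banach theorem.  It is elementary in the Hilbert
spaces to which the locale is applied: there the functional is the inner product with the normalised
element.\<close>

locale fspace =
  fixes X :: "'a fun_space"
  assumes zero_mem: "(\<lambda>x. 0) \<in> elems X"
    and add_mem: "u \<in> elems X \<Longrightarrow> v \<in> elems X \<Longrightarrow> (\<lambda>x. u x + v x) \<in> elems X"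
    and cmult_mem: "u \<in> elems X \<Longrightarrow> (\<lambda>x. c * u x) \<in> elems X"
    and fnorm_triangle: "u \<in> elems X \<Longrightarrow> v \<in> elems X \<Longrightarrow> fnorm X (\<lambda>x. u x + v x) \<le> fnorm X u + fnorm X v"
    and fnorm_cmult: "u \<in> elems X \<Longrightarrow> fnorm X (\<lambda>x. c * u x) = \<bar>c\<bar> * fnorm X u"
    and norming: "u \<in> elems X \<Longrightarrow> 0 < e \<Longrightarrow> \<exists>l\<in>dual_ball X. fnorm X u \<le> l u + e"
    and complete: "\<And>s :: nat \<Rightarrow> 'a \<Rightarrow> real. (\<And>n. s n \<in> elems X) \<Longrightarrow>
     (\<And>e. 0 < e \<Longrightarrow> \<exists>N. \<forall>m\<ge>N. \<forall>n\<ge>N. fnorm X (\<lambda>x. s m x - s n x) < e) \<Longrightarrow>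
     \<exists>w\<in>elems X. (\<lambda>n. fnorm X (\<lambda>x. s n x - w x)) \<longlonglongrightarrow> 0"
begin

lemma diff_mem: "u \<in> elems X \<Longrightarrow> v \<in> elems X \<Longrightarrow> (\<lambda>x. u x - v x) \<in> elems X"
  using add_mem[of u "\<lambda>x. (- 1) * v x"] cmult_mem[of v "- 1"] by simp

lemma sum_mem: "(\<And>i. i \<in> I \<Longrightarrow> u i \<in> elems X) \<Longrightarrow> (\<lambda>x. \<Sum>i\<in>I. u i x) \<in> elems X"
  by (induction I rule: infinite_finite_induct) (auto intro: zero_mem add_mem)

lemmas mem_intros = zero_mem add_mem cmult_mem diff_mem sum_mem

lemma fnorm_zero: "fnorm X (\<lambda>x. 0) = 0"
  using fnorm_cmult[OF zero_mem, of 0] by simp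

lemma fnorm_minus: "u \<in> elems X \<Longrightarrow> fnorm X (\<lambda>x. - u x) = fnorm X u"
  using fnorm_cmult[of u "- 1"] by simp

lemma fnorm_diff_commute:
  "u \<in> elems X \<Longrightarrow> v \<in> elems X \<Longrightarrow> fnorm X (\<lambda>x. u x - v x) = fnorm X (\<lambda>x. v x - u x)"
  using fnorm_minus[OF diff_mem[of u v]] by simp

lemma fnorm_nonneg: "u \<in> elems X \<Longrightarrow> 0 \<le> fnorm X u"
  using fnorm_triangle[of u "\<lambda>x. (- 1) * u x"] cmult_mem[of u "- 1"] fnorm_cmult[of u "- 1"] fnorm_zero by simp

lemma fnorm_triangle_diff:
  "u \<in> elems X \<Longrightarrow> v \<in> elems X \<Longrightarrow> fnorm X (\<lambda>x. u x - v x) \<le> fnorm X u + fnorm X v"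
  using fnorm_triangle[of u "\<lambda>x. (- 1) * v x"] cmult_mem[of v "- 1"] fnorm_cmult[of v "- 1"] by simp

lemma fnorm_diff_triangle:
  assumes "u \<in> elems X" "v \<in> elems X" "w \<in> elems X"
  shows "fnorm X (\<lambda>x. u x - w x) \<le> fnorm X (\<lambda>x. u x - v x) + fnorm X (\<lambda>x. v x - w x)"
  using fnorm_triangle[OF diff_mem[of u v] diff_mem[of v w]] assms by simp

lemma fnorm_le_diff: "u \<in> elems X \<Longrightarrow> v \<in> elems X \<Longrightarrow> fnorm X u \<le> fnorm X v + fnorm X (\<lambda>x. u x - v x)"
  using fnorm_triangle[of v "\<lambda>x. u x - v x"] diff_mem[of u v] by simp

lemma fnorm_sum_le:
  "(\<And>i. i \<in> I \<Longrightarrow> u i \<in> elems X) \<Longrightarrow> fnorm X (\<lambda>x. \<Sum>i\<in>I. u i x) \<le> (\<Sum>i\<in>I. fnorm X (u i))"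
proof (induction I rule: infinite_finite_induct)
  case (insert i I)
  then have "fnorm X (\<lambda>x. u i x + (\<Sum>i\<in>I. u i x)) \<le> fnorm X (u i) + fnorm X (\<lambda>x. \<Sum>i\<in>I. u i x)"
    by (intro fnorm_triangle sum_mem) auto
  with insert show ?case by simp
qed (auto simp: fnorm_zero)

lemma fnorm_eq_if_diff_0:
  assumes "u \<in> elems X" "v \<in> elems X" "fnorm X (\<lambda>x. u x - v x) = 0"
  shows "fnorm X u = fnorm X v"
  using fnorm_le_diff[of u v] fnorm_le_diff[of v u] fnorm_diff_commute[of u v] assms by simp

lemma dual_ball_add: "l \<in> dual_ball X \<Longrightarrow> u \<in> elems X \<Longrightarrow> v \<in> elems X \<Longrightarrow> l (\<lambda>x. u x + v x) = l u + l v"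
  and dual_ball_cmult: "l \<in> dual_ball X \<Longrightarrow> u \<in> elems X \<Longrightarrow> l (\<lambda>x. c * u x) = c * l u"
  and dual_ball_le: "l \<in> dual_ball X \<Longrightarrow> u \<in> elems X \<Longrightarrow> \<bar>l u\<bar> \<le> fnorm X u"
  by (auto simp: dual_ball_def)

lemma dual_ball_diff: "l \<in> dual_ball X \<Longrightarrow> u \<in> elems X \<Longrightarrow> v \<in> elems X \<Longrightarrow> l (\<lambda>x. u x - v x) = l u - l v"
  using dual_ball_add[of l u "\<lambda>x. (- 1) * v x"] cmult_mem[of v "- 1"] dual_ball_cmult[of l v "- 1"] by simp

lemma dual_ball_zero: "l \<in> dual_ball X \<Longrightarrow> l (\<lambda>x. 0) = 0"
  using dual_ball_cmult[OF _ zero_mem, of l 0] by simp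

lemma dual_ball_sum: "l \<in> dual_ball X \<Longrightarrow> (\<And>i. i \<in> I \<Longrightarrow> u i \<in> elems X) \<Longrightarrow>
    l (\<lambda>x. \<Sum>i\<in>I. u i x) = (\<Sum>i\<in>I. l (u i))"
proof (induction I rule: infinite_finite_induct)
  case (insert i I)
  then have "l (\<lambda>x. u i x + (\<Sum>i\<in>I. u i x)) = l (u i) + l (\<lambda>x. \<Sum>i\<in>I. u i x)"
    by (intro dual_ball_add sum_mem) auto
  with insert show ?case by simp
qed (auto simp: dual_ball_zero)

lemma fnorm_le_if_dual_le:
  assumes "u \<in> elems X" "\<And>l. l \<in> dual_ball X \<Longrightarrow> l u \<le> c"
  shows "fnorm X u \<le> c"
proof (rule field_le_epsilon)
  fix e :: real assume "0 < e"
  then obtain l where "l \<in> dual_ball X" "fnorm X u \<le> l u + e" using norming[OF assms(1)] by blast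
  then show "fnorm X u \<le> c + e" using assms(2)[of l] by simp
qed

end

lemma fspace_of_semi_hilbert:
  assumes H: "semi_hilbert (elems X) B" and n: "\<And>u. u \<in> elems X \<Longrightarrow> fnorm X u = sqrt (B u u)"
  shows "fspace X"
proof -
  interpret semi_hilbert "elems X" B by (rule H)
  show ?thesis
  proof
    fix u e :: "_" assume u: "u \<in> elems X" and e: "0 < (e :: real)"
    show "\<exists>l\<in>dual_ball X. fnorm X u \<le> l u + e"
    proof (cases "B u u = 0")
      case True
      then have "fnorm X u = 0" using n u by simp
      moreover have "(\<lambda>_. 0) \<in> dual_ball X" by (auto simp: dual_ball_def n B_nonneg)
      ultimately show ?thesis using e by (intro bexI[of _ "\<lambda>_. 0"]) auto
    next
      case False
      then have pos: "0 < B u u" using B_nonneg[OF u] by simp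
      define l where "l v = B v u / sqrt (B u u)" for v
      have "l \<in> dual_ball X"
        unfolding dual_ball_def using u pos Cauchy_Schwarz
        by (auto simp: l_def B_simps n add_divide_distrib pos_divide_le_eq)
      moreover have "l u = fnorm X u" using pos u by (simp add: l_def n real_div_sqrt)
      ultimately show ?thesis using e by (intro bexI[of _ l]) auto
    qed
  next
    fix s :: "nat \<Rightarrow> 'a \<Rightarrow> real"
    assume s: "\<And>n. s n \<in> elems X"
      "\<And>e. 0 < e \<Longrightarrow> \<exists>N. \<forall>m\<ge>N. \<forall>n\<ge>N. fnorm X (\<lambda>x. s m x - s n x) < e"
    have "\<exists>w\<in>elems X. (\<lambda>n. sqrt (B (\<lambda>x. s n x - w x) (\<lambda>x. s n x - w x))) \<longlonglongrightarrow> 0"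
      using s by (intro complete) (simp_all add: n diff_mem)
    then show "\<exists>w\<in>elems X. (\<lambda>n. fnorm X (\<lambda>x. s n x - w x)) \<longlonglongrightarrow> 0"
      using s(1) by (simp add: n diff_mem)
  qed (use sqrt_B_triangle sqrt_B_cmult n in \<open>auto intro: mem_intros simp: mem_intros\<close>)
qed

section \<open>Square-integrable functions\<close>

lemma lebesgue_on_measurable_AE_cong:
  fixes f g :: "'a::euclidean_space \<Rightarrow> real"
  assumes S: "S \<in> sets lebesgue" and f: "f \<in> borel_measurable (lebesgue_on S)"
    and ae: "AE x in lebesgue_on S. f x = g x"
  shows "g \<in> borel_measurable (lebesgue_on S)"
proof -
  have "AE x in lebesgue. (if x \<in> S then f x else 0) = (if x \<in> S then g x else 0)"
    using ae S by (auto simp: AE_restrict_space_iff)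
  from borel_measurable_AE[OF borel_measurable_if_I[OF f S] this] show ?thesis
    by (rule borel_measurable_if_D)
qed

lemma lebesgue_on_measurable_AE_limit:
  fixes f :: "'a::euclidean_space \<Rightarrow> real"
  assumes S: "S \<in> sets lebesgue" and s: "\<And>n. s n \<in> borel_measurable (lebesgue_on S)"
    and ae: "AE x in lebesgue_on S. (\<lambda>n. s n x) \<longlonglongrightarrow> f x"
  shows "f \<in> borel_measurable (lebesgue_on S)"
proof (rule lebesgue_on_measurable_AE_cong[OF S])
  show "(\<lambda>x. lim (\<lambda>n. s n x)) \<in> borel_measurable (lebesgue_on S)" using s by measurable
  show "AE x in lebesgue_on S. lim (\<lambda>n. s n x) = f x" using ae by eventually_elim (rule limI)
qed

lemma sqrt_lessD: "sqrt a < e \<Longrightarrow> 0 < e \<Longrightarrow> a < e\<^sup>2"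
  by (metis abs_of_pos real_sqrt_abs real_sqrt_less_iff)

lemma multi_partial_0: "multi_partial (\<lambda>_. 0) (\<phi> :: real^'n::finite \<Rightarrow> real) = \<phi>"
proof -
  have "(SOME is. \<forall>i. count_list is i = (0 :: nat)) = ([] :: 'n list)"
  proof (rule some_equality)
    fix xs :: "'n list" assume "\<forall>i. count_list xs i = 0"
    then have "set xs = {}" by (auto simp: count_list_0_iff)
    then show "xs = []" by simp
  qed simp
  then show ?thesis by (simp add: multi_partial_def)
qed

locale bounded_domain =
  fixes \<Omega> :: "(real^'d::finite) set"
  assumes open_dom: "open \<Omega>" and bounded_dom: "bounded \<Omega>"
begin

abbreviation "M \<equiv> lebesgue_on \<Omega>"

lemma dom_sets [simp, intro]: "\<Omega> \<in> sets lebesgue"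
  using open_dom by simp

lemma finite_measure_M: "finite_measure M"
  by (intro finite_measure_lebesgue_on bounded_set_imp_lmeasurable bounded_dom dom_sets)

lemma const_integrable: "integrable M (\<lambda>x. c :: real)"
  using finite_measure.integrable_const[OF finite_measure_M] .

definition ip :: "(real^'d \<Rightarrow> real) \<Rightarrow> (real^'d \<Rightarrow> real) \<Rightarrow> real" where
  "ip v w = (LINT x|M. v x * w x)"

lemma L2_measurable: "w \<in> L2 \<Omega> \<Longrightarrow> w \<in> borel_measurable M"
  and L2_square: "w \<in> L2 \<Omega> \<Longrightarrow> integrable M (\<lambda>x. (w x)\<^sup>2)"
  by (auto simp: L2_def)

lemma L2I: "w \<in> borel_measurable M \<Longrightarrow> integrable M (\<lambda>x. (w x)\<^sup>2) \<Longrightarrow> w \<in> L2 \<Omega>"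
  by (auto simp: L2_def)

lemma L2_integrable_mult:
  assumes "v \<in> L2 \<Omega>" "w \<in> L2 \<Omega>"
  shows "integrable M (\<lambda>x. v x * w x)"
proof (rule Bochner_Integration.integrable_bound)
  show "integrable M (\<lambda>x. (v x)\<^sup>2 + (w x)\<^sup>2)"
    using assms by (intro Bochner_Integration.integrable_add L2_square)
  show "(\<lambda>x. v x * w x) \<in> borel_measurable M"
    using assms by (intro borel_measurable_times L2_measurable)
  have "\<bar>v x * w x\<bar> \<le> (v x)\<^sup>2 + (w x)\<^sup>2" for x
  proof -
    have "0 \<le> (\<bar>v x\<bar> - \<bar>w x\<bar>)\<^sup>2" by simp
    then have "2 * (\<bar>v x\<bar> * \<bar>w x\<bar>) \<le> (v x)\<^sup>2 + (w x)\<^sup>2" by (simp add: power2_diff)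
    then show ?thesis unfolding abs_mult using mult_nonneg_nonneg[OF abs_ge_zero[of "v x"] abs_ge_zero[of "w x"]] by linarith
  qed
  then show "AE x in M. norm (v x * w x) \<le> norm ((v x)\<^sup>2 + (w x)\<^sup>2)" by (auto intro!: AE_I2)
qed

lemma L2_const: "(\<lambda>x. c) \<in> L2 \<Omega>"
  by (intro L2I const_integrable) simp

lemma L2_integrable: "w \<in> L2 \<Omega> \<Longrightarrow> integrable M w"
  using L2_integrable_mult[OF _ L2_const[of 1]] by simp

lemma L2_add: assumes "v \<in> L2 \<Omega>" "w \<in> L2 \<Omega>" shows "(\<lambda>x. v x + w x) \<in> L2 \<Omega>"
proof (rule L2I)
  show "integrable M (\<lambda>x. (v x + w x)\<^sup>2)"
    unfolding power2_sum using assms L2_integrable_mult[OF assms]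
    by (intro Bochner_Integration.integrable_add L2_square) (auto simp: mult.assoc)
qed (use assms L2_measurable in auto)

lemma L2_cmult: "v \<in> L2 \<Omega> \<Longrightarrow> (\<lambda>x. c * v x) \<in> L2 \<Omega>"
  by (auto simp: L2_def power_mult_distrib)

lemma L2_cong_AE:
  assumes v: "v \<in> L2 \<Omega>" and ae: "AE x in M. v x = w x" shows "w \<in> L2 \<Omega>"
proof (rule L2I)
  show m: "w \<in> borel_measurable M"
    by (rule lebesgue_on_measurable_AE_cong[OF dom_sets L2_measurable[OF v] ae])
  show "integrable M (\<lambda>x. (w x)\<^sup>2)"
    by (rule integrable_cong_AE_imp[OF L2_square[OF v]]) (use m ae in auto)
qed

lemma L2_Linf_mult:
  assumes a: "a \<in> Linf \<Omega>" and v: "v \<in> L2 \<Omega>" shows "(\<lambda>x. a x * v x) \<in> L2 \<Omega>"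
proof (rule L2I)
  obtain C where C: "AE x in M. \<bar>a x\<bar> \<le> C" and m: "a \<in> borel_measurable M" using a by (auto simp: Linf_def)
  show mm: "(\<lambda>x. a x * v x) \<in> borel_measurable M" using m L2_measurable[OF v] by measurable
  show "integrable M (\<lambda>x. (a x * v x)\<^sup>2)"
  proof (rule Bochner_Integration.integrable_bound[OF integrable_mult_right[OF L2_square[OF v], of "C\<^sup>2"]])
    show "AE x in M. norm ((a x * v x)\<^sup>2) \<le> norm (C\<^sup>2 * (v x)\<^sup>2)"
      using C by eventually_elim (auto simp: power_mult_distrib abs_mult intro!: mult_right_mono power_mono abs_le_square_iff[THEN iffD1])
  qed (use mm in measurable)
qed

lemma ip_Linf_bound:
  assumes a: "a \<in> borel_measurable M" "AE x in M. \<bar>a x\<bar> \<le> C" "0 \<le> C" and v: "v \<in> L2 \<Omega>"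
  shows "ip (\<lambda>x. a x * v x) (\<lambda>x. a x * v x) \<le> C\<^sup>2 * ip v v"
proof -
  have "(\<lambda>x. a x * v x) \<in> L2 \<Omega>" using a v by (intro L2_Linf_mult) (auto simp: Linf_def)
  from L2_square[OF this] have "(LINT x|M. (a x * v x)\<^sup>2) \<le> (LINT x|M. C\<^sup>2 * (v x)\<^sup>2)"
  proof (rule integral_mono_AE[OF _ integrable_mult_right[OF L2_square[OF v]]])
    show "AE x in M. (a x * v x)\<^sup>2 \<le> C\<^sup>2 * (v x)\<^sup>2"
      using a(2) by eventually_elim
        (use a(3) in \<open>auto simp: power_mult_distrib intro!: mult_right_mono abs_le_square_iff[THEN iffD1]\<close>)
  qed
  then show ?thesis by (simp add: ip_def power2_eq_square)
qed

lemma Linf_mult_bound: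
  assumes a: "a \<in> Linf \<Omega>"
  obtains c where "0 \<le> c"
    "\<And>v. v \<in> L2 \<Omega> \<Longrightarrow> sqrt (ip (\<lambda>x. a x * v x) (\<lambda>x. a x * v x)) \<le> c * sqrt (ip v v)"
proof -
  obtain C where C: "a \<in> borel_measurable M" "AE x in M. \<bar>a x\<bar> \<le> C" using a by (auto simp: Linf_def)
  then have "AE x in M. \<bar>a x\<bar> \<le> \<bar>C\<bar>" by (auto elim: AE_mp)
  from that[of "\<bar>C\<bar>"] real_sqrt_le_mono[OF ip_Linf_bound[OF C(1) this]] show ?thesis
    by (simp add: real_sqrt_mult)
qed

lemma ip_cong_AE:
  assumes "v \<in> L2 \<Omega>" "w \<in> L2 \<Omega>" "AE x in M. v x = v' x" "AE x in M. w x = w' x"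
  shows "ip v w = ip v' w'"
  unfolding ip_def
proof (rule integral_cong_AE)
  have "v' \<in> L2 \<Omega>" "w' \<in> L2 \<Omega>" using assms L2_cong_AE by blast+
  then show "(\<lambda>x. v' x * w' x) \<in> borel_measurable M" by (intro borel_measurable_times L2_measurable)
  show "AE x in M. v x * w x = v' x * w' x" using assms(3,4) by eventually_elim simp
qed (use assms L2_measurable in auto)

lemma semi_inner_L2: "semi_inner (L2 \<Omega>) ip"
proof
  fix u v w :: "real^'d \<Rightarrow> real" and c :: real
  assume uv: "u \<in> L2 \<Omega>" "w \<in> L2 \<Omega>"
  show "ip (\<lambda>x. c * u x) w = c * ip u w" by (simp add: ip_def mult.assoc)
  show "ip u w = ip w u" by (simp add: ip_def mult.commute)
  show "0 \<le> ip u u" by (simp add: ip_def)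
  assume "v \<in> L2 \<Omega>"
  then show "ip (\<lambda>x. u x + v x) w = ip u w + ip v w"
    using uv L2_integrable_mult by (simp add: ip_def distrib_right)
qed (auto intro: L2_const L2_add L2_cmult)

sublocale L2: semi_inner "L2 \<Omega>" ip by (rule semi_inner_L2)

lemma ip_self_0_iff: "v \<in> L2 \<Omega> \<Longrightarrow> ip v v = 0 \<longleftrightarrow> (AE x in M. v x = 0)"
  unfolding ip_def power2_eq_square[symmetric]
  by (subst integral_nonneg_eq_0_iff_AE) (auto intro: L2_square)

lemma L1_le_L2:
  assumes "v \<in> L2 \<Omega>"
  shows "(LINT x|M. \<bar>v x\<bar>) \<le> sqrt (measure M \<Omega>) * sqrt (ip v v)"
proof -
  have v: "(\<lambda>x. \<bar>v x\<bar>) \<in> L2 \<Omega>"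
    using assms by (auto simp: L2_def)
  have "\<bar>ip (\<lambda>x. 1) (\<lambda>x. \<bar>v x\<bar>)\<bar> \<le> sqrt (ip (\<lambda>x. 1) (\<lambda>x. 1)) * sqrt (ip (\<lambda>x. \<bar>v x\<bar>) (\<lambda>x. \<bar>v x\<bar>))"
    by (rule L2.Cauchy_Schwarz[OF L2_const v])
  then show ?thesis by (simp add: ip_def)
qed

text \<open>The Riesz-Fischer argument: a subsequence with summable increments converges almost everywhere, and
Fatou's lemma shows that its limit is the limit of the whole sequence in norm.\<close>

theorem L2_complete: "semi_hilbert (L2 \<Omega>) ip"
proof
  fix s :: "nat \<Rightarrow> real^'d \<Rightarrow> real"
  assume s: "\<And>n. s n \<in> L2 \<Omega>"
    and C: "\<And>e. 0 < e \<Longrightarrow> \<exists>N. \<forall>m\<ge>N. \<forall>n\<ge>N. sqrt (ip (\<lambda>x. s m x - s n x) (\<lambda>x. s m x - s n x)) < e"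
  let ?n = "\<lambda>v. sqrt (ip v v)"
  have "\<exists>N. \<forall>m\<ge>N. \<forall>n\<ge>N. ?n (\<lambda>x. s m x - s n x) < (1/2)^k" for k :: nat by (rule C) simp
  then obtain N where N: "\<And>k m n. N k \<le> m \<Longrightarrow> N k \<le> n \<Longrightarrow> ?n (\<lambda>x. s m x - s n x) < (1/2)^k" by metis
  \<comment> \<open>The sum makes \<open>r k\<close> and \<open>r (Suc k)\<close> at least \<open>N k\<close>; the summand \<open>k\<close> makes \<open>r\<close> unbounded.\<close>
  define r where "r k = (\<Sum>j\<le>k. N j) + k" for k
  have rN: "N k \<le> r k" "N k \<le> r (Suc k)" "k \<le> r k" for k
    using member_le_sum[of k "{..k}" N] by (auto simp: r_def)
  define d where "d k x = \<bar>s (r (Suc k)) x - s (r k) x\<bar>" for k x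
  have d_nonneg: "0 \<le> d k x" for k x by (simp add: d_def)
  have dL2: "(\<lambda>x. s m x - s n x) \<in> L2 \<Omega>" for m n using s by (intro L2.mem_intros)
  have int_d: "integrable M (d k)" for k
    unfolding d_def by (intro integrable_abs L2_integrable dL2)
  have "(LINT x|M. d k x) \<le> sqrt (measure M \<Omega>) * (1/2)^k" for k
  proof -
    have "(LINT x|M. d k x) \<le> sqrt (measure M \<Omega>) * ?n (\<lambda>x. s (r (Suc k)) x - s (r k) x)"
      unfolding d_def by (rule L1_le_L2[OF dL2])
    also have "\<dots> \<le> sqrt (measure M \<Omega>) * (1/2)^k"
      using N[OF rN(2,1), of k] by (intro mult_left_mono) auto
    finally show ?thesis .
  qed
  then have nn_d: "(\<integral>\<^sup>+x. ennreal (d k x) \<partial>M) \<le> ennreal (sqrt (measure M \<Omega>) * (1/2)^k)" for k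
    by (subst nn_integral_eq_integral[OF int_d]) (auto simp: d_nonneg intro: ennreal_leI)
  have "(\<integral>\<^sup>+x. (\<Sum>k. ennreal (d k x)) \<partial>M) = (\<Sum>k. \<integral>\<^sup>+x. ennreal (d k x) \<partial>M)"
    using int_d by (intro nn_integral_suminf) auto
  also have "\<dots> \<le> (\<Sum>k. ennreal (sqrt (measure M \<Omega>) * (1/2)^k))"
    by (intro suminf_le nn_d summableI)
  also have "\<dots> = ennreal (\<Sum>k. sqrt (measure M \<Omega>) * (1/2)^k)"
    by (intro suminf_ennreal2) (auto intro!: summable_mult)
  also have "\<dots> < top" by simp
  finally have "AE x in M. (\<Sum>k. ennreal (d k x)) \<noteq> \<infinity>"
    using int_d by (intro nn_integral_PInf_AE) auto
  then have conv: "AE x in M. (\<lambda>k. s (r k) x) \<longlonglongrightarrow> lim (\<lambda>k. s (r k) x)"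
  proof eventually_elim
    fix x assume "(\<Sum>k. ennreal (d k x)) \<noteq> \<infinity>"
    then have "summable (\<lambda>k. d k x)" by (intro summable_suminf_not_top) (auto simp: d_def)
    then have "summable (\<lambda>k. s (r (Suc k)) x - s (r k) x)"
      unfolding d_def by (rule summable_rabs_cancel)
    then have "convergent (\<lambda>n. (\<Sum>k<n. s (r (Suc k)) x - s (r k) x))"
      by (simp add: summable_iff_convergent)
    then have "convergent (\<lambda>n. s (r n) x - s (r 0) x)" 
      using sum_lessThan_telescope[of "\<lambda>k. s (r k) x"] by simp
    then have "convergent (\<lambda>n. s (r n) x)"
      using convergent_add[OF _ convergent_const[of "s (r 0) x"]] by fastforce
    then show "(\<lambda>k. s (r k) x) \<longlonglongrightarrow> lim (\<lambda>k. s (r k) x)" by (simp add: convergent_LIMSEQ_iff)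
  qed
  define w where "w x = lim (\<lambda>k. s (r k) x)" for x
  have wm: "w \<in> borel_measurable M"
    unfolding w_def using s L2_measurable by (intro borel_measurable_lim_metric) auto
  have fatou: "(\<lambda>x. s n x - w x) \<in> L2 \<Omega> \<and> ip (\<lambda>x. s n x - w x) (\<lambda>x. s n x - w x) \<le> e\<^sup>2"
    if e: "0 < e" and n: "\<And>m. K \<le> m \<Longrightarrow> ?n (\<lambda>x. s n x - s m x) < e" for n e K
  proof -
    have m1: "(\<lambda>x. s n x - s m x) \<in> borel_measurable M" for m by (rule L2_measurable[OF dL2])
    have m2: "(\<lambda>x. s n x - w x) \<in> borel_measurable M" using wm L2_measurable[OF s] by measurable
    have "(\<integral>\<^sup>+x. ennreal ((s n x - w x)\<^sup>2) \<partial>M) = (\<integral>\<^sup>+x. liminf (\<lambda>k. ennreal ((s n x - s (r k) x)\<^sup>2)) \<partial>M)"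
    proof (rule nn_integral_cong_AE)
      show "AE x in M. ennreal ((s n x - w x)\<^sup>2) = liminf (\<lambda>k. ennreal ((s n x - s (r k) x)\<^sup>2))"
        using conv
      proof eventually_elim
        fix x assume "(\<lambda>k. s (r k) x) \<longlonglongrightarrow> lim (\<lambda>k. s (r k) x)"
        then have "(\<lambda>k. ennreal ((s n x - s (r k) x)\<^sup>2)) \<longlonglongrightarrow> ennreal ((s n x - w x)\<^sup>2)"
          unfolding w_def by (intro tendsto_intros)
        then show "ennreal ((s n x - w x)\<^sup>2) = liminf (\<lambda>k. ennreal ((s n x - s (r k) x)\<^sup>2))"
          using lim_imp_Liminf[OF sequentially_bot] by metis
      qed
    qed
    also have "\<dots> \<le> liminf (\<lambda>k. \<integral>\<^sup>+x. ennreal ((s n x - s (r k) x)\<^sup>2) \<partial>M)"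
      using L2_measurable[OF s] by (intro nn_integral_liminf) measurable
    also have "\<dots> \<le> ennreal (e\<^sup>2)"
    proof (rule Liminf_le)
      show "\<forall>\<^sub>F k in sequentially. (\<integral>\<^sup>+x. ennreal ((s n x - s (r k) x)\<^sup>2) \<partial>M) \<le> ennreal (e\<^sup>2)"
      proof (rule eventually_sequentiallyI[of K])
        fix k assume "K \<le> k"
        then have "K \<le> r k" using rN(3)[of k] by simp
        from sqrt_lessD[OF n[OF this] e] have "(LINT x|M. (s n x - s (r k) x)\<^sup>2) \<le> e\<^sup>2"
          by (simp add: ip_def power2_eq_square)
        then show "(\<integral>\<^sup>+x. ennreal ((s n x - s (r k) x)\<^sup>2) \<partial>M) \<le> ennreal (e\<^sup>2)"
          by (subst nn_integral_eq_integral[OF L2_square[OF dL2]]) (auto intro: ennreal_leI)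
      qed
    qed simp
    finally have le: "(\<integral>\<^sup>+x. ennreal ((s n x - w x)\<^sup>2) \<partial>M) \<le> ennreal (e\<^sup>2)" .
    then have "(\<integral>\<^sup>+x. ennreal ((s n x - w x)\<^sup>2) \<partial>M) < \<infinity>"
      by (rule le_less_trans) simp
    then have i: "integrable M (\<lambda>x. (s n x - w x)\<^sup>2)"
      using m2 by (intro integrableI_nonneg) auto
    moreover have "(LINT x|M. (s n x - w x)\<^sup>2) \<le> e\<^sup>2"
      using le by (subst (asm) nn_integral_eq_integral[OF i]) auto
    ultimately show ?thesis using m2 by (auto intro: L2I simp: ip_def power2_eq_square)
  qed
  have "w \<in> L2 \<Omega>"
  proof -
    obtain K where "\<And>m n. K \<le> m \<Longrightarrow> K \<le> n \<Longrightarrow> ?n (\<lambda>x. s m x - s n x) < 1" using C[of 1] by auto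
    then have "(\<lambda>x. s K x - w x) \<in> L2 \<Omega>" using fatou[of 1 K K] by simp
    from L2.diff_mem[OF s[of K] this] show ?thesis by simp
  qed
  moreover have "(\<lambda>n. ?n (\<lambda>x. s n x - w x)) \<longlonglongrightarrow> 0"
  proof (rule LIMSEQ_I)
    fix e :: real assume e: "0 < e"
    obtain K where K: "\<And>m n. K \<le> m \<Longrightarrow> K \<le> n \<Longrightarrow> ?n (\<lambda>x. s m x - s n x) < e / 2" using C[of "e/2"] e by auto
    have "norm (?n (\<lambda>x. s n x - w x) - 0) < e" if "K \<le> n" for n
    proof -
      have f: "(\<lambda>x. s n x - w x) \<in> L2 \<Omega>" "ip (\<lambda>x. s n x - w x) (\<lambda>x. s n x - w x) \<le> (e / 2)\<^sup>2"
        using fatou[of "e/2" K n] e K that by auto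
      then have "?n (\<lambda>x. s n x - w x) \<le> e / 2" using e real_sqrt_le_mono by fastforce
      then show ?thesis using e L2.B_nonneg[OF f(1)] by simp
    qed
    then show "\<exists>no. \<forall>n\<ge>no. norm (?n (\<lambda>x. s n x - w x) - 0) < e" by blast
  qed
  ultimately show "\<exists>w\<in>L2 \<Omega>. (\<lambda>n. ?n (\<lambda>x. s n x - w x)) \<longlonglongrightarrow> 0" by blast
qed

section \<open>Weak derivatives\<close>

lemma integrable_imp_locally_integrable:
  fixes w :: "real^'d \<Rightarrow> real"
  assumes "integrable M w" shows "locally_integrable \<Omega> w"
  unfolding locally_integrable_def
proof safe
  fix K assume K: "compact K" "K \<subseteq> \<Omega>"
  have "set_integrable lebesgue \<Omega> w"
    using assms by (simp add: set_integrable_def integrable_restrict_space)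
  then show "set_integrable lebesgue K w"
    by (rule set_integrable_subset) (use K in \<open>auto simp: compact_imp_closed\<close>)
qed

lemma L2_locally_integrable: "w \<in> L2 \<Omega> \<Longrightarrow> locally_integrable \<Omega> w"
  by (intro integrable_imp_locally_integrable L2_integrable)

lemma Linf_imp_L2: "a \<in> Linf \<Omega> \<Longrightarrow> a \<in> L2 \<Omega>"
  using L2_Linf_mult[OF _ L2_const[of 1]] by simp

lemma locally_integrable_add:
  "locally_integrable \<Omega> v \<Longrightarrow> locally_integrable \<Omega> w \<Longrightarrow> locally_integrable \<Omega> (\<lambda>x. v x + w x)"
  unfolding locally_integrable_def set_integrable_def by (auto simp: distrib_left)

lemma locally_integrable_cmult:
  "locally_integrable \<Omega> v \<Longrightarrow> locally_integrable \<Omega> (\<lambda>x. c * v x)"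
  unfolding locally_integrable_def set_integrable_def by (auto simp: mult.left_commute)

lemma test_function_L2: "\<phi> \<in> test_functions U \<Longrightarrow> \<phi> \<in> L2 \<Omega>"
proof (rule L2I)
  assume \<phi>: "\<phi> \<in> test_functions U"
  show m: "\<phi> \<in> borel_measurable M"
    by (rule measurable_restrict_space1, rule measurable_completion)
       (use test_functions_measurable[OF \<phi>] in simp)
  obtain C where C: "\<And>x. \<bar>\<phi> x\<bar> \<le> C" using test_functions_bounded[OF \<phi>] by blast
  show "integrable M (\<lambda>x. (\<phi> x)\<^sup>2)"
    by (rule Bochner_Integration.integrable_bound[OF const_integrable[of "C\<^sup>2"]])
       (use m C abs_le_square_iff in \<open>auto intro!: AE_I2 simp: abs_le_square_iff[symmetric] intro: order_trans[OF C abs_ge_self]\<close>)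
qed

lemma is_weak_deriv_add:
  assumes v: "is_weak_deriv \<Omega> \<alpha> v g" and w: "is_weak_deriv \<Omega> \<alpha> w h"
  shows "is_weak_deriv \<Omega> \<alpha> (\<lambda>x. v x + w x) (\<lambda>x. g x + h x)"
  unfolding is_weak_deriv_def
proof (intro conjI ballI)
  fix \<phi> assume \<phi>: "\<phi> \<in> test_functions \<Omega>"
  have i: "integrable M (\<lambda>x. v x * multi_partial \<alpha> \<phi> x)" "integrable M (\<lambda>x. w x * multi_partial \<alpha> \<phi> x)"
    "integrable M (\<lambda>x. g x * \<phi> x)" "integrable M (\<lambda>x. h x * \<phi> x)"
    using v w \<phi> by (auto simp: is_weak_deriv_def intro!: locally_integrable_times_test test_functions_multi_partial)
  show "(LINT x|M. (v x + w x) * multi_partial \<alpha> \<phi> x) = (- 1) ^ sum \<alpha> UNIV * (LINT x|M. (g x + h x) * \<phi> x)"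
    using i v w \<phi> by (simp add: is_weak_deriv_def distrib_right distrib_left)
qed (use assms in \<open>auto simp: is_weak_deriv_def intro: locally_integrable_add\<close>)

lemma is_weak_deriv_cmult:
  assumes v: "is_weak_deriv \<Omega> \<alpha> v g"
  shows "is_weak_deriv \<Omega> \<alpha> (\<lambda>x. c * v x) (\<lambda>x. c * g x)"
  using assms unfolding is_weak_deriv_def
  by (auto simp: mult.assoc intro: locally_integrable_cmult)

lemma is_weak_deriv_diff:
  assumes v: "is_weak_deriv \<Omega> \<alpha> v g" and w: "is_weak_deriv \<Omega> \<alpha> w h"
  shows "is_weak_deriv \<Omega> \<alpha> (\<lambda>x. v x - w x) (\<lambda>x. g x - h x)"
  using is_weak_deriv_add[OF v is_weak_deriv_cmult[OF w, of "- 1"]] by simp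

text \<open>Together with linearity this makes weak derivatives unique up to null sets, so that the choice made in
\<open>weak_deriv\<close> is immaterial.\<close>

lemma weak_deriv_of_AE_zero:
  assumes g: "is_weak_deriv \<Omega> \<alpha> w g" and w: "AE x in M. w x = 0"
  shows "AE x in M. g x = 0"
proof (rule fundamental_lemma[OF _ open_dom])
  fix \<phi> assume \<phi>: "\<phi> \<in> test_functions \<Omega>"
  have "(LINT x|M. w x * multi_partial \<alpha> \<phi> x) = 0"
    by (rule integral_eq_zero_AE) (use w in auto)
  then show "(LINT x|M. g x * \<phi> x) = 0" using g \<phi> by (auto simp: is_weak_deriv_def)
qed (use g in \<open>simp add: is_weak_deriv_def\<close>)

lemma is_weak_deriv_unique_AE:
  assumes "is_weak_deriv \<Omega> \<alpha> v g" "is_weak_deriv \<Omega> \<alpha> w h" "AE x in M. v x = w x"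
  shows "AE x in M. g x = h x"
  using weak_deriv_of_AE_zero[OF is_weak_deriv_diff[OF assms(1,2)]] assms(3) by auto

lemma weak_deriv_AE_eq:
  assumes "is_weak_deriv \<Omega> \<alpha> w g" shows "AE x in M. weak_deriv \<Omega> \<alpha> w x = g x"
    and "is_weak_deriv \<Omega> \<alpha> w (weak_deriv \<Omega> \<alpha> w)"
proof -
  show d: "is_weak_deriv \<Omega> \<alpha> w (weak_deriv \<Omega> \<alpha> w)"
    unfolding weak_deriv_def by (rule someI[of "is_weak_deriv \<Omega> \<alpha> w", OF assms])
  show "AE x in M. weak_deriv \<Omega> \<alpha> w x = g x"
    by (rule is_weak_deriv_unique_AE[OF d assms]) simp
qed

lemma is_weak_deriv_0: "locally_integrable \<Omega> w \<Longrightarrow> is_weak_deriv \<Omega> (\<lambda>_. 0) w w"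
  by (simp add: is_weak_deriv_def multi_partial_0)

lemma zero_multi_index: "(\<lambda>_. 0) \<in> multi_indices m"
  by (simp add: multi_indices_def)

section \<open>The Sobolev spaces of integer order\<close>

abbreviation \<H> :: "nat \<Rightarrow> (real^'d \<Rightarrow> real) set" where "\<H> m \<equiv> elems (Hm m \<Omega>)"

lemma Hm_iff: "w \<in> \<H> m \<longleftrightarrow> w \<in> L2 \<Omega> \<and> (\<forall>\<alpha>\<in>multi_indices m. \<exists>g\<in>L2 \<Omega>. is_weak_deriv \<Omega> \<alpha> w g)"
  by (simp add: Hm_def)

lemma Hm_L2: "w \<in> \<H> m \<Longrightarrow> w \<in> L2 \<Omega>"
  by (simp add: Hm_iff)

lemma Hm_weak_deriv:
  assumes "w \<in> \<H> m" "\<alpha> \<in> multi_indices m"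
  shows "is_weak_deriv \<Omega> \<alpha> w (weak_deriv \<Omega> \<alpha> w)" "weak_deriv \<Omega> \<alpha> w \<in> L2 \<Omega>"
proof -
  obtain g where g: "g \<in> L2 \<Omega>" "is_weak_deriv \<Omega> \<alpha> w g" using assms by (auto simp: Hm_iff)
  show "is_weak_deriv \<Omega> \<alpha> w (weak_deriv \<Omega> \<alpha> w)" by (rule weak_deriv_AE_eq(2)[OF g(2)])
  have "AE x in M. g x = weak_deriv \<Omega> \<alpha> w x" using weak_deriv_AE_eq(1)[OF g(2)] by eventually_elim simp
  then show "weak_deriv \<Omega> \<alpha> w \<in> L2 \<Omega>" by (rule L2_cong_AE[OF g(1)])
qed

lemma Hm_add: assumes "v \<in> \<H> m" "w \<in> \<H> m" shows "(\<lambda>x. v x + w x) \<in> \<H> m"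
  unfolding Hm_iff
proof (intro conjI ballI)
  show "(\<lambda>x. v x + w x) \<in> L2 \<Omega>" by (rule L2_add[OF assms[THEN Hm_L2]])
  fix \<alpha> :: "'d \<Rightarrow> nat" assume \<alpha>: "\<alpha> \<in> multi_indices m"
  show "\<exists>g\<in>L2 \<Omega>. is_weak_deriv \<Omega> \<alpha> (\<lambda>x. v x + w x) g"
    by (intro bexI[of _ "\<lambda>x. weak_deriv \<Omega> \<alpha> v x + weak_deriv \<Omega> \<alpha> w x"] is_weak_deriv_add L2_add
        Hm_weak_deriv[OF _ \<alpha>] assms)
qed

lemma Hm_cmult: assumes "v \<in> \<H> m" shows "(\<lambda>x. c * v x) \<in> \<H> m"
  unfolding Hm_iff
proof (intro conjI ballI)
  show "(\<lambda>x. c * v x) \<in> L2 \<Omega>" by (rule L2_cmult[OF Hm_L2[OF assms]])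
  fix \<alpha> :: "'d \<Rightarrow> nat" assume "\<alpha> \<in> multi_indices m"
  note d = Hm_weak_deriv[OF assms this]
  show "\<exists>g\<in>L2 \<Omega>. is_weak_deriv \<Omega> \<alpha> (\<lambda>x. c * v x) g"
    by (intro bexI[of _ "\<lambda>x. c * weak_deriv \<Omega> \<alpha> v x"] is_weak_deriv_cmult d L2_cmult)
qed

lemma Hm_zero: "(\<lambda>x. 0) \<in> \<H> m"
proof -
  have "is_weak_deriv \<Omega> \<alpha> (\<lambda>x. 0) (\<lambda>x. 0)" for \<alpha>
    using L2_locally_integrable[OF L2_const[of 0]] by (simp add: is_weak_deriv_def)
  then show ?thesis unfolding Hm_iff using L2_const[of 0] by auto
qed

lemma weak_deriv_add_AE:
  assumes "v \<in> \<H> m" "w \<in> \<H> m" "\<alpha> \<in> multi_indices m"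
  shows "AE x in M. weak_deriv \<Omega> \<alpha> (\<lambda>x. v x + w x) x = weak_deriv \<Omega> \<alpha> v x + weak_deriv \<Omega> \<alpha> w x"
  using assms by (intro weak_deriv_AE_eq is_weak_deriv_add Hm_weak_deriv)

lemma weak_deriv_cmult_AE:
  assumes "v \<in> \<H> m" "\<alpha> \<in> multi_indices m"
  shows "AE x in M. weak_deriv \<Omega> \<alpha> (\<lambda>x. c * v x) x = c * weak_deriv \<Omega> \<alpha> v x"
  using assms by (intro weak_deriv_AE_eq is_weak_deriv_cmult Hm_weak_deriv)

lemma weak_deriv_diff_AE:
  assumes "v \<in> \<H> m" "w \<in> \<H> m" "\<alpha> \<in> multi_indices m"
  shows "AE x in M. weak_deriv \<Omega> \<alpha> (\<lambda>x. v x - w x) x = weak_deriv \<Omega> \<alpha> v x - weak_deriv \<Omega> \<alpha> w x"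
  using assms by (intro weak_deriv_AE_eq is_weak_deriv_diff Hm_weak_deriv)

definition ipH :: "nat \<Rightarrow> (real^'d \<Rightarrow> real) \<Rightarrow> (real^'d \<Rightarrow> real) \<Rightarrow> real" where
  "ipH m v w = (\<Sum>\<alpha>\<in>multi_indices m. ip (weak_deriv \<Omega> \<alpha> v) (weak_deriv \<Omega> \<alpha> w))"

lemma fnorm_Hm: "fnorm (Hm m \<Omega>) w = sqrt (ipH m w w)"
  by (simp add: Hm_def ipH_def ip_def power2_eq_square)

lemma semi_inner_Hm: "semi_inner (\<H> m) (ipH m)"
proof
  fix u v w :: "real^'d \<Rightarrow> real" and c :: real
  assume u: "u \<in> \<H> m" and w: "w \<in> \<H> m"
  show "ipH m (\<lambda>x. c * u x) w = c * ipH m u w"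
    unfolding ipH_def sum_distrib_left
  proof (rule sum.cong[OF refl])
    fix \<alpha> :: "'d \<Rightarrow> nat" assume \<alpha>: "\<alpha> \<in> multi_indices m"
    have "ip (weak_deriv \<Omega> \<alpha> (\<lambda>x. c * u x)) (weak_deriv \<Omega> \<alpha> w) = ip (\<lambda>x. c * weak_deriv \<Omega> \<alpha> u x) (weak_deriv \<Omega> \<alpha> w)"
      using u w \<alpha> by (intro ip_cong_AE weak_deriv_cmult_AE Hm_weak_deriv[OF _ \<alpha>] Hm_cmult) auto
    then show "ip (weak_deriv \<Omega> \<alpha> (\<lambda>x. c * u x)) (weak_deriv \<Omega> \<alpha> w) = c * ip (weak_deriv \<Omega> \<alpha> u) (weak_deriv \<Omega> \<alpha> w)"
      using u w \<alpha> Hm_weak_deriv by (simp add: L2.B_cmult)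
  qed
  show "ipH m u w = ipH m w u"
    unfolding ipH_def using u w by (intro sum.cong refl L2.B_sym Hm_weak_deriv)
  show "0 \<le> ipH m u u"
    unfolding ipH_def using u by (intro sum_nonneg L2.B_nonneg Hm_weak_deriv)
  assume v: "v \<in> \<H> m"
  show "ipH m (\<lambda>x. u x + v x) w = ipH m u w + ipH m v w"
    unfolding ipH_def sum.distrib[symmetric]
  proof (rule sum.cong[OF refl])
    fix \<alpha> :: "'d \<Rightarrow> nat" assume \<alpha>: "\<alpha> \<in> multi_indices m"
    have "ip (weak_deriv \<Omega> \<alpha> (\<lambda>x. u x + v x)) (weak_deriv \<Omega> \<alpha> w) = ip (\<lambda>x. weak_deriv \<Omega> \<alpha> u x + weak_deriv \<Omega> \<alpha> v x) (weak_deriv \<Omega> \<alpha> w)"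
      using u v w \<alpha> by (intro ip_cong_AE weak_deriv_add_AE Hm_weak_deriv[OF _ \<alpha>] Hm_add) auto
    then show "ip (weak_deriv \<Omega> \<alpha> (\<lambda>x. u x + v x)) (weak_deriv \<Omega> \<alpha> w) =
        ip (weak_deriv \<Omega> \<alpha> u) (weak_deriv \<Omega> \<alpha> w) + ip (weak_deriv \<Omega> \<alpha> v) (weak_deriv \<Omega> \<alpha> w)"
      using u v w \<alpha> Hm_weak_deriv by (simp add: L2.B_add)
  qed
qed (auto intro: Hm_zero Hm_add Hm_cmult)

sublocale Hm: semi_inner "\<H> m" "ipH m" for m by (rule semi_inner_Hm)

lemma L2_norm_weak_deriv_le:
  assumes "w \<in> \<H> m" "\<alpha> \<in> multi_indices m"
  shows "sqrt (ip (weak_deriv \<Omega> \<alpha> w) (weak_deriv \<Omega> \<alpha> w)) \<le> fnorm (Hm m \<Omega>) w"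
  unfolding fnorm_Hm ipH_def using assms
  by (intro real_sqrt_le_mono member_le_sum finite_multi_indices L2.B_nonneg Hm_weak_deriv) auto

lemma L2_norm_le_Hm:
  assumes "w \<in> \<H> m" shows "sqrt (ip w w) \<le> fnorm (Hm m \<Omega>) w"
proof -
  have w: "w \<in> L2 \<Omega>" using assms by (rule Hm_L2)
  have "ip w w = ip (weak_deriv \<Omega> (\<lambda>_. 0) w) (weak_deriv \<Omega> (\<lambda>_. 0) w)"
    using weak_deriv_AE_eq(1)[OF is_weak_deriv_0[OF L2_locally_integrable[OF w]]]
    by (intro ip_cong_AE w) (auto elim: AE_mp)
  then show ?thesis using L2_norm_weak_deriv_le[OF assms zero_multi_index] by simp
qed

lemma ip_tendsto:
  assumes s: "\<And>n. s n \<in> L2 \<Omega>" and w: "w \<in> L2 \<Omega>" and v: "v \<in> L2 \<Omega>"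
    and lim: "(\<lambda>n. sqrt (ip (\<lambda>x. s n x - w x) (\<lambda>x. s n x - w x))) \<longlonglongrightarrow> 0"
  shows "(\<lambda>n. ip (s n) v) \<longlonglongrightarrow> ip w v"
proof (rule LIM_zero_cancel, rule tendsto_rabs_zero_cancel, rule tendsto_sandwich[OF _ _ tendsto_const])
  show "\<forall>\<^sub>F n in sequentially. \<bar>ip (s n) v - ip w v\<bar> \<le> sqrt (ip (\<lambda>x. s n x - w x) (\<lambda>x. s n x - w x)) * sqrt (ip v v)"
    using L2.Cauchy_Schwarz[OF L2.diff_mem[OF s w] v] by (simp add: L2.B_diff s w v)
  show "(\<lambda>n. sqrt (ip (\<lambda>x. s n x - w x) (\<lambda>x. s n x - w x)) * sqrt (ip v v)) \<longlonglongrightarrow> 0"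
    using tendsto_mult_right[OF lim, of "sqrt (ip v v)"] by simp
qed auto

text \<open>All weak derivatives of the sequence converge in \<open>L\<^sup>2\<close>, and the defining identity of a weak derivative
is preserved under such limits.\<close>

lemma Hm_complete_strong:
  assumes s: "\<And>n. s n \<in> \<H> m"
    and C: "\<And>e. 0 < e \<Longrightarrow> \<exists>N. \<forall>k\<ge>N. \<forall>n\<ge>N. sqrt (ipH m (\<lambda>x. s k x - s n x) (\<lambda>x. s k x - s n x)) < e"
  shows "\<exists>w\<in>\<H> m. (\<lambda>n. sqrt (ipH m (\<lambda>x. s n x - w x) (\<lambda>x. s n x - w x))) \<longlonglongrightarrow> 0"
proof -
  interpret L2': semi_hilbert "L2 \<Omega>" ip by (rule L2_complete)
  let ?D = "weak_deriv \<Omega>"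
  define Q where "Q \<alpha> g \<longleftrightarrow>
    (\<lambda>n. sqrt (ip (\<lambda>x. ?D \<alpha> (s n) x - g x) (\<lambda>x. ?D \<alpha> (s n) x - g x))) \<longlonglongrightarrow> 0" for \<alpha> g
  have "\<exists>g\<in>L2 \<Omega>. (\<lambda>n. sqrt (ip (\<lambda>x. ?D \<alpha> (s n) x - g x) (\<lambda>x. ?D \<alpha> (s n) x - g x))) \<longlonglongrightarrow> 0"
    if \<alpha>: "\<alpha> \<in> multi_indices m" for \<alpha>
  proof (rule L2'.complete)
    show "?D \<alpha> (s n) \<in> L2 \<Omega>" for n by (rule Hm_weak_deriv[OF s \<alpha>])
    fix e :: real assume "0 < e"
    then obtain N where N: "\<And>k n. N \<le> k \<Longrightarrow> N \<le> n \<Longrightarrow> sqrt (ipH m (\<lambda>x. s k x - s n x) (\<lambda>x. s k x - s n x)) < e"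
      using C by blast
    have "sqrt (ip (\<lambda>x. ?D \<alpha> (s k) x - ?D \<alpha> (s n) x) (\<lambda>x. ?D \<alpha> (s k) x - ?D \<alpha> (s n) x)) < e"
      if "N \<le> k" "N \<le> n" for k n
    proof -
      have "ip (\<lambda>x. ?D \<alpha> (s k) x - ?D \<alpha> (s n) x) (\<lambda>x. ?D \<alpha> (s k) x - ?D \<alpha> (s n) x)
          = ip (?D \<alpha> (\<lambda>x. s k x - s n x)) (?D \<alpha> (\<lambda>x. s k x - s n x))"
        using weak_deriv_diff_AE[OF s[of k] s[of n] \<alpha>] s \<alpha>
        by (intro ip_cong_AE L2.diff_mem Hm_weak_deriv) (auto elim: AE_mp)
      then show ?thesis
        using le_less_trans[OF L2_norm_weak_deriv_le[OF Hm.diff_mem[OF s[of k] s[of n]] \<alpha>, unfolded fnorm_Hm] N[OF that]]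
        by simp
    qed
    then show "\<exists>N. \<forall>k\<ge>N. \<forall>n\<ge>N. sqrt (ip (\<lambda>x. ?D \<alpha> (s k) x - ?D \<alpha> (s n) x) (\<lambda>x. ?D \<alpha> (s k) x - ?D \<alpha> (s n) x)) < e"
      by blast
  qed
  then have "\<exists>g\<in>L2 \<Omega>. Q \<alpha> g" if "\<alpha> \<in> multi_indices m" for \<alpha>
    unfolding Q_def using that by blast
  then obtain g where g1: "\<And>\<alpha>. \<alpha> \<in> multi_indices m \<Longrightarrow> g \<alpha> \<in> L2 \<Omega>"
    and g2: "\<And>\<alpha>. \<alpha> \<in> multi_indices m \<Longrightarrow> Q \<alpha> (g \<alpha>)" by metis
  note g = g1 g2[unfolded Q_def]
  let ?z = "(\<lambda>_. 0) :: 'd \<Rightarrow> nat"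
  define w where "w = g ?z"
  have w: "w \<in> L2 \<Omega>" unfolding w_def by (rule g(1)[OF zero_multi_index])
  have d: "is_weak_deriv \<Omega> \<alpha> w (g \<alpha>)" if \<alpha>: "\<alpha> \<in> multi_indices m" for \<alpha>
    unfolding is_weak_deriv_def
  proof (intro conjI ballI)
    fix \<phi> assume \<phi>: "\<phi> \<in> test_functions \<Omega>"
    have "(\<lambda>n. ip (?D ?z (s n)) (multi_partial \<alpha> \<phi>)) \<longlonglongrightarrow> ip w (multi_partial \<alpha> \<phi>)"
      unfolding w_def
      by (intro ip_tendsto g zero_multi_index Hm_weak_deriv[OF s zero_multi_index]
          test_function_L2[OF test_functions_multi_partial[OF \<phi>]])
    moreover have "ip (?D ?z (s n)) (multi_partial \<alpha> \<phi>) = (- 1) ^ sum \<alpha> UNIV * ip (?D \<alpha> (s n)) \<phi>" for n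
    proof -
      have "ip (?D ?z (s n)) (multi_partial \<alpha> \<phi>) = ip (s n) (multi_partial \<alpha> \<phi>)"
        by (intro ip_cong_AE Hm_weak_deriv[OF s zero_multi_index] weak_deriv_AE_eq is_weak_deriv_0
            L2_locally_integrable Hm_L2[OF s] test_function_L2[OF test_functions_multi_partial[OF \<phi>]]) simp
      also have "\<dots> = (- 1) ^ sum \<alpha> UNIV * ip (?D \<alpha> (s n)) \<phi>"
        using Hm_weak_deriv(1)[OF s \<alpha>] \<phi> unfolding is_weak_deriv_def ip_def by blast
      finally show ?thesis .
    qed
    ultimately have "(\<lambda>n. (- 1) ^ sum \<alpha> UNIV * ip (?D \<alpha> (s n)) \<phi>) \<longlonglongrightarrow> ip w (multi_partial \<alpha> \<phi>)" by simp
    moreover have "(\<lambda>n. (- 1) ^ sum \<alpha> UNIV * ip (?D \<alpha> (s n)) \<phi>) \<longlonglongrightarrow> (- 1) ^ sum \<alpha> UNIV * ip (g \<alpha>) \<phi>"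
      by (intro tendsto_mult_left ip_tendsto g \<alpha> Hm_weak_deriv[OF s \<alpha>] test_function_L2[OF \<phi>])
    ultimately show "(LINT x|M. w x * multi_partial \<alpha> \<phi> x) = (- 1) ^ sum \<alpha> UNIV * (LINT x|M. g \<alpha> x * \<phi> x)"
      using LIMSEQ_unique unfolding ip_def by blast
  qed (use g(1)[OF \<alpha>] w L2_locally_integrable in auto)
  have wH: "w \<in> \<H> m" unfolding Hm_iff using w d g(1) by blast
  moreover have "(\<lambda>n. sqrt (ipH m (\<lambda>x. s n x - w x) (\<lambda>x. s n x - w x))) \<longlonglongrightarrow> 0"
  proof -
    have eq: "ip (?D \<alpha> (\<lambda>x. s n x - w x)) (?D \<alpha> (\<lambda>x. s n x - w x)) =
        (sqrt (ip (\<lambda>x. ?D \<alpha> (s n) x - g \<alpha> x) (\<lambda>x. ?D \<alpha> (s n) x - g \<alpha> x)))\<^sup>2"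
      if \<alpha>: "\<alpha> \<in> multi_indices m" for \<alpha> n
    proof -
      have D: "AE x in M. ?D \<alpha> (\<lambda>x. s n x - w x) x = ?D \<alpha> (s n) x - g \<alpha> x"
        by (intro weak_deriv_AE_eq is_weak_deriv_diff Hm_weak_deriv[OF s \<alpha>] d \<alpha>)
      have "ip (?D \<alpha> (\<lambda>x. s n x - w x)) (?D \<alpha> (\<lambda>x. s n x - w x)) =
          ip (\<lambda>x. ?D \<alpha> (s n) x - g \<alpha> x) (\<lambda>x. ?D \<alpha> (s n) x - g \<alpha> x)"
        by (intro ip_cong_AE D Hm_weak_deriv[OF _ \<alpha>] Hm.diff_mem s wH)
      moreover have "0 \<le> ip (\<lambda>x. ?D \<alpha> (s n) x - g \<alpha> x) (\<lambda>x. ?D \<alpha> (s n) x - g \<alpha> x)"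
        by (intro L2.B_nonneg L2.diff_mem Hm_weak_deriv[OF s \<alpha>] g \<alpha>)
      ultimately show ?thesis by simp
    qed
    have "(\<lambda>n. sqrt (\<Sum>\<alpha>\<in>multi_indices m. (sqrt (ip (\<lambda>x. ?D \<alpha> (s n) x - g \<alpha> x) (\<lambda>x. ?D \<alpha> (s n) x - g \<alpha> x)))\<^sup>2))
        \<longlonglongrightarrow> sqrt (\<Sum>\<alpha>\<in>(multi_indices m :: ('d \<Rightarrow> nat) set). 0\<^sup>2)"
      by (intro tendsto_intros g(2))
    then show ?thesis unfolding ipH_def by (simp add: eq)
  qed
  ultimately show ?thesis by blast
qed

lemma semi_hilbert_Hm: "semi_hilbert (\<H> m) (ipH m)"
  by (intro semi_hilbert.intro semi_inner_Hm semi_hilbert_axioms.intro Hm_complete_strong)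

lemma fspace_Hm: "fspace (Hm m \<Omega>)"
  by (rule fspace_of_semi_hilbert[OF semi_hilbert_Hm fnorm_Hm])

end

section \<open>Functions vanishing on the boundary\<close>

lemma multi_partial_unit_index: "multi_partial (unit_index i) (\<phi> :: real^'n::finite \<Rightarrow> real) = partial_deriv i \<phi>"
proof -
  have "(SOME is. \<forall>j. count_list is j = unit_index i j) = [i]"
  proof (rule some_equality)
    show "\<forall>j. count_list [i] j = unit_index i j" by (simp add: unit_index_def)
    fix xs :: "'n list" assume xs: "\<forall>j. count_list xs j = unit_index i j"
    have "x \<in> set xs \<longleftrightarrow> x = i" for x
      using xs[rule_format, of x] count_list_0_iff[of xs x] by (auto simp: unit_index_def split: if_splits)
    then have "set xs = {i}" by blast
    moreover have "count_list xs i = 1" using xs by (simp add: unit_index_def)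
    ultimately show "xs = [i]"
    proof (cases xs)
      case (Cons a ys)
      then have "a = i" using \<open>set xs = {i}\<close> by auto
      then have "count_list ys i = 0" using Cons \<open>count_list xs i = 1\<close> by simp
      moreover have "set ys \<subseteq> {i}" using Cons \<open>set xs = {i}\<close> by auto
      ultimately have "ys = []" by (cases ys) (auto simp: count_list_0_iff)
      then show ?thesis using Cons \<open>a = i\<close> by simp
    qed simp
  qed
  then show ?thesis by (simp add: multi_partial_def)
qed

lemma sum_unit_index: "sum (unit_index i) (UNIV :: 'n::finite set) = 1"
  by (simp add: unit_index_def)

lemma unit_index_mem: "unit_index i \<in> multi_indices (Suc m)"
  by (simp add: multi_indices_def sum_unit_index)

lemma multi_indices_1: "(multi_indices 1 :: ('n::finite \<Rightarrow> nat) set) = insert (\<lambda>_. 0) (range unit_index)"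
proof (rule set_eqI, rule iffI)
  fix \<alpha> :: "'n \<Rightarrow> nat" assume "\<alpha> \<in> multi_indices 1"
  then have s: "sum \<alpha> UNIV \<le> 1" by (simp add: multi_indices_def)
  show "\<alpha> \<in> insert (\<lambda>_. 0) (range unit_index)"
  proof (cases "\<exists>i. \<alpha> i \<noteq> 0")
    case True
    then obtain i where i: "\<alpha> i \<noteq> 0" by blast
    have "sum \<alpha> UNIV = \<alpha> i + sum \<alpha> (UNIV - {i})" by (rule sum.remove) auto
    then have "\<alpha> i = 1" "sum \<alpha> (UNIV - {i}) = 0" using s i by linarith+
    then have "\<alpha> j = 0" if "j \<noteq> i" for j using that by (simp add: sum_nonneg_eq_0_iff)
    with \<open>\<alpha> i = 1\<close> have "\<alpha> = unit_index i" by (auto simp: unit_index_def fun_eq_iff)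
    then show ?thesis by blast
  qed auto
qed (auto simp: multi_indices_def sum_unit_index)

lemma inj_unit_index: "inj unit_index"
proof (rule injI)
  fix i j :: 'a assume "unit_index i = unit_index j"
  from fun_cong[OF this, of i] show "i = j" by (simp add: unit_index_def split: if_splits)
qed

context bounded_domain
begin

interpretation HmF: fspace "Hm m \<Omega>" for m by (rule fspace_Hm)

lemma dom_integral_test:
  fixes f :: "real^'d \<Rightarrow> real"
  assumes \<phi>: "\<phi> \<in> test_functions \<Omega>" and f: "f \<in> borel_measurable borel"
  shows "(LINT x|M. f x * \<phi> x) = (\<integral>x. f x * \<phi> x \<partial>lborel)"
proof -
  obtain K where K: "K \<subseteq> \<Omega>" "\<And>x. x \<notin> K \<Longrightarrow> \<phi> x = 0"
    using test_functions_support[OF \<phi>] by metis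
  have m: "(\<lambda>x. f x * \<phi> x) \<in> borel_measurable lborel"
    using f test_functions_measurable[OF \<phi>] by simp
  have "(LINT x|M. f x * \<phi> x) = (LINT x|lebesgue. indicator \<Omega> x * (f x * \<phi> x))"
    by (rule lebesgue_on_integral_indicator) simp
  also have "(\<lambda>x. indicator \<Omega> x * (f x * \<phi> x)) = (\<lambda>x. f x * \<phi> x)"
    using K by (force simp: fun_eq_iff indicator_def)
  also have "(LINT x|lebesgue. f x * \<phi> x) = (\<integral>x. f x * \<phi> x \<partial>lborel)"
    by (rule integral_completion[OF m])
  finally show ?thesis .
qed

lemma test_function_weak_deriv:
  assumes "\<phi> \<in> test_functions \<Omega>"
  shows "is_weak_deriv \<Omega> (unit_index i) \<phi> (partial_deriv i \<phi>)"
  unfolding is_weak_deriv_def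
proof (intro conjI ballI)
  fix \<psi> assume \<psi>: "\<psi> \<in> test_functions \<Omega>"
  have "(LINT x|M. \<phi> x * partial_deriv i \<psi> x) = - (LINT x|M. partial_deriv i \<phi> x * \<psi> x)"
    using integration_by_parts_test[OF \<psi> test_functions_smooth[OF assms], of i]
      dom_integral_test[OF test_functions_partial_deriv[OF \<psi>] test_functions_measurable[OF assms], of i]
      dom_integral_test[OF \<psi> test_functions_measurable[OF test_functions_partial_deriv[OF assms]], of i]
    by simp
  then show "(LINT x|M. \<phi> x * multi_partial (unit_index i) \<psi> x) =
      (- 1) ^ sum (unit_index i) UNIV * (LINT x|M. partial_deriv i \<phi> x * \<psi> x)"
    by (simp add: multi_partial_unit_index sum_unit_index)
qed (use assms in \<open>auto intro: L2_locally_integrable test_function_L2 test_functions_partial_deriv\<close>)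

lemma test_function_H1: assumes "\<phi> \<in> test_functions \<Omega>" shows "\<phi> \<in> \<H> 1"
  unfolding Hm_iff
proof (intro conjI ballI)
  show L: "\<phi> \<in> L2 \<Omega>" by (rule test_function_L2[OF assms])
  fix \<alpha> :: "'d \<Rightarrow> nat" assume "\<alpha> \<in> multi_indices 1"
  then have "\<alpha> \<in> insert (\<lambda>_. 0) (range unit_index)" unfolding multi_indices_1 .
  then consider "\<alpha> = (\<lambda>_. 0)" | i where "\<alpha> = unit_index i" by auto
  then show "\<exists>g\<in>L2 \<Omega>. is_weak_deriv \<Omega> \<alpha> \<phi> g"
  proof cases
    case 1
    then show ?thesis using L is_weak_deriv_0[OF L2_locally_integrable[OF L]] by blast
  next
    case 2
    then show ?thesis
      using test_function_weak_deriv[OF assms] test_function_L2[OF test_functions_partial_deriv[OF assms]] by blast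
  qed
qed

abbreviation V :: "(real^'d \<Rightarrow> real) set" where "V \<equiv> elems (H10 \<Omega>)"
abbreviation nrm :: "(real^'d \<Rightarrow> real) \<Rightarrow> real" where "nrm \<equiv> fnorm (H10 \<Omega>)"

lemma H10_iff: "w \<in> V \<longleftrightarrow> w \<in> \<H> 1 \<and>
    (\<exists>\<phi>. (\<forall>n. \<phi> n \<in> test_functions \<Omega>) \<and> (\<lambda>n::nat. fnorm (Hm 1 \<Omega>) (\<lambda>x. \<phi> n x - w x)) \<longlonglongrightarrow> 0)"
  by (simp add: H10_def)

lemma H10_H1: "w \<in> V \<Longrightarrow> w \<in> \<H> 1"
  by (simp add: H10_iff)

lemma H10_L2: "w \<in> V \<Longrightarrow> w \<in> L2 \<Omega>"
  by (rule Hm_L2[OF H10_H1])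

lemma test_function_H10: assumes "\<phi> \<in> test_functions \<Omega>" shows "\<phi> \<in> V"
  unfolding H10_iff using assms test_function_H1 HmF.fnorm_zero
  by (intro conjI exI[of _ "\<lambda>_. \<phi>"]) auto

abbreviation D :: "'d \<Rightarrow> (real^'d \<Rightarrow> real) \<Rightarrow> real^'d \<Rightarrow> real" where
  "D i \<equiv> weak_deriv \<Omega> (unit_index i)"

definition gip :: "(real^'d \<Rightarrow> real) \<Rightarrow> (real^'d \<Rightarrow> real) \<Rightarrow> real" where
  "gip v w = (LINT x|M. weak_grad \<Omega> v x \<bullet> weak_grad \<Omega> w x)"

lemma unit_index_mem_1: "unit_index i \<in> multi_indices 1"
  using unit_index_mem[of i 0] by simp

lemma H1_D:
  assumes "w \<in> \<H> 1"
  shows "D i w \<in> L2 \<Omega>" "is_weak_deriv \<Omega> (unit_index i) w (D i w)"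
  using Hm_weak_deriv[OF assms unit_index_mem_1] by auto

lemma gip_sum:
  assumes "v \<in> \<H> 1" "w \<in> \<H> 1"
  shows "gip v w = (\<Sum>i\<in>UNIV. ip (D i v) (D i w))"
  unfolding gip_def ip_def weak_grad_def inner_vec_def
  using assms by (simp add: Bochner_Integration.integral_sum L2_integrable_mult H1_D)

lemma ipH_1_eq:
  assumes "w \<in> \<H> 1"
  shows "ipH 1 w w = ip w w + gip w w"
proof -
  have z: "ip (weak_deriv \<Omega> (\<lambda>_. 0) w) (weak_deriv \<Omega> (\<lambda>_. 0) w) = ip w w"
    using weak_deriv_AE_eq(1)[OF is_weak_deriv_0[OF L2_locally_integrable[OF Hm_L2[OF assms]]]]
    by (intro ip_cong_AE Hm_weak_deriv[OF assms zero_multi_index])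
  have "(\<lambda>_. 0) \<notin> range (unit_index :: 'd \<Rightarrow> _)"
    by (auto simp: unit_index_def fun_eq_iff split: if_splits)
  then show ?thesis
    unfolding ipH_def multi_indices_1 gip_sum[OF assms assms] by (simp add: z sum.reindex inj_unit_index)
qed

lemma fnorm_H10: "nrm w = sqrt (gip w w)"
  by (simp add: H10_def gip_def power2_norm_eq_inner)

lemma gip_nonneg: "0 \<le> gip w w"
  unfolding gip_def by (rule integral_nonneg_AE) simp

lemma semi_inner_gip_H1: "semi_inner (\<H> 1) gip"
proof
  fix u v w :: "real^'d \<Rightarrow> real" and c :: real
  assume u: "u \<in> \<H> 1" and w: "w \<in> \<H> 1"
  note u1 = unit_index_mem_1
  have "ip (D i (\<lambda>x. c * u x)) (D i w) = c * ip (D i u) (D i w)" for i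
  proof -
    have "ip (D i (\<lambda>x. c * u x)) (D i w) = ip (\<lambda>x. c * D i u x) (D i w)"
      by (intro ip_cong_AE weak_deriv_cmult_AE[OF _ u1] u w H1_D Hm_cmult) auto
    then show ?thesis using u w by (simp add: L2.B_cmult H1_D)
  qed
  then show "gip (\<lambda>x. c * u x) w = c * gip u w"
    using u w by (simp add: gip_sum Hm_cmult sum_distrib_left)
  show "gip u w = gip w u" by (simp add: gip_def inner_commute)
  show "0 \<le> gip u u" by (rule gip_nonneg)
  assume v: "v \<in> \<H> 1"
  have "ip (D i (\<lambda>x. u x + v x)) (D i w) = ip (D i u) (D i w) + ip (D i v) (D i w)" for i
  proof -
    have "ip (D i (\<lambda>x. u x + v x)) (D i w) = ip (\<lambda>x. D i u x + D i v x) (D i w)"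
      by (intro ip_cong_AE weak_deriv_add_AE[OF _ _ u1] u v w H1_D Hm_add) auto
    then show ?thesis using u v w by (simp add: L2.B_add H1_D)
  qed
  then show "gip (\<lambda>x. u x + v x) w = gip u w + gip v w"
    using u v w by (simp add: gip_sum Hm_add sum.distrib)
qed (auto intro: Hm_zero Hm_add Hm_cmult)

interpretation gH1: semi_inner "\<H> 1" gip by (rule semi_inner_gip_H1)

lemma fnorm_H1_sq: "w \<in> \<H> 1 \<Longrightarrow> fnorm (Hm 1 \<Omega>) w = sqrt (ip w w + gip w w)"
  by (simp only: fnorm_Hm ipH_1_eq)

lemma H10_norm_le_H1: "w \<in> \<H> 1 \<Longrightarrow> nrm w \<le> fnorm (Hm 1 \<Omega>) w"
  using L2.B_nonneg[OF Hm_L2, of w 1] by (simp add: fnorm_H1_sq[simplified] fnorm_H10)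

lemma H1_norm_le: "w \<in> \<H> 1 \<Longrightarrow> fnorm (Hm 1 \<Omega>) w \<le> sqrt (ip w w) + nrm w"
  using L2.B_nonneg[OF Hm_L2, of w 1] gip_nonneg[of w] sqrt_add_le_add_sqrt
  by (simp add: fnorm_H1_sq[simplified] fnorm_H10)

lemma H10_zero: "(\<lambda>x. 0) \<in> V"
  by (rule test_function_H10[OF test_functions_0])

lemma H10_add:
  assumes "v \<in> V" "w \<in> V" shows "(\<lambda>x. v x + w x) \<in> V"
proof -
  obtain \<phi> \<psi> where \<phi>: "\<And>n. \<phi> n \<in> test_functions \<Omega>" "(\<lambda>n::nat. fnorm (Hm 1 \<Omega>) (\<lambda>x. \<phi> n x - v x)) \<longlonglongrightarrow> 0"
    and \<psi>: "\<And>n. \<psi> n \<in> test_functions \<Omega>" "(\<lambda>n::nat. fnorm (Hm 1 \<Omega>) (\<lambda>x. \<psi> n x - w x)) \<longlonglongrightarrow> 0"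
    using assms unfolding H10_iff by blast
  have H: "v \<in> \<H> 1" "w \<in> \<H> 1" using assms H10_H1 by auto
  have mem: "(\<lambda>x. \<phi> n x - v x) \<in> \<H> 1" "(\<lambda>x. \<psi> n x - w x) \<in> \<H> 1" for n
    by (intro Hm.diff_mem test_function_H1 \<phi> \<psi> H)+
  have le: "fnorm (Hm 1 \<Omega>) (\<lambda>x. (\<phi> n x + \<psi> n x) - (v x + w x)) \<le>
      fnorm (Hm 1 \<Omega>) (\<lambda>x. \<phi> n x - v x) + fnorm (Hm 1 \<Omega>) (\<lambda>x. \<psi> n x - w x)" for n
    using HmF.fnorm_triangle[OF mem[of n]] by (simp add: algebra_simps)
  have nn: "0 \<le> fnorm (Hm 1 \<Omega>) (\<lambda>x. (\<phi> n x + \<psi> n x) - (v x + w x))" for n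
    by (intro HmF.fnorm_nonneg Hm.diff_mem Hm.add_mem test_function_H1 \<phi> \<psi> H)
  have "(\<lambda>n. fnorm (Hm 1 \<Omega>) (\<lambda>x. (\<phi> n x + \<psi> n x) - (v x + w x))) \<longlonglongrightarrow> 0"
    by (rule tendsto_sandwich[OF _ _ tendsto_const tendsto_add_zero[OF \<phi>(2) \<psi>(2)]]) (use le nn in auto)
  then show ?thesis unfolding H10_iff
    using H by (intro conjI Hm_add exI[of _ "\<lambda>n x. \<phi> n x + \<psi> n x"]) (auto intro: test_functions_add \<phi> \<psi>)
qed

lemma H10_cmult:
  assumes "v \<in> V" shows "(\<lambda>x. c * v x) \<in> V"
proof -
  obtain \<phi> where \<phi>: "\<And>n. \<phi> n \<in> test_functions \<Omega>" "(\<lambda>n::nat. fnorm (Hm 1 \<Omega>) (\<lambda>x. \<phi> n x - v x)) \<longlonglongrightarrow> 0"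
    using assms unfolding H10_iff by blast
  have H: "v \<in> \<H> 1" using assms H10_H1 by auto
  have "fnorm (Hm 1 \<Omega>) (\<lambda>x. c * \<phi> n x - c * v x) = \<bar>c\<bar> * fnorm (Hm 1 \<Omega>) (\<lambda>x. \<phi> n x - v x)" for n
    using HmF.fnorm_cmult[OF Hm.diff_mem[OF test_function_H1[OF \<phi>(1)] H], of c n] by (simp add: right_diff_distrib)
  then have "(\<lambda>n. fnorm (Hm 1 \<Omega>) (\<lambda>x. c * \<phi> n x - c * v x)) \<longlonglongrightarrow> 0"
    using tendsto_mult_right_zero[OF \<phi>(2), of "\<bar>c\<bar>"] by simp
  then show ?thesis unfolding H10_iff
    using H by (intro conjI Hm_cmult exI[of _ "\<lambda>n x. c * \<phi> n x"]) (auto intro: test_functions_cmult \<phi>)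
qed

text \<open>Each \<open>s n\<close> is replaced by a test function at distance less than \<open>1 / (n + 1)\<close>.\<close>

lemma H10_closed:
  assumes s: "\<And>n. s n \<in> V" and w: "w \<in> \<H> 1"
    and lim: "(\<lambda>n::nat. fnorm (Hm 1 \<Omega>) (\<lambda>x. s n x - w x)) \<longlonglongrightarrow> 0"
  shows "w \<in> V"
proof -
  have "\<exists>\<phi>\<in>test_functions \<Omega>. fnorm (Hm 1 \<Omega>) (\<lambda>x. \<phi> x - s n x) < 1 / real (Suc n)" for n
  proof -
    obtain \<phi> where \<phi>: "\<And>k. \<phi> k \<in> test_functions \<Omega>" "(\<lambda>k::nat. fnorm (Hm 1 \<Omega>) (\<lambda>x. \<phi> k x - s n x)) \<longlonglongrightarrow> 0"
      using s[of n] unfolding H10_iff by blast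
    have "\<forall>\<^sub>F k in sequentially. fnorm (Hm 1 \<Omega>) (\<lambda>x. \<phi> k x - s n x) < 1 / real (Suc n)"
      by (rule order_tendstoD(2)[OF \<phi>(2)]) simp
    then show ?thesis using \<phi>(1) by (auto simp: eventually_sequentially)
  qed
  then obtain \<phi> where \<phi>: "\<And>n. \<phi> n \<in> test_functions \<Omega>"
    and small: "\<And>n. fnorm (Hm 1 \<Omega>) (\<lambda>x. \<phi> n x - s n x) < 1 / real (Suc n)" by metis
  have nn: "0 \<le> fnorm (Hm 1 \<Omega>) (\<lambda>x. \<phi> n x - w x)" for n
    by (intro HmF.fnorm_nonneg Hm.diff_mem test_function_H1 \<phi> w)
  have le: "fnorm (Hm 1 \<Omega>) (\<lambda>x. \<phi> n x - w x) \<le> 1 / real (Suc n) + fnorm (Hm 1 \<Omega>) (\<lambda>x. s n x - w x)" for n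
    using HmF.fnorm_diff_triangle[OF test_function_H1[OF \<phi>[of n]] H10_H1[OF s[of n]] w] small[of n] by linarith
  have "(\<lambda>n. fnorm (Hm 1 \<Omega>) (\<lambda>x. \<phi> n x - w x)) \<longlonglongrightarrow> 0"
    by (rule tendsto_sandwich[OF _ _ tendsto_const tendsto_add_zero[OF LIMSEQ_Suc[OF lim_1_over_n] lim]]) (use le nn in auto)
  then show ?thesis unfolding H10_iff using w \<phi> by blast
qed

text \<open>The integral of \<open>\<partial>\<^sub>i (x\<^sub>i \<phi>\<^sup>2)\<close> vanishes, so that the integral of \<open>\<phi>\<^sup>2\<close> equals that of
\<open>- 2 x\<^sub>i \<phi> \<partial>\<^sub>i \<phi>\<close>; here \<open>|x\<^sub>i| \<le> R\<close> on the bounded domain.\<close>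

lemma Poincare_test:
  obtains R where "0 \<le> R" "\<And>\<phi>. \<phi> \<in> test_functions \<Omega> \<Longrightarrow> sqrt (ip \<phi> \<phi>) \<le> 2 * R * nrm \<phi>"
proof -
  obtain R where R: "0 < R" "\<And>x. x \<in> \<Omega> \<Longrightarrow> norm x \<le> R" using bounded_dom bounded_pos by metis
  fix i :: 'd
  have "sqrt (ip \<phi> \<phi>) \<le> 2 * R * nrm \<phi>" if \<phi>: "\<phi> \<in> test_functions \<Omega>" for \<phi>
  proof -
    note sm = test_functions_smooth[OF \<phi>]
    let ?d = "partial_deriv i \<phi>"
    have \<phi>L: "\<phi> \<in> L2 \<Omega>" and dL: "?d \<in> L2 \<Omega>"
      by (rule test_function_L2[OF \<phi>], rule test_function_L2[OF test_functions_partial_deriv[OF \<phi>]])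
    have xm: "(\<lambda>x. x $ i) \<in> borel_measurable M"
      by (rule measurable_restrict_space1, rule measurable_completion) simp
    have xb: "AE x in M. \<bar>x $ i\<bar> \<le> R"
      using R(2) component_le_norm_cart order_trans by (intro AE_I2) fastforce
    have xL: "(\<lambda>x. x $ i * \<phi> x) \<in> L2 \<Omega>"
      using xm xb by (intro L2_Linf_mult \<phi>L) (auto simp: Linf_def)
    have ibp: "(LINT x|M. \<phi> x * \<phi> x) = - (LINT x|M. (2 * (x $ i * \<phi> x)) * ?d x)"
    proof -
      have d1: "partial_deriv i (\<lambda>x. x $ i) = (\<lambda>x. 1)"
      proof
        fix x :: "real^'d"
        have "((\<lambda>x::real^'d. x $ i) has_derivative (\<lambda>h. h $ i)) (at x)"
          by (rule bounded_linear_imp_has_derivative) (rule bounded_linear_vec_nth)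
        from partial_deriv_eqI[OF this] show "partial_deriv i (\<lambda>x. x $ i) x = 1" by (simp add: axis_def)
      qed
      have sq: "(\<lambda>x. \<phi> x * \<phi> x) \<in> test_functions \<Omega>" by (rule test_functions_mult_smooth[OF \<phi> sm])
      have dsq: "partial_deriv i (\<lambda>x. \<phi> x * \<phi> x) = (\<lambda>x. 2 * (\<phi> x * ?d x))"
        using sm by (subst partial_deriv_mult) (auto simp: smooth_differentiable)
      have "(\<integral>x. x $ i * partial_deriv i (\<lambda>x. \<phi> x * \<phi> x) x \<partial>lborel) = - (\<integral>x. 1 * (\<phi> x * \<phi> x) \<partial>lborel)"
        using integration_by_parts_test[OF sq smooth_component, of i i] unfolding d1 .
      then have "(\<integral>x. \<phi> x * \<phi> x \<partial>lborel) = - (\<integral>x. (2 * (x $ i * \<phi> x)) * ?d x \<partial>lborel)"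
        by (simp add: dsq mult_ac)
      then show ?thesis
        using test_functions_measurable[OF \<phi>]
        by (subst (1 2) dom_integral_test) (auto intro: \<phi> test_functions_partial_deriv)
    qed
    have "ip \<phi> \<phi> = - (2 * ip (\<lambda>x. x $ i * \<phi> x) ?d)"
      using ibp by (simp add: ip_def mult.assoc)
    also have "\<dots> \<le> 2 * (sqrt (ip (\<lambda>x. x $ i * \<phi> x) (\<lambda>x. x $ i * \<phi> x)) * sqrt (ip ?d ?d))"
      using L2.Cauchy_Schwarz[OF xL dL] by linarith
    also have "sqrt (ip (\<lambda>x. x $ i * \<phi> x) (\<lambda>x. x $ i * \<phi> x)) \<le> R * sqrt (ip \<phi> \<phi>)"
      using real_sqrt_le_mono[OF ip_Linf_bound[OF xm xb _ \<phi>L]] R(1) by (simp add: real_sqrt_mult)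
    finally have main: "ip \<phi> \<phi> \<le> 2 * R * sqrt (ip \<phi> \<phi>) * sqrt (ip ?d ?d)"
      using L2.B_nonneg[OF dL] by (simp add: mult_right_mono mult.assoc)
    have "sqrt (ip ?d ?d) \<le> nrm \<phi>"
    proof -
      have H: "\<phi> \<in> \<H> 1" by (rule test_function_H1[OF \<phi>])
      have "ip ?d ?d = ip (D i \<phi>) (D i \<phi>)"
        using is_weak_deriv_unique_AE[OF test_function_weak_deriv[OF \<phi>] H1_D(2)[OF H]]
        by (intro ip_cong_AE dL) auto
      also have "\<dots> \<le> gip \<phi> \<phi>"
        unfolding gip_sum[OF H H] by (intro member_le_sum L2.B_nonneg H1_D(1)[OF H]) auto
      finally show ?thesis by (simp add: fnorm_H10)
    qed
    moreover have "sqrt (ip \<phi> \<phi>) \<le> 2 * R * sqrt (ip ?d ?d)"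
    proof (cases "ip \<phi> \<phi> = 0")
      case True
      then show ?thesis using R(1) L2.B_nonneg[OF dL] by simp
    next
      case False
      then have p: "0 < ip \<phi> \<phi>" using L2.B_nonneg[OF \<phi>L] by simp
      then have "sqrt (ip \<phi> \<phi>) * sqrt (ip \<phi> \<phi>) \<le> sqrt (ip \<phi> \<phi>) * (2 * R * sqrt (ip ?d ?d))"
        using main by (simp add: mult_ac)
      then show ?thesis using p by (simp del: real_sqrt_mult_self)
    qed
    ultimately show ?thesis using R(1) by (smt (verit) mult_left_mono)
  qed
  with R(1) show ?thesis using that[of R] by simp
qed

text \<open>By density of the test functions.\<close>

theorem Poincare:
  obtains C where "0 \<le> C" "\<And>w. w \<in> V \<Longrightarrow> sqrt (ip w w) \<le> C * nrm w"
proof -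
  obtain R where R: "0 \<le> R" "\<And>\<phi>. \<phi> \<in> test_functions \<Omega> \<Longrightarrow> sqrt (ip \<phi> \<phi>) \<le> 2 * R * nrm \<phi>"
    using Poincare_test by blast
  have "sqrt (ip w w) \<le> 2 * R * nrm w" if w: "w \<in> V" for w
  proof -
    obtain \<phi> where \<phi>: "\<And>n. \<phi> n \<in> test_functions \<Omega>" "(\<lambda>n::nat. fnorm (Hm 1 \<Omega>) (\<lambda>x. \<phi> n x - w x)) \<longlonglongrightarrow> 0"
      using w unfolding H10_iff by blast
    have H: "w \<in> \<H> 1" "\<phi> n \<in> \<H> 1" for n
      using w H10_H1 test_function_H1 \<phi> by auto
    let ?e = "\<lambda>n. fnorm (Hm 1 \<Omega>) (\<lambda>x. \<phi> n x - w x)"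
    have "sqrt (ip w w) \<le> 2 * R * nrm w + (2 * R + 1) * ?e n" for n
    proof -
      let ?d = "\<lambda>x. \<phi> n x - w x"
      have d: "?d \<in> \<H> 1" by (intro Hm.diff_mem H)
      have d': "(\<lambda>x. (- 1) * ?d x) \<in> \<H> 1" by (rule Hm_cmult[OF d])
      have "sqrt (ip w w) \<le> sqrt (ip (\<phi> n) (\<phi> n)) + sqrt (ip ?d ?d)"
        using L2.sqrt_B_triangle[OF Hm_L2[OF H(2)[of n]] Hm_L2[OF d']] L2.sqrt_B_cmult[OF Hm_L2[OF d], of "- 1"] by simp
      also have "\<dots> \<le> 2 * R * nrm (\<phi> n) + ?e n"
        using R(2)[OF \<phi>(1)[of n]] L2_norm_le_Hm[OF d] by linarith
      also have "\<dots> \<le> 2 * R * (nrm w + ?e n) + ?e n"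
      proof -
        have "nrm (\<phi> n) \<le> nrm w + nrm ?d"
          using gH1.sqrt_B_triangle[OF H(1) d] by (simp add: fnorm_H10)
        also have "\<dots> \<le> nrm w + ?e n" using H10_norm_le_H1[OF d] by simp
        finally show ?thesis using R(1) by (intro add_right_mono mult_left_mono) auto
      qed
      finally show ?thesis by (simp add: algebra_simps)
    qed
    moreover have "(\<lambda>n. 2 * R * nrm w + (2 * R + 1) * ?e n) \<longlonglongrightarrow> 2 * R * nrm w + (2 * R + 1) * 0"
      by (intro tendsto_intros \<phi>)
    ultimately show ?thesis by (intro LIMSEQ_le_const) auto
  qed
  then show ?thesis using that[of "2 * R"] R(1) by simp
qed

definition poincare_const :: real where
  "poincare_const = (SOME C. 0 \<le> C \<and> (\<forall>w\<in>V. sqrt (ip w w) \<le> C * nrm w))"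

lemma poincare_const: "0 \<le> poincare_const"
    "w \<in> V \<Longrightarrow> sqrt (ip w w) \<le> poincare_const * nrm w"
proof -
  have "\<exists>C. 0 \<le> C \<and> (\<forall>w\<in>V. sqrt (ip w w) \<le> C * nrm w)"
    using Poincare by metis
  from someI_ex[OF this] show "0 \<le> poincare_const"
    "w \<in> V \<Longrightarrow> sqrt (ip w w) \<le> poincare_const * nrm w"
    unfolding poincare_const_def by auto
qed

lemma semi_inner_gip: "semi_inner (V) gip"
  by unfold_locales (auto intro: H10_zero H10_add H10_cmult gH1.B_add gH1.B_cmult gH1.B_sym gip_nonneg H10_H1)

sublocale H10: semi_inner "V" gip by (rule semi_inner_gip)

lemma semi_hilbert_gip: "semi_hilbert (V) gip"
proof (rule semi_hilbert.semi_hilbert_of_equivalent[OF semi_hilbert_Hm[of 1] semi_inner_gip])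
  show "V \<subseteq> \<H> 1" using H10_H1 by blast
  show "0 \<le> poincare_const + 1" using poincare_const(1) by simp
  show "w \<in> V" if "\<And>n. s n \<in> V" "w \<in> \<H> 1"
    "(\<lambda>n::nat. sqrt (ipH 1 (\<lambda>x. s n x - w x) (\<lambda>x. s n x - w x))) \<longlonglongrightarrow> 0" for s w
    by (rule H10_closed[OF that(1,2)]) (use that(3) in \<open>simp only: fnorm_Hm\<close>)
  fix v assume v: "v \<in> V"
  show "sqrt (ipH 1 v v) \<le> (poincare_const + 1) * sqrt (gip v v)"
    using H1_norm_le[OF H10_H1[OF v]] poincare_const(2)[OF v] by (simp only: fnorm_H10 fnorm_Hm distrib_right; simp)
  have "sqrt (gip v v) \<le> sqrt (ipH 1 v v)"
    using H10_norm_le_H1[OF H10_H1[OF v]] by (simp only: fnorm_H10 fnorm_Hm)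
  also have "\<dots> \<le> (poincare_const + 1) * sqrt (ipH 1 v v)"
    using poincare_const(1) Hm.B_nonneg[OF H10_H1[OF v]] by (simp only: distrib_right; simp)
  finally show "sqrt (gip v v) \<le> (poincare_const + 1) * sqrt (ipH 1 v v)" .
qed

lemma fspace_H10: "fspace (H10 \<Omega>)"
  by (rule fspace_of_semi_hilbert[OF semi_hilbert_gip fnorm_H10])

section \<open>The dual space\<close>

abbreviation "H10_ball \<equiv> {v \<in> V. nrm v \<le> 1}"

abbreviation V' :: "((real^'d \<Rightarrow> real) \<Rightarrow> real) set" where "V' \<equiv> elems (Hminus1 \<Omega>)"
abbreviation nrm' :: "((real^'d \<Rightarrow> real) \<Rightarrow> real) \<Rightarrow> real" where "nrm' \<equiv> fnorm (Hminus1 \<Omega>)"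

lemma Hminus1_iff: "F \<in> V' \<longleftrightarrow>
    (\<forall>v\<in>V. \<forall>w\<in>V. F (\<lambda>x. v x + w x) = F v + F w) \<and>
    (\<forall>c. \<forall>v\<in>V. F (\<lambda>x. c * v x) = c * F v) \<and>
    (\<exists>C. \<forall>v\<in>V. \<bar>F v\<bar> \<le> C * nrm v)"
  by (simp add: Hminus1_def)

lemma Hminus1_add: "F \<in> V' \<Longrightarrow> v \<in> V \<Longrightarrow> w \<in> V \<Longrightarrow> F (\<lambda>x. v x + w x) = F v + F w"
  and Hminus1_cmult: "F \<in> V' \<Longrightarrow> v \<in> V \<Longrightarrow> F (\<lambda>x. c * v x) = c * F v"
  by (auto simp: Hminus1_def)

lemma Hminus1_bound:
  assumes "F \<in> V'"
  obtains C where "0 \<le> C" "\<And>v. v \<in> V \<Longrightarrow> \<bar>F v\<bar> \<le> C * nrm v"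
proof -
  obtain C where C: "\<And>v. v \<in> V \<Longrightarrow> \<bar>F v\<bar> \<le> C * nrm v"
    using assms unfolding Hminus1_iff by blast
  have "\<bar>F v\<bar> \<le> max C 0 * nrm v" if "v \<in> V" for v
    using C[OF that] mult_right_mono[of C "max C 0" "nrm v"] gip_nonneg[of v]
    by (auto simp: fnorm_H10)
  then show ?thesis using that[of "max C 0"] by simp
qed

lemma fnorm_Hminus1: "nrm' F = (SUP v\<in>H10_ball. \<bar>F v\<bar>)"
  by (simp add: Hminus1_def)

lemma H10_ball_zero: "(\<lambda>x. 0) \<in> H10_ball"
  using fspace.fnorm_zero[OF fspace_H10] H10_zero by simp

lemma Hminus1_bdd:
  assumes "F \<in> V'" shows "bdd_above ((\<lambda>v. \<bar>F v\<bar>) ` H10_ball)"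
proof -
  obtain C where C: "0 \<le> C" "\<And>v. v \<in> V \<Longrightarrow> \<bar>F v\<bar> \<le> C * nrm v"
    using Hminus1_bound[OF assms] by blast
  show ?thesis
  proof (rule bdd_aboveI2)
    fix v assume v: "v \<in> H10_ball"
    then have "C * nrm v \<le> C * 1" using C(1) by (intro mult_left_mono) auto
    then show "\<bar>F v\<bar> \<le> C" using C(2)[of v] v by simp
  qed
qed

lemma Hminus1_le:
  assumes F: "F \<in> V'" and v: "v \<in> V"
  shows "\<bar>F v\<bar> \<le> nrm' F * nrm v"
proof (cases "nrm v = 0")
  case True
  then show ?thesis using Hminus1_bound[OF F] v by (metis mult_zero_right)
next
  case False
  then have p: "0 < nrm v" using gip_nonneg[of v] by (simp add: fnorm_H10)
  let ?w = "\<lambda>x. (1 / nrm v) * v x"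
  have "?w \<in> H10_ball"
    using p fspace.fnorm_cmult[OF fspace_H10 v, of "1 / nrm v"] H10_cmult[OF v, of "1 / nrm v"] by simp
  then have "\<bar>F ?w\<bar> \<le> nrm' F"
    unfolding fnorm_Hminus1 by (intro cSUP_upper Hminus1_bdd F)
  also have "F ?w = (1 / nrm v) * F v" by (rule Hminus1_cmult[OF F v])
  finally show ?thesis using p by (simp add: abs_mult field_simps)
qed

lemma Hminus1_norm_leI:
  assumes "\<And>v. v \<in> V \<Longrightarrow> \<bar>F v\<bar> \<le> C * nrm v" "0 \<le> C"
  shows "nrm' F \<le> C"
  unfolding fnorm_Hminus1
proof (rule cSUP_least)
  show "H10_ball \<noteq> {}" using H10_ball_zero by blast
  fix v assume v: "v \<in> H10_ball"
  then have "C * nrm v \<le> C * 1" using assms(2) by (intro mult_left_mono) auto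
  then show "\<bar>F v\<bar> \<le> C" using assms(1)[of v] v by simp
qed

lemma Hminus1I:
  assumes "\<And>v w. v \<in> V \<Longrightarrow> w \<in> V \<Longrightarrow> F (\<lambda>x. v x + w x) = F v + F w"
    "\<And>c v. v \<in> V \<Longrightarrow> F (\<lambda>x. c * v x) = c * F v"
    "\<And>v. v \<in> V \<Longrightarrow> \<bar>F v\<bar> \<le> C * nrm v"
  shows "F \<in> V'"
  using assms unfolding Hminus1_iff by blast

lemma Hminus1_add_mem:
  assumes F: "F \<in> V'" and G: "G \<in> V'"
  shows "(\<lambda>v. F v + G v) \<in> V'"
proof (rule Hminus1I)
  show "\<bar>F v + G v\<bar> \<le> (nrm' F + nrm' G) * nrm v"
    if "v \<in> V" for v
    using Hminus1_le[OF F that] Hminus1_le[OF G that] by (simp add: distrib_right)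
qed (auto simp: Hminus1_add[OF F] Hminus1_add[OF G] Hminus1_cmult[OF F] Hminus1_cmult[OF G] algebra_simps)

lemma Hminus1_cmult_mem:
  assumes F: "F \<in> V'" shows "(\<lambda>v. c * F v) \<in> V'"
proof (rule Hminus1I)
  show "\<bar>c * F v\<bar> \<le> (\<bar>c\<bar> * nrm' F) * nrm v" if "v \<in> V" for v
    using mult_left_mono[OF Hminus1_le[OF F that], of "\<bar>c\<bar>"] by (simp add: abs_mult mult.assoc)
qed (auto simp: Hminus1_add[OF F] Hminus1_cmult[OF F] algebra_simps)

lemma gip_functional_mem:
  assumes w: "w \<in> V" shows "gip w \<in> V'"
  by (rule Hminus1I[where C = "nrm w"])
     (auto simp: H10.B_simps w fnorm_H10 H10.Cauchy_Schwarz)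

text \<open>Via the Riesz isomorphism the dual of \<open>H10\<close> becomes a Hilbert space itself.  Writing its inner
product as \<open>F (riesz G)\<close> makes linearity in \<open>F\<close> hold by definition.\<close>

definition riesz :: "((real^'d \<Rightarrow> real) \<Rightarrow> real) \<Rightarrow> real^'d \<Rightarrow> real" where
  "riesz F = (SOME w. w \<in> V \<and> (\<forall>v\<in>V. gip w v = F v))"

lemma riesz:
  assumes F: "F \<in> V'"
  shows "riesz F \<in> V" "v \<in> V \<Longrightarrow> gip (riesz F) v = F v"
proof -
  have "\<exists>w\<in>V. \<forall>v\<in>V. gip w v = F v"
    by (rule semi_hilbert.Riesz_representation[OF semi_hilbert_gip, where C = "nrm' F"])
       (use Hminus1_add[OF F] Hminus1_cmult[OF F] Hminus1_le[OF F] in \<open>auto simp: fnorm_H10\<close>)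
  then have "\<exists>w. w \<in> V \<and> (\<forall>v\<in>V. gip w v = F v)" by blast
  from someI_ex[OF this]
  show "riesz F \<in> V" "v \<in> V \<Longrightarrow> gip (riesz F) v = F v"
    unfolding riesz_def by blast+
qed

lemma riesz_square:
  assumes F: "F \<in> V'" and w: "w \<in> V"
    and eq: "\<And>v. v \<in> V \<Longrightarrow> gip w v = F v"
  shows "F (riesz F) = gip w w"
  using eq[OF riesz(1)[OF F]] H10.B_sym[OF w riesz(1)[OF F]] riesz(2)[OF F w] eq[OF w] by simp

lemma semi_hilbert_Hminus1: "semi_hilbert (V') (\<lambda>F G. F (riesz G))"
proof
  fix F G H :: "(real^'d \<Rightarrow> real) \<Rightarrow> real" and c :: real
  show "(\<lambda>v. 0) \<in> V'" by (rule Hminus1I[where C = 0]) auto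
  assume F: "F \<in> V'"
  show "(\<lambda>v. c * F v) \<in> V'" by (rule Hminus1_cmult_mem[OF F])
  show "0 \<le> F (riesz F)" using riesz_square[OF F riesz[OF F]] gip_nonneg by simp
  assume G: "G \<in> V'"
  show "(\<lambda>v. F v + G v) \<in> V'" by (rule Hminus1_add_mem[OF F G])
  show "F (riesz G) = G (riesz F)"
    using riesz(2)[OF F riesz(1)[OF G]] riesz(2)[OF G riesz(1)[OF F]] H10.B_sym[OF riesz(1)[OF F] riesz(1)[OF G]] by simp
next
  fix s :: "nat \<Rightarrow> (real^'d \<Rightarrow> real) \<Rightarrow> real"
  assume s: "\<And>n. s n \<in> V'"
    and C: "\<And>e. 0 < e \<Longrightarrow> \<exists>N. \<forall>m\<ge>N. \<forall>n\<ge>N.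
      sqrt (s m (riesz (\<lambda>v. s m v - s n v)) - s n (riesz (\<lambda>v. s m v - s n v))) < e"
  have diff: "(\<lambda>v. F v - G v) \<in> V'" if "F \<in> V'" "G \<in> V'" for F G
    using Hminus1_add_mem[OF that(1) Hminus1_cmult_mem[OF that(2), of "- 1"]] by simp
  let ?r = "\<lambda>n. riesz (s n)"
  note rs = riesz[OF s]
  have "s m (riesz (\<lambda>v. s m v - s n v)) - s n (riesz (\<lambda>v. s m v - s n v)) = gip (\<lambda>x. ?r m x - ?r n x) (\<lambda>x. ?r m x - ?r n x)" for m n
    by (rule riesz_square[OF diff[OF s[of m] s[of n]]])
       (auto simp: rs intro!: H10.diff_mem, auto simp: H10.B_diff rs)
  from semi_hilbert.complete[OF semi_hilbert_gip, of ?r, OF rs(1)] C[unfolded this]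
  obtain w where w: "w \<in> V" "(\<lambda>n. sqrt (gip (\<lambda>x. ?r n x - w x) (\<lambda>x. ?r n x - w x))) \<longlonglongrightarrow> 0" by blast
  have "s n (riesz (\<lambda>v. s n v - gip w v)) - gip w (riesz (\<lambda>v. s n v - gip w v)) = gip (\<lambda>x. ?r n x - w x) (\<lambda>x. ?r n x - w x)" for n
    by (rule riesz_square[OF diff[OF s[of n] gip_functional_mem[OF w(1)]]])
       (auto simp: rs w intro!: H10.diff_mem, auto simp: H10.B_diff rs w)
  then show "\<exists>F\<in>V'. (\<lambda>n. sqrt (s n (riesz (\<lambda>v. s n v - F v)) - F (riesz (\<lambda>v. s n v - F v)))) \<longlonglongrightarrow> 0"
    using w(2) by (intro bexI[OF _ gip_functional_mem[OF w(1)]]) simp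
qed simp_all

theorem fspace_Hminus1: "fspace (Hminus1 \<Omega>)"
proof (rule fspace_of_semi_hilbert[OF semi_hilbert_Hminus1])
  fix F assume F: "F \<in> V'"
  let ?n = "sqrt (F (riesz F))"
  have sq: "F (riesz F) = gip (riesz F) (riesz F)" by (rule riesz_square[OF F riesz[OF F]])
  show "nrm' F = ?n"
  proof (rule antisym)
    show "nrm' F \<le> ?n"
      using H10.Cauchy_Schwarz[OF riesz(1)[OF F]] riesz(2)[OF F] gip_nonneg
      by (intro Hminus1_norm_leI) (auto simp: sq fnorm_H10)
    have le: "?n * ?n \<le> nrm' F * ?n"
      using Hminus1_le[OF F riesz(1)[OF F]] gip_nonneg[of "riesz F"] by (simp add: sq fnorm_H10)
    have f0: "0 \<le> nrm' F"
      unfolding fnorm_Hminus1 by (rule order_trans[OF abs_ge_zero cSUP_upper[OF H10_ball_zero Hminus1_bdd[OF F]]])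
    show "?n \<le> nrm' F"
    proof (cases "?n = 0")
      case False
      then have "0 < ?n" using gip_nonneg[of "riesz F"] by (simp add: sq less_le)
      then show ?thesis by (rule mult_right_le_imp_le[OF le])
    qed (use f0 in simp)
  qed
qed

end

section \<open>The parameter box\<close>

abbreviation TM :: "(real^'t::finite) measure" where "TM \<equiv> lebesgue_on param_box"

lemma param_box_cbox: "(param_box :: (real^'t::finite) set) = cbox 0 1"
  by (auto simp: param_box_def mem_box_cart)

lemma param_box_sets [simp, intro]: "param_box \<in> sets lebesgue"
  by (simp add: param_box_cbox)

lemma measure_param_box: "measure (TM :: (real^'t::finite) measure) param_box = 1"
proof -
  have "(0 :: real^'t) \<in> cbox 0 1" by (simp add: mem_box_cart)
  then have "cbox (0 :: real^'t) 1 \<noteq> {}" by blast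
  then show ?thesis by (simp add: measure_restrict_space param_box_cbox content_cbox_cart)
qed

lemma finite_measure_TM: "finite_measure (TM :: (real^'t::finite) measure)"
  by (rule finite_measure_lebesgue_on) (simp add: param_box_cbox)

lemma emeasure_param_box: "emeasure (TM :: (real^'t::finite) measure) param_box = 1"
  using finite_measure.emeasure_eq_measure[OF finite_measure_TM, of param_box] by (simp add: measure_param_box)

lemma TM_integrable_const: "integrable (TM :: (real^'t::finite) measure) (\<lambda>t. c :: real)"
  using finite_measure.integrable_const[OF finite_measure_TM] .

lemma TM_integral_const: "(LINT t|(TM :: (real^'t::finite) measure). c :: real) = c"
  using measure_param_box[where 't = 't] by simp

lemma TM_integrable_bounded:
  fixes h :: "real^'t::finite \<Rightarrow> real"
  assumes "h \<in> borel_measurable TM" "AE t in TM. \<bar>h t\<bar> \<le> C"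
  shows "integrable TM h"
  by (rule Bochner_Integration.integrable_bound[OF TM_integrable_const[of C]]) (use assms in auto)

abbreviation U :: "(real^'t::finite) set" where "U \<equiv> interior param_box"

lemma U_subset: "U \<subseteq> param_box" by (rule interior_subset)

text \<open>The boundary of the box is a null set.\<close>

lemma AE_TM_if_AE_U:
  fixes P :: "real^'t::finite \<Rightarrow> bool"
  assumes "AE t in lebesgue. t \<in> U \<longrightarrow> P t" shows "AE t in TM. P t"
proof -
  have "negligible (param_box - U :: (real^'t) set)"
    by (simp add: param_box_cbox interior_cbox negligible_frontier_interval)
  then have "AE t in lebesgue. t \<notin> (param_box - U :: (real^'t) set)"
    unfolding negligible_iff_null_sets by (rule AE_not_in)
  with assms have "AE t in lebesgue. t \<in> param_box \<longrightarrow> P t" by eventually_elim auto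
  then show ?thesis by (simp add: AE_restrict_space_iff)
qed

lemma AE_TM_lebesgue: "(AE t in TM. P t) \<longleftrightarrow> (AE t in lebesgue. t \<in> (param_box :: (real^'t::finite) set) \<longrightarrow> P t)"
  by (simp add: AE_restrict_space_iff)

section \<open>Strongly measurable functions\<close>

lemma simple_function_sum_integral:
  fixes h :: "'b \<Rightarrow> real"
  assumes s: "simple_function TM s"
  shows "integrable TM (\<lambda>t. h (s t))"
    "(LINT t|TM. h (s t)) = (\<Sum>y\<in>s ` space (TM :: (real^'t::finite) measure). measure TM {t \<in> space TM. s t = y} * h y)"
proof -
  let ?M = "TM :: (real^'t) measure"
  let ?A = "\<lambda>y. {t \<in> space ?M. s t = y}"
  have fin: "finite (s ` space ?M)" using s by (simp add: simple_function_def)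
  have A: "?A y \<in> sets ?M" for y
    using simple_functionD(2)[OF s, of "{y}"] by (simp add: vimage_def Int_def conj_commute)
  have i: "integrable ?M (\<lambda>t. h y * indicator (?A y) t)" for y
    using A[of y] finite_measure.emeasure_finite[OF finite_measure_TM, of "?A y"]
    by (intro integrable_mult_right integrable_real_indicator) (auto simp: top.not_eq_extremum)
  have eq: "h (s t) = (\<Sum>y\<in>s ` space ?M. h y * indicator (?A y) t)" if "t \<in> space ?M" for t
  proof -
    have "(\<Sum>y\<in>s ` space ?M. h y * indicator (?A y) t) = (\<Sum>y\<in>s ` space ?M. if y = s t then h y else 0)"
      using that by (intro sum.cong refl) (auto simp: indicator_def)
    also have "\<dots> = h (s t)" using fin that by (subst sum.delta) auto
    finally show ?thesis by simp
  qed
  show "integrable TM (\<lambda>t. h (s t))"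
    by (subst Bochner_Integration.integrable_cong[OF refl eq]) (assumption, rule Bochner_Integration.integrable_sum[OF i])
  have "(LINT t|?M. h (s t)) = (LINT t|?M. (\<Sum>y\<in>s ` space ?M. h y * indicator (?A y) t))"
    by (rule Bochner_Integration.integral_cong[OF refl eq])
  also have "\<dots> = (\<Sum>y\<in>s ` space ?M. LINT t|?M. h y * indicator (?A y) t)"
    by (rule Bochner_Integration.integral_sum) (rule i)
  also have "\<dots> = (\<Sum>y\<in>s ` space ?M. measure ?M (?A y) * h y)"
    using A sets.sets_into_space[OF A] by (intro sum.cong refl) (simp add: Int_absorb2 mult.commute)
  finally show "(LINT t|TM. h (s t)) = (\<Sum>y\<in>s ` space ?M. measure ?M (?A y) * h y)" .
qed

lemma strongly_measurableE:
  assumes "strongly_measurable M X u"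
  obtains s where "AE t in M. u t \<in> elems X" "\<And>n. simple_into M X (s n)"
    "AE t in M. (\<lambda>n::nat. fnorm X (\<lambda>x. s n t x - u t x)) \<longlonglongrightarrow> 0"
  using assms unfolding strongly_measurable_def by blast

lemma simple_into_mem: "simple_into M X s \<Longrightarrow> t \<in> space M \<Longrightarrow> s t \<in> elems X"
  by (auto simp: simple_into_def)

text \<open>A sequentially continuous function of the values of two strongly measurable functions is the limit of
the corresponding functions of the approximating simple functions.\<close>

lemma strongly_measurable_compose2:
  assumes u: "strongly_measurable TM X u" and v: "strongly_measurable TM Y v"
    and cont: "\<And>xs x ys y. (\<And>n. xs n \<in> elems X) \<Longrightarrow> x \<in> elems X \<Longrightarrow> (\<And>n. ys n \<in> elems Y) \<Longrightarrow> y \<in> elems Y \<Longrightarrow>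
       (\<lambda>n::nat. fnorm X (\<lambda>z. xs n z - x z)) \<longlonglongrightarrow> 0 \<Longrightarrow> (\<lambda>n. fnorm Y (\<lambda>z. ys n z - y z)) \<longlonglongrightarrow> 0 \<Longrightarrow>
       (\<lambda>n. \<Phi> (xs n) (ys n)) \<longlonglongrightarrow> \<Phi> x y"
  shows "(\<lambda>t. \<Phi> (u t) (v t) :: real) \<in> borel_measurable (TM :: (real^'t::finite) measure)"
proof -
  obtain s where s: "AE t in TM. u t \<in> elems X" "\<And>n. simple_into TM X (s n)"
    "AE t in TM. (\<lambda>n. fnorm X (\<lambda>x. s n t x - u t x)) \<longlonglongrightarrow> 0" using strongly_measurableE[OF u] by blast
  obtain r where r: "AE t in TM. v t \<in> elems Y" "\<And>n. simple_into TM Y (r n)"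
    "AE t in TM. (\<lambda>n. fnorm Y (\<lambda>x. r n t x - v t x)) \<longlonglongrightarrow> 0" using strongly_measurableE[OF v] by blast
  show ?thesis
  proof (rule lebesgue_on_measurable_AE_limit[OF param_box_sets])
    show "(\<lambda>t. \<Phi> (s n t) (r n t)) \<in> borel_measurable TM" for n
      using s(2)[of n] r(2)[of n]
      by (intro borel_measurable_simple_function simple_function_compose2[of TM "s n" "r n" \<Phi>])
         (auto simp: simple_into_def)
    show "AE t in TM. (\<lambda>n. \<Phi> (s n t) (r n t)) \<longlonglongrightarrow> \<Phi> (u t) (v t)"
      using s(1,3) r(1,3) AE_space
    proof eventually_elim
      case (elim t)
      show ?case
        by (rule cont) (use elim simple_into_mem[OF s(2)] simple_into_mem[OF r(2)] in auto)
    qed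
  qed
qed

context fspace
begin

lemma fnorm_tendsto:
  assumes "\<And>n. xs n \<in> elems X" "x \<in> elems X" "(\<lambda>n::nat. fnorm X (\<lambda>z. xs n z - x z)) \<longlonglongrightarrow> 0"
  shows "(\<lambda>n. fnorm X (xs n)) \<longlonglongrightarrow> fnorm X x"
proof (rule LIM_zero_cancel, rule tendsto_rabs_zero_cancel, rule tendsto_sandwich[OF _ _ tendsto_const assms(3)])
  have "\<bar>fnorm X (xs n) - fnorm X x\<bar> \<le> fnorm X (\<lambda>z. xs n z - x z)" for n
    using fnorm_le_diff[OF assms(1)[of n] assms(2)] fnorm_le_diff[OF assms(2) assms(1)[of n]]
      fnorm_diff_commute[OF assms(2) assms(1)[of n]] by linarith
  then show "\<forall>\<^sub>F n in sequentially. \<bar>fnorm X (xs n) - fnorm X x\<bar> \<le> fnorm X (\<lambda>z. xs n z - x z)" by simp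
qed simp

lemma bounded_functional_tendsto:
  assumes "\<And>n. xs n \<in> elems X" "x \<in> elems X" "(\<lambda>n::nat. fnorm X (\<lambda>z. xs n z - x z)) \<longlonglongrightarrow> 0"
    and l: "\<And>u v. u \<in> elems X \<Longrightarrow> v \<in> elems X \<Longrightarrow> \<bar>l u - l v\<bar> \<le> C * fnorm X (\<lambda>z. u z - v z)"
  shows "(\<lambda>n. l (xs n)) \<longlonglongrightarrow> (l x :: real)"
proof (rule LIM_zero_cancel, rule tendsto_rabs_zero_cancel, rule tendsto_sandwich[OF _ _ tendsto_const])
  show "\<forall>\<^sub>F n in sequentially. \<bar>l (xs n) - l x\<bar> \<le> C * fnorm X (\<lambda>z. xs n z - x z)"
    using l assms(1,2) by simp
  show "(\<lambda>n. C * fnorm X (\<lambda>z. xs n z - x z)) \<longlonglongrightarrow> 0"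
    using tendsto_mult_right_zero[OF assms(3)] .
qed simp

lemma strongly_measurable_functional:
  assumes "strongly_measurable TM X u"
    and l: "\<And>u v. u \<in> elems X \<Longrightarrow> v \<in> elems X \<Longrightarrow> \<bar>l u - l v\<bar> \<le> C * fnorm X (\<lambda>z. u z - v z)"
  shows "(\<lambda>t. l (u t) :: real) \<in> borel_measurable TM"
  by (rule strongly_measurable_compose2[OF assms(1) assms(1), where \<Phi> = "\<lambda>x y. l x"])
     (rule bounded_functional_tendsto[OF _ _ _ l])

lemma strongly_measurable_dual:
  assumes "strongly_measurable TM X u" "l \<in> dual_ball X"
  shows "(\<lambda>t. l (u t)) \<in> borel_measurable TM"
proof (rule strongly_measurable_functional[OF assms(1), where C = 1])
  fix a b assume "a \<in> elems X" "b \<in> elems X"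
  then show "\<bar>l a - l b\<bar> \<le> 1 * fnorm X (\<lambda>z. a z - b z)"
    using dual_ball_le[OF assms(2) diff_mem[of a b]] by (simp add: dual_ball_diff[OF assms(2)])
qed

lemma strongly_measurable_fnorm:
  assumes "strongly_measurable TM X u"
  shows "(\<lambda>t. fnorm X (u t)) \<in> borel_measurable TM"
  by (rule strongly_measurable_compose2[OF assms assms, where \<Phi> = "\<lambda>x y. fnorm X x"])
     (rule fnorm_tendsto)

lemma fnorm_diff_null:
  assumes "a \<in> elems X" "b \<in> elems X" "c \<in> elems X" "fnorm X (\<lambda>x. b x - c x) = 0"
  shows "fnorm X (\<lambda>x. a x - b x) = fnorm X (\<lambda>x. a x - c x)"
  using fnorm_diff_triangle[of a b c] fnorm_diff_triangle[of a c b] fnorm_diff_commute[of b c] assms by simp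

lemma simple_into_diff:
  assumes "simple_into M X s" "simple_into M X r"
  shows "simple_into M X (\<lambda>t x. s t x - r t x)"
  using assms simple_function_compose2[of M s r "\<lambda>a b x. a x - b x"]
  by (auto simp: simple_into_def image_subset_iff intro: diff_mem)

lemma strongly_measurable_diff:
  assumes u: "strongly_measurable M X u" and v: "strongly_measurable M X v"
  shows "strongly_measurable M X (\<lambda>t x. u t x - v t x)"
proof -
  obtain s where s: "AE t in M. u t \<in> elems X" "\<And>n. simple_into M X (s n)"
    "AE t in M. (\<lambda>n. fnorm X (\<lambda>x. s n t x - u t x)) \<longlonglongrightarrow> 0" using strongly_measurableE[OF u] by blast
  obtain r where r: "AE t in M. v t \<in> elems X" "\<And>n. simple_into M X (r n)"
    "AE t in M. (\<lambda>n. fnorm X (\<lambda>x. r n t x - v t x)) \<longlonglongrightarrow> 0" using strongly_measurableE[OF v] by blast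
  show ?thesis unfolding strongly_measurable_def
  proof (intro conjI exI[of _ "\<lambda>n t x. s n t x - r n t x"] allI)
    show "AE t in M. (\<lambda>x. u t x - v t x) \<in> elems X"
      using s(1) r(1) by eventually_elim (rule diff_mem)
    show "simple_into M X (\<lambda>t x. s n t x - r n t x)" for n by (intro simple_into_diff s r)
    show "AE t in M. (\<lambda>n. fnorm X (\<lambda>x. (s n t x - r n t x) - (u t x - v t x))) \<longlonglongrightarrow> 0"
      using s(1,3) r(1,3) AE_space
    proof eventually_elim
      case (elim t)
      note m = simple_into_mem[OF s(2) elim(5)] simple_into_mem[OF r(2) elim(5)]
      have e: "(\<lambda>x. (s n t x - r n t x) - (u t x - v t x)) = (\<lambda>x. (s n t x - u t x) - (r n t x - v t x))" for n
        by (simp add: fun_eq_iff)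
      have le: "fnorm X (\<lambda>x. (s n t x - r n t x) - (u t x - v t x)) \<le>
          fnorm X (\<lambda>x. s n t x - u t x) + fnorm X (\<lambda>x. r n t x - v t x)" for n
        unfolding e using elim m by (intro fnorm_triangle_diff diff_mem) auto
      have nn: "0 \<le> fnorm X (\<lambda>x. (s n t x - r n t x) - (u t x - v t x))" for n
        using elim m by (intro fnorm_nonneg diff_mem) auto
      show ?case
        by (rule tendsto_sandwich[OF _ _ tendsto_const tendsto_add_zero[OF elim(2) elim(4)]]) (use le nn in auto)
    qed
  qed
qed

lemma strongly_measurable_cong_AE:
  assumes u: "strongly_measurable M X u"
    and ae: "AE t in M. v t \<in> elems X \<and> fnorm X (\<lambda>x. v t x - u t x) = 0"
  shows "strongly_measurable M X v"
proof -
  obtain s where s: "AE t in M. u t \<in> elems X" "\<And>n. simple_into M X (s n)"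
    "AE t in M. (\<lambda>n. fnorm X (\<lambda>x. s n t x - u t x)) \<longlonglongrightarrow> 0" using strongly_measurableE[OF u] by blast
  show ?thesis unfolding strongly_measurable_def
  proof (intro conjI exI[of _ s] allI s(2))
    show "AE t in M. v t \<in> elems X" using ae by auto
    show "AE t in M. (\<lambda>n. fnorm X (\<lambda>x. s n t x - v t x)) \<longlonglongrightarrow> 0"
      using ae s(1,3) AE_space
    proof eventually_elim
      case (elim t)
      have "fnorm X (\<lambda>x. s n t x - v t x) = fnorm X (\<lambda>x. s n t x - u t x)" for n
        using elim simple_into_mem[OF s(2) elim(4)] by (intro fnorm_diff_null) auto
      then show ?case using elim by simp
    qed
  qed
qed

lemma bochner_L2_diff:
  fixes u v :: "real^'t::finite \<Rightarrow> 'a \<Rightarrow> real"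
  assumes "u \<in> bochner_L2 X" "v \<in> bochner_L2 X"
  shows "(\<lambda>t x. u t x - v t x) \<in> bochner_L2 X"
proof -
  have s: "strongly_measurable TM X u" "strongly_measurable TM X v"
    and i: "integrable TM (\<lambda>t. (fnorm X (u t))\<^sup>2)" "integrable TM (\<lambda>t. (fnorm X (v t))\<^sup>2)"
    using assms by (auto simp: bochner_L2_def)
  have d: "strongly_measurable TM X (\<lambda>t x. u t x - v t x)" by (rule strongly_measurable_diff[OF s])
  have "integrable TM (\<lambda>t. (fnorm X (\<lambda>x. u t x - v t x))\<^sup>2)"
  proof (rule Bochner_Integration.integrable_bound)
    show "integrable TM (\<lambda>t. 2 * (fnorm X (u t))\<^sup>2 + 2 * (fnorm X (v t))\<^sup>2)" using i by simp
    show "(\<lambda>t. (fnorm X (\<lambda>x. u t x - v t x))\<^sup>2) \<in> borel_measurable TM"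
      using strongly_measurable_fnorm[OF d] by simp
    have "AE t in TM. u t \<in> elems X" "AE t in TM. v t \<in> elems X"
      using s by (auto simp: strongly_measurable_def)
    then show "AE t in TM. norm ((fnorm X (\<lambda>x. u t x - v t x))\<^sup>2) \<le> norm (2 * (fnorm X (u t))\<^sup>2 + 2 * (fnorm X (v t))\<^sup>2)"
    proof eventually_elim
      case (elim t)
      have "(fnorm X (\<lambda>x. u t x - v t x))\<^sup>2 \<le> (fnorm X (u t) + fnorm X (v t))\<^sup>2"
        using elim by (intro power_mono fnorm_triangle_diff fnorm_nonneg diff_mem)
      also have "\<dots> \<le> 2 * (fnorm X (u t))\<^sup>2 + 2 * (fnorm X (v t))\<^sup>2"
        using zero_le_power2[of "fnorm X (u t) - fnorm X (v t)"] by (simp add: power2_eq_square algebra_simps)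
      finally show ?case by simp
    qed
  qed
  then show ?thesis using d by (simp add: bochner_L2_def)
qed

lemma bochner_L2_cong_AE:
  fixes u v :: "real^'t::finite \<Rightarrow> 'a \<Rightarrow> real"
  assumes u: "u \<in> bochner_L2 X" and ae: "AE t in TM. v t \<in> elems X \<and> fnorm X (\<lambda>x. v t x - u t x) = 0"
  shows "v \<in> bochner_L2 X" "bochner_L2_norm X v = bochner_L2_norm X u"
proof -
  have su: "strongly_measurable TM X u" and i: "integrable TM (\<lambda>t. (fnorm X (u t))\<^sup>2)"
    using u by (auto simp: bochner_L2_def)
  have sv: "strongly_measurable TM X v" by (rule strongly_measurable_cong_AE[OF su ae])
  have "AE t in TM. u t \<in> elems X" using su by (auto simp: strongly_measurable_def)
  with ae have eq: "AE t in TM. (fnorm X (u t))\<^sup>2 = (fnorm X (v t))\<^sup>2"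
    by eventually_elim (use fnorm_eq_if_diff_0 in auto)
  have mm: "(\<lambda>t. (fnorm X (u t))\<^sup>2) \<in> borel_measurable TM" "(\<lambda>t. (fnorm X (v t))\<^sup>2) \<in> borel_measurable TM"
    using strongly_measurable_fnorm[OF su] strongly_measurable_fnorm[OF sv] by auto
  show "v \<in> bochner_L2 X"
    unfolding bochner_L2_def using sv integrable_cong_AE_imp[OF i mm(2) eq] by simp
  show "bochner_L2_norm X v = bochner_L2_norm X u"
    unfolding bochner_L2_norm_def using integral_cong_AE[OF mm eq] by simp
qed

section \<open>The Bochner integral\<close>

lemma simple_integral_mem:
  assumes "simple_into (TM :: (real^'t::finite) measure) X s"
  shows "simple_integral TM s \<in> elems X"
  unfolding simple_integral_def
proof (rule sum_mem)
  fix y assume "y \<in> s ` space (TM :: (real^'t) measure)"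
  then have "y \<in> elems X" using assms by (auto simp: simple_into_def)
  then show "(\<lambda>x. measure TM {t \<in> space TM. s t = y} * y x) \<in> elems X" by (rule cmult_mem)
qed

lemma dual_simple_integral:
  assumes s: "simple_into (TM :: (real^'t::finite) measure) X s" and l: "l \<in> dual_ball X"
  shows "l (simple_integral TM s) = (LINT t|TM. l (s t))" "integrable TM (\<lambda>t. l (s t))"
proof -
  have sf: "simple_function TM s" and m: "\<And>y. y \<in> s ` space TM \<Longrightarrow> y \<in> elems X"
    using s by (auto simp: simple_into_def)
  show "integrable TM (\<lambda>t. l (s t))" by (rule simple_function_sum_integral(1)[OF sf])
  show "l (simple_integral TM s) = (LINT t|TM. l (s t))"
    unfolding simple_integral_def simple_function_sum_integral(2)[OF sf]
  proof (subst dual_ball_sum[OF l])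
    fix y assume "y \<in> s ` space (TM :: (real^'t) measure)"
    then show "(\<lambda>x. measure TM {t \<in> space TM. s t = y} * y x) \<in> elems X" by (intro cmult_mem m)
  next
    show "(\<Sum>y\<in>s ` space TM. l (\<lambda>x. measure TM {t \<in> space TM. s t = y} * y x)) =
        (\<Sum>y\<in>s ` space TM. measure TM {t \<in> space TM. s t = y} * l y)"
      by (intro sum.cong refl dual_ball_cmult[OF l] m)
  qed
qed

text \<open>Bounded functionals commute with the integral of a simple function by linearity; both sides
are continuous along the approximating sequence.\<close>

lemma bochner_integral_dual:
  fixes u :: "real^'t::finite \<Rightarrow> 'a \<Rightarrow> real"
  assumes u: "has_bochner_integral_in TM X u J" and l: "l \<in> dual_ball X"
  shows "integrable TM (\<lambda>t. l (u t))" "(LINT t|TM. l (u t)) = l J"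
proof -
  have su: "strongly_measurable TM X u" and J: "J \<in> elems X" using u by (auto simp: has_bochner_integral_in_def)
  obtain s where s: "\<And>n. simple_into TM X (s n)"
    and lim1: "(\<lambda>n::nat. \<integral>\<^sup>+t. ennreal (fnorm X (\<lambda>x. s n t x - u t x)) \<partial>TM) \<longlonglongrightarrow> 0"
    and lim2: "(\<lambda>n. fnorm X (\<lambda>x. simple_integral TM (s n) x - J x)) \<longlonglongrightarrow> 0"
    using u unfolding has_bochner_integral_in_def by blast
  have uX: "AE t in TM. u t \<in> elems X" using su by (auto simp: strongly_measurable_def)
  have lu: "(\<lambda>t. l (u t)) \<in> borel_measurable TM" by (rule strongly_measurable_dual[OF su l])
  have ls: "integrable TM (\<lambda>t. l (s n t))" for n by (rule dual_simple_integral(2)[OF s l])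
  have le: "(\<integral>\<^sup>+t. ennreal \<bar>l (s n t) - l (u t)\<bar> \<partial>TM) \<le> (\<integral>\<^sup>+t. ennreal (fnorm X (\<lambda>x. s n t x - u t x)) \<partial>TM)" for n
  proof (rule nn_integral_mono_AE)
    show "AE t in TM. ennreal \<bar>l (s n t) - l (u t)\<bar> \<le> ennreal (fnorm X (\<lambda>x. s n t x - u t x))"
      using uX AE_space
    proof eventually_elim
      case (elim t)
      note m = simple_into_mem[OF s elim(2)]
      show ?case using dual_ball_le[OF l diff_mem[OF m[of n] elim(1)]] dual_ball_diff[OF l m[of n] elim(1)]
        by (intro ennreal_leI) simp
    qed
  qed
  have iu: "integrable TM (\<lambda>t. l (u t))"
  proof -
    have "\<forall>\<^sub>F n in sequentially. (\<integral>\<^sup>+t. ennreal (fnorm X (\<lambda>x. s n t x - u t x)) \<partial>TM) < 1"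
      by (rule order_tendstoD(2)[OF lim1]) simp
    then obtain n where "(\<integral>\<^sup>+t. ennreal (fnorm X (\<lambda>x. s n t x - u t x)) \<partial>TM) < 1"
      by (auto simp: eventually_sequentially)
    then have "(\<integral>\<^sup>+t. ennreal \<bar>l (s n t) - l (u t)\<bar> \<partial>TM) < \<infinity>"
      using le[of n] by (auto intro: le_less_trans less_trans[OF _ ennreal_one_less_top])
    then have "integrable TM (\<lambda>t. l (s n t) - l (u t))"
      using lu borel_measurable_integrable[OF ls[of n]] by (intro integrableI_bounded) auto
    from Bochner_Integration.integrable_diff[OF ls[of n] this] show ?thesis by simp
  qed
  then show "integrable TM (\<lambda>t. l (u t))" .
  have "(\<lambda>n. LINT t|TM. l (s n t)) \<longlonglongrightarrow> (LINT t|TM. l (u t))"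
  proof (rule LIM_zero_cancel, rule tendsto_rabs_zero_cancel)
    have d: "integrable TM (\<lambda>t. l (s n t) - l (u t))" for n using ls iu by simp
    have b: "ennreal \<bar>(LINT t|TM. l (s n t)) - (LINT t|TM. l (u t))\<bar>
        \<le> (\<integral>\<^sup>+t. ennreal (fnorm X (\<lambda>x. s n t x - u t x)) \<partial>TM)" for n
    proof -
      have "\<bar>(LINT t|TM. l (s n t)) - (LINT t|TM. l (u t))\<bar> = \<bar>LINT t|TM. l (s n t) - l (u t)\<bar>"
        using ls iu by simp
      also have "\<dots> \<le> (LINT t|TM. \<bar>l (s n t) - l (u t)\<bar>)" by (rule integral_abs_bound)
      finally have "ennreal \<bar>(LINT t|TM. l (s n t)) - (LINT t|TM. l (u t))\<bar> \<le> ennreal (LINT t|TM. \<bar>l (s n t) - l (u t)\<bar>)"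
        by (rule ennreal_leI)
      also have "\<dots> = (\<integral>\<^sup>+t. ennreal \<bar>l (s n t) - l (u t)\<bar> \<partial>TM)"
        by (rule nn_integral_eq_integral[symmetric]) (use d in auto)
      also note le[of n]
      finally show ?thesis .
    qed
    have "(\<lambda>n. ennreal \<bar>(LINT t|TM. l (s n t)) - (LINT t|TM. l (u t))\<bar>) \<longlonglongrightarrow> 0"
      by (rule tendsto_sandwich[OF _ _ tendsto_const lim1]) (use b in auto)
    then show "(\<lambda>n. \<bar>(LINT t|TM. l (s n t)) - (LINT t|TM. l (u t))\<bar>) \<longlonglongrightarrow> 0"
      by (simp add: ennreal_0[symmetric] del: ennreal_0)
  qed
  moreover have "(\<lambda>n. LINT t|TM. l (s n t)) \<longlonglongrightarrow> l J"
  proof -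
    have "(\<lambda>n. l (simple_integral TM (s n))) \<longlonglongrightarrow> l J"
    proof (rule bounded_functional_tendsto[OF simple_integral_mem[OF s] J lim2, where C = 1])
      fix a b assume "a \<in> elems X" "b \<in> elems X"
      then show "\<bar>l a - l b\<bar> \<le> 1 * fnorm X (\<lambda>z. a z - b z)"
        using dual_ball_le[OF l diff_mem[of a b]] by (simp add: dual_ball_diff[OF l])
    qed
    then show ?thesis by (simp add: dual_simple_integral(1)[OF s l])
  qed
  ultimately show "(LINT t|TM. l (u t)) = l J" by (rule LIMSEQ_unique)
qed

lemma bochner_integral_cong:
  fixes u v :: "real^'t::finite \<Rightarrow> 'a \<Rightarrow> real"
  assumes u: "has_bochner_integral_in TM X u J"
    and ae: "AE t in TM. v t \<in> elems X \<and> fnorm X (\<lambda>x. v t x - u t x) = 0"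
    and J': "J' \<in> elems X" "fnorm X (\<lambda>x. J x - J' x) = 0"
  shows "has_bochner_integral_in TM X v J'"
proof -
  have su: "strongly_measurable TM X u" and J: "J \<in> elems X" using u by (auto simp: has_bochner_integral_in_def)
  obtain s where s: "\<And>n. simple_into TM X (s n)"
    and lim1: "(\<lambda>n::nat. \<integral>\<^sup>+t. ennreal (fnorm X (\<lambda>x. s n t x - u t x)) \<partial>TM) \<longlonglongrightarrow> 0"
    and lim2: "(\<lambda>n. fnorm X (\<lambda>x. simple_integral TM (s n) x - J x)) \<longlonglongrightarrow> 0"
    using u unfolding has_bochner_integral_in_def by blast
  have uX: "AE t in TM. u t \<in> elems X" using su by (auto simp: strongly_measurable_def)
  show ?thesis unfolding has_bochner_integral_in_def
  proof (intro conjI exI[of _ s] allI s J'(1) strongly_measurable_cong_AE[OF su ae])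
    have "(\<integral>\<^sup>+t. ennreal (fnorm X (\<lambda>x. s n t x - v t x)) \<partial>TM) = (\<integral>\<^sup>+t. ennreal (fnorm X (\<lambda>x. s n t x - u t x)) \<partial>TM)" for n
    proof (rule nn_integral_cong_AE)
      show "AE t in TM. ennreal (fnorm X (\<lambda>x. s n t x - v t x)) = ennreal (fnorm X (\<lambda>x. s n t x - u t x))"
        using ae uX AE_space
        by eventually_elim (auto simp: fnorm_diff_null intro!: arg_cong[of _ _ ennreal] fnorm_diff_null simple_into_mem[OF s])
    qed
    then show "(\<lambda>n. \<integral>\<^sup>+t. ennreal (fnorm X (\<lambda>x. s n t x - v t x)) \<partial>TM) \<longlonglongrightarrow> 0" using lim1 by simp
    have "fnorm X (\<lambda>x. simple_integral TM (s n) x - J' x) = fnorm X (\<lambda>x. simple_integral TM (s n) x - J x)" for n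
      using fnorm_diff_null[OF simple_integral_mem[OF s] J J'] by simp
    then show "(\<lambda>n. fnorm X (\<lambda>x. simple_integral TM (s n) x - J' x)) \<longlonglongrightarrow> 0" using lim2 by simp
  qed
qed

section \<open>Lipschitz curves\<close>

definition lipschitz_curve :: "(real^'t::finite \<Rightarrow> 'a \<Rightarrow> real) \<Rightarrow> bool" where
  "lipschitz_curve w \<longleftrightarrow> (\<forall>t\<in>param_box. w t \<in> elems X) \<and>
     (\<exists>L\<ge>0. \<forall>s\<in>param_box. \<forall>t\<in>param_box. fnorm X (\<lambda>x. w s x - w t x) \<le> L * norm (s - t))"

end

text \<open>The lower corner of the cell of the grid of width \<open>1 / (n + 1)\<close> that contains \<open>t\<close>.  Composition with it
turns a Lipschitz curve into a step function that is uniformly close to it.\<close>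

definition grid_point :: "nat \<Rightarrow> real^'t::finite \<Rightarrow> real^'t" where
  "grid_point n t = (\<chi> i. real_of_int \<lfloor>real (Suc n) * t $ i\<rfloor> / real (Suc n))"

lemma grid_point_mem: "t \<in> param_box \<Longrightarrow> grid_point n t \<in> param_box"
proof -
  assume t: "t \<in> param_box"
  have "real_of_int \<lfloor>real (Suc n) * t $ i\<rfloor> \<le> real (Suc n)" for i
  proof -
    have "real (Suc n) * t $ i \<le> real (Suc n) * 1" using t by (intro mult_left_mono) (auto simp: param_box_def)
    then have "real (Suc n) * t $ i \<le> real (Suc n)" by simp
    then show ?thesis using of_int_floor_le order_trans by blast
  qed
  then show ?thesis using t by (auto simp: grid_point_def param_box_def divide_le_eq)
qed

lemma grid_point_near: "norm (grid_point n t - t :: real^'t::finite) \<le> real CARD('t) / real (Suc n)"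
proof -
  have "\<bar>(grid_point n t - t) $ i\<bar> \<le> 1 / real (Suc n)" for i
  proof -
    have "\<bar>real_of_int \<lfloor>real (Suc n) * t $ i\<rfloor> - real (Suc n) * t $ i\<bar> \<le> 1" by linarith
    then have "\<bar>(real_of_int \<lfloor>real (Suc n) * t $ i\<rfloor> - real (Suc n) * t $ i) / real (Suc n)\<bar> \<le> 1 / real (Suc n)"
      by (simp add: abs_divide divide_right_mono)
    also have "(real_of_int \<lfloor>real (Suc n) * t $ i\<rfloor> - real (Suc n) * t $ i) / real (Suc n) = (grid_point n t - t) $ i"
      unfolding grid_point_def by (simp add: diff_divide_distrib del: of_nat_Suc)
    finally show ?thesis .
  qed
  then have "(\<Sum>i\<in>UNIV. \<bar>(grid_point n t - t) $ i\<bar>) \<le> (\<Sum>i\<in>(UNIV :: 't set). 1 / real (Suc n))"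
    by (intro sum_mono)
  then show ?thesis using norm_le_l1_cart[of "grid_point n t - t"] by simp
qed

lemma grid_point_simple: "simple_function (TM :: (real^'t::finite) measure) (grid_point n)"
proof (rule simple_function_borel_measurable)
  have "grid_point n \<in> borel_measurable (borel :: (real^'t) measure)"
  proof (subst borel_measurable_euclidean_space, rule ballI)
    fix b :: "real^'t" assume "b \<in> Basis"
    then obtain i where "b = axis i 1" by (auto simp: Basis_vec_def)
    then have eq: "(\<lambda>t. grid_point n t \<bullet> b) = (\<lambda>t. real_of_int \<lfloor>real (Suc n) * t $ i\<rfloor> / real (Suc n))"
      by (simp add: grid_point_def inner_axis del: of_nat_Suc)
    show "(\<lambda>t. grid_point n t \<bullet> b) \<in> borel_measurable borel" unfolding eq by measurable
  qed
  then show "grid_point n \<in> borel_measurable (TM :: (real^'t) measure)"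
    by (intro measurable_restrict_space1 measurable_completion) simp
  have "grid_point n t \<in> (\<lambda>k. \<chi> i. real_of_int (k i) / real (Suc n)) ` ((UNIV :: 't set) \<rightarrow>\<^sub>E {0..int (Suc n)})"
    if "t \<in> param_box" for t
  proof (rule image_eqI)
    show "grid_point n t = (\<chi> i. real_of_int ((\<lambda>i. \<lfloor>real (Suc n) * t $ i\<rfloor>) i) / real (Suc n))"
      by (simp add: grid_point_def)
    have "\<lfloor>real (Suc n) * t $ i\<rfloor> \<in> {0..int (Suc n)}" for i
    proof -
      have "0 \<le> real (Suc n) * t $ i" using that by (simp add: param_box_def)
      moreover have "real (Suc n) * t $ i \<le> real (Suc n) * 1" using that by (intro mult_left_mono) (auto simp: param_box_def)
      then have "\<lfloor>real (Suc n) * t $ i\<rfloor> \<le> \<lfloor>real (Suc n)\<rfloor>" by (intro floor_mono) simp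
      ultimately show ?thesis by (simp del: of_nat_Suc)
    qed
    then show "(\<lambda>i. \<lfloor>real (Suc n) * t $ i\<rfloor>) \<in> (UNIV :: 't set) \<rightarrow>\<^sub>E {0..int (Suc n)}" by auto
  qed
  then have "grid_point n ` space (TM :: (real^'t) measure) \<subseteq>
      (\<lambda>k. \<chi> i. real_of_int (k i) / real (Suc n)) ` ((UNIV :: 't set) \<rightarrow>\<^sub>E {0..int (Suc n)})" by auto
  then show "finite (grid_point n ` space (TM :: (real^'t) measure))"
    by (rule finite_subset) (intro finite_imageI finite_PiE, auto)
qed

context fspace
begin

lemma lipschitz_curve_grid:
  fixes w :: "real^'t::finite \<Rightarrow> 'a \<Rightarrow> real"
  assumes "lipschitz_curve w"
  obtains b :: "nat \<Rightarrow> real" where "b \<longlonglongrightarrow> 0" "\<And>n. 0 \<le> b n"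
    "\<And>n. simple_into TM X (\<lambda>t. w (grid_point n t))"
    "\<And>n t. t \<in> param_box \<Longrightarrow> fnorm X (\<lambda>x. w (grid_point n t) x - w t x) \<le> b n"
proof -
  obtain L where L: "0 \<le> L" "\<And>s t. s \<in> param_box \<Longrightarrow> t \<in> param_box \<Longrightarrow> fnorm X (\<lambda>x. w s x - w t x) \<le> L * norm (s - t)"
    and w: "\<And>t. t \<in> param_box \<Longrightarrow> w t \<in> elems X"
    using assms unfolding lipschitz_curve_def by blast
  define b where "b n = L * (real CARD('t) / real (Suc n))" for n
  have "(\<lambda>n. L * (real CARD('t) * (1 / real (Suc n)))) \<longlonglongrightarrow> L * (real CARD('t) * 0)"
    by (intro tendsto_intros LIMSEQ_Suc[OF lim_1_over_n])
  then have "b \<longlonglongrightarrow> 0" by (simp add: b_def[abs_def])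
  moreover have "0 \<le> b n" for n using L(1) by (simp add: b_def)
  moreover have "simple_into TM X (\<lambda>t. w (grid_point n t))" for n
    unfolding simple_into_def
    using simple_function_compose1[OF grid_point_simple, of w n] w grid_point_mem by auto
  moreover have "fnorm X (\<lambda>x. w (grid_point n t) x - w t x) \<le> b n" if "t \<in> param_box" for n t
    using L(2)[OF grid_point_mem[OF that] that, of n] mult_left_mono[OF grid_point_near[of n t] L(1)]
    by (simp add: b_def)
  ultimately show ?thesis by (rule that)
qed

lemma lipschitz_curve_mem: "lipschitz_curve w \<Longrightarrow> t \<in> param_box \<Longrightarrow> w t \<in> elems X"
  by (simp add: lipschitz_curve_def)

lemma lipschitz_curve_strongly_measurable:
  fixes w :: "real^'t::finite \<Rightarrow> 'a \<Rightarrow> real"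
  assumes w: "lipschitz_curve w" shows "strongly_measurable TM X w"
proof -
  obtain b where b: "b \<longlonglongrightarrow> 0" "\<And>n. 0 \<le> b n"
    "\<And>n. simple_into TM X (\<lambda>t. w (grid_point n t))"
    "\<And>n t. t \<in> param_box \<Longrightarrow> fnorm X (\<lambda>x. w (grid_point n t) x - w t x) \<le> b n"
    using lipschitz_curve_grid[OF w] by blast
  have "(\<lambda>n. fnorm X (\<lambda>x. w (grid_point n t) x - w t x)) \<longlonglongrightarrow> 0" if t: "t \<in> param_box" for t
  proof (rule tendsto_sandwich[OF _ _ tendsto_const b(1)])
    have "0 \<le> fnorm X (\<lambda>x. w (grid_point n t) x - w t x)" for n
      by (intro fnorm_nonneg diff_mem lipschitz_curve_mem[OF w] grid_point_mem t)
    then show "\<forall>\<^sub>F n in sequentially. 0 \<le> fnorm X (\<lambda>x. w (grid_point n t) x - w t x)" by simp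
  qed (use b(4)[OF t] in simp)
  then show ?thesis unfolding strongly_measurable_def using b(3) w
    by (intro conjI exI[of _ "\<lambda>n t. w (grid_point n t)"]) (auto intro!: AE_I2 simp: lipschitz_curve_mem)
qed

text \<open>The integrals of the step functions along finer and finer grids form a Cauchy sequence.\<close>

lemma lipschitz_curve_bochner_integral:
  fixes w :: "real^'t::finite \<Rightarrow> 'a \<Rightarrow> real"
  assumes w: "lipschitz_curve w" shows "\<exists>J. has_bochner_integral_in TM X w J"
proof -
  obtain b where b: "b \<longlonglongrightarrow> 0" "\<And>n. 0 \<le> b n"
    "\<And>n. simple_into TM X (\<lambda>t. w (grid_point n t))"
    "\<And>n t. t \<in> param_box \<Longrightarrow> fnorm X (\<lambda>x. w (grid_point n t) x - w t x) \<le> b n"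
    using lipschitz_curve_grid[OF w] by blast
  let ?s = "\<lambda>n t. w (grid_point n t)"
  let ?I = "\<lambda>n. simple_integral TM (?s n)"
  note wm = lipschitz_curve_mem[OF w] lipschitz_curve_mem[OF w grid_point_mem]
  have le: "fnorm X (\<lambda>x. ?I m x - ?I n x) \<le> b m + b n" for m n
  proof (rule fnorm_le_if_dual_le[OF diff_mem[OF simple_integral_mem[OF b(3)] simple_integral_mem[OF b(3)]]])
    fix l assume l: "l \<in> dual_ball X"
    have "l (\<lambda>x. ?I m x - ?I n x) = (LINT t|TM. l (?s m t) - l (?s n t))"
      by (simp add: dual_ball_diff[OF l simple_integral_mem[OF b(3)] simple_integral_mem[OF b(3)]]
          dual_simple_integral[OF b(3) l])
    also have "\<dots> \<le> (LINT t|(TM :: (real^'t) measure). b m + b n)"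
    proof (rule integral_mono)
      fix t assume "t \<in> space (TM :: (real^'t) measure)"
      then have t: "t \<in> param_box" by simp
      have "l (?s m t) - l (?s n t) = l (\<lambda>x. ?s m t x - ?s n t x)"
        using dual_ball_diff[OF l wm(2)[OF t] wm(2)[OF t]] by simp
      also have "\<dots> \<le> fnorm X (\<lambda>x. ?s m t x - ?s n t x)"
        using dual_ball_le[OF l diff_mem[OF wm(2)[OF t] wm(2)[OF t]]] by (rule order_trans[OF abs_ge_self])
      also have "\<dots> \<le> fnorm X (\<lambda>x. ?s m t x - w t x) + fnorm X (\<lambda>x. w t x - ?s n t x)"
        by (rule fnorm_diff_triangle[OF wm(2)[OF t] wm(1)[OF t] wm(2)[OF t]])
      also have "\<dots> \<le> b m + b n"
        using b(4)[OF t] fnorm_diff_commute[OF wm(1)[OF t] wm(2)[OF t], of n] by (intro add_mono) auto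
      finally show "l (?s m t) - l (?s n t) \<le> b m + b n" .
    qed (auto intro: dual_simple_integral[OF b(3) l] TM_integrable_const)
    finally show "l (\<lambda>x. ?I m x - ?I n x) \<le> b m + b n" by (simp only: TM_integral_const)
  qed
  have "\<exists>J\<in>elems X. (\<lambda>n. fnorm X (\<lambda>x. ?I n x - J x)) \<longlonglongrightarrow> 0"
  proof (rule complete)
    fix e :: real assume "0 < e"
    then have "\<forall>\<^sub>F n in sequentially. b n < e / 2" using b(1) by (intro order_tendstoD(2)) auto
    then obtain N where N: "\<And>n. N \<le> n \<Longrightarrow> b n < e / 2" by (auto simp: eventually_sequentially)
    have "fnorm X (\<lambda>x. ?I m x - ?I n x) < e" if "N \<le> m" "N \<le> n" for m n
      using le[of m n] N[OF that(1)] N[OF that(2)] by linarith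
    then show "\<exists>N. \<forall>m\<ge>N. \<forall>n\<ge>N. fnorm X (\<lambda>x. ?I m x - ?I n x) < e" by blast
  qed (rule simple_integral_mem[OF b(3)])
  then obtain J where J: "J \<in> elems X" "(\<lambda>n. fnorm X (\<lambda>x. ?I n x - J x)) \<longlonglongrightarrow> 0" by blast
  have "(\<lambda>n. \<integral>\<^sup>+t. ennreal (fnorm X (\<lambda>x. ?s n t x - w t x)) \<partial>TM) \<longlonglongrightarrow> 0"
  proof (rule tendsto_sandwich[OF _ _ tendsto_const])
    show "\<forall>\<^sub>F n in sequentially. (\<integral>\<^sup>+t. ennreal (fnorm X (\<lambda>x. ?s n t x - w t x)) \<partial>TM) \<le> ennreal (b n)"
    proof (intro always_eventually allI)
      fix n
      have "(\<integral>\<^sup>+t. ennreal (fnorm X (\<lambda>x. ?s n t x - w t x)) \<partial>TM) \<le> (\<integral>\<^sup>+t. ennreal (b n) \<partial>(TM :: (real^'t) measure))"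
        using b(4) by (intro nn_integral_mono ennreal_leI) simp
      then show "(\<integral>\<^sup>+t. ennreal (fnorm X (\<lambda>x. ?s n t x - w t x)) \<partial>TM) \<le> ennreal (b n)"
        by (simp add: emeasure_param_box)
    qed
    show "(\<lambda>n. ennreal (b n)) \<longlonglongrightarrow> 0" using tendsto_ennrealI[OF b(1)] by simp
  qed simp
  then show ?thesis
    unfolding has_bochner_integral_in_def
    by (intro exI[of _ J] exI[of _ ?s] conjI allI b(3) lipschitz_curve_strongly_measurable[OF w] J)
qed

lemma lipschitz_curve_bochner_L2:
  fixes w :: "real^'t::finite \<Rightarrow> 'a \<Rightarrow> real"
  assumes w: "lipschitz_curve w" and K: "\<And>t. t \<in> param_box \<Longrightarrow> fnorm X (w t) \<le> K"
  shows "w \<in> bochner_L2 X" "bochner_L2_norm X w \<le> K"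
proof -
  have s: "strongly_measurable TM X w" by (rule lipschitz_curve_strongly_measurable[OF w])
  have m: "(\<lambda>t. (fnorm X (w t))\<^sup>2) \<in> borel_measurable TM" using strongly_measurable_fnorm[OF s] by simp
  have le: "(fnorm X (w t))\<^sup>2 \<le> K\<^sup>2" if "t \<in> param_box" for t
    using K[OF that] fnorm_nonneg[OF lipschitz_curve_mem[OF w that]] by (rule power_mono)
  have i: "integrable TM (\<lambda>t. (fnorm X (w t))\<^sup>2)"
    by (rule TM_integrable_bounded[OF m, of "K\<^sup>2"]) (use le in \<open>auto intro!: AE_I2\<close>)
  then show "w \<in> bochner_L2 X" using s by (simp add: bochner_L2_def)
  have "(0 :: real^'t) \<in> param_box" by (simp add: param_box_def)
  then have K0: "0 \<le> K" using K fnorm_nonneg[OF lipschitz_curve_mem[OF w]] by (meson order_trans)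
  have "(LINT t|TM. (fnorm X (w t))\<^sup>2) \<le> (LINT t|(TM :: (real^'t) measure). K\<^sup>2)"
    using le by (intro integral_mono i TM_integrable_const) simp
  then show "bochner_L2_norm X w \<le> K"
    unfolding bochner_L2_norm_def TM_integral_const using K0 by (simp add: real_le_lsqrt)
qed

end

section \<open>Test functions on the parameter box\<close>

lemma test_functions_outside: "\<phi> \<in> test_functions V \<Longrightarrow> x \<notin> V \<Longrightarrow> \<phi> x = 0"
  unfolding test_functions_iff by blast

lemma exists_list_with_counts: "\<exists>xs. \<forall>i. count_list xs i = (\<alpha> i :: nat)" for \<alpha> :: "'n::finite \<Rightarrow> nat"
proof -
  have "\<exists>xs. \<forall>i. count_list xs i = (if i \<in> A then \<alpha> i else 0)" if "finite A" for A :: "'n set"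
    using that
  proof induction
    case empty
    show ?case by (rule exI[of _ "[]"]) simp
  next
    case (insert a A)
    then obtain xs where xs: "\<forall>i. count_list xs i = (if i \<in> A then \<alpha> i else 0)" by blast
    have "count_list (replicate n a) i = (if i = a then n else 0)" for n i by (induction n) auto
    then show ?case using xs insert(2) by (intro exI[of _ "replicate (\<alpha> a) a @ xs"]) auto
  qed
  from this[of UNIV] show ?thesis by simp
qed

lemma multi_partial_iter:
  fixes \<alpha> :: "'n::finite \<Rightarrow> nat"
  obtains xs where "length xs = sum \<alpha> UNIV" "\<And>i. count_list xs i = \<alpha> i" "\<And>\<phi>. multi_partial \<alpha> \<phi> = iter_partial xs \<phi>"
proof -
  define xs where "xs = (SOME is. \<forall>i. count_list is i = \<alpha> i)"
  have c: "\<forall>i. count_list xs i = \<alpha> i" unfolding xs_def using exists_list_with_counts by (rule someI_ex)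
  have "sum (count_list xs) UNIV = length xs" by (rule sum_count_set) auto
  then have "length xs = sum \<alpha> UNIV" using ext[of "count_list xs" \<alpha>] c by simp
  then show ?thesis using c by (intro that[of xs]) (auto simp: multi_partial_def xs_def)
qed

lemma test_function_lipschitz:
  fixes \<phi> :: "real^'n::finite \<Rightarrow> real"
  assumes \<phi>: "\<phi> \<in> test_functions V"
  obtains L where "0 \<le> L" "\<And>s t. \<bar>\<phi> s - \<phi> t\<bar> \<le> L * norm (s - t)"
proof -
  have "\<exists>M. 0 \<le> M \<and> (\<forall>x. \<bar>partial_deriv i \<phi> x\<bar> \<le> M)" for i
    using test_functions_bounded[OF test_functions_partial_deriv[OF \<phi>, of i]] by blast
  then obtain M where M: "\<And>i. 0 \<le> M i" "\<And>i x. \<bar>partial_deriv i \<phi> x\<bar> \<le> M i" by metis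
  let ?L = "\<Sum>i\<in>UNIV. M i"
  have "norm (\<phi> s - \<phi> t) \<le> ?L * norm (s - t)" for s t
  proof (rule differentiable_bound[of UNIV \<phi> "\<lambda>x h. \<Sum>i\<in>UNIV. h $ i * partial_deriv i \<phi> x"])
    show "(\<phi> has_derivative (\<lambda>h. \<Sum>i\<in>UNIV. h $ i * partial_deriv i \<phi> x)) (at x within UNIV)" for x
      using has_derivative_partial_derivs[OF smooth_differentiable[OF test_functions_smooth[OF \<phi>]]] by simp
    show "onorm (\<lambda>h. \<Sum>i\<in>UNIV. h $ i * partial_deriv i \<phi> x) \<le> ?L" for x
    proof (rule onorm_bound)
      fix h :: "real^'n"
      have "\<bar>\<Sum>i\<in>UNIV. h $ i * partial_deriv i \<phi> x\<bar> \<le> (\<Sum>i\<in>UNIV. \<bar>h $ i * partial_deriv i \<phi> x\<bar>)" by (rule sum_abs)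
      also have "\<dots> \<le> (\<Sum>i\<in>UNIV. M i * norm h)"
        unfolding abs_mult mult.commute[of _ "norm h"] using M component_le_norm_cart by (intro sum_mono mult_mono) auto
      finally show "norm (\<Sum>i\<in>UNIV. h $ i * partial_deriv i \<phi> x) \<le> ?L * norm h"
        by (simp add: sum_distrib_right)
    qed (use M in \<open>simp add: sum_nonneg\<close>)
  qed auto
  then show ?thesis using that[of ?L] M(1) by (simp add: sum_nonneg)
qed

text \<open>The product of a test function supported in the interior with a function known on the closed box only
becomes a continuous function on the whole space.\<close>

definition extend_zero :: "(real^'t::finite \<Rightarrow> real) \<Rightarrow> real^'t \<Rightarrow> real" where
  "extend_zero h t = (if t \<in> param_box then h t else 0)"

lemma continuous_test_times:
  fixes h :: "real^'t::finite \<Rightarrow> real"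
  assumes \<phi>: "\<phi> \<in> test_functions U" and h: "continuous_on param_box h"
  shows "continuous_on UNIV (\<lambda>t. \<phi> t * extend_zero h t)"
proof -
  obtain K where K: "compact K" "K \<subseteq> U" "\<And>x. x \<notin> K \<Longrightarrow> \<phi> x = 0"
    using test_functions_support[OF \<phi>] by blast
  have "continuous_on (U \<union> - K) (\<lambda>t. \<phi> t * extend_zero h t)"
  proof (rule continuous_on_open_Un)
    have "continuous_on U (\<lambda>t. \<phi> t * h t)"
      by (intro continuous_on_mult smooth_continuous test_functions_smooth[OF \<phi>] continuous_on_subset[OF h U_subset])
    then show "continuous_on U (\<lambda>t. \<phi> t * extend_zero h t)"
      by (rule continuous_on_eq) (use U_subset in \<open>auto simp: extend_zero_def\<close>)
    show "continuous_on (- K) (\<lambda>t. \<phi> t * extend_zero h t)"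
      by (rule continuous_on_eq[OF continuous_on_const[of _ 0]]) (use K in auto)
  qed (use K in \<open>auto simp: compact_imp_closed\<close>)
  moreover have "U \<union> - K = (UNIV :: (real^'t) set)" using K by auto
  ultimately show ?thesis by simp
qed

lemma continuous_box_bounded:
  fixes h :: "real^'t::finite \<Rightarrow> real"
  assumes "continuous_on param_box h"
  obtains M where "0 \<le> M" "\<And>t. t \<in> param_box \<Longrightarrow> \<bar>h t\<bar> \<le> M"
proof -
  have "bounded (h ` param_box)"
    by (rule compact_imp_bounded[OF compact_continuous_image[OF assms]]) (simp add: param_box_cbox)
  then obtain M where "\<And>t. t \<in> param_box \<Longrightarrow> \<bar>h t\<bar> \<le> M" by (auto simp: bounded_iff)
  then have "\<bar>h t\<bar> \<le> max 0 M" if "t \<in> param_box" for t using that by fastforce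
  then show ?thesis using that[of "max 0 M"] by simp
qed

lemma test_times_continuous:
  fixes h :: "real^'t::finite \<Rightarrow> real"
  assumes \<phi>: "\<phi> \<in> test_functions U" and h: "continuous_on param_box h"
  shows "integrable lborel (\<lambda>t. \<phi> t * extend_zero h t)"
    "(LINT t|TM. \<phi> t * h t) = (\<integral>t. \<phi> t * extend_zero h t \<partial>lborel)"
    "\<exists>M. \<forall>t. \<bar>\<phi> t * extend_zero h t\<bar> \<le> M"
proof -
  have c: "continuous_on UNIV (\<lambda>t. \<phi> t * extend_zero h t)" by (rule continuous_test_times[OF assms])
  then have m: "(\<lambda>t. \<phi> t * extend_zero h t) \<in> borel_measurable borel" by (rule borel_measurable_continuous_onI)
  have "integrable lborel (\<lambda>t. indicator param_box t *\<^sub>R (\<phi> t * extend_zero h t))"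
    by (rule borel_integrable_compact) (auto simp: param_box_cbox intro: continuous_on_subset[OF c])
  also have "(\<lambda>t. indicator param_box t *\<^sub>R (\<phi> t * extend_zero h t)) = (\<lambda>t. \<phi> t * extend_zero h t)"
    by (auto simp: fun_eq_iff extend_zero_def indicator_def)
  finally show "integrable lborel (\<lambda>t. \<phi> t * extend_zero h t)" .
  have "(LINT t|TM. \<phi> t * h t) = (LINT t|lebesgue. indicator param_box t * (\<phi> t * h t))"
    by (rule lebesgue_on_integral_indicator) simp
  also have "(\<lambda>t. indicator param_box t * (\<phi> t * h t)) = (\<lambda>t. \<phi> t * extend_zero h t)"
    by (auto simp: fun_eq_iff extend_zero_def indicator_def)
  also have "(LINT t|lebesgue. \<phi> t * extend_zero h t) = (\<integral>t. \<phi> t * extend_zero h t \<partial>lborel)"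
    using m by (intro integral_completion) simp
  finally show "(LINT t|TM. \<phi> t * h t) = (\<integral>t. \<phi> t * extend_zero h t \<partial>lborel)" .
  obtain M1 where M1: "0 \<le> M1" "\<And>x. \<bar>\<phi> x\<bar> \<le> M1" using test_functions_bounded[OF \<phi>] by blast
  obtain M2 where M2: "0 \<le> M2" "\<And>t. t \<in> param_box \<Longrightarrow> \<bar>h t\<bar> \<le> M2" using continuous_box_bounded[OF h] by blast
  have "\<bar>\<phi> t * extend_zero h t\<bar> \<le> M1 * M2" for t
    unfolding abs_mult using M1 M2 by (intro mult_mono) (auto simp: extend_zero_def)
  then show "\<exists>M. \<forall>t. \<bar>\<phi> t * extend_zero h t\<bar> \<le> M" by blast
qed

text \<open>The product \<open>\<psi> h\<close>, extended by zero, has a bounded derivative along the \<open>i\<close>-th axis everywhere although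
\<open>h\<close> is differentiable in the interior only.\<close>

lemma integration_by_parts_box:
  fixes h :: "real^'t::finite \<Rightarrow> real"
  assumes \<psi>: "\<psi> \<in> test_functions U" and h: "continuous_on param_box h" and hi: "continuous_on param_box hi"
    and d: "\<And>t. t \<in> U \<Longrightarrow> ((\<lambda>r. h (t + r *\<^sub>R axis i 1)) has_real_derivative hi t) (at 0)"
  shows "(LINT t|TM. partial_deriv i \<psi> t * h t) = - (LINT t|TM. \<psi> t * hi t)"
proof -
  note d\<psi> = test_functions_partial_deriv[OF \<psi>, of i]
  define p where "p t = \<psi> t * extend_zero h t" for t
  define p' where "p' t = partial_deriv i \<psi> t * extend_zero h t + \<psi> t * extend_zero hi t" for t
  obtain K where K: "compact K" "K \<subseteq> U" "\<And>x. x \<notin> K \<Longrightarrow> \<psi> x = 0"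
    using test_functions_support[OF \<psi>] by blast
  have at0: "((\<lambda>r. p (y + r *\<^sub>R axis i 1)) has_real_derivative p' y) (at 0)" for y
  proof (cases "y \<in> U")
    case True
    have "((\<lambda>r. \<psi> (y + r *\<^sub>R axis i 1) * h (y + r *\<^sub>R axis i 1)) has_real_derivative
        (partial_deriv i \<psi> y * h (y + 0 *\<^sub>R axis i 1) + hi y * \<psi> (y + 0 *\<^sub>R axis i 1))) (at 0)"
      by (rule DERIV_mult[OF directional_derivative_partial[OF smooth_differentiable[OF test_functions_smooth[OF \<psi>]]] d[OF True]])
    then have D: "((\<lambda>r. \<psi> (y + r *\<^sub>R axis i 1) * h (y + r *\<^sub>R axis i 1)) has_real_derivative p' y) (at 0)"
      using True U_subset by (auto simp: p'_def extend_zero_def mult.commute)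
    have "\<forall>\<^sub>F r in nhds 0. y + r *\<^sub>R axis i 1 \<in> U"
    proof -
      have "((\<lambda>r::real. y + r *\<^sub>R axis i 1) \<longlongrightarrow> y + 0 *\<^sub>R axis i 1) (nhds 0)"
        by (intro tendsto_intros filterlim_ident)
      then show ?thesis using True by (intro topological_tendstoD) auto
    qed
    then have ev: "\<forall>\<^sub>F r in nhds 0. \<psi> (y + r *\<^sub>R axis i 1) * h (y + r *\<^sub>R axis i 1) = p (y + r *\<^sub>R axis i 1)"
      by eventually_elim (use U_subset in \<open>auto simp: p_def extend_zero_def\<close>)
    show ?thesis using DERIV_cong_ev[OF refl ev refl] D by simp
  next
    case False
    then have y: "y \<in> - K" using K by auto
    have "\<forall>\<^sub>F r in nhds 0. y + r *\<^sub>R axis i 1 \<in> - K"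
    proof -
      have "((\<lambda>r::real. y + r *\<^sub>R axis i 1) \<longlongrightarrow> y + 0 *\<^sub>R axis i 1) (nhds 0)"
        by (intro tendsto_intros filterlim_ident)
      then show ?thesis using y K by (intro topological_tendstoD) (auto simp: compact_imp_closed open_Compl)
    qed
    then have ev: "\<forall>\<^sub>F r in nhds 0. p (y + r *\<^sub>R axis i 1) = 0"
      by eventually_elim (use K in \<open>auto simp: p_def\<close>)
    have "partial_deriv i \<psi> y = 0"
      using partial_deriv_zero_outside[OF compact_imp_closed[OF K(1)] K(3)] y by simp
    then have "p' y = 0" using K(3)[of y] y by (simp add: p'_def)
    then show ?thesis using DERIV_cong_ev[OF refl ev refl, of 0] by simp
  qed
  obtain M1 where M1: "\<And>t. \<bar>partial_deriv i \<psi> t * extend_zero h t\<bar> \<le> M1" using test_times_continuous(3)[OF d\<psi> h] by blast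
  obtain M2 where M2: "\<And>t. \<bar>\<psi> t * extend_zero hi t\<bar> \<le> M2" using test_times_continuous(3)[OF \<psi> hi] by blast
  have "(\<integral>t. p' t \<partial>lborel) = 0"
  proof (rule integral_directional_derivative_zero[where p = p and e = "axis i 1" and S = K and M = "M1 + M2"])
    show "p \<in> borel_measurable borel"
      unfolding p_def by (intro borel_measurable_continuous_onI continuous_test_times \<psi> h)
    show "integrable lborel p" unfolding p_def by (rule test_times_continuous(1)[OF \<psi> h])
    show "bounded K" by (rule compact_imp_bounded[OF K(1)])
    show "p x = 0" if "x \<notin> K" for x using K(3)[OF that] by (simp add: p_def)
    show "\<bar>p' x\<bar> \<le> M1 + M2" for x using M1[of x] M2[of x] by (simp add: p'_def)
    show "((\<lambda>s. p (x + s *\<^sub>R axis i 1)) has_real_derivative p' (x + s *\<^sub>R axis i 1)) (at s)" for x s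
      using at0[of "x + s *\<^sub>R axis i 1"] DERIV_shift[of "\<lambda>s. p (x + s *\<^sub>R axis i 1)" _ 0 s]
      by (simp add: algebra_simps)
  qed
  then show ?thesis
    unfolding p'_def test_times_continuous(2)[OF d\<psi> h] test_times_continuous(2)[OF \<psi> hi]
    using test_times_continuous(1)[OF d\<psi> h] test_times_continuous(1)[OF \<psi> hi] by simp
qed

section \<open>Uniqueness of weak derivatives in the parameter\<close>

context fspace
begin

text \<open>The exceptional null set depends on the functional.  Countably many functionals suffice, as the simple
approximations of \<open>w\<close> have countably many values altogether.\<close>

lemma dual_zero_imp_AE_zero:
  fixes w :: "real^'t::finite \<Rightarrow> 'a \<Rightarrow> real"
  assumes w: "strongly_measurable TM X w"
    and zero: "\<And>l. l \<in> dual_ball X \<Longrightarrow> AE t in TM. l (w t) = 0"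
  shows "AE t in TM. fnorm X (w t) = 0"
proof -
  obtain s where s: "AE t in TM. w t \<in> elems X" "\<And>n. simple_into TM X (s n)"
    "AE t in TM. (\<lambda>n. fnorm X (\<lambda>x. s n t x - w t x)) \<longlonglongrightarrow> 0" using strongly_measurableE[OF w] by blast
  define S where "S = (\<Union>n. s n ` space (TM :: (real^'t) measure))"
  have cS: "countable S"
    unfolding S_def
  proof (rule countable_UN)
    show "countable (s n ` space (TM :: (real^'t) measure))" for n
      using s(2)[of n] by (intro countable_finite) (simp add: simple_into_def simple_function_def)
  qed simp
  have SX: "y \<in> elems X" if "y \<in> S" for y using that simple_into_mem[OF s(2)] unfolding S_def by blast
  have "\<exists>l\<in>dual_ball X. fnorm X y \<le> l y + 1 / real (Suc k)" if "y \<in> S" for y k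
    using norming[OF SX[OF that], of "1 / real (Suc k)"] by simp
  then obtain l where l: "\<And>y k. y \<in> S \<Longrightarrow> l y k \<in> dual_ball X"
    "\<And>y k. y \<in> S \<Longrightarrow> fnorm X y \<le> l y k y + 1 / real (Suc k)" by metis
  have ae: "AE t in TM. \<forall>y\<in>S. \<forall>k. l y k (w t) = 0"
    using l(1) zero by (subst AE_ball_countable[OF cS]) (auto simp: AE_all_countable)
  show ?thesis
    using s(1,3) ae AE_space
  proof eventually_elim
    case (elim t)
    have "fnorm X (w t) \<le> 0 + 2 * 0 + 0"
    proof (rule LIMSEQ_le_const)
      show "(\<lambda>n. 1 / real (Suc n) + 2 * fnorm X (\<lambda>x. s n t x - w t x) + 0) \<longlonglongrightarrow> 0 + 2 * 0 + 0"
        by (intro tendsto_intros elim LIMSEQ_Suc[OF lim_1_over_n])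
      have "fnorm X (w t) \<le> 1 / real (Suc n) + 2 * fnorm X (\<lambda>x. s n t x - w t x) + 0" for n
      proof -
        let ?y = "s n t"
        have y: "?y \<in> S" unfolding S_def using elim(4) by blast
        note yX = SX[OF y]
        have "l ?y n ?y = l ?y n (\<lambda>x. ?y x - w t x)"
          using dual_ball_diff[OF l(1)[OF y] yX elim(1), of n] elim(3) y by simp
        also have "\<dots> \<le> fnorm X (\<lambda>x. ?y x - w t x)"
          using dual_ball_le[OF l(1)[OF y] diff_mem[OF yX elim(1)], of n] by simp
        finally have "fnorm X ?y \<le> fnorm X (\<lambda>x. ?y x - w t x) + 1 / real (Suc n)" using l(2)[OF y, of n] by simp
        then show ?thesis
          using fnorm_le_diff[OF elim(1) yX] fnorm_diff_commute[OF yX elim(1)] by linarith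
      qed
      then show "\<exists>N. \<forall>n\<ge>N. fnorm X (w t) \<le> 1 / real (Suc n) + 2 * fnorm X (\<lambda>x. s n t x - w t x) + 0" by blast
    qed
    then show ?case using fnorm_nonneg[OF elim(1)] by simp
  qed
qed

text \<open>The function \<open>v\<close> is only known to be strongly measurable after multiplication with a test function \<open>\<eta>\<close>,
which is why the argument is carried out for \<open>\<eta> v\<close> where \<open>\<eta>\<close> does not vanish.  For a functional \<open>l\<close>, the
fundamental lemma applies to \<open>l (\<eta> v) - l (\<eta> v')\<close>.\<close>

lemma bochner_weak_deriv_unique:
  fixes u v v' :: "real^'t::finite \<Rightarrow> 'a \<Rightarrow> real"
  assumes v: "is_bochner_weak_deriv X \<alpha> u v" and v': "is_bochner_weak_deriv X \<alpha> u v'"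
  shows "AE t in TM. v t \<in> elems X \<and> v' t \<in> elems X \<and> fnorm X (\<lambda>x. v t x - v' t x) = 0"
proof (rule AE_TM_if_AE_U, rule AE_on_open_local[OF open_interior])
  fix \<eta> :: "real^'t \<Rightarrow> real" assume \<eta>: "\<eta> \<in> test_functions U"
  have key: "\<exists>I I'. has_bochner_integral_in TM X (\<lambda>t x. \<phi> t * v t x) I \<and>
      has_bochner_integral_in TM X (\<lambda>t x. \<phi> t * v' t x) I' \<and> (\<forall>l\<in>dual_ball X. l I = l I')"
    if \<phi>: "\<phi> \<in> test_functions U" for \<phi> :: "real^'t \<Rightarrow> real"
  proof -
    let ?c = "(-1 :: real) ^ (sum \<alpha> UNIV)"
    obtain J where J: "has_bochner_integral_in TM X (\<lambda>t x. multi_partial \<alpha> \<phi> t * u t x) J"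
      "has_bochner_integral_in TM X (\<lambda>t x. \<phi> t * v t x) (\<lambda>x. ?c * J x)"
      using v \<phi> unfolding is_bochner_weak_deriv_def by blast
    obtain J' where J': "has_bochner_integral_in TM X (\<lambda>t x. multi_partial \<alpha> \<phi> t * u t x) J'"
      "has_bochner_integral_in TM X (\<lambda>t x. \<phi> t * v' t x) (\<lambda>x. ?c * J' x)"
      using v' \<phi> unfolding is_bochner_weak_deriv_def by blast
    have JX: "J \<in> elems X" "J' \<in> elems X" using J(1) J'(1) by (auto simp: has_bochner_integral_in_def)
    have "l (\<lambda>x. ?c * J x) = l (\<lambda>x. ?c * J' x)" if l: "l \<in> dual_ball X" for l
      using bochner_integral_dual(2)[OF J(1) l] bochner_integral_dual(2)[OF J'(1) l]
      by (simp add: dual_ball_cmult[OF l JX(1)] dual_ball_cmult[OF l JX(2)])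
    then show ?thesis using J(2) J'(2) by blast
  qed
  obtain I I' where I: "has_bochner_integral_in TM X (\<lambda>t x. \<eta> t * v t x) I"
      "has_bochner_integral_in TM X (\<lambda>t x. \<eta> t * v' t x) I'" using key[OF \<eta>] by blast
  define w where "w t x = \<eta> t * v t x - \<eta> t * v' t x" for t x
  have s1: "strongly_measurable TM X (\<lambda>t x. \<eta> t * v t x)" "strongly_measurable TM X (\<lambda>t x. \<eta> t * v' t x)"
    using I by (auto simp: has_bochner_integral_in_def)
  have mem: "AE t in TM. (\<lambda>x. \<eta> t * v t x) \<in> elems X \<and> (\<lambda>x. \<eta> t * v' t x) \<in> elems X"
    using s1 by (auto simp: strongly_measurable_def)
  have sw: "strongly_measurable TM X w"
    unfolding w_def[abs_def] by (rule strongly_measurable_diff[OF s1])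
  have "AE t in TM. l (w t) = 0" if l: "l \<in> dual_ball X" for l
  proof -
    define g where "g t = l (\<lambda>x. \<eta> t * v t x) - l (\<lambda>x. \<eta> t * v' t x)" for t
    have ig: "integrable TM g"
      unfolding g_def using bochner_integral_dual(1)[OF I(1) l] bochner_integral_dual(1)[OF I(2) l] by simp
    have "AE t in lebesgue_on U. g t = 0"
    proof (rule fundamental_lemma[OF _ open_interior])
      have "set_integrable lebesgue param_box g"
        using ig by (simp add: set_integrable_def integrable_restrict_space)
      then show "locally_integrable U g"
        unfolding locally_integrable_def using U_subset
        by (auto intro!: set_integrable_subset[of lebesgue param_box g] simp: compact_imp_closed)
      fix \<phi> :: "real^'t \<Rightarrow> real" assume \<phi>: "\<phi> \<in> test_functions U"
      then have m: "(\<lambda>t. \<eta> t * \<phi> t) \<in> test_functions U"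
        by (intro test_functions_mult_smooth \<eta> test_functions_smooth)
      obtain N N' where N: "has_bochner_integral_in TM X (\<lambda>t x. (\<eta> t * \<phi> t) * v t x) N"
          "has_bochner_integral_in TM X (\<lambda>t x. (\<eta> t * \<phi> t) * v' t x) N'" "l N = l N'"
        using key[OF m] l by blast
      have e: "AE t in TM. l (\<lambda>x. (\<eta> t * \<phi> t) * v t x) - l (\<lambda>x. (\<eta> t * \<phi> t) * v' t x) = g t * \<phi> t"
        using mem
      proof eventually_elim
        case (elim t)
        have "l (\<lambda>x. (\<eta> t * \<phi> t) * v t x) = \<phi> t * l (\<lambda>x. \<eta> t * v t x)"
          using dual_ball_cmult[OF l, of "\<lambda>x. \<eta> t * v t x" "\<phi> t"] elim by (simp add: mult_ac)
        moreover have "l (\<lambda>x. (\<eta> t * \<phi> t) * v' t x) = \<phi> t * l (\<lambda>x. \<eta> t * v' t x)"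
          using dual_ball_cmult[OF l, of "\<lambda>x. \<eta> t * v' t x" "\<phi> t"] elim by (simp add: mult_ac)
        ultimately show ?case by (simp add: g_def algebra_simps)
      qed
      have \<phi>m: "\<phi> \<in> borel_measurable TM"
        by (intro measurable_restrict_space1 measurable_completion) (use test_functions_measurable[OF \<phi>] in simp)
      have "(LINT t|TM. g t * \<phi> t) = (LINT t|TM. l (\<lambda>x. (\<eta> t * \<phi> t) * v t x) - l (\<lambda>x. (\<eta> t * \<phi> t) * v' t x))"
        by (rule integral_cong_AE)
           (use e \<phi>m borel_measurable_integrable[OF ig] bochner_integral_dual(1)[OF N(1) l] bochner_integral_dual(1)[OF N(2) l]
            in auto)
      also have "\<dots> = 0"
        using bochner_integral_dual[OF N(1) l] bochner_integral_dual[OF N(2) l] N(3) by simp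
      finally have z: "(LINT t|TM. g t * \<phi> t) = 0" .
      have e2: "indicator U t * (g t * \<phi> t) = indicator param_box t * (g t * \<phi> t)" for t
      proof (cases "t \<in> U")
        case False
        then have "\<phi> t = 0" by (rule test_functions_outside[OF \<phi>])
        then show ?thesis by simp
      qed (use U_subset in \<open>auto simp: indicator_def\<close>)
      have Us: "(U :: (real^'t) set) \<in> sets lebesgue" by simp
      show "(LINT t|lebesgue_on U. g t * \<phi> t) = 0"
        using z unfolding lebesgue_on_integral_indicator[OF Us] lebesgue_on_integral_indicator[OF param_box_sets] e2 .
    qed
    then have "AE t in lebesgue. t \<in> U \<longrightarrow> g t = 0" by (simp add: AE_restrict_space_iff)
    then have "AE t in TM. g t = 0" by (rule AE_TM_if_AE_U)
    with mem show ?thesis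
    proof eventually_elim
      case (elim t)
      then show ?case unfolding w_def g_def using dual_ball_diff[OF l] by simp
    qed
  qed
  then have "AE t in TM. fnorm X (w t) = 0" by (rule dual_zero_imp_AE_zero[OF sw])
  then have "AE t in TM. \<eta> t \<noteq> 0 \<longrightarrow> (v t \<in> elems X \<and> v' t \<in> elems X \<and> fnorm X (\<lambda>x. v t x - v' t x) = 0)"
    using mem
  proof eventually_elim
    case (elim t)
    show ?case
    proof
      assume n: "\<eta> t \<noteq> 0"
      have a: "v t \<in> elems X" "v' t \<in> elems X"
        using cmult_mem[of "\<lambda>x. \<eta> t * v t x" "1 / \<eta> t"] cmult_mem[of "\<lambda>x. \<eta> t * v' t x" "1 / \<eta> t"] elim n by auto
      have "fnorm X (w t) = \<bar>\<eta> t\<bar> * fnorm X (\<lambda>x. v t x - v' t x)"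
        using fnorm_cmult[OF diff_mem[OF a], of "\<eta> t"] by (simp add: w_def[abs_def] right_diff_distrib)
      then show "v t \<in> elems X \<and> v' t \<in> elems X \<and> fnorm X (\<lambda>x. v t x - v' t x) = 0"
        using a elim n by simp
    qed
  qed
  then have "AE t in lebesgue. t \<in> param_box \<longrightarrow> \<eta> t \<noteq> 0 \<longrightarrow>
      (v t \<in> elems X \<and> v' t \<in> elems X \<and> fnorm X (\<lambda>x. v t x - v' t x) = 0)" by (simp add: AE_TM_lebesgue)
  then show "AE t in lebesgue. \<eta> t \<noteq> 0 \<longrightarrow> (v t \<in> elems X \<and> v' t \<in> elems X \<and> fnorm X (\<lambda>x. v t x - v' t x) = 0)"
  proof eventually_elim
    case (elim t)
    have "t \<in> param_box" if "\<eta> t \<noteq> 0" using test_functions_outside[OF \<eta>, of t] that U_subset by blast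
    then show ?case using elim by blast
  qed
qed

lemma bochner_weak_deriv_norm:
  fixes u V :: "real^'t::finite \<Rightarrow> 'a \<Rightarrow> real"
  assumes V: "V \<in> bochner_L2 X" and d: "is_bochner_weak_deriv X \<alpha> u V"
  shows "bochner_L2_norm X (bochner_weak_deriv X \<alpha> u) = bochner_L2_norm X V"
proof -
  have "is_bochner_weak_deriv X \<alpha> u (bochner_weak_deriv X \<alpha> u)"
    unfolding bochner_weak_deriv_def by (rule someI[of "is_bochner_weak_deriv X \<alpha> u", OF d])
  from bochner_weak_deriv_unique[OF this d]
  show ?thesis by (intro bochner_L2_cong_AE(2)[OF V]) auto
qed

lemma is_bochner_weak_deriv_cong:
  fixes u u' v :: "real^'t::finite \<Rightarrow> 'a \<Rightarrow> real"
  assumes d: "is_bochner_weak_deriv X \<alpha> u v"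
    and ae: "AE t in TM. u' t \<in> elems X \<and> u t \<in> elems X \<and> fnorm X (\<lambda>x. u' t x - u t x) = 0"
  shows "is_bochner_weak_deriv X \<alpha> u' v"
  unfolding is_bochner_weak_deriv_def
proof
  fix \<phi> :: "real^'t \<Rightarrow> real" assume \<phi>: "\<phi> \<in> test_functions U"
  obtain J where J: "has_bochner_integral_in TM X (\<lambda>t x. multi_partial \<alpha> \<phi> t * u t x) J"
      "has_bochner_integral_in TM X (\<lambda>t x. \<phi> t * v t x) (\<lambda>x. (-1) ^ (sum \<alpha> UNIV) * J x)"
    using d \<phi> unfolding is_bochner_weak_deriv_def by blast
  have JX: "J \<in> elems X" using J(1) by (simp add: has_bochner_integral_in_def)
  have "has_bochner_integral_in TM X (\<lambda>t x. multi_partial \<alpha> \<phi> t * u' t x) J"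
  proof (rule bochner_integral_cong[OF J(1) _ JX])
    show "AE t in TM. (\<lambda>x. multi_partial \<alpha> \<phi> t * u' t x) \<in> elems X \<and>
        fnorm X (\<lambda>x. multi_partial \<alpha> \<phi> t * u' t x - multi_partial \<alpha> \<phi> t * u t x) = 0"
      using ae
    proof eventually_elim
      case (elim t)
      then show ?case
        using fnorm_cmult[OF diff_mem[of "u' t" "u t"], of "multi_partial \<alpha> \<phi> t"]
        by (auto simp: right_diff_distrib intro: cmult_mem)
    qed
  qed (simp add: fnorm_zero)
  then show "\<exists>J. has_bochner_integral_in TM X (\<lambda>t x. multi_partial \<alpha> \<phi> t * u' t x) J \<and>
      has_bochner_integral_in TM X (\<lambda>t x. \<phi> t * v t x) (\<lambda>x. (-1) ^ (sum \<alpha> UNIV) * J x)"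
    using J(2) by blast
qed

section \<open>Smooth curves\<close>

text \<open>A Taylor expansion of first order whose remainder is quadratic, uniformly on the closed box.  This is
stronger than differentiability, meaningful at the boundary of the box and directly inherited by
solutions of the parametric problem.\<close>

definition has_partials :: "(real^'t::finite \<Rightarrow> 'a \<Rightarrow> real) \<Rightarrow> ('t \<Rightarrow> real^'t \<Rightarrow> 'a \<Rightarrow> real) \<Rightarrow> bool" where
  "has_partials u u' \<longleftrightarrow> (\<exists>L. \<forall>s\<in>param_box. \<forall>t\<in>param_box.
     fnorm X (\<lambda>x. u s x - u t x - (\<Sum>i\<in>UNIV. (s $ i - t $ i) * u' i t x)) \<le> L * (norm (s - t))\<^sup>2)"

text \<open>The constant \<open>K\<close> bounds the curve and its derivatives up to order \<open>n\<close>; the Lipschitz constants and the constants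
in the Taylor remainders are arbitrary.\<close>

primrec smooth_curve :: "nat \<Rightarrow> real \<Rightarrow> (real^'t::finite \<Rightarrow> 'a \<Rightarrow> real) \<Rightarrow> bool" where
  "smooth_curve 0 K u \<longleftrightarrow> lipschitz_curve u \<and> (\<forall>t\<in>param_box. fnorm X (u t) \<le> K)"
| "smooth_curve (Suc n) K u \<longleftrightarrow> lipschitz_curve u \<and> (\<forall>t\<in>param_box. fnorm X (u t) \<le> K) \<and>
     (\<exists>u'. has_partials u u' \<and> (\<forall>i. smooth_curve n K (u' i)))"

lemma smooth_curveD:
  "smooth_curve n K u \<Longrightarrow> lipschitz_curve u" "smooth_curve n K u \<Longrightarrow> t \<in> param_box \<Longrightarrow> fnorm X (u t) \<le> K"
  by (cases n; simp)+

lemma smooth_curve_mono_const: "smooth_curve n K u \<Longrightarrow> K \<le> K' \<Longrightarrow> smooth_curve n K' u"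
  by (induction n arbitrary: u) (auto intro: order_trans)

lemma smooth_curve_Suc: "smooth_curve (Suc n) K u \<Longrightarrow> smooth_curve n K u"
  by (induction n arbitrary: u) auto

lemma lipschitz_curve_dual_continuous:
  assumes "lipschitz_curve u" "l \<in> dual_ball X"
  shows "continuous_on param_box (\<lambda>t. l (u t))"
proof -
  obtain L where L: "0 \<le> L" "\<And>s t. s \<in> param_box \<Longrightarrow> t \<in> param_box \<Longrightarrow> fnorm X (\<lambda>x. u s x - u t x) \<le> L * norm (s - t)"
    and m: "\<And>t. t \<in> param_box \<Longrightarrow> u t \<in> elems X"
    using assms(1) unfolding lipschitz_curve_def by blast
  have "L-lipschitz_on param_box (\<lambda>t. l (u t))"
  proof (rule lipschitz_onI)
    fix s t :: "real^'b" assume st: "s \<in> param_box" "t \<in> param_box"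
    have "\<bar>l (u s) - l (u t)\<bar> \<le> fnorm X (\<lambda>x. u s x - u t x)"
      using dual_ball_le[OF assms(2) diff_mem[OF m[OF st(1)] m[OF st(2)]]]
      by (simp add: dual_ball_diff[OF assms(2) m[OF st(1)] m[OF st(2)]])
    also have "\<dots> \<le> L * norm (s - t)" by (rule L(2)[OF st])
    finally show "dist (l (u s)) (l (u t)) \<le> L * dist s t" by (simp add: dist_norm)
  qed (rule L(1))
  then show ?thesis by (rule lipschitz_on_continuous_on)
qed

lemma partials_line_derivative:
  assumes u: "lipschitz_curve u" and u': "\<And>i. lipschitz_curve (u' i)" and p: "has_partials u u'"
    and l: "l \<in> dual_ball X" and t: "t \<in> U"
  shows "((\<lambda>r. l (u (t + r *\<^sub>R axis i 1))) has_real_derivative l (u' i t)) (at 0)"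
proof -
  obtain L where L: "\<And>s t. s \<in> param_box \<Longrightarrow> t \<in> param_box \<Longrightarrow>
     fnorm X (\<lambda>x. u s x - u t x - (\<Sum>i\<in>UNIV. (s $ i - t $ i) * u' i t x)) \<le> L * (norm (s - t))\<^sup>2"
    using p unfolding has_partials_def by blast
  have tb: "t \<in> param_box" using t U_subset by blast
  have b: "\<bar>l (u (t + r *\<^sub>R axis i 1)) - l (u t) - r * l (u' i t)\<bar> \<le> L * r\<^sup>2"
    if s: "t + r *\<^sub>R axis i 1 \<in> param_box" for r
  proof -
    let ?s = "t + r *\<^sub>R axis i 1"
    have eq: "(\<Sum>j\<in>UNIV. (?s $ j - t $ j) * u' j t x) = r * u' i t x" for x
    proof -
      have "(\<Sum>j\<in>UNIV. (?s $ j - t $ j) * u' j t x) = (\<Sum>j\<in>UNIV. if j = i then r * u' j t x else 0)"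
        by (intro sum.cong refl) (auto simp: axis_def)
      then show ?thesis by simp
    qed
    have m: "u ?s \<in> elems X" "u t \<in> elems X" "u' i t \<in> elems X"
      using lipschitz_curve_mem[OF u] lipschitz_curve_mem[OF u'] s tb by auto
    have d: "(\<lambda>x. u ?s x - u t x - r * u' i t x) \<in> elems X" using m by (intro diff_mem cmult_mem)
    have "l (\<lambda>x. u ?s x - u t x - r * u' i t x) = l (u ?s) - l (u t) - r * l (u' i t)"
      using dual_ball_diff[OF l diff_mem[OF m(1,2)] cmult_mem[OF m(3), of r]] dual_ball_diff[OF l m(1,2)] dual_ball_cmult[OF l m(3)]
      by simp
    then have "\<bar>l (u ?s) - l (u t) - r * l (u' i t)\<bar> \<le> fnorm X (\<lambda>x. u ?s x - u t x - r * u' i t x)"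
      using dual_ball_le[OF l d] by simp
    also have "\<dots> \<le> L * (norm (?s - t))\<^sup>2" using L[OF s tb] by (simp only: eq)
    also have "norm (?s - t) = \<bar>r\<bar>" by (simp add: norm_axis_1)
    finally show ?thesis by simp
  qed
  have "\<forall>\<^sub>F r in at 0. t + r *\<^sub>R axis i 1 \<in> U"
  proof -
    have "((\<lambda>r::real. t + r *\<^sub>R axis i 1) \<longlongrightarrow> t + 0 *\<^sub>R axis i 1) (at 0)" by (intro tendsto_intros)
    then show ?thesis using t by (intro topological_tendstoD) auto
  qed
  then have ev: "\<forall>\<^sub>F r in at 0. \<bar>(l (u (t + r *\<^sub>R axis i 1)) - l (u t)) / r - l (u' i t)\<bar> \<le> \<bar>L\<bar> * \<bar>r\<bar>"
    using eventually_neq_at_within[of 0]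
  proof eventually_elim
    case (elim r)
    have "\<bar>l (u (t + r *\<^sub>R axis i 1)) - l (u t) - r * l (u' i t)\<bar> \<le> L * r\<^sup>2"
      using elim U_subset by (intro b) auto
    also have "\<dots> \<le> \<bar>L\<bar> * \<bar>r\<bar> * \<bar>r\<bar>"
      using mult_right_mono[OF abs_ge_self[of L], of "r\<^sup>2"] by (simp add: power2_eq_square mult.assoc)
    finally have "\<bar>l (u (t + r *\<^sub>R axis i 1)) - l (u t) - r * l (u' i t)\<bar> / \<bar>r\<bar> \<le> \<bar>L\<bar> * \<bar>r\<bar>"
      using elim by (simp add: pos_divide_le_eq)
    moreover have "(l (u (t + r *\<^sub>R axis i 1)) - l (u t)) / r - l (u' i t) = (l (u (t + r *\<^sub>R axis i 1)) - l (u t) - r * l (u' i t)) / r"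
      using elim by (simp add: diff_divide_distrib)
    ultimately show ?case by (simp add: abs_divide)
  qed
  have "((\<lambda>r. (l (u (t + r *\<^sub>R axis i 1)) - l (u t)) / r) \<longlongrightarrow> l (u' i t)) (at 0)"
  proof (rule LIM_zero_cancel, rule tendsto_rabs_zero_cancel, rule tendsto_sandwich[OF _ ev tendsto_const])
    have "((\<lambda>r::real. \<bar>L\<bar> * \<bar>r\<bar>) \<longlongrightarrow> \<bar>L\<bar> * \<bar>0\<bar>) (at 0)" by (intro tendsto_intros)
    then show "((\<lambda>r::real. \<bar>L\<bar> * \<bar>r\<bar>) \<longlongrightarrow> 0) (at 0)" by simp
  qed simp
  then show ?thesis by (simp add: DERIV_def)
qed

text \<open>Repeated integration by parts of \<open>l \<circ> u\<close>.  The derivative \<open>V\<close> is the same for all functionals \<open>l\<close>.\<close>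

lemma smooth_curve_weak_derivative_dual:
  fixes u :: "real^'t::finite \<Rightarrow> 'a \<Rightarrow> real"
  assumes "smooth_curve (length xs + m) K u"
  shows "\<exists>V. smooth_curve m K V \<and> (\<forall>l\<in>dual_ball X. \<forall>\<phi>\<in>test_functions U.
     (LINT t|TM. iter_partial xs \<phi> t * l (u t)) = (-1) ^ length xs * (LINT t|TM. \<phi> t * l (V t)))"
  using assms
proof (induction xs arbitrary: u)
  case Nil
  then show ?case by (intro exI[of _ u]) simp
next
  case (Cons i xs)
  then have u: "smooth_curve (Suc (length xs + m)) K u" by simp
  then obtain u' where p: "has_partials u u'" and u': "\<And>i. smooth_curve (length xs + m) K (u' i)"
    by auto
  obtain V where V: "smooth_curve m K V" "\<And>l \<phi>. l \<in> dual_ball X \<Longrightarrow> \<phi> \<in> test_functions U \<Longrightarrow>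
     (LINT t|TM. iter_partial xs \<phi> t * l (u' i t)) = (-1) ^ length xs * (LINT t|TM. \<phi> t * l (V t))"
    using Cons.IH[OF u'[of i]] by blast
  have "(LINT t|TM. iter_partial (i # xs) \<phi> t * l (u t)) = (-1) ^ length (i # xs) * (LINT t|TM. \<phi> t * l (V t))"
    if l: "l \<in> dual_ball X" and \<phi>: "\<phi> \<in> test_functions U" for l \<phi>
  proof -
    have "(LINT t|TM. partial_deriv i (iter_partial xs \<phi>) t * l (u t)) = - (LINT t|TM. iter_partial xs \<phi> t * l (u' i t))"
      by (rule integration_by_parts_box[OF test_functions_iter_partial[OF \<phi>]
          lipschitz_curve_dual_continuous[OF smooth_curveD(1)[OF u] l]
          lipschitz_curve_dual_continuous[OF smooth_curveD(1)[OF u'] l]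
          partials_line_derivative[OF smooth_curveD(1)[OF u] smooth_curveD(1)[OF u'] p l]])
    then show ?thesis by (simp add: V(2)[OF l \<phi>])
  qed
  then show ?case using V(1) by blast
qed

lemma test_times_lipschitz_curve:
  fixes u :: "real^'t::finite \<Rightarrow> 'a \<Rightarrow> real"
  assumes \<phi>: "\<phi> \<in> test_functions U" and u: "lipschitz_curve u" and K: "\<And>t. t \<in> param_box \<Longrightarrow> fnorm X (u t) \<le> K"
  shows "lipschitz_curve (\<lambda>t x. \<phi> t * u t x)"
proof -
  obtain L where L: "0 \<le> L" "\<And>s t. s \<in> param_box \<Longrightarrow> t \<in> param_box \<Longrightarrow> fnorm X (\<lambda>x. u s x - u t x) \<le> L * norm (s - t)"
    and m: "\<And>t. t \<in> param_box \<Longrightarrow> u t \<in> elems X"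
    using u unfolding lipschitz_curve_def by blast
  obtain L' where L': "0 \<le> L'" "\<And>s t. \<bar>\<phi> s - \<phi> t\<bar> \<le> L' * norm (s - t)" using test_function_lipschitz[OF \<phi>] by blast
  obtain M where M: "0 \<le> M" "\<And>t. \<bar>\<phi> t\<bar> \<le> M" using test_functions_bounded[OF \<phi>] by blast
  have "(0 :: real^'t) \<in> param_box" by (simp add: param_box_def)
  then have K0: "0 \<le> K" using K fnorm_nonneg[OF m] by (meson order_trans)
  have "fnorm X (\<lambda>x. \<phi> s * u s x - \<phi> t * u t x) \<le> (M * L + L' * K) * norm (s - t)"
    if st: "s \<in> param_box" "t \<in> param_box" for s t
  proof -
    have "(\<lambda>x. \<phi> s * u s x - \<phi> t * u t x) = (\<lambda>x. \<phi> s * (u s x - u t x) + (\<phi> s - \<phi> t) * u t x)"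
      by (simp add: fun_eq_iff algebra_simps)
    then have "fnorm X (\<lambda>x. \<phi> s * u s x - \<phi> t * u t x) \<le>
        fnorm X (\<lambda>x. \<phi> s * (u s x - u t x)) + fnorm X (\<lambda>x. (\<phi> s - \<phi> t) * u t x)"
      using fnorm_triangle[OF cmult_mem[OF diff_mem[OF m[OF st(1)] m[OF st(2)]], of "\<phi> s"] cmult_mem[OF m[OF st(2)], of "\<phi> s - \<phi> t"]] by simp
    also have "\<dots> = \<bar>\<phi> s\<bar> * fnorm X (\<lambda>x. u s x - u t x) + \<bar>\<phi> s - \<phi> t\<bar> * fnorm X (u t)"
      using fnorm_cmult[OF diff_mem[OF m[OF st(1)] m[OF st(2)]]] fnorm_cmult[OF m[OF st(2)]] by simp
    also have "\<dots> \<le> M * (L * norm (s - t)) + (L' * norm (s - t)) * K"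
      using M L L' K K0 st fnorm_nonneg m diff_mem by (intro add_mono mult_mono) auto
    finally show ?thesis by (simp add: algebra_simps)
  qed
  moreover have "0 \<le> M * L + L' * K" using M L L' K0 by simp
  ultimately show ?thesis unfolding lipschitz_curve_def using m cmult_mem by blast
qed

text \<open>A Lipschitz curve times a test function is a Lipschitz curve and thus has a Bochner integral.  The two
integrals in question agree up to norm zero as all functionals agree on them.\<close>

lemma bochner_weak_derivI:
  fixes u V :: "real^'t::finite \<Rightarrow> 'a \<Rightarrow> real"
  assumes ul: "lipschitz_curve u" "\<And>t. t \<in> param_box \<Longrightarrow> fnorm X (u t) \<le> K"
    and Vl: "lipschitz_curve V" "\<And>t. t \<in> param_box \<Longrightarrow> fnorm X (V t) \<le> K'"
    and V: "\<And>l \<phi>. l \<in> dual_ball X \<Longrightarrow> \<phi> \<in> test_functions U \<Longrightarrow>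
     (LINT t|TM. multi_partial \<alpha> \<phi> t * l (u t)) = (-1) ^ (sum \<alpha> UNIV) * (LINT t|TM. \<phi> t * l (V t))"
  shows "is_bochner_weak_deriv X \<alpha> u V"
  unfolding is_bochner_weak_deriv_def
proof
  fix \<phi> :: "real^'t \<Rightarrow> real" assume \<phi>: "\<phi> \<in> test_functions U"
  let ?c = "(-1 :: real) ^ (sum \<alpha> UNIV)"
  obtain J where J: "has_bochner_integral_in TM X (\<lambda>t x. multi_partial \<alpha> \<phi> t * u t x) J"
    using lipschitz_curve_bochner_integral[OF test_times_lipschitz_curve[OF test_functions_multi_partial[OF \<phi>] ul]] by blast
  have cu: "lipschitz_curve (\<lambda>t x. \<phi> t * V t x)" by (rule test_times_lipschitz_curve[OF \<phi> Vl])
  obtain J' where J': "has_bochner_integral_in TM X (\<lambda>t x. \<phi> t * V t x) J'"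
    using lipschitz_curve_bochner_integral[OF cu] by blast
  have JX: "J \<in> elems X" "J' \<in> elems X" using J J' by (auto simp: has_bochner_integral_in_def)
  have cJ: "(\<lambda>x. ?c * J x) \<in> elems X" by (rule cmult_mem[OF JX(1)])
  have "fnorm X (\<lambda>x. J' x - ?c * J x) \<le> 0"
  proof (rule fnorm_le_if_dual_le[OF diff_mem[OF JX(2) cJ]])
    fix l assume l: "l \<in> dual_ball X"
    have "(LINT t|TM. l (\<lambda>x. multi_partial \<alpha> \<phi> t * u t x)) = (LINT t|TM. multi_partial \<alpha> \<phi> t * l (u t))"
      by (rule Bochner_Integration.integral_cong[OF refl])
         (simp add: dual_ball_cmult[OF l] lipschitz_curve_mem[OF ul(1)])
    then have a: "l J = ?c * (LINT t|TM. \<phi> t * l (V t))"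
      using bochner_integral_dual(2)[OF J l] V[OF l \<phi>] by simp
    have "(LINT t|TM. l (\<lambda>x. \<phi> t * V t x)) = (LINT t|TM. \<phi> t * l (V t))"
      by (rule Bochner_Integration.integral_cong[OF refl]) (simp add: dual_ball_cmult[OF l] lipschitz_curve_mem[OF Vl(1)])
    then have b: "l J' = (LINT t|TM. \<phi> t * l (V t))" using bochner_integral_dual(2)[OF J' l] by simp
    have "?c * (?c * z) = z" for z :: real
      by (simp flip: mult.assoc power_mult_distrib)
    then have "l J' = ?c * l J" using a b by simp
    then show "l (\<lambda>x. J' x - ?c * J x) \<le> 0"
      using dual_ball_diff[OF l JX(2) cJ] dual_ball_cmult[OF l JX(1), of ?c] by simp
  qed
  then have z: "fnorm X (\<lambda>x. J' x - ?c * J x) = 0" using fnorm_nonneg[OF diff_mem[OF JX(2) cJ]] by simp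
  have "has_bochner_integral_in TM X (\<lambda>t x. \<phi> t * V t x) (\<lambda>x. ?c * J x)"
    by (rule bochner_integral_cong[OF J' _ cJ z])
       (use lipschitz_curve_mem[OF cu] fnorm_zero in \<open>auto intro!: AE_I2\<close>)
  then show "\<exists>J. has_bochner_integral_in TM X (\<lambda>t x. multi_partial \<alpha> \<phi> t * u t x) J \<and>
      has_bochner_integral_in TM X (\<lambda>t x. \<phi> t * V t x) (\<lambda>x. ?c * J x)" using J by blast
qed

theorem smooth_curve_bochner_weak_deriv:
  fixes u :: "real^'t::finite \<Rightarrow> 'a \<Rightarrow> real"
  assumes u: "smooth_curve k K u" and \<alpha>: "\<alpha> \<in> multi_indices k"
  shows "\<exists>V. smooth_curve 0 K V \<and> is_bochner_weak_deriv X \<alpha> u V"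
proof -
  obtain xs where xs: "length xs = sum \<alpha> UNIV" "\<And>\<phi>. multi_partial \<alpha> \<phi> = iter_partial xs \<phi>"
    using multi_partial_iter[of \<alpha>] by metis
  have "length xs \<le> k" using \<alpha> xs by (simp add: multi_indices_def)
  then obtain m where "k = length xs + m" using le_Suc_ex by blast
  then obtain V where Vm: "smooth_curve m K V" and V: "\<And>l \<phi>. l \<in> dual_ball X \<Longrightarrow> \<phi> \<in> test_functions U \<Longrightarrow>
     (LINT t|TM. iter_partial xs \<phi> t * l (u t)) = (-1) ^ length xs * (LINT t|TM. \<phi> t * l (V t))"
    using smooth_curve_weak_derivative_dual[of xs m K u] u by blast
  have "is_bochner_weak_deriv X \<alpha> u V"
    by (rule bochner_weak_derivI[OF smooth_curveD[OF u] smooth_curveD[OF Vm]]) (simp_all add: V xs)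
  then show ?thesis using smooth_curveD[OF Vm] by auto
qed

lemma has_partials_bochner_weak_deriv:
  fixes u :: "real^'t::finite \<Rightarrow> 'a \<Rightarrow> real"
  assumes u: "smooth_curve 0 K u" and u': "\<And>i. smooth_curve 0 K' (u' i)" and p: "has_partials u u'"
  shows "is_bochner_weak_deriv X (unit_index i) u (u' i)"
proof (rule bochner_weak_derivI[OF smooth_curveD[OF u] smooth_curveD[OF u']])
  fix l \<phi> assume l: "l \<in> dual_ball X" and \<phi>: "\<phi> \<in> test_functions (U :: (real^'t) set)"
  have "(LINT t|TM. partial_deriv i \<phi> t * l (u t)) = - (LINT t|TM. \<phi> t * l (u' i t))"
    by (rule integration_by_parts_box[OF \<phi>
        lipschitz_curve_dual_continuous[OF smooth_curveD(1)[OF u] l]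
        lipschitz_curve_dual_continuous[OF smooth_curveD(1)[OF u'] l]
        partials_line_derivative[OF smooth_curveD(1)[OF u] smooth_curveD(1)[OF u'] p l]])
  then show "(LINT t|TM. multi_partial (unit_index i) \<phi> t * l (u t)) = (-1) ^ (sum (unit_index i) UNIV) * (LINT t|TM. \<phi> t * l (u' i t))"
    by (simp add: multi_partial_unit_index sum_unit_index)
qed

lemma bochner_weak_deriv_0:
  fixes W :: "real^'t::finite \<Rightarrow> 'a \<Rightarrow> real"
  assumes W: "smooth_curve k K W" shows "is_bochner_weak_deriv X (\<lambda>_. 0) W W"
proof (rule bochner_weak_derivI[OF smooth_curveD[OF W] smooth_curveD[OF W]])
  fix l and \<phi> :: "real^'t \<Rightarrow> real"
  show "(LINT t|TM. multi_partial (\<lambda>_. 0) \<phi> t * l (W t)) =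
      (-1) ^ (sum (\<lambda>_. 0) (UNIV :: 't set)) * (LINT t|TM. \<phi> t * l (W t))"
    unfolding multi_partial_0 by simp
qed

text \<open>Weak solutions agree with the pointwise solution only almost everywhere and up to functions of
norm zero.\<close>

theorem bochner_Hk_of_smooth_curve:
  fixes u W :: "real^'t::finite \<Rightarrow> 'a \<Rightarrow> real"
  assumes W: "smooth_curve k K W"
    and ae: "AE t in TM. u t \<in> elems X \<and> fnorm X (\<lambda>x. u t x - W t x) = 0"
  shows "u \<in> bochner_Hk k X"
    "\<alpha> \<in> multi_indices k \<Longrightarrow> bochner_L2_norm X (bochner_weak_deriv X \<alpha> u) \<le> K"
    "bochner_L2_norm X (bochner_weak_deriv X (\<lambda>_. 0) u) = bochner_L2_norm X u"
proof -
  have WX: "AE t in TM. W t \<in> elems X" using lipschitz_curve_mem[OF smooth_curveD(1)[OF W]] by (auto intro!: AE_I2)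
  have WL: "W \<in> bochner_L2 X" by (rule lipschitz_curve_bochner_L2[OF smooth_curveD[OF W]])
  note uL = bochner_L2_cong_AE[OF WL ae]
  have ae': "AE t in TM. u t \<in> elems X \<and> W t \<in> elems X \<and> fnorm X (\<lambda>x. u t x - W t x) = 0"
    using ae WX by eventually_elim simp
  have V: "\<exists>V\<in>bochner_L2 X. is_bochner_weak_deriv X \<alpha> u V \<and> bochner_L2_norm X V \<le> K" if \<alpha>: "\<alpha> \<in> multi_indices k" for \<alpha>
  proof -
    obtain V where V: "smooth_curve 0 K V" "is_bochner_weak_deriv X \<alpha> W V"
      using smooth_curve_bochner_weak_deriv[OF W \<alpha>] by blast
    show ?thesis
      using lipschitz_curve_bochner_L2[OF smooth_curveD[OF V(1)]] is_bochner_weak_deriv_cong[OF V(2) ae'] by blast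
  qed
  then show "u \<in> bochner_Hk k X" using uL(1) by (auto simp: bochner_Hk_def)
  show "bochner_L2_norm X (bochner_weak_deriv X \<alpha> u) \<le> K" if "\<alpha> \<in> multi_indices k"
    using V[OF that] bochner_weak_deriv_norm by metis
  from is_bochner_weak_deriv_cong[OF bochner_weak_deriv_0[OF W] ae'] bochner_weak_deriv_norm[OF WL]
  show "bochner_L2_norm X (bochner_weak_deriv X (\<lambda>_. 0) u) = bochner_L2_norm X u" using uL(2) by simp
qed

end

section \<open>Operations on smooth curves\<close>

context fspace
begin

lemma lipschitz_curve_diff:
  assumes "lipschitz_curve u" "lipschitz_curve v"
  shows "lipschitz_curve (\<lambda>t x. u t x - v t x)"
proof -
  obtain L where L: "0 \<le> L" "\<And>s t. s \<in> param_box \<Longrightarrow> t \<in> param_box \<Longrightarrow> fnorm X (\<lambda>x. u s x - u t x) \<le> L * norm (s - t)"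
    and u: "\<And>t. t \<in> param_box \<Longrightarrow> u t \<in> elems X" using assms(1) unfolding lipschitz_curve_def by blast
  obtain L' where L': "0 \<le> L'" "\<And>s t. s \<in> param_box \<Longrightarrow> t \<in> param_box \<Longrightarrow> fnorm X (\<lambda>x. v s x - v t x) \<le> L' * norm (s - t)"
    and v: "\<And>t. t \<in> param_box \<Longrightarrow> v t \<in> elems X" using assms(2) unfolding lipschitz_curve_def by blast
  have "fnorm X (\<lambda>x. (u s x - v s x) - (u t x - v t x)) \<le> (L + L') * norm (s - t)"
    if st: "s \<in> param_box" "t \<in> param_box" for s t
  proof -
    have "(\<lambda>x. (u s x - v s x) - (u t x - v t x)) = (\<lambda>x. (u s x - u t x) - (v s x - v t x))"
      by (simp add: fun_eq_iff)
    then have "fnorm X (\<lambda>x. (u s x - v s x) - (u t x - v t x)) \<le> fnorm X (\<lambda>x. u s x - u t x) + fnorm X (\<lambda>x. v s x - v t x)"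
      using fnorm_triangle_diff[OF diff_mem[OF u[OF st(1)] u[OF st(2)]] diff_mem[OF v[OF st(1)] v[OF st(2)]]] by simp
    also have "\<dots> \<le> L * norm (s - t) + L' * norm (s - t)" by (rule add_mono[OF L(2)[OF st] L'(2)[OF st]])
    finally show ?thesis by (simp add: distrib_right)
  qed
  moreover have "0 \<le> L + L'" using L L' by simp
  ultimately show ?thesis unfolding lipschitz_curve_def using diff_mem[OF u v] by blast
qed

lemma has_partials_diff:
  assumes "lipschitz_curve u" "lipschitz_curve v" "\<And>i. lipschitz_curve (u' i)" "\<And>i. lipschitz_curve (v' i)"
    "has_partials u u'" "has_partials v v'"
  shows "has_partials (\<lambda>t x. u t x - v t x) (\<lambda>i t x. u' i t x - v' i t x)"
proof -
  obtain L where L: "\<And>s t. s \<in> param_box \<Longrightarrow> t \<in> param_box \<Longrightarrow>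
     fnorm X (\<lambda>x. u s x - u t x - (\<Sum>i\<in>UNIV. (s $ i - t $ i) * u' i t x)) \<le> L * (norm (s - t))\<^sup>2"
    using assms(5) unfolding has_partials_def by blast
  obtain L' where L': "\<And>s t. s \<in> param_box \<Longrightarrow> t \<in> param_box \<Longrightarrow>
     fnorm X (\<lambda>x. v s x - v t x - (\<Sum>i\<in>UNIV. (s $ i - t $ i) * v' i t x)) \<le> L' * (norm (s - t))\<^sup>2"
    using assms(6) unfolding has_partials_def by blast
  note m = assms(1-4)[THEN lipschitz_curve_mem]
  have "fnorm X (\<lambda>x. (u s x - v s x) - (u t x - v t x) - (\<Sum>i\<in>UNIV. (s $ i - t $ i) * (u' i t x - v' i t x)))
      \<le> (L + L') * (norm (s - t))\<^sup>2" if st: "s \<in> param_box" "t \<in> param_box" for s t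
  proof -
    let ?a = "\<lambda>x. u s x - u t x - (\<Sum>i\<in>UNIV. (s $ i - t $ i) * u' i t x)"
    let ?b = "\<lambda>x. v s x - v t x - (\<Sum>i\<in>UNIV. (s $ i - t $ i) * v' i t x)"
    have "?a \<in> elems X" "?b \<in> elems X" by (intro diff_mem sum_mem cmult_mem m st)+
    then have "fnorm X (\<lambda>x. ?a x - ?b x) \<le> fnorm X ?a + fnorm X ?b" by (rule fnorm_triangle_diff)
    also have "(\<lambda>x. ?a x - ?b x) = (\<lambda>x. (u s x - v s x) - (u t x - v t x) - (\<Sum>i\<in>UNIV. (s $ i - t $ i) * (u' i t x - v' i t x)))"
      by (simp add: fun_eq_iff right_diff_distrib sum_subtractf)
    also have "fnorm X ?a + fnorm X ?b \<le> L * (norm (s - t))\<^sup>2 + L' * (norm (s - t))\<^sup>2"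
      by (rule add_mono[OF L[OF st] L'[OF st]])
    finally show ?thesis by (simp add: distrib_right)
  qed
  then show ?thesis unfolding has_partials_def by blast
qed

lemma smooth_curve_diff:
  "smooth_curve n K u \<Longrightarrow> smooth_curve n K' v \<Longrightarrow> smooth_curve n (K + K') (\<lambda>t x. u t x - v t x)"
proof (induction n arbitrary: u v)
  case 0
  have "fnorm X (\<lambda>x. u t x - v t x) \<le> K + K'" if "t \<in> param_box" for t
    using fnorm_triangle_diff[OF lipschitz_curve_mem[OF smooth_curveD(1)[OF 0(1)] that] lipschitz_curve_mem[OF smooth_curveD(1)[OF 0(2)] that]]
      smooth_curveD(2)[OF 0(1) that] smooth_curveD(2)[OF 0(2) that] by linarith
  then show ?case using lipschitz_curve_diff[of u v] 0 by simp
next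
  case (Suc n)
  obtain u' where u': "has_partials u u'" "\<And>i. smooth_curve n K (u' i)" using Suc.prems(1) by auto
  obtain v' where v': "has_partials v v'" "\<And>i. smooth_curve n K' (v' i)" using Suc.prems(2) by auto
  note l = smooth_curveD(1)[OF Suc.prems(1)] smooth_curveD(1)[OF Suc.prems(2)]
  have "has_partials (\<lambda>t x. u t x - v t x) (\<lambda>i t x. u' i t x - v' i t x)"
    using smooth_curveD(1)[OF u'(2)] smooth_curveD(1)[OF v'(2)] by (intro has_partials_diff l u' v')
  moreover have "smooth_curve n (K + K') (\<lambda>t x. u' i t x - v' i t x)" for i by (rule Suc.IH[OF u'(2) v'(2)])
  moreover have "fnorm X (\<lambda>x. u t x - v t x) \<le> K + K'" if "t \<in> param_box" for t
    using fnorm_triangle_diff[OF lipschitz_curve_mem[OF l(1) that] lipschitz_curve_mem[OF l(2) that]]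
      smooth_curveD(2)[OF Suc.prems(1) that] smooth_curveD(2)[OF Suc.prems(2) that] by linarith
  ultimately show ?case unfolding smooth_curve.simps(2) using lipschitz_curve_diff[OF l] by blast
qed

lemma smooth_curve_const:
  assumes a: "a \<in> elems X" shows "smooth_curve n (fnorm X a) (\<lambda>t. a)"
proof -
  have l: "lipschitz_curve (\<lambda>t. b)" if "b \<in> elems X" for b
    unfolding lipschitz_curve_def using that by (auto simp: fnorm_zero intro!: exI[of _ 0])
  have p: "has_partials (\<lambda>t. b) (\<lambda>i t x. 0)" for b
    unfolding has_partials_def by (auto simp: fnorm_zero intro!: exI[of _ 0])
  have z: "smooth_curve n K (\<lambda>t x. 0)" if "0 \<le> K" for n K
  proof (induction n)
    case (Suc n)
    then show ?case using l[OF zero_mem] p[of "\<lambda>x. 0"] that by (auto simp: fnorm_zero intro!: exI[of _ "\<lambda>i t x. 0"])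
  qed (use l[OF zero_mem] that in \<open>simp add: fnorm_zero\<close>)
  show ?thesis
  proof (cases n)
    case (Suc m)
    then show ?thesis using l[OF a] p[of a] z[OF fnorm_nonneg[OF a]] by (auto intro!: exI[of _ "\<lambda>i t x. 0"])
  qed (use l[OF a] in simp)
qed

definition affine_bound :: "('a \<Rightarrow> real) \<Rightarrow> ('t::finite \<Rightarrow> 'a \<Rightarrow> real) \<Rightarrow> real" where
  "affine_bound a0 a = fnorm X a0 + (\<Sum>i\<in>UNIV. fnorm X (a i))"

lemma affine_bound_ge:
  assumes "a0 \<in> elems X" "range a \<subseteq> elems X"
  shows "fnorm X (a i) \<le> affine_bound a0 a" "0 \<le> affine_bound a0 a"
proof -
  have ai: "a i \<in> elems X" for i using assms(2) by blast
  have "fnorm X (a i) \<le> (\<Sum>i\<in>UNIV. fnorm X (a i))"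
    by (rule member_le_sum) (auto intro: fnorm_nonneg ai)
  then show "fnorm X (a i) \<le> affine_bound a0 a" using fnorm_nonneg[OF assms(1)] by (simp add: affine_bound_def)
  then show "0 \<le> affine_bound a0 a" using fnorm_nonneg[OF ai[of i]] by linarith
qed

lemma affine_param_mem:
  assumes "a0 \<in> elems X" "range a \<subseteq> elems X" shows "affine_param a0 a t \<in> elems X"
  unfolding affine_param_def by (intro add_mem sum_mem cmult_mem assms) (use assms in blast)

lemma affine_param_le:
  assumes a: "a0 \<in> elems X" "range a \<subseteq> elems X" and t: "t \<in> param_box"
  shows "fnorm X (affine_param a0 a t) \<le> affine_bound a0 a"
    "fnorm X a0 \<le> fnorm X (affine_param a0 a t) + (\<Sum>i\<in>UNIV. fnorm X (a i))"
proof -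
  have ai: "a i \<in> elems X" for i using a(2) by blast
  let ?s = "\<lambda>y. \<Sum>i\<in>UNIV. t $ i * a i y"
  have s: "?s \<in> elems X" by (intro sum_mem cmult_mem ai)
  have "fnorm X ?s \<le> (\<Sum>i\<in>UNIV. fnorm X (\<lambda>y. t $ i * a i y))" by (intro fnorm_sum_le cmult_mem ai)
  also have "\<dots> \<le> (\<Sum>i\<in>UNIV. fnorm X (a i))"
  proof (rule sum_mono)
    fix i
    have "\<bar>t $ i\<bar> \<le> 1" using t by (auto simp: param_box_def)
    then show "fnorm X (\<lambda>y. t $ i * a i y) \<le> fnorm X (a i)"
      using mult_right_mono[of "\<bar>t $ i\<bar>" 1 "fnorm X (a i)"] fnorm_nonneg[OF ai] by (simp add: fnorm_cmult[OF ai])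
  qed
  finally have le: "fnorm X ?s \<le> (\<Sum>i\<in>UNIV. fnorm X (a i))" .
  show "fnorm X (affine_param a0 a t) \<le> affine_bound a0 a"
    unfolding affine_param_def affine_bound_def using fnorm_triangle[OF a(1) s] le by linarith
  show "fnorm X a0 \<le> fnorm X (affine_param a0 a t) + (\<Sum>i\<in>UNIV. fnorm X (a i))"
    using fnorm_triangle_diff[OF affine_param_mem[OF a, of t] s] le by (simp add: affine_param_def)
qed

lemma affine_param_partials:
  assumes a: "a0 \<in> elems X" "range a \<subseteq> elems X"
  shows "lipschitz_curve (affine_param a0 a)" "has_partials (affine_param a0 a) (\<lambda>i t. a i)"
proof -
  have ai: "a i \<in> elems X" for i using a(2) by blast
  have d: "affine_param a0 a s x - affine_param a0 a t x = (\<Sum>i\<in>UNIV. (s $ i - t $ i) * a i x)" for s t x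
    by (simp add: affine_param_def left_diff_distrib sum_subtractf)
  show "has_partials (affine_param a0 a) (\<lambda>i t. a i)"
    unfolding has_partials_def d by (auto simp: fnorm_zero intro!: exI[of _ 0])
  have "fnorm X (\<lambda>x. affine_param a0 a s x - affine_param a0 a t x) \<le> (\<Sum>i\<in>UNIV. fnorm X (a i)) * norm (s - t)" for s t
  proof -
    have "fnorm X (\<lambda>x. \<Sum>i\<in>UNIV. (s $ i - t $ i) * a i x) \<le> (\<Sum>i\<in>UNIV. fnorm X (\<lambda>x. (s $ i - t $ i) * a i x))"
      by (intro fnorm_sum_le cmult_mem ai)
    also have "\<dots> \<le> (\<Sum>i\<in>UNIV. fnorm X (a i) * norm (s - t))"
    proof (rule sum_mono)
      fix i
      have "\<bar>s $ i - t $ i\<bar> \<le> norm (s - t)" using component_le_norm_cart[of "s - t" i] by simp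
      then show "fnorm X (\<lambda>x. (s $ i - t $ i) * a i x) \<le> fnorm X (a i) * norm (s - t)"
        unfolding fnorm_cmult[OF ai] mult.commute[of "\<bar>s $ i - t $ i\<bar>"]
        by (rule mult_left_mono[OF _ fnorm_nonneg[OF ai]])
    qed
    finally show ?thesis unfolding d by (simp add: sum_distrib_right)
  qed
  moreover have "0 \<le> (\<Sum>i\<in>UNIV. fnorm X (a i))" by (intro sum_nonneg fnorm_nonneg ai)
  ultimately show "lipschitz_curve (affine_param a0 a)"
    unfolding lipschitz_curve_def using affine_param_mem[OF a] by blast
qed

lemma smooth_curve_affine_param:
  assumes a: "a0 \<in> elems X" "range a \<subseteq> elems X"
  shows "smooth_curve n (affine_bound a0 a) (affine_param a0 a)"
proof (cases n)
  case 0
  then show ?thesis using affine_param_partials[OF a] affine_param_le[OF a] by simp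
next
  case (Suc m)
  have ai: "a i \<in> elems X" for i using a(2) by blast
  have "smooth_curve m (affine_bound a0 a) (\<lambda>t. a i)" for i
    by (rule smooth_curve_mono_const[OF smooth_curve_const[OF ai] affine_bound_ge(1)[OF a]])
  then show ?thesis using Suc affine_param_partials[OF a] affine_param_le[OF a] by auto
qed

text \<open>The \<open>i\<close>-th derivative of an affine curve is its coefficient \<open>a i\<close>, whose norm is its \<open>L\<^sup>2\<close> norm as the box has
volume one.  The coefficient \<open>a0\<close> differs from the value of the curve at \<open>t\<close> by at most the sum of the other
norms, hence the factor two.\<close>

lemma affine_bound_le_deriv_sum:
  fixes g :: "real^'t::finite \<Rightarrow> 'a \<Rightarrow> real"
  assumes a: "a0 \<in> elems X" "range a \<subseteq> elems X"
    and ae: "AE t in TM. g t \<in> elems X \<and> fnorm X (\<lambda>x. g t x - affine_param a0 a t x) = 0"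
  shows "affine_bound a0 a \<le> 2 * bochner_deriv_sum 1 X g"
    "bochner_L2_norm X (affine_param a0 a) = bochner_deriv_sum 0 X g"
    "0 \<le> bochner_deriv_sum j X g"
proof -
  have ai: "a i \<in> elems X" for i using a(2) by blast
  let ?F = "affine_param a0 a"
  have F: "smooth_curve 0 (affine_bound a0 a) ?F" by (rule smooth_curve_affine_param[OF a])
  have ae': "AE t in TM. g t \<in> elems X \<and> ?F t \<in> elems X \<and> fnorm X (\<lambda>x. g t x - ?F t x) = 0"
    using ae by eventually_elim (simp add: affine_param_mem[OF a])
  have FL: "?F \<in> bochner_L2 X" by (rule lipschitz_curve_bochner_L2[OF smooth_curveD[OF F]])
  have n0: "bochner_L2_norm X (bochner_weak_deriv X (\<lambda>_. 0) g) = bochner_L2_norm X ?F"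
    by (rule bochner_weak_deriv_norm[OF FL is_bochner_weak_deriv_cong[OF bochner_weak_deriv_0[OF F] ae']])
  have n1: "bochner_L2_norm X (bochner_weak_deriv X (unit_index i) g) = fnorm X (a i)" for i
  proof -
    have c: "smooth_curve 0 (affine_bound a0 a) (\<lambda>t. a i)" for i
      by (rule smooth_curve_mono_const[OF smooth_curve_const[OF ai] affine_bound_ge(1)[OF a]])
    have "is_bochner_weak_deriv X (unit_index i) ?F (\<lambda>t. a i)"
      using has_partials_bochner_weak_deriv[OF F c affine_param_partials(2)[OF a]] by simp
    then have "bochner_L2_norm X (bochner_weak_deriv X (unit_index i) g) = bochner_L2_norm X (\<lambda>t :: real^'t. a i)"
      by (intro bochner_weak_deriv_norm lipschitz_curve_bochner_L2(1)[OF smooth_curveD[OF c]] is_bochner_weak_deriv_cong[OF _ ae'])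
    also have "\<dots> = fnorm X (a i)"
      unfolding bochner_L2_norm_def TM_integral_const using fnorm_nonneg[OF ai] by simp
    finally show ?thesis .
  qed
  have m0: "(multi_indices 0 :: ('t \<Rightarrow> nat) set) = {\<lambda>_. 0}"
    by (auto simp: multi_indices_def)
  show "bochner_L2_norm X ?F = bochner_deriv_sum 0 X g"
    unfolding bochner_deriv_sum_def m0 by (simp add: n0)
  show "0 \<le> bochner_deriv_sum j X g"
    unfolding bochner_deriv_sum_def bochner_L2_norm_def by (intro sum_nonneg) simp
  have nz: "(\<lambda>_. 0) \<notin> range (unit_index :: 't \<Rightarrow> _)"
    by (auto simp: unit_index_def fun_eq_iff split: if_splits)
  have sum1: "bochner_deriv_sum 1 X g = bochner_L2_norm X ?F + (\<Sum>i\<in>UNIV. fnorm X (a i))"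
    unfolding bochner_deriv_sum_def multi_indices_1 using nz by (simp add: n0 n1 sum.reindex inj_unit_index)
  have F0: "0 \<le> bochner_L2_norm X ?F" by (simp add: bochner_L2_norm_def)
  have "fnorm X a0 - (\<Sum>i\<in>UNIV. fnorm X (a i)) \<le> bochner_L2_norm X ?F"
  proof (cases "fnorm X a0 \<le> (\<Sum>i\<in>UNIV. fnorm X (a i))")
    case True
    then show ?thesis using F0 by linarith
  next
    case False
    let ?d = "fnorm X a0 - (\<Sum>i\<in>UNIV. fnorm X (a i))"
    have "(LINT t|(TM :: (real^'t) measure). ?d\<^sup>2) \<le> (LINT t|TM. (fnorm X (?F t))\<^sup>2)"
    proof (rule integral_mono)
      show "integrable TM (\<lambda>t. (fnorm X (?F t))\<^sup>2)" using FL by (simp add: bochner_L2_def)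
      fix t :: "real^'t" assume "t \<in> space TM"
      then have "?d \<le> fnorm X (?F t)" using affine_param_le(2)[OF a, of t] by simp
      then show "?d\<^sup>2 \<le> (fnorm X (?F t))\<^sup>2" using False by (intro power_mono) auto
    qed (rule TM_integrable_const)
    then have "sqrt (?d\<^sup>2) \<le> bochner_L2_norm X ?F"
      unfolding bochner_L2_norm_def TM_integral_const by (rule real_sqrt_le_mono)
    then show ?thesis using False by simp
  qed
  then show "affine_bound a0 a \<le> 2 * bochner_deriv_sum 1 X g"
    unfolding sum1 affine_bound_def using F0 by simp
qed

end

section \<open>Parametric solution operators\<close>

text \<open>The relation \<open>S t y w\<close> stands for \<open>A(t) w = y\<close>, where solutions are unique up to norm zero only.  The
assumption \<open>S_shift\<close> says that \<open>A(s) w = A(t) w + (\<Sum>i. (s\<^sub>i - t\<^sub>i) Mul i w)\<close>.\<close>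

locale param_solver = X: fspace X + Y: fspace Y for X :: "'a fun_space" and Y :: "'b fun_space" +
  fixes S :: "real^'t::finite \<Rightarrow> ('b \<Rightarrow> real) \<Rightarrow> ('a \<Rightarrow> real) \<Rightarrow> bool"
    and Mul :: "'t \<Rightarrow> ('a \<Rightarrow> real) \<Rightarrow> 'b \<Rightarrow> real" and C C' :: real
  assumes C_nonneg: "0 \<le> C" and C'_nonneg: "0 \<le> C'"
    and S_mem: "t \<in> param_box \<Longrightarrow> S t y w \<Longrightarrow> w \<in> elems X"
    and S_add: "t \<in> param_box \<Longrightarrow> S t y w \<Longrightarrow> S t z v \<Longrightarrow> S t (\<lambda>x. y x + z x) (\<lambda>x. w x + v x)"
    and S_cmult: "t \<in> param_box \<Longrightarrow> S t y w \<Longrightarrow> S t (\<lambda>x. c * y x) (\<lambda>x. c * w x)"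
    and S_bound: "t \<in> param_box \<Longrightarrow> S t y w \<Longrightarrow> fnorm X w \<le> C * fnorm Y y"
    and S_ex: "t \<in> param_box \<Longrightarrow> y \<in> elems Y \<Longrightarrow> \<exists>w. S t y w"
    and S_shift: "s \<in> param_box \<Longrightarrow> t \<in> param_box \<Longrightarrow> S t y w \<Longrightarrow>
      S s (\<lambda>x. y x + (\<Sum>i\<in>UNIV. (s $ i - t $ i) * Mul i w x)) w"
    and Mul_mem: "w \<in> elems X \<Longrightarrow> Mul i w \<in> elems Y"
    and Mul_add: "v \<in> elems X \<Longrightarrow> w \<in> elems X \<Longrightarrow> Mul i (\<lambda>x. v x + w x) = (\<lambda>x. Mul i v x + Mul i w x)"
    and Mul_cmult: "w \<in> elems X \<Longrightarrow> Mul i (\<lambda>x. c * w x) = (\<lambda>x. c * Mul i w x)"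
    and Mul_bound: "w \<in> elems X \<Longrightarrow> fnorm Y (Mul i w) \<le> C' * fnorm X w"
begin

lemma S_diff: "t \<in> param_box \<Longrightarrow> S t y w \<Longrightarrow> S t z v \<Longrightarrow> S t (\<lambda>x. y x - z x) (\<lambda>x. w x - v x)"
  using S_add[of t y w "\<lambda>x. (- 1) * z x" "\<lambda>x. (- 1) * v x"] S_cmult[of t z v "- 1"] by simp

lemma S_sum:
  assumes "t \<in> param_box" "finite I" "I \<noteq> {}" "\<And>i. i \<in> I \<Longrightarrow> S t (y i) (w i)"
  shows "S t (\<lambda>x. \<Sum>i\<in>I. y i x) (\<lambda>x. \<Sum>i\<in>I. w i x)"
  using assms(2-4) by (induction rule: finite_ne_induct) (auto intro: S_add[OF assms(1)])

lemma S_unique: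
  assumes "t \<in> param_box" "y \<in> elems Y" "S t y w" "S t y v" shows "fnorm X (\<lambda>x. w x - v x) = 0"
proof -
  have "fnorm X (\<lambda>x. w x - v x) \<le> C * fnorm Y (\<lambda>x. y x - y x)" by (rule S_bound[OF assms(1) S_diff[OF assms(1,3,4)]])
  then have "fnorm X (\<lambda>x. w x - v x) \<le> 0" by (simp add: Y.fnorm_zero)
  then show ?thesis using X.fnorm_nonneg[OF X.diff_mem[OF S_mem[OF assms(1,3)] S_mem[OF assms(1,4)]]] by simp
qed

lemma Mul_diff: "v \<in> elems X \<Longrightarrow> w \<in> elems X \<Longrightarrow> Mul i (\<lambda>x. v x - w x) = (\<lambda>x. Mul i v x - Mul i w x)"
  using Mul_add[of v "\<lambda>x. (- 1) * w x" i] Mul_cmult[of w i "- 1"] X.cmult_mem[of w "- 1"] by simp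

lemma Mul_zero: "Mul i (\<lambda>x. 0) = (\<lambda>x. 0)"
  using Mul_cmult[OF X.zero_mem, of i 0] by simp

lemma Mul_sum:
  "(\<And>j. j \<in> I \<Longrightarrow> w j \<in> elems X) \<Longrightarrow> Mul i (\<lambda>x. \<Sum>j\<in>I. w j x) = (\<lambda>x. \<Sum>j\<in>I. Mul i (w j) x)"
proof (induction I rule: infinite_finite_induct)
  case (insert j I)
  then have "Mul i (\<lambda>x. w j x + (\<Sum>j\<in>I. w j x)) = (\<lambda>x. Mul i (w j) x + Mul i (\<lambda>x. \<Sum>j\<in>I. w j x) x)"
    by (intro Mul_add X.sum_mem) auto
  with insert show ?case by simp
qed (auto simp: Mul_zero)

lemma smooth_curve_Mul:
  "X.smooth_curve n K W \<Longrightarrow> Y.smooth_curve n (C' * K) (\<lambda>t. Mul i (W t))"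
proof (induction n arbitrary: W)
  case (0 W)
  note m = X.lipschitz_curve_mem[OF X.smooth_curveD(1)[OF 0]]
  have b: "fnorm Y (Mul i (W t)) \<le> C' * K" if "t \<in> param_box" for t
    using Mul_bound[OF m[OF that], of i] mult_left_mono[OF X.smooth_curveD(2)[OF 0 that] C'_nonneg] by linarith
  obtain L where L: "0 \<le> L" "\<And>s t. s \<in> param_box \<Longrightarrow> t \<in> param_box \<Longrightarrow> fnorm X (\<lambda>x. W s x - W t x) \<le> L * norm (s - t)"
    using X.smooth_curveD(1)[OF 0] unfolding X.lipschitz_curve_def by blast
  have "fnorm Y (\<lambda>x. Mul i (W s) x - Mul i (W t) x) \<le> C' * L * norm (s - t)" if st: "s \<in> param_box" "t \<in> param_box" for s t
    using Mul_bound[OF X.diff_mem[OF m[OF st(1)] m[OF st(2)]], of i] mult_left_mono[OF L(2)[OF st] C'_nonneg]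
    by (simp add: Mul_diff m st mult.assoc)
  moreover have "0 \<le> C' * L" using C'_nonneg L by simp
  ultimately have "Y.lipschitz_curve (\<lambda>t. Mul i (W t))" unfolding Y.lipschitz_curve_def using m Mul_mem by blast
  then show ?case using b by simp
next
  case (Suc n W)
  have l: "Y.lipschitz_curve (\<lambda>t. Mul i (W t))" "\<forall>t\<in>param_box. fnorm Y (Mul i (W t)) \<le> C' * K"
    using Suc.IH[OF X.smooth_curve_Suc[OF Suc.prems]] Y.smooth_curveD by blast+
  obtain W' where W': "X.has_partials W W'" "\<And>j. X.smooth_curve n K (W' j)" using Suc.prems by auto
  note m = X.lipschitz_curve_mem[OF X.smooth_curveD(1)[OF Suc.prems]]
  note m' = X.lipschitz_curve_mem[OF X.smooth_curveD(1)[OF W'(2)]]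
  obtain L where L: "\<And>s t. s \<in> param_box \<Longrightarrow> t \<in> param_box \<Longrightarrow>
     fnorm X (\<lambda>x. W s x - W t x - (\<Sum>j\<in>UNIV. (s $ j - t $ j) * W' j t x)) \<le> L * (norm (s - t))\<^sup>2"
    using W'(1) unfolding X.has_partials_def by blast
  have "fnorm Y (\<lambda>x. Mul i (W s) x - Mul i (W t) x - (\<Sum>j\<in>UNIV. (s $ j - t $ j) * Mul i (W' j t) x)) \<le> C' * L * (norm (s - t))\<^sup>2"
    if st: "s \<in> param_box" "t \<in> param_box" for s t
  proof -
    let ?r = "\<lambda>x. W s x - W t x - (\<Sum>j\<in>UNIV. (s $ j - t $ j) * W' j t x)"
    have c: "(\<lambda>x. (s $ j - t $ j) * W' j t x) \<in> elems X" for j by (rule X.cmult_mem[OF m'[OF st(2)]])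
    have sm: "(\<lambda>x. \<Sum>j\<in>UNIV. (s $ j - t $ j) * W' j t x) \<in> elems X" by (rule X.sum_mem[OF c])
    have r: "?r \<in> elems X" by (intro X.diff_mem X.sum_mem c m st)
    have "Mul i ?r = (\<lambda>x. Mul i (W s) x - Mul i (W t) x - (\<Sum>j\<in>UNIV. (s $ j - t $ j) * Mul i (W' j t) x))"
      using Mul_diff[OF X.diff_mem[OF m[OF st(1)] m[OF st(2)]] sm, of i]
        Mul_diff[OF m[OF st(1)] m[OF st(2)], of i] Mul_sum[of UNIV "\<lambda>j x. (s $ j - t $ j) * W' j t x" i, OF c]
      by (simp add: Mul_cmult[OF m'[OF st(2)]])
    then show ?thesis using Mul_bound[OF r, of i] mult_left_mono[OF L[OF st] C'_nonneg] by (simp add: mult.assoc)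
  qed
  then have "Y.has_partials (\<lambda>t. Mul i (W t)) (\<lambda>j t. Mul i (W' j t))" unfolding Y.has_partials_def by blast
  then show ?case using l Suc.IH[OF W'(2)] by auto
qed

text \<open>By \<open>S_shift\<close> the difference \<open>W s - W t\<close> solves the problem at \<open>s\<close> with the datum
\<open>y s - y t - (\<Sum>i. (s\<^sub>i - t\<^sub>i) Mul i (W t))\<close>.\<close>

lemma solution_lipschitz:
  assumes y: "Y.lipschitz_curve y" and K: "\<And>t. t \<in> param_box \<Longrightarrow> fnorm Y (y t) \<le> K"
    and W: "\<And>t. t \<in> param_box \<Longrightarrow> S t (y t) (W t)"
  shows "X.lipschitz_curve W"
proof -
  obtain L where L: "0 \<le> L" "\<And>s t. s \<in> param_box \<Longrightarrow> t \<in> param_box \<Longrightarrow> fnorm Y (\<lambda>x. y s x - y t x) \<le> L * norm (s - t)"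
    and m: "\<And>t. t \<in> param_box \<Longrightarrow> y t \<in> elems Y"
    using y unfolding Y.lipschitz_curve_def by blast
  have WX: "W t \<in> elems X" if "t \<in> param_box" for t using S_mem[OF that W[OF that]] .
  have "(0 :: real^'t) \<in> param_box" by (simp add: param_box_def)
  then have K0: "0 \<le> K" using K Y.fnorm_nonneg[OF m] by (meson order_trans)
  let ?N = "real CARD('t)"
  have "fnorm X (\<lambda>x. W s x - W t x) \<le> C * (L + ?N * (C' * (C * K))) * norm (s - t)" if st: "s \<in> param_box" "t \<in> param_box" for s t
  proof -
    let ?q = "\<lambda>x. \<Sum>i\<in>UNIV. (s $ i - t $ i) * Mul i (W t) x"
    have q: "?q \<in> elems Y" by (intro Y.sum_mem Y.cmult_mem Mul_mem WX st)
    have "fnorm Y ?q \<le> (\<Sum>i\<in>UNIV. fnorm Y (\<lambda>x. (s $ i - t $ i) * Mul i (W t) x))"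
      by (intro Y.fnorm_sum_le Y.cmult_mem Mul_mem WX st)
    also have "\<dots> \<le> (\<Sum>i\<in>(UNIV :: 't set). norm (s - t) * (C' * (C * K)))"
    proof (rule sum_mono)
      fix i
      have "fnorm X (W t) \<le> C * K"
        using S_bound[OF st(2) W[OF st(2)]] mult_left_mono[OF K[OF st(2)] C_nonneg] by linarith
      then have "fnorm Y (Mul i (W t)) \<le> C' * (C * K)"
        using Mul_bound[OF WX[OF st(2)], of i] mult_left_mono[OF _ C'_nonneg, of "fnorm X (W t)" "C * K"] by linarith
      moreover have "\<bar>s $ i - t $ i\<bar> \<le> norm (s - t)" using component_le_norm_cart[of "s - t" i] by simp
      ultimately show "fnorm Y (\<lambda>x. (s $ i - t $ i) * Mul i (W t) x) \<le> norm (s - t) * (C' * (C * K))"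
        unfolding Y.fnorm_cmult[OF Mul_mem[OF WX[OF st(2)]]] by (intro mult_mono Y.fnorm_nonneg Mul_mem WX st) auto
    qed
    finally have qn: "fnorm Y ?q \<le> ?N * (C' * (C * K)) * norm (s - t)" by (simp add: mult_ac)
    have "S s (\<lambda>x. y s x - (y t x + ?q x)) (\<lambda>x. W s x - W t x)"
      by (rule S_diff[OF st(1) W[OF st(1)] S_shift[OF st W[OF st(2)]]])
    then have "fnorm X (\<lambda>x. W s x - W t x) \<le> C * fnorm Y (\<lambda>x. y s x - (y t x + ?q x))" by (rule S_bound[OF st(1)])
    also have "(\<lambda>x. y s x - (y t x + ?q x)) = (\<lambda>x. (y s x - y t x) - ?q x)" by (simp add: fun_eq_iff)
    also have "C * fnorm Y \<dots> \<le> C * (L * norm (s - t) + ?N * (C' * (C * K)) * norm (s - t))"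
      using Y.fnorm_triangle_diff[OF Y.diff_mem[OF m[OF st(1)] m[OF st(2)]] q] L(2)[OF st] qn
      by (intro mult_left_mono[OF _ C_nonneg]) linarith
    finally show ?thesis by (simp add: algebra_simps)
  qed
  moreover have "0 \<le> C * (L + ?N * (C' * (C * K)))" using C_nonneg C'_nonneg L K0 by simp
  ultimately show ?thesis unfolding X.lipschitz_curve_def using WX by blast
qed

text \<open>One differentiation replaces a bound \<open>K\<close> of the datum by \<open>K + C' (growth n) K\<close>, a bound of
\<open>\<partial>\<^sub>i y - Mul i u\<close>.\<close>

primrec growth :: "nat \<Rightarrow> real" where
  "growth 0 = C"
| "growth (Suc n) = growth n * (1 + C' * growth n)"

lemma growth_nonneg: "0 \<le> growth n"
  using C_nonneg C'_nonneg by (induction n) auto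

lemma growth_mono: "growth n \<le> growth (Suc n)"
  using mult_left_mono[OF _ growth_nonneg[of n], of 1 "1 + C' * growth n"] growth_nonneg[of n] C'_nonneg by simp

text \<open>The partial derivatives are the solutions \<open>W' i\<close> of the differentiated equation, whose datum
\<open>z i = y' i - Mul i W\<close> is \<open>n\<close> times differentiable by the induction hypothesis for \<open>W\<close>.  With \<open>S_shift\<close> all terms of
the Taylor remainder of \<open>W\<close> are solutions at the same parameter \<open>s\<close>.  Its datum \<open>A - B\<close> consists of
the Taylor remainder \<open>A\<close> of \<open>y\<close> and of a double sum \<open>B\<close> with the factors \<open>(s\<^sub>i - t\<^sub>i) (s\<^sub>j - t\<^sub>j)\<close>, both
of quadratic order.\<close>

theorem solution_smooth_curve:
  assumes "Y.smooth_curve n K y" "0 \<le> K" "\<And>t. t \<in> param_box \<Longrightarrow> S t (y t) (W t)"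
  shows "X.smooth_curve n (growth n * K) W"
  using assms
proof (induction n arbitrary: K y W)
  case (0 K y W)
  have "X.lipschitz_curve W" by (rule solution_lipschitz[OF Y.smooth_curveD[OF 0(1)] 0(3)])
  moreover have "fnorm X (W t) \<le> C * K" if "t \<in> param_box" for t
    using S_bound[OF that 0(3)[OF that]] mult_left_mono[OF Y.smooth_curveD(2)[OF 0(1) that] C_nonneg] by linarith
  ultimately show ?case by simp
next
  case (Suc n K y W)
  note y = Suc.prems(1) and K = Suc.prems(2) and W = Suc.prems(3)
  have Wn: "X.smooth_curve n (growth n * K) W" by (rule Suc.IH[OF Y.smooth_curve_Suc[OF y] K W])
  obtain y' where y': "Y.has_partials y y'" "\<And>i. Y.smooth_curve n K (y' i)" using y by auto
  define K1 where "K1 = K + C' * (growth n * K)"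
  have K1: "0 \<le> K1" using K growth_nonneg[of n] C'_nonneg by (simp add: K1_def)
  define z where "z i t = (\<lambda>x. y' i t x - Mul i (W t) x)" for i t
  have z: "Y.smooth_curve n K1 (z i)" for i
    using Y.smooth_curve_diff[OF y'(2)[of i] smooth_curve_Mul[OF Wn, of i]] by (simp add: K1_def z_def[abs_def])
  have zm: "z i t \<in> elems Y" if "t \<in> param_box" for i t
    using Y.lipschitz_curve_mem[OF Y.smooth_curveD(1)[OF z] that] .
  define W' where "W' i t = (SOME w. S t (z i t) w)" for i t
  have W': "S t (z i t) (W' i t)" if "t \<in> param_box" for i t
    unfolding W'_def using S_ex[OF that zm[OF that]] by (rule someI_ex)
  have W's: "X.smooth_curve n (growth n * K1) (W' i)" for i
    by (rule Suc.IH[OF z K1 W'])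
  obtain L where L: "\<And>s t. s \<in> param_box \<Longrightarrow> t \<in> param_box \<Longrightarrow>
     fnorm Y (\<lambda>x. y s x - y t x - (\<Sum>i\<in>UNIV. (s $ i - t $ i) * y' i t x)) \<le> L * (norm (s - t))\<^sup>2"
    using y'(1) unfolding Y.has_partials_def by blast
  let ?N = "real CARD('t)"
  let ?K2 = "growth n * K1"
  have W'm: "W' i t \<in> elems X" if "t \<in> param_box" for i t by (rule S_mem[OF that W'[OF that]])
  have Wm: "W t \<in> elems X" if "t \<in> param_box" for t by (rule S_mem[OF that W[OF that]])
  have rem: "fnorm X (\<lambda>x. W s x - W t x - (\<Sum>i\<in>UNIV. (s $ i - t $ i) * W' i t x))
      \<le> C * (L + ?N * (?N * (C' * ?K2))) * (norm (s - t))\<^sup>2"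
    if st: "s \<in> param_box" "t \<in> param_box" for s t
  proof -
    let ?h = "\<lambda>i. s $ i - t $ i"
    let ?q = "\<lambda>i x. \<Sum>j\<in>UNIV. ?h j * Mul j (W' i t) x"
    let ?A = "\<lambda>x. y s x - y t x - (\<Sum>i\<in>UNIV. ?h i * y' i t x)" and ?B = "\<lambda>x. \<Sum>i\<in>UNIV. ?h i * ?q i x"
    have hn: "\<bar>?h i\<bar> \<le> norm (s - t)" for i using component_le_norm_cart[of "s - t" i] by simp
    have M: "Mul j (W' i t) \<in> elems Y" for i j by (intro Mul_mem W'm st)
    have q: "?q i \<in> elems Y" for i by (intro Y.sum_mem Y.cmult_mem M)
    have qn: "fnorm Y (?q i) \<le> ?N * (norm (s - t) * (C' * ?K2))" for i
    proof -
      have "fnorm Y (?q i) \<le> (\<Sum>j\<in>UNIV. fnorm Y (\<lambda>x. ?h j * Mul j (W' i t) x))"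
        by (intro Y.fnorm_sum_le Y.cmult_mem M)
      also have "\<dots> \<le> (\<Sum>j\<in>(UNIV :: 't set). norm (s - t) * (C' * ?K2))"
      proof (rule sum_mono)
        fix j
        have "fnorm Y (Mul j (W' i t)) \<le> C' * ?K2"
          using Mul_bound[OF W'm[OF st(2)], of j i] mult_left_mono[OF X.smooth_curveD(2)[OF W's st(2)] C'_nonneg] by (rule order_trans)
        then show "fnorm Y (\<lambda>x. ?h j * Mul j (W' i t) x) \<le> norm (s - t) * (C' * ?K2)"
          unfolding Y.fnorm_cmult[OF M] by (intro mult_mono hn Y.fnorm_nonneg M) auto
      qed
      finally show ?thesis by simp
    qed
    have "fnorm Y ?B \<le> (\<Sum>i\<in>UNIV. fnorm Y (\<lambda>x. ?h i * ?q i x))" by (intro Y.fnorm_sum_le Y.cmult_mem q)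
    also have "\<dots> \<le> (\<Sum>i\<in>(UNIV :: 't set). norm (s - t) * (?N * (norm (s - t) * (C' * ?K2))))"
    proof (rule sum_mono)
      show "fnorm Y (\<lambda>x. ?h i * ?q i x) \<le> norm (s - t) * (?N * (norm (s - t) * (C' * ?K2)))" for i
        unfolding Y.fnorm_cmult[OF q] by (intro mult_mono hn qn Y.fnorm_nonneg q) auto
    qed
    finally have B: "fnorm Y ?B \<le> ?N * (norm (s - t) * (?N * (norm (s - t) * (C' * ?K2))))" by simp
    have "S s (\<lambda>x. (y s x - (y t x + (\<Sum>i\<in>UNIV. ?h i * Mul i (W t) x))) - (\<Sum>i\<in>UNIV. ?h i * (z i t x + ?q i x)))
        (\<lambda>x. (W s x - W t x) - (\<Sum>i\<in>UNIV. ?h i * W' i t x))"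
      by (intro S_diff[OF st(1) S_diff[OF st(1) W[OF st(1)] S_shift[OF st W[OF st(2)]]]] S_sum[OF st(1)] S_cmult[OF st(1)]
          S_shift[OF st W'[OF st(2)]]) auto
    also have "(\<lambda>x. (y s x - (y t x + (\<Sum>i\<in>UNIV. ?h i * Mul i (W t) x))) - (\<Sum>i\<in>UNIV. ?h i * (z i t x + ?q i x))) = (\<lambda>x. ?A x - ?B x)"
      by (simp add: fun_eq_iff z_def right_diff_distrib distrib_left sum_subtractf sum.distrib)
    finally have "fnorm X (\<lambda>x. W s x - W t x - (\<Sum>i\<in>UNIV. ?h i * W' i t x)) \<le> C * fnorm Y (\<lambda>x. ?A x - ?B x)"
      by (rule S_bound[OF st(1)])
    also have "\<dots> \<le> C * (fnorm Y ?A + fnorm Y ?B)"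
      using Y.lipschitz_curve_mem[OF Y.smooth_curveD(1)[OF y]] Y.lipschitz_curve_mem[OF Y.smooth_curveD(1)[OF y'(2)]] st
      by (intro mult_left_mono[OF _ C_nonneg] Y.fnorm_triangle_diff Y.diff_mem Y.sum_mem Y.cmult_mem q) auto
    also have "\<dots> \<le> C * (L * (norm (s - t))\<^sup>2 + ?N * (norm (s - t) * (?N * (norm (s - t) * (C' * ?K2)))))"
      by (rule mult_left_mono[OF add_mono[OF L[OF st] B] C_nonneg])
    finally show ?thesis by (simp add: power2_eq_square algebra_simps)
  qed
  have p: "X.has_partials W W'" unfolding X.has_partials_def using rem by blast
  have g: "growth (Suc n) * K = growth n * K1" by (simp add: K1_def algebra_simps)
  have "growth n * K \<le> growth (Suc n) * K" by (rule mult_right_mono[OF growth_mono K])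
  then have "X.lipschitz_curve W \<and> (\<forall>t\<in>param_box. fnorm X (W t) \<le> growth (Suc n) * K)"
    using X.smooth_curveD[OF Wn] by (meson order_trans)
  moreover have "\<forall>i. X.smooth_curve n (growth (Suc n) * K) (W' i)" using W's unfolding g by blast
  ultimately show ?case using p by (auto simp del: growth.simps)
qed

text \<open>For \<open>k = 0\<close> the right-hand side contains no derivatives, and the bound must come from the boundedness of the
solution operator for almost every \<open>t\<close> rather than from bounds for the coefficients of the datum.\<close>

theorem parametric_regularity:
  "\<exists>c>0. \<forall>a0 a g u. a0 \<in> elems Y \<longrightarrow> (\<forall>i. a i \<in> elems Y) \<longrightarrow>
     (AE t in TM. g t \<in> elems Y \<and> fnorm Y (\<lambda>x. g t x - affine_param a0 a t x) = 0) \<longrightarrow>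
     (AE t in TM. S t (affine_param a0 a t) (u t)) \<longrightarrow>
     u \<in> bochner_Hk k X \<and> bochner_deriv_sum k X u \<le> c * bochner_deriv_sum (min k 1) Y g"
proof -
  let ?n = "real (card (multi_indices k :: ('t \<Rightarrow> nat) set))"
  \<comment> \<open>The summand \<open>C\<close> serves the case \<open>k = 0\<close>, the last summand the case \<open>k > 0\<close>.\<close>
  define c where "c = 1 + C + ?n * (2 * growth k)"
  have n0: "0 \<le> ?n * (2 * growth k)" using growth_nonneg by simp
  have cpos: "0 < c" using C_nonneg n0 by (simp add: c_def)
  have main: "u \<in> bochner_Hk k X \<and> bochner_deriv_sum k X u \<le> c * bochner_deriv_sum (min k 1) Y g"
    if a: "a0 \<in> elems Y" "range a \<subseteq> elems Y"
      and g: "AE t in TM. g t \<in> elems Y \<and> fnorm Y (\<lambda>x. g t x - affine_param a0 a t x) = 0"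
      and u: "AE t in TM. S t (affine_param a0 a t) (u t)" for a0 a g u
  proof -
    let ?F = "affine_param a0 a"
    define W where "W t = (SOME w. S t (?F t) w)" for t
    have W: "S t (?F t) (W t)" if "t \<in> param_box" for t
      unfolding W_def using S_ex[OF that Y.affine_param_mem[OF a]] by (rule someI_ex)
    have sW: "X.smooth_curve k (growth k * Y.affine_bound a0 a) W"
      by (rule solution_smooth_curve[OF Y.smooth_curve_affine_param[OF a] Y.affine_bound_ge(2)[OF a] W])
    have ae: "AE t in TM. u t \<in> elems X \<and> fnorm X (\<lambda>x. u t x - W t x) = 0"
      using u AE_space by eventually_elim (auto intro: S_mem S_unique[OF _ Y.affine_param_mem[OF a] _ W])
    note R = X.bochner_Hk_of_smooth_curve[OF sW ae]
    note G = Y.affine_bound_le_deriv_sum[OF a g]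
    have "bochner_deriv_sum k X u \<le> c * bochner_deriv_sum (min k 1) Y g"
    proof (cases k)
      case 0
      have m0: "(multi_indices 0 :: ('t \<Rightarrow> nat) set) = {\<lambda>_. 0}" by (auto simp: multi_indices_def)
      have uL: "u \<in> bochner_L2 X" using R(1) by (simp add: bochner_Hk_def)
      have FL: "?F \<in> bochner_L2 Y"
        by (rule Y.lipschitz_curve_bochner_L2[OF Y.smooth_curveD[OF Y.smooth_curve_affine_param[OF a, of 0]]])
      have "bochner_deriv_sum k X u = bochner_L2_norm X u"
        unfolding bochner_deriv_sum_def 0 m0 by (simp add: R(3))
      also have "\<dots> \<le> C * bochner_L2_norm Y ?F"
      proof -
        have "(LINT t|TM. (fnorm X (u t))\<^sup>2) \<le> (LINT t|TM. C\<^sup>2 * (fnorm Y (?F t))\<^sup>2)"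
        proof (rule integral_mono_AE)
          show "integrable TM (\<lambda>t. (fnorm X (u t))\<^sup>2)" using uL by (simp add: bochner_L2_def)
          show "integrable TM (\<lambda>t. C\<^sup>2 * (fnorm Y (?F t))\<^sup>2)" using FL by (simp add: bochner_L2_def)
          show "AE t in TM. (fnorm X (u t))\<^sup>2 \<le> C\<^sup>2 * (fnorm Y (?F t))\<^sup>2"
            using u AE_space
          proof eventually_elim
            case (elim t)
            then have t: "t \<in> param_box" by simp
            have "(fnorm X (u t))\<^sup>2 \<le> (C * fnorm Y (?F t))\<^sup>2"
              by (intro power_mono S_bound[OF t elim(1)] X.fnorm_nonneg S_mem[OF t elim(1)])
            then show ?case by (simp add: power_mult_distrib)
          qed
        qed
        then have "bochner_L2_norm X u \<le> sqrt (C\<^sup>2 * (LINT t|TM. (fnorm Y (?F t))\<^sup>2))"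
          unfolding bochner_L2_norm_def by (intro real_sqrt_le_mono) simp
        then show ?thesis using C_nonneg by (simp add: bochner_L2_norm_def real_sqrt_mult)
      qed
      also have "\<dots> = C * bochner_deriv_sum (min k 1) Y g" using G(2) 0 by simp
      also have "\<dots> \<le> c * bochner_deriv_sum (min k 1) Y g"
        using n0 by (intro mult_right_mono G(3)) (simp add: c_def)
      finally show ?thesis .
    next
      case (Suc m)
      have "bochner_deriv_sum k X u \<le> (\<Sum>\<alpha>\<in>(multi_indices k :: ('t \<Rightarrow> nat) set). growth k * Y.affine_bound a0 a)"
        unfolding bochner_deriv_sum_def by (intro sum_mono R(2))
      also have "\<dots> = ?n * (growth k * Y.affine_bound a0 a)" by simp
      also have "\<dots> \<le> ?n * (growth k * (2 * bochner_deriv_sum 1 Y g))"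
        by (intro mult_left_mono G(1) growth_nonneg) simp
      also have "\<dots> = (?n * (2 * growth k)) * bochner_deriv_sum 1 Y g" by simp
      also have "\<dots> \<le> c * bochner_deriv_sum 1 Y g"
        using C_nonneg by (intro mult_right_mono G(3)) (simp add: c_def)
      finally show ?thesis using Suc by simp
    qed
    then show ?thesis using R(1) by blast
  qed
  show ?thesis by (intro exI[of _ c] conjI cpos allI impI main) auto
qed

end

section \<open>Symmetry of iterated partial derivatives\<close>

text \<open>Two applications of the mean value theorem.  The left-hand side is symmetric in \<open>i\<close> and \<open>j\<close>, so that the
mixed partial derivatives coincide in the limit.\<close>

lemma second_difference:
  fixes \<phi> :: "real^'n::finite \<Rightarrow> real"
  assumes \<phi>: "smooth \<phi>" and h: "0 < h"
  obtains y where "norm (y - x) \<le> 2 * h"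
    "\<phi> (x + h *\<^sub>R axis i 1 + h *\<^sub>R axis j 1) - \<phi> (x + h *\<^sub>R axis i 1) - \<phi> (x + h *\<^sub>R axis j 1) + \<phi> x
      = h\<^sup>2 * partial_deriv j (partial_deriv i \<phi>) y"
proof -
  let ?i = "axis i (1 :: real) :: real^'n" and ?j = "axis j (1 :: real) :: real^'n"
  have "((\<lambda>s. \<phi> ((x + h *\<^sub>R ?j) + s *\<^sub>R ?i) - \<phi> (x + s *\<^sub>R ?i)) has_real_derivative
      (partial_deriv i \<phi> ((x + h *\<^sub>R ?j) + s *\<^sub>R ?i) - partial_deriv i \<phi> (x + s *\<^sub>R ?i))) (at s)" for s
    by (intro DERIV_diff smooth_line_derivative \<phi>)
  then obtain z where z: "0 < z" "z < h"
    "(\<phi> ((x + h *\<^sub>R ?j) + h *\<^sub>R ?i) - \<phi> (x + h *\<^sub>R ?i)) - (\<phi> ((x + h *\<^sub>R ?j) + 0 *\<^sub>R ?i) - \<phi> (x + 0 *\<^sub>R ?i))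
     = (h - 0) * (partial_deriv i \<phi> ((x + h *\<^sub>R ?j) + z *\<^sub>R ?i) - partial_deriv i \<phi> (x + z *\<^sub>R ?i))"
    using MVT2[of 0 h "\<lambda>s. \<phi> ((x + h *\<^sub>R ?j) + s *\<^sub>R ?i) - \<phi> (x + s *\<^sub>R ?i)"
      "\<lambda>s. partial_deriv i \<phi> ((x + h *\<^sub>R ?j) + s *\<^sub>R ?i) - partial_deriv i \<phi> (x + s *\<^sub>R ?i)"] h by blast
  have "((\<lambda>r. partial_deriv i \<phi> ((x + z *\<^sub>R ?i) + r *\<^sub>R ?j)) has_real_derivative
      partial_deriv j (partial_deriv i \<phi>) ((x + z *\<^sub>R ?i) + r *\<^sub>R ?j)) (at r)" for r
    by (intro smooth_line_derivative smooth_partial_deriv \<phi>)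
  then obtain r where r: "0 < r" "r < h"
    "partial_deriv i \<phi> ((x + z *\<^sub>R ?i) + h *\<^sub>R ?j) - partial_deriv i \<phi> ((x + z *\<^sub>R ?i) + 0 *\<^sub>R ?j)
     = (h - 0) * partial_deriv j (partial_deriv i \<phi>) ((x + z *\<^sub>R ?i) + r *\<^sub>R ?j)"
    using MVT2[of 0 h "\<lambda>r. partial_deriv i \<phi> ((x + z *\<^sub>R ?i) + r *\<^sub>R ?j)"
      "\<lambda>r. partial_deriv j (partial_deriv i \<phi>) ((x + z *\<^sub>R ?i) + r *\<^sub>R ?j)"] h by blast
  let ?y = "(x + z *\<^sub>R ?i) + r *\<^sub>R ?j"
  have "norm (?y - x) \<le> norm (z *\<^sub>R ?i) + norm (r *\<^sub>R ?j)" 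
    using norm_triangle_ineq[of "z *\<^sub>R ?i" "r *\<^sub>R ?j"] by (simp add: algebra_simps)
  also have "\<dots> = z + r" using z r by (simp add: norm_axis_1)
  finally have "norm (?y - x) \<le> 2 * h" using z r by simp
  moreover have "\<phi> (x + h *\<^sub>R ?i + h *\<^sub>R ?j) - \<phi> (x + h *\<^sub>R ?i) - \<phi> (x + h *\<^sub>R ?j) + \<phi> x
      = h\<^sup>2 * partial_deriv j (partial_deriv i \<phi>) ?y"
    using z(3) r(3) by (simp add: power2_eq_square algebra_simps)
  ultimately show ?thesis by (rule that)
qed

lemma partial_deriv_commute:
  fixes \<phi> :: "real^'n::finite \<Rightarrow> real"
  assumes \<phi>: "smooth \<phi>"
  shows "partial_deriv i (partial_deriv j \<phi>) = partial_deriv j (partial_deriv i \<phi>)"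
proof
  fix x
  define h where "h n = 1 / real (Suc n)" for n
  have h: "0 < h n" for n by (simp add: h_def)
  have h0: "h \<longlonglongrightarrow> 0" unfolding h_def by (rule LIMSEQ_Suc[OF lim_1_over_n])
  define \<Delta> where "\<Delta> i j n = (\<phi> (x + h n *\<^sub>R axis i 1 + h n *\<^sub>R axis j 1) - \<phi> (x + h n *\<^sub>R axis i 1)
    - \<phi> (x + h n *\<^sub>R axis j 1) + \<phi> x) / (h n)\<^sup>2" for i j n
  have lim: "\<Delta> i j \<longlonglongrightarrow> partial_deriv j (partial_deriv i \<phi>) x" for i j
  proof -
    have "\<exists>y. norm (y - x) \<le> 2 * h n \<and> \<Delta> i j n = partial_deriv j (partial_deriv i \<phi>) y" for n
      by (rule second_difference[OF \<phi> h[of n], of x i j]) (use h[of n] in \<open>auto simp: \<Delta>_def\<close>)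
    then obtain y where y: "\<And>n. norm (y n - x) \<le> 2 * h n" "\<And>n. \<Delta> i j n = partial_deriv j (partial_deriv i \<phi>) (y n)"
      by metis
    have "(\<lambda>n. y n - x) \<longlonglongrightarrow> 0"
      by (rule Lim_null_comparison[OF always_eventually tendsto_mult_right_zero[OF h0]]) (use y(1) in blast)
    then have "y \<longlonglongrightarrow> x" by (rule LIM_zero_cancel)
    then have "(\<lambda>n. partial_deriv j (partial_deriv i \<phi>) (y n)) \<longlonglongrightarrow> partial_deriv j (partial_deriv i \<phi>) x"
      by (intro continuous_on_tendsto_compose[OF smooth_continuous[of _ UNIV]] smooth_partial_deriv \<phi>) auto
    then show ?thesis by (simp flip: y(2))
  qed
  have "\<Delta> i j = \<Delta> j i" by (simp add: \<Delta>_def algebra_simps fun_eq_iff)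
  then show "partial_deriv i (partial_deriv j \<phi>) x = partial_deriv j (partial_deriv i \<phi>) x"
    using LIMSEQ_unique[OF lim[of i j]] lim[of j i] by simp
qed

lemma iter_partial_remove1:
  assumes \<phi>: "smooth \<phi>" and i: "i \<in> set xs"
  shows "iter_partial xs \<phi> = partial_deriv i (iter_partial (remove1 i xs) \<phi>)"
  using i
proof (induction xs)
  case (Cons a xs)
  show ?case
  proof (cases "a = i")
    case False
    then have "iter_partial xs \<phi> = partial_deriv i (iter_partial (remove1 i xs) \<phi>)" using Cons by simp
    then show ?thesis using False partial_deriv_commute[OF smooth_iter_partial[OF \<phi>]] by simp
  qed simp
qed simp

lemma count_list_remove1: "count_list (remove1 i xs) j = count_list xs j - (if j = i then 1 else 0)"
  by (induction xs) auto

lemma iter_partial_cong_counts: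
  assumes \<phi>: "smooth \<phi>" and "\<And>i. count_list xs i = count_list ys i"
  shows "iter_partial xs \<phi> = iter_partial ys \<phi>"
  using assms(2)
proof (induction xs arbitrary: ys)
  case Nil
  have "i \<notin> set ys" for i using Nil[of i] count_list_0_iff[of ys i] by simp
  then show ?case by (cases ys) auto
next
  case (Cons a xs)
  have "count_list ys a \<noteq> 0" using Cons.prems[of a] by simp
  then have a: "a \<in> set ys" using count_list_0_iff[of ys a] by auto
  have "count_list xs i = count_list (remove1 a ys) i" for i
    using Cons.prems[of i] by (simp add: count_list_remove1 split: if_splits)
  then have "iter_partial xs \<phi> = iter_partial (remove1 a ys) \<phi>" by (rule Cons.IH)
  then show ?case using iter_partial_remove1[OF \<phi> a] by simp
qed

definition index_add :: "('n \<Rightarrow> nat) \<Rightarrow> 'n \<Rightarrow> 'n \<Rightarrow> nat" where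
  "index_add \<alpha> i = (\<lambda>j. \<alpha> j + unit_index i j)"

lemma sum_index_add: "sum (index_add \<alpha> i) (UNIV :: 'n::finite set) = Suc (sum \<alpha> UNIV)"
  by (simp add: index_add_def sum.distrib sum_unit_index)

lemma index_add_mem: "index_add \<alpha> i \<in> multi_indices (Suc n) \<longleftrightarrow> \<alpha> \<in> multi_indices n"
  by (simp add: multi_indices_def sum_index_add)

lemma multi_indices_Suc_cases:
  assumes "\<alpha> \<in> multi_indices (Suc n)"
  obtains "\<alpha> = (\<lambda>_. 0)" | i \<beta> where "\<alpha> = index_add \<beta> i" "\<beta> \<in> multi_indices n"
proof (cases "\<alpha> = (\<lambda>_. 0)")
  case False
  then obtain i where i: "\<alpha> i \<noteq> 0" by auto
  have "\<alpha> = index_add (\<lambda>j. \<alpha> j - unit_index i j) i"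
    using i by (auto simp: index_add_def unit_index_def fun_eq_iff)
  then show ?thesis using that(2) assms index_add_mem by metis
qed (rule that(1))

lemma multi_partial_index_add:
  fixes \<phi> :: "real^'n::finite \<Rightarrow> real"
  assumes "smooth \<phi>"
  shows "multi_partial (index_add \<alpha> i) \<phi> = partial_deriv i (multi_partial \<alpha> \<phi>)"
proof -
  obtain xs where xs: "\<And>j. count_list xs j = index_add \<alpha> i j" "multi_partial (index_add \<alpha> i) \<phi> = iter_partial xs \<phi>"
    using multi_partial_iter[of "index_add \<alpha> i"] by metis
  obtain ys where ys: "\<And>j. count_list ys j = \<alpha> j" "multi_partial \<alpha> \<phi> = iter_partial ys \<phi>"
    using multi_partial_iter[of \<alpha>] by metis
  have "iter_partial xs \<phi> = iter_partial (i # ys) \<phi>"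
    by (rule iter_partial_cong_counts[OF assms]) (simp add: xs ys index_add_def unit_index_def)
  then show ?thesis by (simp add: xs ys)
qed

section \<open>The product rule\<close>

lemma fubini_bounded_kernel:
  fixes f g :: "'a::euclidean_space \<Rightarrow> real" and k :: "'a \<Rightarrow> 'a \<Rightarrow> real"
  assumes f: "integrable lborel f" and g: "integrable lborel g"
    and k [measurable]: "(\<lambda>p. k (fst p) (snd p)) \<in> borel_measurable (borel \<Otimes>\<^sub>M borel)"
    and M: "\<And>x y. \<bar>k x y\<bar> \<le> M"
  shows "(\<integral>x. f x * (\<integral>y. k x y * g y \<partial>lborel) \<partial>lborel) = (\<integral>y. g y * (\<integral>x. k x y * f x \<partial>lborel) \<partial>lborel)"
    "integrable lborel (\<lambda>x. f x * (\<integral>y. k x y * g y \<partial>lborel))"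
    "integrable lborel (\<lambda>y. k x y * g y)"
proof -
  have [measurable]: "f \<in> borel_measurable borel" "g \<in> borel_measurable borel"
    using f g by (auto dest: borel_measurable_integrable)
  have M0: "0 \<le> M" using M[of 0 0] by linarith
  have kx [measurable]: "(\<lambda>y. k x y) \<in> borel_measurable borel" for x
  proof -
    have "(\<lambda>y. (\<lambda>p. k (fst p) (snd p)) (x, y)) \<in> borel_measurable borel" by measurable
    then show ?thesis by simp
  qed
  have ikg: "integrable lborel (\<lambda>y. k x y * g y)" for x
    by (rule Bochner_Integration.integrable_bound[OF integrable_mult_right[OF g, of M]])
       (use M M0 in \<open>auto simp: abs_mult intro!: AE_I2 mult_right_mono\<close>)
  show "integrable lborel (\<lambda>y. k x y * g y)" by (rule ikg)
  have b: "(\<integral>y. \<bar>k x y * g y\<bar> \<partial>lborel) \<le> M * (\<integral>y. \<bar>g y\<bar> \<partial>lborel)" for x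
  proof -
    have "(\<integral>y. \<bar>k x y * g y\<bar> \<partial>lborel) \<le> (\<integral>y. M * \<bar>g y\<bar> \<partial>lborel)"
      using M by (intro integral_mono integrable_abs ikg integrable_mult_right g) (auto simp: abs_mult intro: mult_right_mono)
    then show ?thesis by simp
  qed
  have int: "integrable (lborel \<Otimes>\<^sub>M lborel) (\<lambda>(x, y). f x * (k x y * g y))"
  proof (rule lborel_pair.Fubini_integrable)
    have eq: "(\<integral>y. norm (case (x, y) of (x, y) \<Rightarrow> f x * (k x y * g y)) \<partial>lborel) = \<bar>f x\<bar> * (\<integral>y. \<bar>k x y * g y\<bar> \<partial>lborel)" for x
      by (simp add: abs_mult mult.assoc flip: integral_mult_right_zero)
    show "integrable lborel (\<lambda>x. \<integral>y. norm (case (x, y) of (x, y) \<Rightarrow> f x * (k x y * g y)) \<partial>lborel)"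
      unfolding eq
    proof (rule Bochner_Integration.integrable_bound[OF integrable_mult_left[OF f, of "M * (\<integral>y. \<bar>g y\<bar> \<partial>lborel)"]])
      show "AE x in lborel. norm (\<bar>f x\<bar> * (\<integral>y. \<bar>k x y * g y\<bar> \<partial>lborel)) \<le> norm (f x * (M * (\<integral>y. \<bar>g y\<bar> \<partial>lborel)))"
        using b M0 by (intro AE_I2) (auto simp: abs_mult intro!: mult_left_mono)
    qed measurable
    show "AE x in lborel. integrable lborel (\<lambda>y. case (x, y) of (x, y) \<Rightarrow> f x * (k x y * g y))"
      using integrable_mult_right[OF ikg] by simp
  qed measurable
  from lborel_pair.Fubini_integral[OF int]
  have "(\<integral>y. (\<integral>x. f x * (k x y * g y) \<partial>lborel) \<partial>lborel) = (\<integral>x. (\<integral>y. f x * (k x y * g y) \<partial>lborel) \<partial>lborel)" .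
  moreover have "(\<integral>x. f x * (k x y * g y) \<partial>lborel) = g y * (\<integral>x. k x y * f x \<partial>lborel)" for y
    by (simp add: mult_ac flip: integral_mult_right_zero)
  ultimately show "(\<integral>x. f x * (\<integral>y. k x y * g y \<partial>lborel) \<partial>lborel) = (\<integral>y. g y * (\<integral>x. k x y * f x \<partial>lborel) \<partial>lborel)"
    by simp
  from lborel_pair.integrable_fst[OF int]
  show "integrable lborel (\<lambda>x. f x * (\<integral>y. k x y * g y \<partial>lborel))" by simp
qed

context bounded_domain
begin

text \<open>Fubini's theorem and mollification are applied to Borel functions on the whole space.\<close>

lemma borel_representative:
  fixes w :: "real^'d \<Rightarrow> real"
  assumes m: "w \<in> borel_measurable M"
  obtains W where "W \<in> borel_measurable borel" "AE x in lborel. indicator \<Omega> x * w x = W x" "\<And>x. x \<notin> \<Omega> \<Longrightarrow> W x = 0"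
    "\<And>f. f \<in> borel_measurable borel \<Longrightarrow> (LINT x|M. w x * f x) = (\<integral>x. W x * f x \<partial>lborel)"
    "integrable M w \<Longrightarrow> integrable lborel W"
proof -
  have "(\<lambda>x. if x \<in> \<Omega> then w x else 0) \<in> borel_measurable lebesgue" by (rule borel_measurable_if_I[OF m]) simp
  also have "(\<lambda>x. if x \<in> \<Omega> then w x else 0) = (\<lambda>x. indicator \<Omega> x * w x)" by (auto simp: fun_eq_iff)
  finally have m': "(\<lambda>x. indicator \<Omega> x * w x) \<in> borel_measurable lebesgue" .
  obtain W0 where W0: "W0 \<in> borel_measurable lborel" "AE x in lborel. indicator \<Omega> x * w x = W0 x"
    using completion_ex_borel_measurable_real[OF m'] by blast
  define W where "W x = indicator \<Omega> x * W0 x" for x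
  have Wm: "W \<in> borel_measurable borel" 
    unfolding W_def by (intro borel_measurable_times borel_measurable_indicator) (use W0(1) open_dom in auto)
  have ae: "AE x in lborel. indicator \<Omega> x * w x = W x"
    using W0(2) by eventually_elim (auto simp: W_def indicator_def)
  have ae': "AE x in lebesgue. indicator \<Omega> x * w x = W x" by (rule AE_completion[OF ae])
  show ?thesis
  proof (rule that[OF Wm ae])
    show "W x = 0" if "x \<notin> \<Omega>" for x using that by (simp add: W_def)
    fix f :: "real^'d \<Rightarrow> real" assume f: "f \<in> borel_measurable borel"
    have fl: "f \<in> borel_measurable lebesgue" "W \<in> borel_measurable lebesgue"
      using f Wm by (auto intro: measurable_completion)
    have "(LINT x|M. w x * f x) = (LINT x|lebesgue. (indicator \<Omega> x * w x) * f x)"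
      by (simp add: lebesgue_on_integral_indicator mult.assoc)
    also have "\<dots> = (LINT x|lebesgue. W x * f x)"
      by (rule integral_cong_AE) (use ae' m' fl in auto)
    also have "\<dots> = (\<integral>x. W x * f x \<partial>lborel)"
      by (rule integral_completion) (use f Wm in simp)
    finally show "(LINT x|M. w x * f x) = (\<integral>x. W x * f x \<partial>lborel)" .
  next
    assume "integrable M w"
    then have "integrable lebesgue (\<lambda>x. indicator \<Omega> x * w x)" by (simp add: integrable_restrict_space)
    then have "integrable lebesgue W"
      by (rule integrable_cong_AE_imp) (use ae' Wm in \<open>auto intro: measurable_completion\<close>)
    then show "integrable lborel W" using Wm by (simp add: integrable_completion)
  qed
qed

lemma Linf_representative:
  assumes a: "a \<in> Linf \<Omega>"
  obtains A K where "A \<in> borel_measurable borel" "\<And>x. \<bar>A x\<bar> \<le> K" "integrable lborel A"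
    "AE x in lborel. indicator \<Omega> x * a x = A x"
    "\<And>f. f \<in> borel_measurable borel \<Longrightarrow> (LINT x|M. a x * f x) = (\<integral>x. A x * f x \<partial>lborel)"
proof -
  obtain C where C: "AE x in M. \<bar>a x\<bar> \<le> C" and m: "a \<in> borel_measurable M" using a by (auto simp: Linf_def)
  define c where "c x = clip \<bar>C\<bar> (a x)" for x
  have "clip \<bar>C\<bar> \<in> borel_measurable borel"
    unfolding clip_def by (intro borel_measurable_continuous_onI continuous_intros)
  then have cm: "c \<in> borel_measurable M" unfolding c_def using m by measurable
  have ca: "AE x in M. c x = a x" using C by eventually_elim (auto simp: c_def clip_def)
  obtain A0 where A0: "A0 \<in> borel_measurable borel" "AE x in lborel. indicator \<Omega> x * c x = A0 x"
    "\<And>x. x \<notin> \<Omega> \<Longrightarrow> A0 x = 0"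
    "\<And>f. f \<in> borel_measurable borel \<Longrightarrow> (LINT x|M. c x * f x) = (\<integral>x. A0 x * f x \<partial>lborel)"
    "integrable M c \<Longrightarrow> integrable lborel A0"
    by (rule borel_representative[OF cm]) (rule that)
  have ci: "integrable M c"
    by (rule Bochner_Integration.integrable_bound[OF const_integrable[of "\<bar>C\<bar>"] cm])
       (auto simp: c_def intro!: AE_I2 clip_bounds)
  \<comment> \<open>The Borel representative obeys the bound only almost everywhere; a second truncation makes it bounded.\<close>
  define A where "A x = clip \<bar>C\<bar> (A0 x)" for x
  have Am: "A \<in> borel_measurable borel"
    unfolding A_def using A0(1) \<open>clip \<bar>C\<bar> \<in> borel_measurable borel\<close> by measurable
  have "\<bar>indicator \<Omega> x * c x\<bar> \<le> \<bar>C\<bar>" for x by (auto simp: indicator_def c_def clip_bounds)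
  then have AA: "AE x in lborel. A x = A0 x"
    using A0(2) by (elim AE_mp) (auto simp: A_def clip_def intro!: AE_I2 split: if_splits; smt (verit, best))
  show ?thesis
  proof (rule that[OF Am])
    show "\<bar>A x\<bar> \<le> \<bar>C\<bar>" for x by (simp add: A_def clip_bounds)
    show "integrable lborel A"
      by (rule integrable_cong_AE_imp[OF A0(5)[OF ci]]) (use Am AA in auto)
    have "AE x in lebesgue. x \<in> \<Omega> \<longrightarrow> c x = a x" using ca by (simp add: AE_restrict_space_iff)
    then have ca': "AE x in lborel. x \<in> \<Omega> \<longrightarrow> c x = a x" by (simp add: AE_completion_iff)
    show "AE x in lborel. indicator \<Omega> x * a x = A x"
      using ca' AA A0(2) by eventually_elim (auto simp: indicator_def split: if_splits)
    fix f :: "real^'d \<Rightarrow> real" assume f: "f \<in> borel_measurable borel"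
    have fM: "f \<in> borel_measurable M"
      by (rule measurable_restrict_space1, rule measurable_completion) (use f in simp)
    have "(LINT x|M. a x * f x) = (LINT x|M. c x * f x)"
      by (rule integral_cong_AE) (use m cm fM ca in auto)
    also have "\<dots> = (\<integral>x. A0 x * f x \<partial>lborel)" by (rule A0(4)[OF f])
    also have "\<dots> = (\<integral>x. A x * f x \<partial>lborel)"
      by (rule integral_cong_AE) (use A0(1) Am f AA in auto)
    finally show "(LINT x|M. a x * f x) = (\<integral>x. A x * f x \<partial>lborel)" .
  qed
qed

text \<open>For every \<open>x\<close>, the product of \<open>\<phi>\<close> and the bump centred at \<open>x\<close> is a test function for the weak derivative of \<open>w\<close>.
Integrating the resulting identity against \<open>a x\<close> and moving the derivative of the bump from \<open>y\<close> to \<open>x\<close>, where it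
meets \<open>a\<close> and turns it into \<open>b\<close>, gives the mollified form of the product rule exactly, provided the
radius is less than the distance from the support of \<open>\<phi>\<close> to the boundary.  The radius then tends to zero.\<close>

theorem weak_product_rule:
  assumes a: "a \<in> Linf \<Omega>" and b: "b \<in> Linf \<Omega>" and w: "w \<in> L2 \<Omega>" and g: "g \<in> L2 \<Omega>"
    and da: "is_weak_deriv \<Omega> (unit_index i) a b" and dw: "is_weak_deriv \<Omega> (unit_index i) w g"
  shows "is_weak_deriv \<Omega> (unit_index i) (\<lambda>x. a x * w x) (\<lambda>x. b x * w x + a x * g x)"
  unfolding is_weak_deriv_def
proof (intro conjI ballI)
  show "locally_integrable \<Omega> (\<lambda>x. a x * w x)" by (rule L2_locally_integrable[OF L2_Linf_mult[OF a w]])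
  show "locally_integrable \<Omega> (\<lambda>x. b x * w x + a x * g x)"
    by (rule L2_locally_integrable[OF L2_add[OF L2_Linf_mult[OF b w] L2_Linf_mult[OF a g]]])
  fix \<phi> assume \<phi>: "\<phi> \<in> test_functions \<Omega>"
  obtain A KA where A: "A \<in> borel_measurable borel" "\<And>x. \<bar>A x\<bar> \<le> KA" "integrable lborel A"
    "AE x in lborel. indicator \<Omega> x * a x = A x"
    "\<And>f. f \<in> borel_measurable borel \<Longrightarrow> (LINT x|M. a x * f x) = (\<integral>x. A x * f x \<partial>lborel)"
    by (rule Linf_representative[OF a]) (rule that)
  obtain B KB where B: "B \<in> borel_measurable borel" "\<And>x. \<bar>B x\<bar> \<le> KB" "integrable lborel B"
    "AE x in lborel. indicator \<Omega> x * b x = B x"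
    "\<And>f. f \<in> borel_measurable borel \<Longrightarrow> (LINT x|M. b x * f x) = (\<integral>x. B x * f x \<partial>lborel)"
    by (rule Linf_representative[OF b]) (rule that)
  obtain W where W: "W \<in> borel_measurable borel" "AE x in lborel. indicator \<Omega> x * w x = W x"
    "\<And>f. f \<in> borel_measurable borel \<Longrightarrow> (LINT x|M. w x * f x) = (\<integral>x. W x * f x \<partial>lborel)"
    "integrable M w \<Longrightarrow> integrable lborel W" by (rule borel_representative[OF L2_measurable[OF w]]) (rule that)
  obtain G where G: "G \<in> borel_measurable borel" "AE x in lborel. indicator \<Omega> x * g x = G x"
    "\<And>f. f \<in> borel_measurable borel \<Longrightarrow> (LINT x|M. g x * f x) = (\<integral>x. G x * f x \<partial>lborel)"
    "integrable M g \<Longrightarrow> integrable lborel G" by (rule borel_representative[OF L2_measurable[OF g]]) (rule that)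
  note [measurable] = A(1) B(1) W(1) G(1)
  note d\<phi> = test_functions_partial_deriv[OF \<phi>, of i]
  have \<phi>m [measurable]: "\<phi> \<in> borel_measurable borel" "partial_deriv i \<phi> \<in> borel_measurable borel"
    by (rule test_functions_measurable[OF \<phi>], rule test_functions_measurable[OF d\<phi>])
  have times: "integrable lborel (\<lambda>x. H x * \<psi> x)" if H: "integrable lborel H" and \<psi>: "\<psi> \<in> test_functions \<Omega>" for H \<psi>
  proof -
    obtain c where c: "0 \<le> c" "\<And>x. \<bar>\<psi> x\<bar> \<le> c" using test_functions_bounded[OF \<psi>] by blast
    show ?thesis
      by (rule Bochner_Integration.integrable_bound[OF integrable_mult_left[OF H, of c]])
         (use c borel_measurable_integrable[OF H] test_functions_measurable[OF \<psi>] in \<open>auto simp: abs_mult intro!: AE_I2 mult_left_mono\<close>)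
  qed
  define h1 where "h1 y = W y * partial_deriv i \<phi> y" for y
  define h2 where "h2 y = W y * \<phi> y" for y
  define h3 where "h3 y = G y * \<phi> y" for y
  have h: "integrable lborel h1" "integrable lborel h2" "integrable lborel h3"
    unfolding h1_def h2_def h3_def
    by (intro times W(4) G(4) L2_integrable w g \<phi> d\<phi>)+
  obtain S where S: "compact S" "S \<subseteq> \<Omega>" "\<And>x. x \<notin> S \<Longrightarrow> \<phi> x = 0" using test_functions_support[OF \<phi>] by blast
  obtain \<delta> where \<delta>: "0 < \<delta>" "\<And>x y. x \<in> S \<Longrightarrow> y \<in> - \<Omega> \<Longrightarrow> \<delta> \<le> dist x y"
  proof -
    have "\<exists>\<delta>>0. \<forall>x\<in>S. \<forall>y\<in>- \<Omega>. \<delta> \<le> dist x y"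
      by (rule separate_compact_closed[OF S(1)]) (use open_dom S(2) in \<open>auto simp: closed_Compl\<close>)
    then show ?thesis using that by blast
  qed
  let ?c = "bump_mass TYPE('d)"
  let ?T1 = "\<lambda>r. \<integral>x. A x * (\<integral>y. bump x r y * h1 y \<partial>lborel) \<partial>lborel"
  let ?T2 = "\<lambda>r. \<integral>x. B x * (\<integral>y. bump x r y * h2 y \<partial>lborel) \<partial>lborel"
  let ?T3 = "\<lambda>r. \<integral>x. A x * (\<integral>y. bump x r y * h3 y \<partial>lborel) \<partial>lborel"
  have id: "?T1 r + ?T2 r + ?T3 r = 0" if r: "0 < r" "r < \<delta>" for r
  proof -
    define k where "k x y = partial_deriv i (bump x r) y" for x y :: "real^'d"
    have test0: "bump (0 :: real^'d) r \<in> test_functions UNIV" by (rule bump_test_function) simp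
    have kshift: "k x y = partial_deriv i (bump 0 r) (y - x)" for x y
      unfolding k_def bump_def partial_deriv_flat_norm by simp
    have dm: "partial_deriv i (bump (0 :: real^'d) r) \<in> borel_measurable borel"
      by (rule test_functions_measurable[OF test_functions_partial_deriv[OF test0]])
    have km: "(\<lambda>p. k (fst p) (snd p)) \<in> borel_measurable (borel \<Otimes>\<^sub>M borel)"
      unfolding kshift by (rule measurable_compose[OF _ dm]) measurable
    obtain Mk where Mk0: "\<And>y. \<bar>partial_deriv i (bump 0 r) y\<bar> \<le> Mk"
      by (rule test_functions_bounded[OF test_functions_partial_deriv[OF test0]]) (rule that)
    have Mk: "\<bar>k x y\<bar> \<le> Mk" for x y unfolding kshift by (rule Mk0)
    obtain Mb where Mb0: "\<And>y. \<bar>bump (0 :: real^'d) r y\<bar> \<le> Mb" by (rule test_functions_bounded[OF test0]) (rule that)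
    have Mb: "\<bar>bump x r y\<bar> \<le> Mb" for x y :: "real^'d" unfolding bump_shift[of x] by (rule Mb0)
    have bm: "(\<lambda>p. bump (fst p) r (snd p)) \<in> borel_measurable (borel \<Otimes>\<^sub>M (borel :: (real^'d) measure))"
      unfolding borel_prod by (rule bump_measurable)
    note F1 = fubini_bounded_kernel[OF A(3) h(1) bm Mb]
    note F3 = fubini_bounded_kernel[OF A(3) h(3) bm Mb]
    note Fk = fubini_bounded_kernel[OF A(3) h(2) km Mk]
    note F2 = fubini_bounded_kernel[OF B(3) h(2) bm Mb]
    \<comment> \<open>The weak derivative of \<open>w\<close>, tested with the product of \<open>\<phi>\<close> and the bump around \<open>x\<close>.\<close>
    have pt: "(\<integral>y. bump x r y * h1 y \<partial>lborel) + (\<integral>y. k x y * h2 y \<partial>lborel) = - (\<integral>y. bump x r y * h3 y \<partial>lborel)" for x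
    proof -
      have t: "(\<lambda>y. \<phi> y * bump x r y) \<in> test_functions \<Omega>" by (rule test_functions_mult_smooth[OF \<phi> smooth_bump])
      have dt: "partial_deriv i (\<lambda>y. \<phi> y * bump x r y) = (\<lambda>y. \<phi> y * k x y + partial_deriv i \<phi> y * bump x r y)"
        unfolding k_def by (rule partial_deriv_mult) (auto intro: smooth_differentiable smooth_bump test_functions_smooth[OF \<phi>])
      have "(LINT y|M. w y * partial_deriv i (\<lambda>y. \<phi> y * bump x r y) y) = - (LINT y|M. g y * (\<phi> y * bump x r y))"
        using dw t unfolding is_weak_deriv_def by (simp add: multi_partial_unit_index sum_unit_index)
      then have "(\<integral>y. W y * partial_deriv i (\<lambda>y. \<phi> y * bump x r y) y \<partial>lborel) = - (\<integral>y. G y * (\<phi> y * bump x r y) \<partial>lborel)"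
        using W(3)[OF test_functions_measurable[OF test_functions_partial_deriv[OF t]], of i] G(3)[OF test_functions_measurable[OF t]] by simp
      moreover have "(\<integral>y. W y * partial_deriv i (\<lambda>y. \<phi> y * bump x r y) y \<partial>lborel) = (\<integral>y. bump x r y * h1 y + k x y * h2 y \<partial>lborel)"
        unfolding dt h1_def h2_def by (simp add: algebra_simps)
      ultimately show ?thesis
        using F1(3)[of x] Fk(3)[of x] by (simp add: h3_def mult_ac)
    qed
    \<comment> \<open>For \<open>y\<close> in the support of \<open>\<phi>\<close>, the bump around \<open>y\<close> is a test function for the weak derivative of \<open>a\<close>.\<close>
    have inner: "h2 y * (\<integral>x. k x y * A x \<partial>lborel) = h2 y * (\<integral>x. bump x r y * B x \<partial>lborel)" for y
    proof (cases "y \<in> S")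
      case True
      have "cball y \<bar>r\<bar> \<subseteq> \<Omega>"
      proof
        fix x assume "x \<in> cball y \<bar>r\<bar>"
        then have "dist y x < \<delta>" using r by simp
        then show "x \<in> \<Omega>" using \<delta>(2)[OF True, of x] by force
      qed
      then have t: "bump y r \<in> test_functions \<Omega>" by (rule bump_test_function)
      have "(LINT x|M. a x * partial_deriv i (bump y r) x) = - (LINT x|M. b x * bump y r x)"
        using da t unfolding is_weak_deriv_def by (simp add: multi_partial_unit_index sum_unit_index)
      then have "(\<integral>x. A x * partial_deriv i (bump y r) x \<partial>lborel) = - (\<integral>x. B x * bump y r x \<partial>lborel)"
        using A(5)[OF test_functions_measurable[OF test_functions_partial_deriv[OF t]], of i] B(5)[OF test_functions_measurable[OF t]] by simp
      moreover have "k x y * A x = - (A x * partial_deriv i (bump y r) x)" for x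
        unfolding k_def partial_deriv_bump_commute[of i x r y] by simp
      ultimately show ?thesis by (simp add: bump_commute[of _ r y] mult.commute)
    next
      case False
      then show ?thesis using S(3) by (simp add: h2_def)
    qed
    have "?T1 r + (\<integral>x. A x * (\<integral>y. k x y * h2 y \<partial>lborel) \<partial>lborel) = (\<integral>x. A x * (\<integral>y. bump x r y * h1 y \<partial>lborel) + A x * (\<integral>y. k x y * h2 y \<partial>lborel) \<partial>lborel)"
      using F1(2) Fk(2) by simp
    also have "\<dots> = (\<integral>x. - (A x * (\<integral>y. bump x r y * h3 y \<partial>lborel)) \<partial>lborel)"
      by (rule Bochner_Integration.integral_cong[OF refl]) (simp add: pt flip: distrib_left)
    also have "\<dots> = - ?T3 r" by simp
    finally have "?T1 r + (\<integral>x. A x * (\<integral>y. k x y * h2 y \<partial>lborel) \<partial>lborel) = - ?T3 r" .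
    moreover have "(\<integral>x. A x * (\<integral>y. k x y * h2 y \<partial>lborel) \<partial>lborel) = ?T2 r"
      unfolding Fk(1) F2(1) inner ..
    ultimately show ?thesis by simp
  qed
  let ?L1 = "\<integral>x. A x * h1 x \<partial>lborel" and ?L2 = "\<integral>x. B x * h2 x \<partial>lborel" and ?L3 = "\<integral>x. A x * h3 x \<partial>lborel"
  have "\<bar>?L1 + ?L2 + ?L3\<bar> \<le> 0 + e" if e: "0 < e" for e
  proof -
    have e3: "0 < e / 3" using e by simp
    obtain d1 where d1: "0 < d1" "\<And>r. 0 < r \<Longrightarrow> r < d1 \<Longrightarrow> \<bar>?T1 r / ?c r - ?L1\<bar> \<le> e / 3"
      by (rule mollification_weak_limit[OF h(1) A(1) A(2) e3]) blast
    obtain d2 where d2: "0 < d2" "\<And>r. 0 < r \<Longrightarrow> r < d2 \<Longrightarrow> \<bar>?T2 r / ?c r - ?L2\<bar> \<le> e / 3"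
      by (rule mollification_weak_limit[OF h(2) B(1) B(2) e3]) blast
    obtain d3 where d3: "0 < d3" "\<And>r. 0 < r \<Longrightarrow> r < d3 \<Longrightarrow> \<bar>?T3 r / ?c r - ?L3\<bar> \<le> e / 3"
      by (rule mollification_weak_limit[OF h(3) A(1) A(2) e3]) blast
    define r where "r = min (min d1 d2) (min d3 \<delta>) / 2"
    have r: "0 < r" "r < d1" "r < d2" "r < d3" "r < \<delta>" using d1 d2 d3 \<delta> by (auto simp: r_def)
    have "?T1 r / ?c r + ?T2 r / ?c r + ?T3 r / ?c r = 0"
      using id[OF r(1,5)] by (simp flip: add_divide_distrib)
    then show ?thesis using d1(2)[OF r(1,2)] d2(2)[OF r(1,3)] d3(2)[OF r(1,4)] by linarith
  qed
  then have L: "?L1 + ?L2 + ?L3 = 0" using field_le_epsilon[of "\<bar>?L1 + ?L2 + ?L3\<bar>" 0] by simp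
  have lborel_form: "(LINT x|M. (p x * q x) * \<psi> x) = (\<integral>x. P x * (Q x * \<psi> x) \<partial>lborel)"
    if P: "P \<in> borel_measurable borel" "AE x in lborel. indicator \<Omega> x * p x = P x" "p \<in> borel_measurable M"
      and Q: "Q \<in> borel_measurable borel" "AE x in lborel. indicator \<Omega> x * q x = Q x" "q \<in> borel_measurable M"
      and \<psi>: "\<psi> \<in> borel_measurable borel" for p q P Q \<psi> :: "real^'d \<Rightarrow> real"
  proof -
    have ae: "AE x in lebesgue. indicator \<Omega> x * p x = P x \<and> indicator \<Omega> x * q x = Q x"
      using AE_completion[OF P(2)] AE_completion[OF Q(2)] by simp
    have pm: "(\<lambda>x. if x \<in> \<Omega> then (p x * q x) else 0) \<in> borel_measurable lebesgue"
      using P(3) Q(3) by (intro borel_measurable_if_I) auto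
    have "(LINT x|M. (p x * q x) * \<psi> x) = (LINT x|lebesgue. (if x \<in> \<Omega> then (p x * q x) else 0) * \<psi> x)"
      unfolding lebesgue_on_integral_indicator[OF dom_sets]
      by (rule Bochner_Integration.integral_cong[OF refl]) auto
    also have "\<dots> = (LINT x|lebesgue. P x * (Q x * \<psi> x))"
    proof (rule integral_cong_AE)
      show "(\<lambda>x. P x * (Q x * \<psi> x)) \<in> borel_measurable lebesgue"
        by (intro borel_measurable_times measurable_completion) (use P Q \<psi> in auto)
      show "(\<lambda>x. (if x \<in> \<Omega> then (p x * q x) else 0) * \<psi> x) \<in> borel_measurable lebesgue"
        by (intro borel_measurable_times pm measurable_completion) (use \<psi> in auto)
      show "AE x in lebesgue. (if x \<in> \<Omega> then (p x * q x) else 0) * \<psi> x = P x * (Q x * \<psi> x)"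
        using ae by eventually_elim (auto simp: indicator_def split: if_splits)
    qed
    also have "\<dots> = (\<integral>x. P x * (Q x * \<psi> x) \<partial>lborel)"
      by (rule integral_completion) (use P Q \<psi> in simp)
    finally show ?thesis .
  qed
  have am: "a \<in> borel_measurable M" "b \<in> borel_measurable M" using a b by (auto simp: Linf_def)
  have e1: "(LINT x|M. (a x * w x) * partial_deriv i \<phi> x) = ?L1"
    unfolding h1_def by (rule lborel_form[OF A(1,4) am(1) W(1,2) L2_measurable[OF w] \<phi>m(2)])
  have e2: "(LINT x|M. (b x * w x) * \<phi> x) = ?L2"
    unfolding h2_def by (rule lborel_form[OF B(1,4) am(2) W(1,2) L2_measurable[OF w] \<phi>m(1)])
  have e3: "(LINT x|M. (a x * g x) * \<phi> x) = ?L3"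
    unfolding h3_def by (rule lborel_form[OF A(1,4) am(1) G(1,2) L2_measurable[OF g] \<phi>m(1)])
  have "(LINT x|M. (b x * w x + a x * g x) * \<phi> x) = (LINT x|M. (b x * w x) * \<phi> x) + (LINT x|M. (a x * g x) * \<phi> x)"
    using L2_integrable_mult[OF L2_Linf_mult[OF b w] test_function_L2[OF \<phi>]]
      L2_integrable_mult[OF L2_Linf_mult[OF a g] test_function_L2[OF \<phi>]] by (simp add: distrib_right)
  then show "(LINT x|M. a x * w x * multi_partial (unit_index i) \<phi> x) =
      (- 1) ^ sum (unit_index i) UNIV * (LINT x|M. (b x * w x + a x * g x) * \<phi> x)"
    using L e1 e2 e3 by (simp add: multi_partial_unit_index sum_unit_index)
qed

section \<open>Multipliers of Sobolev spaces\<close>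

lemma weak_deriv_index_add:
  assumes g: "is_weak_deriv \<Omega> (unit_index i) w g"
  shows "is_weak_deriv \<Omega> \<alpha> g k \<longleftrightarrow> is_weak_deriv \<Omega> (index_add \<alpha> i) w k"
proof -
  have "(LINT x|M. w x * multi_partial (index_add \<alpha> i) \<phi> x) = - (LINT x|M. g x * multi_partial \<alpha> \<phi> x)"
    if \<phi>: "\<phi> \<in> test_functions \<Omega>" for \<phi>
    using g test_functions_multi_partial[OF \<phi>, of \<alpha>] unfolding is_weak_deriv_def
    by (simp add: multi_partial_index_add[OF test_functions_smooth[OF \<phi>]] multi_partial_unit_index sum_unit_index)
  then show ?thesis using g unfolding is_weak_deriv_def by (auto simp: sum_index_add)
qed

text \<open>The common form of \<open>H\<^sup>n\<close> and \<open>W\<^sup>n\<^sup>,\<^sup>\<infinity>\<close>, both of which can be described recursively by first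
derivatives.\<close>

definition sobolev :: "(real^'d \<Rightarrow> real) set \<Rightarrow> nat \<Rightarrow> (real^'d \<Rightarrow> real) set" where
  "sobolev P n = {w \<in> P. \<forall>\<alpha>\<in>multi_indices n. \<exists>g\<in>P. is_weak_deriv \<Omega> \<alpha> w g}"

lemma Hm_sobolev: "\<H> n = sobolev (L2 \<Omega>) n"
  by (simp add: Hm_def sobolev_def)

lemma Winf_sobolev: "Winf n \<Omega> = sobolev (Linf \<Omega>) n"
  by (simp add: Winf_def sobolev_def)

lemma sobolev_Suc:
  assumes P: "\<And>w. w \<in> P \<Longrightarrow> locally_integrable \<Omega> w"
  shows "w \<in> sobolev P (Suc n) \<longleftrightarrow> w \<in> P \<and> (\<forall>i. \<exists>g\<in>sobolev P n. is_weak_deriv \<Omega> (unit_index i) w g)"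
proof
  assume w: "w \<in> sobolev P (Suc n)"
  have "\<exists>g\<in>sobolev P n. is_weak_deriv \<Omega> (unit_index i) w g" for i
  proof -
    obtain g where g: "g \<in> P" "is_weak_deriv \<Omega> (unit_index i) w g"
      using w unit_index_mem[of i n] unfolding sobolev_def by blast
    have "\<exists>k\<in>P. is_weak_deriv \<Omega> \<alpha> g k" if "\<alpha> \<in> multi_indices n" for \<alpha>
      using w that index_add_mem[of \<alpha> i n] weak_deriv_index_add[OF g(2)] unfolding sobolev_def by blast
    then show ?thesis using g by (auto simp: sobolev_def)
  qed
  then show "w \<in> P \<and> (\<forall>i. \<exists>g\<in>sobolev P n. is_weak_deriv \<Omega> (unit_index i) w g)"
    using w by (simp add: sobolev_def)
next
  assume w: "w \<in> P \<and> (\<forall>i. \<exists>g\<in>sobolev P n. is_weak_deriv \<Omega> (unit_index i) w g)"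
  have "\<exists>k\<in>P. is_weak_deriv \<Omega> \<alpha> w k" if "\<alpha> \<in> multi_indices (Suc n)" for \<alpha>
    using that
  proof (cases rule: multi_indices_Suc_cases)
    case 1
    then show ?thesis using w is_weak_deriv_0[OF P] by blast
  next
    case (2 i \<beta>)
    obtain g where g: "g \<in> sobolev P n" "is_weak_deriv \<Omega> (unit_index i) w g" using w by blast
    then show ?thesis using 2 weak_deriv_index_add[OF g(2)] unfolding sobolev_def by blast
  qed
  then show "w \<in> sobolev P (Suc n)" using w by (simp add: sobolev_def)
qed

lemma Hm_Suc: "w \<in> \<H> (Suc n) \<longleftrightarrow>
    w \<in> L2 \<Omega> \<and> (\<forall>i. \<exists>g\<in>\<H> n. is_weak_deriv \<Omega> (unit_index i) w g)"
  unfolding Hm_sobolev by (rule sobolev_Suc) (rule L2_locally_integrable)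

lemma Winf_Suc: "w \<in> Winf (Suc n) \<Omega> \<longleftrightarrow>
    w \<in> Linf \<Omega> \<and> (\<forall>i. \<exists>g\<in>Winf n \<Omega>. is_weak_deriv \<Omega> (unit_index i) w g)"
  unfolding Winf_sobolev by (rule sobolev_Suc) (rule L2_locally_integrable[OF Linf_imp_L2])

lemma multi_indices_mono: "n \<le> m \<Longrightarrow> multi_indices n \<subseteq> multi_indices m"
  by (auto simp: multi_indices_def)

lemma Hm_mono: "w \<in> \<H> m \<Longrightarrow> n \<le> m \<Longrightarrow> w \<in> \<H> n"
  unfolding Hm_iff using multi_indices_mono by blast

lemma Winf_mono: "a \<in> Winf m \<Omega> \<Longrightarrow> n \<le> m \<Longrightarrow> a \<in> Winf n \<Omega>"
  unfolding Winf_def using multi_indices_mono by blast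

lemma fnorm_Hm_leI:
  assumes w: "w \<in> \<H> m"
    and c: "\<And>\<alpha>. \<alpha> \<in> multi_indices m \<Longrightarrow> \<exists>g. is_weak_deriv \<Omega> \<alpha> w g \<and> g \<in> L2 \<Omega> \<and> sqrt (ip g g) \<le> c"
  shows "fnorm (Hm m \<Omega>) w \<le> real (card (multi_indices m :: ('d \<Rightarrow> nat) set)) * c"
proof -
  have le: "sqrt (ip (weak_deriv \<Omega> \<alpha> w) (weak_deriv \<Omega> \<alpha> w)) \<le> c" if \<alpha>: "\<alpha> \<in> multi_indices m" for \<alpha>
  proof -
    obtain g where g: "is_weak_deriv \<Omega> \<alpha> w g" "g \<in> L2 \<Omega>" "sqrt (ip g g) \<le> c" using c[OF \<alpha>] by blast
    have "ip (weak_deriv \<Omega> \<alpha> w) (weak_deriv \<Omega> \<alpha> w) = ip g g"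
      by (intro ip_cong_AE weak_deriv_AE_eq g Hm_weak_deriv[OF w \<alpha>])
    then show ?thesis using g(3) by simp
  qed
  have nn: "0 \<le> ip (weak_deriv \<Omega> \<alpha> w) (weak_deriv \<Omega> \<alpha> w)" if "\<alpha> \<in> multi_indices m" for \<alpha>
    using that by (intro L2.B_nonneg Hm_weak_deriv[OF w])
  have "fnorm (Hm m \<Omega>) w = L2_set (\<lambda>\<alpha>. sqrt (ip (weak_deriv \<Omega> \<alpha> w) (weak_deriv \<Omega> \<alpha> w))) (multi_indices m)"
    unfolding fnorm_Hm ipH_def L2_set_def using nn by (intro arg_cong[of _ _ sqrt] sum.cong) auto
  also have "\<dots> \<le> (\<Sum>\<alpha>\<in>multi_indices m. sqrt (ip (weak_deriv \<Omega> \<alpha> w) (weak_deriv \<Omega> \<alpha> w)))"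
    by (rule L2_set_le_sum) (use nn in auto)
  also have "\<dots> \<le> (\<Sum>\<alpha>\<in>(multi_indices m :: ('d \<Rightarrow> nat) set). c)" by (intro sum_mono le)
  finally show ?thesis by simp
qed

definition multiplier :: "nat \<Rightarrow> (real^'d \<Rightarrow> real) \<Rightarrow> real \<Rightarrow> bool" where
  "multiplier n a C \<longleftrightarrow> 0 \<le> C \<and> (\<forall>w\<in>\<H> n. (\<lambda>x. a x * w x) \<in> \<H> n \<and>
     fnorm (Hm n \<Omega>) (\<lambda>x. a x * w x) \<le> C * fnorm (Hm n \<Omega>) w)"

text \<open>By the product rule the first derivatives of \<open>a w\<close> are \<open>b\<^sub>i w + a g\<^sub>i\<close>, to which the induction hypothesis
applies for both \<open>b\<^sub>i\<close> and \<open>a\<close>.\<close>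

theorem Winf_multiplier: "a \<in> Winf n \<Omega> \<Longrightarrow> \<exists>C. multiplier n a C"
proof (induction n arbitrary: a)
  case (0 a)
  have aL: "a \<in> Linf \<Omega>" using 0 by (simp add: Winf_def)
  obtain c where c: "0 \<le> c" "\<And>v. v \<in> L2 \<Omega> \<Longrightarrow> sqrt (ip (\<lambda>x. a x * v x) (\<lambda>x. a x * v x)) \<le> c * sqrt (ip v v)"
    using Linf_mult_bound[OF aL] by blast
  have m0: "(multi_indices 0 :: ('d \<Rightarrow> nat) set) = {\<lambda>_. 0}" by (auto simp: multi_indices_def)
  have "(\<lambda>x. a x * w x) \<in> \<H> 0 \<and> fnorm (Hm 0 \<Omega>) (\<lambda>x. a x * w x) \<le> c * fnorm (Hm 0 \<Omega>) w"
    if w: "w \<in> \<H> 0" for w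
  proof -
    have awL: "(\<lambda>x. a x * w x) \<in> L2 \<Omega>" by (rule L2_Linf_mult[OF aL Hm_L2[OF w]])
    have d0: "is_weak_deriv \<Omega> (\<lambda>_. 0) (\<lambda>x. a x * w x) (\<lambda>x. a x * w x)"
      by (rule is_weak_deriv_0[OF L2_locally_integrable[OF awL]])
    have H: "(\<lambda>x. a x * w x) \<in> \<H> 0" unfolding Hm_iff m0 using awL d0 by blast
    have "sqrt (ip (\<lambda>x. a x * w x) (\<lambda>x. a x * w x)) \<le> c * sqrt (ip w w)"
      by (rule c(2)[OF Hm_L2[OF w]])
    also have "\<dots> \<le> c * fnorm (Hm 0 \<Omega>) w" by (intro mult_left_mono L2_norm_le_Hm w c)
    finally have "fnorm (Hm 0 \<Omega>) (\<lambda>x. a x * w x) \<le> real (card (multi_indices 0 :: ('d \<Rightarrow> nat) set)) * (c * fnorm (Hm 0 \<Omega>) w)"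
      using d0 awL by (intro fnorm_Hm_leI[OF H]) (auto simp: m0)
    then show ?thesis using H by (simp add: m0)
  qed
  then show ?case using c(1) unfolding multiplier_def by blast
next
  case (Suc n a)
  have aL: "a \<in> Linf \<Omega>" using Suc.prems by (simp add: Winf_def)
  have an: "a \<in> Winf n \<Omega>" by (rule Winf_mono[OF Suc.prems]) simp
  have "\<exists>b\<in>Winf n \<Omega>. is_weak_deriv \<Omega> (unit_index i) a b" for i using Suc.prems Winf_Suc by blast
  then obtain b where b: "\<And>i. b i \<in> Winf n \<Omega>" "\<And>i. is_weak_deriv \<Omega> (unit_index i) a (b i)" by metis
  have bL: "b i \<in> Linf \<Omega>" for i using b(1)[of i] by (simp add: Winf_def)
  obtain Ca where Ca: "0 \<le> Ca" "\<And>w. w \<in> \<H> n \<Longrightarrow> (\<lambda>x. a x * w x) \<in> \<H> n \<and>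
     fnorm (Hm n \<Omega>) (\<lambda>x. a x * w x) \<le> Ca * fnorm (Hm n \<Omega>) w" using Suc.IH[OF an] unfolding multiplier_def by blast
  obtain Cb where "\<And>i. multiplier n (b i) (Cb i)" using Suc.IH[OF b(1)] by metis
  then have Cb: "\<And>i. 0 \<le> Cb i" "\<And>i w. w \<in> \<H> n \<Longrightarrow> (\<lambda>x. b i x * w x) \<in> \<H> n \<and>
     fnorm (Hm n \<Omega>) (\<lambda>x. b i x * w x) \<le> Cb i * fnorm (Hm n \<Omega>) w" unfolding multiplier_def by blast+
  obtain c where c: "0 \<le> c" "\<And>v. v \<in> L2 \<Omega> \<Longrightarrow> sqrt (ip (\<lambda>x. a x * v x) (\<lambda>x. a x * v x)) \<le> c * sqrt (ip v v)"
    using Linf_mult_bound[OF aL] by blast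
  let ?N = "real (card (multi_indices n :: ('d \<Rightarrow> nat) set))"
  let ?N1 = "real (card (multi_indices (Suc n) :: ('d \<Rightarrow> nat) set))"
  define C where "C = c + ((\<Sum>i\<in>UNIV. Cb i) * ?N + Ca * ?N)"
  have C0: "0 \<le> C" using Ca(1) Cb(1) c(1) by (simp add: C_def sum_nonneg)
  have main: "(\<lambda>x. a x * w x) \<in> \<H> (Suc n) \<and>
     fnorm (Hm (Suc n) \<Omega>) (\<lambda>x. a x * w x) \<le> (?N1 * C) * fnorm (Hm (Suc n) \<Omega>) w"
    if w: "w \<in> \<H> (Suc n)" for w
  proof -
    let ?f = "fnorm (Hm (Suc n) \<Omega>) w"
    have f0: "0 \<le> ?f" by (rule fspace.fnorm_nonneg[OF fspace_Hm w])
    have wL: "w \<in> L2 \<Omega>" by (rule Hm_L2[OF w])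
    have wn: "w \<in> \<H> n" by (rule Hm_mono[OF w]) simp
    have "\<exists>g\<in>\<H> n. is_weak_deriv \<Omega> (unit_index i) w g" for i using w Hm_Suc by blast
    then obtain g where g: "\<And>i. g i \<in> \<H> n" "\<And>i. is_weak_deriv \<Omega> (unit_index i) w (g i)" by metis
    have awL: "(\<lambda>x. a x * w x) \<in> L2 \<Omega>" by (rule L2_Linf_mult[OF aL wL])
    have w_le: "fnorm (Hm n \<Omega>) w \<le> ?N * ?f"
    proof (rule fnorm_Hm_leI[OF wn])
      fix \<alpha> :: "'d \<Rightarrow> nat" assume "\<alpha> \<in> multi_indices n"
      then have "\<alpha> \<in> multi_indices (Suc n)" using multi_indices_mono[of n "Suc n"] by auto
      then show "\<exists>h. is_weak_deriv \<Omega> \<alpha> w h \<and> h \<in> L2 \<Omega> \<and> sqrt (ip h h) \<le> ?f"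
        using Hm_weak_deriv[OF w] L2_norm_weak_deriv_le[OF w] by blast
    qed
    have g_le: "fnorm (Hm n \<Omega>) (g i) \<le> ?N * ?f" for i
    proof (rule fnorm_Hm_leI[OF g(1)])
      fix \<alpha> :: "'d \<Rightarrow> nat" assume "\<alpha> \<in> multi_indices n"
      then have "index_add \<alpha> i \<in> multi_indices (Suc n)" by (simp add: index_add_mem)
      then show "\<exists>h. is_weak_deriv \<Omega> \<alpha> (g i) h \<and> h \<in> L2 \<Omega> \<and> sqrt (ip h h) \<le> ?f"
        using Hm_weak_deriv[OF w] L2_norm_weak_deriv_le[OF w] weak_deriv_index_add[OF g(2)] by blast
    qed
    define k where "k i = (\<lambda>x. b i x * w x + a x * g i x)" for i
    have kn: "k i \<in> \<H> n" for i
      unfolding k_def using Hm_add Cb(2)[OF wn] Ca(2)[OF g(1)] by blast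
    have dk: "is_weak_deriv \<Omega> (unit_index i) (\<lambda>x. a x * w x) (k i)" for i
      unfolding k_def by (rule weak_product_rule[OF aL bL wL Hm_L2[OF g(1)] b(2) g(2)])
    have H: "(\<lambda>x. a x * w x) \<in> \<H> (Suc n)" unfolding Hm_Suc using awL kn dk by blast
    have k_le: "fnorm (Hm n \<Omega>) (k i) \<le> C * ?f" for i
    proof -
      have "fnorm (Hm n \<Omega>) (k i) \<le> fnorm (Hm n \<Omega>) (\<lambda>x. b i x * w x) + fnorm (Hm n \<Omega>) (\<lambda>x. a x * g i x)"
        unfolding k_def using Cb(2)[OF wn] Ca(2)[OF g(1)] by (intro fspace.fnorm_triangle[OF fspace_Hm]) blast+
      also have "\<dots> \<le> Cb i * (?N * ?f) + Ca * (?N * ?f)"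
        using Cb(2)[OF wn, of i] Ca(2)[OF g(1), of i] mult_left_mono[OF w_le Cb(1)[of i]] mult_left_mono[OF g_le[of i] Ca(1)]
        by linarith
      also have "\<dots> \<le> (\<Sum>i\<in>UNIV. Cb i) * (?N * ?f) + Ca * (?N * ?f)"
        using Cb(1) f0 by (intro add_right_mono mult_right_mono member_le_sum) auto
      also have "\<dots> \<le> c * ?f + ((\<Sum>i\<in>UNIV. Cb i) * (?N * ?f) + Ca * (?N * ?f))" using f0 c(1) by simp
      also have "\<dots> = C * ?f" by (simp add: C_def algebra_simps)
      finally show ?thesis .
    qed
    have "fnorm (Hm (Suc n) \<Omega>) (\<lambda>x. a x * w x) \<le> ?N1 * (C * ?f)"
    proof (rule fnorm_Hm_leI[OF H])
      fix \<alpha> :: "'d \<Rightarrow> nat" assume "\<alpha> \<in> multi_indices (Suc n)"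
      then show "\<exists>h. is_weak_deriv \<Omega> \<alpha> (\<lambda>x. a x * w x) h \<and> h \<in> L2 \<Omega> \<and> sqrt (ip h h) \<le> C * ?f"
      proof (cases rule: multi_indices_Suc_cases)
        case 1
        have "sqrt (ip (\<lambda>x. a x * w x) (\<lambda>x. a x * w x)) \<le> c * sqrt (ip w w)"
          by (rule c(2)[OF wL])
        also have "\<dots> \<le> c * ?f" by (intro mult_left_mono L2_norm_le_Hm w c)
        also have "\<dots> \<le> C * ?f" using Ca(1) Cb(1) f0 by (intro mult_right_mono) (auto simp: C_def sum_nonneg)
        finally show ?thesis using 1 is_weak_deriv_0[OF L2_locally_integrable[OF awL]] awL by blast
      next
        case (2 i \<beta>)
        have "sqrt (ip (weak_deriv \<Omega> \<beta> (k i)) (weak_deriv \<Omega> \<beta> (k i))) \<le> C * ?f"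
          using L2_norm_weak_deriv_le[OF kn 2(2), of i] k_le[of i] by linarith
        then show ?thesis using Hm_weak_deriv[OF kn[of i] 2(2)] weak_deriv_index_add[OF dk[of i]] 2(1) by blast
      qed
    qed
    then show ?thesis using H by (simp add: mult.assoc)
  qed
  show ?case unfolding multiplier_def by (intro exI[of _ "?N1 * C"] conjI ballI main) (use C0 in auto)
qed

end

section \<open>Uniform bounds for the coefficient\<close>

lemma box_bound_from_AE:
  fixes h :: "real^'t::finite \<Rightarrow> real"
  assumes h: "continuous_on UNIV h" and ae: "AE t in lborel. t \<in> param_box \<longrightarrow> c \<le> h t" and t: "t \<in> param_box"
  shows "c \<le> h t"
proof (rule ccontr)
  assume "\<not> c \<le> h t"
  define V where "V = {s. h s < c} \<inter> box 0 1"
  have oV: "open V" unfolding V_def by (intro open_Int open_box open_Collect_less h continuous_on_const)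
  have "t \<in> closure (box 0 1)"
  proof -
    have "(\<chi> i. 1/2) \<in> box (0 :: real^'t) 1" by (simp add: mem_box_cart)
    then have "box (0 :: real^'t) 1 \<noteq> {}" by blast
    then show ?thesis using t by (simp add: closure_box param_box_cbox)
  qed
  moreover have "open {s. h s < c}" by (intro open_Collect_less h continuous_on_const)
  moreover have "t \<in> {s. h s < c}" using \<open>\<not> c \<le> h t\<close> by simp
  ultimately have "V \<noteq> {}" unfolding V_def using open_Int_closure_eq_empty[of "{s. h s < c}" "box 0 1"] by blast
  then have nV: "\<not> negligible V" using open_not_negligible[OF oV] by blast
  have "AE s in lebesgue. s \<in> param_box \<longrightarrow> c \<le> h s" by (rule AE_completion[OF ae])
  then have "AE s in lebesgue. s \<notin> V"
    by eventually_elim (auto simp: V_def param_box_cbox dest: subsetD[OF box_subset_cbox])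
  then have "V \<in> null_sets lebesgue" using oV by (subst AE_iff_null_sets) auto
  then show False using nV by (simp add: negligible_iff_null_sets)
qed

locale parametric_problem = bounded_domain \<Omega> for \<Omega> :: "(real^'d::finite) set" +
  fixes \<mu>0 :: "real^'d \<Rightarrow> real" and \<mu> :: "'t::finite \<Rightarrow> real^'d \<Rightarrow> real" and \<mu>min \<mu>max :: real
  assumes mu0: "\<mu>0 \<in> Linf \<Omega>" and mui: "\<And>i. \<mu> i \<in> Linf \<Omega>"
    and mu_pos: "0 < \<mu>min" "\<mu>min \<le> \<mu>max"
    and mu_bounds: "AE (x, t) in lebesgue_on (\<Omega> \<times> param_box).
        \<mu>min \<le> affine_param \<mu>0 \<mu> t x \<and> affine_param \<mu>0 \<mu> t x \<le> \<mu>max"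
begin

abbreviation mu :: "real^'t \<Rightarrow> real^'d \<Rightarrow> real" where "mu \<equiv> affine_param \<mu>0 \<mu>"

text \<open>By Fubini's theorem the bounds hold for almost every \<open>x\<close> and almost every \<open>t\<close>; by continuity in \<open>t\<close> they then hold
for all \<open>t\<close>, with an exceptional set of points \<open>x\<close> that does not depend on \<open>t\<close>.\<close>

lemma mu_bounds_all: "AE x in M. \<forall>t\<in>param_box. \<mu>min \<le> mu t x \<and> mu t x \<le> \<mu>max"
proof -
  have "\<Omega> \<times> (param_box :: (real^'t) set) \<in> sets (borel \<Otimes>\<^sub>M borel)"
    using open_dom by (intro pair_measureI) (auto simp: param_box_cbox)
  then have "\<Omega> \<times> (param_box :: (real^'t) set) \<in> sets lebesgue"
    unfolding borel_prod by (simp add: sets_completionI_sub)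
  then have "AE z in lebesgue. z \<in> \<Omega> \<times> param_box \<longrightarrow>
      (case z of (x, t) \<Rightarrow> \<mu>min \<le> mu t x \<and> mu t x \<le> \<mu>max)"
    using mu_bounds by (simp add: AE_restrict_space_iff)
  then have "AE z in lborel. z \<in> \<Omega> \<times> param_box \<longrightarrow>
      (case z of (x, t) \<Rightarrow> \<mu>min \<le> mu t x \<and> mu t x \<le> \<mu>max)"
    by (simp add: AE_completion_iff)
  then have "AE z in lborel \<Otimes>\<^sub>M lborel. z \<in> \<Omega> \<times> param_box \<longrightarrow>
      (case z of (x, t) \<Rightarrow> \<mu>min \<le> mu t x \<and> mu t x \<le> \<mu>max)"
    unfolding lborel_prod .
  from lborel_pair.AE_pair[OF this]
  have "AE x in lborel. x \<in> \<Omega> \<longrightarrow> (\<forall>t\<in>param_box. \<mu>min \<le> mu t x \<and> mu t x \<le> \<mu>max)"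
  proof eventually_elim
    case (elim x)
    show ?case
    proof (intro impI ballI)
      fix t :: "real^'t" assume x: "x \<in> \<Omega>" and t: "t \<in> param_box"
      have c: "continuous_on UNIV (\<lambda>t. mu t x)" "continuous_on UNIV (\<lambda>t. - mu t x)"
        unfolding affine_param_def by (intro continuous_intros)+
      have "\<mu>min \<le> mu t x"
        by (rule box_bound_from_AE[OF c(1) _ t]) (use elim x in \<open>auto elim: AE_mp\<close>)
      moreover have "- \<mu>max \<le> - mu t x"
        by (rule box_bound_from_AE[OF c(2) _ t]) (use elim x in \<open>auto elim: AE_mp\<close>)
      ultimately show "\<mu>min \<le> mu t x \<and> mu t x \<le> \<mu>max" by simp
    qed
  qed
  then have "AE x in lebesgue. x \<in> \<Omega> \<longrightarrow> (\<forall>t\<in>param_box. \<mu>min \<le> mu t x \<and> mu t x \<le> \<mu>max)" by (rule AE_completion)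
  then show ?thesis by (simp add: AE_restrict_space_iff)
qed

section \<open>The energy form\<close>

lemma Linf_measurable: "a \<in> Linf \<Omega> \<Longrightarrow> a \<in> borel_measurable M"
  by (simp add: Linf_def)

lemma mu_measurable: "mu t \<in> borel_measurable M"
  unfolding affine_param_def using Linf_measurable[OF mu0] Linf_measurable[OF mui] by measurable

lemma mu_AE: "t \<in> param_box \<Longrightarrow> AE x in M. \<mu>min \<le> mu t x \<and> mu t x \<le> \<mu>max"
  using mu_bounds_all by eventually_elim blast

lemma mu_abs_AE: assumes t: "t \<in> param_box" shows "AE x in M. \<bar>mu t x\<bar> \<le> \<mu>max"
  using mu_AE[OF t] by eventually_elim (use mu_pos in auto)

lemma mu_times_L2: "v \<in> L2 \<Omega> \<Longrightarrow> (\<lambda>x. \<mu> i x * v x) \<in> L2 \<Omega>" "v \<in> L2 \<Omega> \<Longrightarrow> (\<lambda>x. \<mu>0 x * v x) \<in> L2 \<Omega>"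
  by (intro L2_Linf_mult mui mu0; assumption)+

lemma ip_mu:
  assumes "v \<in> L2 \<Omega>" "w \<in> L2 \<Omega>"
  shows "ip (\<lambda>x. mu t x * v x) w = ip (\<lambda>x. \<mu>0 x * v x) w + (\<Sum>i\<in>UNIV. t $ i * ip (\<lambda>x. \<mu> i x * v x) w)"
proof -
  have i0: "integrable M (\<lambda>x. \<mu>0 x * v x * w x)" by (rule L2_integrable_mult[OF mu_times_L2(2)[OF assms(1)] assms(2)])
  have ii: "integrable M (\<lambda>x. t $ i * (\<mu> i x * v x * w x))" for i
    by (rule integrable_mult_right[OF L2_integrable_mult[OF mu_times_L2(1)[OF assms(1)] assms(2)]])
  have "ip (\<lambda>x. mu t x * v x) w = (LINT x|M. \<mu>0 x * v x * w x + (\<Sum>i\<in>UNIV. t $ i * (\<mu> i x * v x * w x)))"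
    unfolding ip_def affine_param_def by (simp add: distrib_right sum_distrib_right mult.assoc)
  also have "\<dots> = (LINT x|M. \<mu>0 x * v x * w x) + (\<Sum>i\<in>UNIV. LINT x|M. t $ i * (\<mu> i x * v x * w x))"
    using i0 ii by (subst Bochner_Integration.integral_add) (auto simp: Bochner_Integration.integral_sum)
  finally show ?thesis by (simp add: ip_def)
qed

lemma mu_L2: assumes "t \<in> param_box" "v \<in> L2 \<Omega>" shows "(\<lambda>x. mu t x * v x) \<in> L2 \<Omega>"
  using mu_measurable[of t] mu_abs_AE[OF assms(1)] by (intro L2_Linf_mult assms) (auto simp: Linf_def)

definition energy :: "real^'t \<Rightarrow> (real^'d \<Rightarrow> real) \<Rightarrow> (real^'d \<Rightarrow> real) \<Rightarrow> real" where
  "energy t v w = gip v w + ip (\<lambda>x. mu t x * v x) w"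

lemma energy_shift:
  assumes "v \<in> V" "w \<in> V"
  shows "energy s v w = energy t v w + (\<Sum>i\<in>UNIV. (s $ i - t $ i) * ip (\<lambda>x. \<mu> i x * v x) w)"
  by (simp add: energy_def ip_mu[OF assms[THEN H10_L2]] left_diff_distrib sum_subtractf)

lemma semi_inner_energy:
  assumes t: "t \<in> param_box" shows "semi_inner (V) (energy t)"
proof
  fix u v w :: "real^'d \<Rightarrow> real" and c :: real
  assume u: "u \<in> V" and w: "w \<in> V"
  note L = u[THEN H10_L2] w[THEN H10_L2]
  have "ip (\<lambda>x. mu t x * (c * u x)) w = c * ip (\<lambda>x. mu t x * u x) w"
    using L2.B_cmult[OF mu_L2[OF t L(1)] L(2), of c] by (simp add: mult.left_commute)
  then show "energy t (\<lambda>x. c * u x) w = c * energy t u w"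
    by (simp add: energy_def H10.B_cmult[OF u w] distrib_left)
  show "energy t u w = energy t w u"
    using H10.B_sym[OF u w] by (simp add: energy_def ip_def mult_ac)
  have "AE x in M. 0 \<le> mu t x * u x * u x"
    using mu_AE[OF t] by eventually_elim (use mu_pos in \<open>auto simp: mult.assoc intro!: mult_nonneg_nonneg\<close>)
  then have "0 \<le> ip (\<lambda>x. mu t x * u x) u" unfolding ip_def by (rule integral_nonneg_AE)
  then show "0 \<le> energy t u u" by (simp add: energy_def gip_nonneg)
  assume v: "v \<in> V"
  have "ip (\<lambda>x. mu t x * (u x + v x)) w = ip (\<lambda>x. mu t x * u x) w + ip (\<lambda>x. mu t x * v x) w"
    using L2.B_add[OF mu_L2[OF t L(1)] mu_L2[OF t v[THEN H10_L2]] L(2)] by (simp add: distrib_left)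
  then show "energy t (\<lambda>x. u x + v x) w = energy t u w + energy t v w"
    by (simp add: energy_def H10.B_add[OF u v w])
qed (auto intro: H10_zero H10_add H10_cmult)

lemma energy_lower:
  assumes t: "t \<in> param_box" and v: "v \<in> V"
  shows "gip v v + \<mu>min * ip v v \<le> energy t v v"
proof -
  note L = v[THEN H10_L2]
  have "\<mu>min * ip v v = (LINT x|M. \<mu>min * (v x * v x))" by (simp add: ip_def)
  also have "\<dots> \<le> (LINT x|M. mu t x * v x * v x)"
  proof (rule integral_mono_AE)
    show "AE x in M. \<mu>min * (v x * v x) \<le> mu t x * v x * v x"
      using mu_AE[OF t] by eventually_elim (auto simp: mult.assoc intro!: mult_right_mono)
  qed (intro integrable_mult_right L2_integrable_mult mu_L2 t L)+
  finally show ?thesis by (simp add: energy_def ip_def)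
qed

lemma gip_le_energy: assumes t: "t \<in> param_box" and v: "v \<in> V" shows "gip v v \<le> energy t v v"
  using energy_lower[OF t v] mult_nonneg_nonneg[OF less_imp_le[OF mu_pos(1)] L2.B_nonneg[OF v[THEN H10_L2]]] by linarith

definition energy_const :: real where "energy_const = 1 + \<mu>max * poincare_const\<^sup>2"

lemma energy_upper:
  assumes t: "t \<in> param_box" and v: "v \<in> V"
  shows "energy t v v \<le> energy_const * gip v v" "1 \<le> energy_const"
proof -
  note L = v[THEN H10_L2]
  have mx: "0 \<le> \<mu>max" using mu_pos by simp
  have "(LINT x|M. mu t x * v x * v x) \<le> (LINT x|M. \<mu>max * (v x * v x))"
  proof (rule integral_mono_AE)
    show "AE x in M. mu t x * v x * v x \<le> \<mu>max * (v x * v x)"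
      using mu_AE[OF t] by eventually_elim (auto simp: mult.assoc intro!: mult_right_mono)
  qed (intro integrable_mult_right L2_integrable_mult mu_L2 t L)+
  then have "energy t v v \<le> gip v v + \<mu>max * ip v v" by (simp add: energy_def ip_def)
  also have "ip v v \<le> (poincare_const * sqrt (gip v v))\<^sup>2"
    using power_mono[OF poincare_const(2)[OF v], of 2] L2.B_nonneg[OF L] by (simp add: fnorm_H10)
  then have "gip v v + \<mu>max * ip v v \<le> gip v v + \<mu>max * (poincare_const * sqrt (gip v v))\<^sup>2"
    using mx by (intro add_left_mono mult_left_mono)
  also have "\<dots> = energy_const * gip v v"
    using gip_nonneg[of v] by (simp add: energy_const_def power_mult_distrib algebra_simps)
  finally show "energy t v v \<le> energy_const * gip v v" .
  show "1 \<le> energy_const" using mx by (simp add: energy_const_def)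
qed

lemma semi_hilbert_energy:
  assumes t: "t \<in> param_box" shows "semi_hilbert (V) (energy t)"
proof (rule semi_hilbert.semi_hilbert_of_equivalent[OF semi_hilbert_gip semi_inner_energy[OF t] order_refl])
  show c: "0 \<le> sqrt energy_const" using energy_upper(2)[OF t H10_zero] by simp
  fix v assume v: "v \<in> V"
  show "sqrt (energy t v v) \<le> sqrt energy_const * sqrt (gip v v)"
    unfolding real_sqrt_mult[symmetric] by (intro real_sqrt_le_mono energy_upper t v)
  have "sqrt (gip v v) \<le> sqrt (energy t v v)" by (intro real_sqrt_le_mono gip_le_energy t v)
  also have "\<dots> \<le> sqrt energy_const * sqrt (energy t v v)"
    using energy_upper(2)[OF t v] semi_inner.B_nonneg[OF semi_inner_energy[OF t] v]
      mult_right_mono[of 1 "sqrt energy_const" "sqrt (energy t v v)"] by simp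
  finally show "sqrt (gip v v) \<le> sqrt energy_const * sqrt (energy t v v)" .
qed

lemma energy_bound:
  assumes t: "t \<in> param_box" and v: "v \<in> V" and w: "w \<in> V"
  shows "\<bar>energy t v w\<bar> \<le> energy_const * nrm v * nrm w"
proof -
  interpret e: semi_inner "V" "energy t" by (rule semi_inner_energy[OF t])
  have c: "0 \<le> energy_const" using energy_upper(2)[OF t v] by simp
  have "\<bar>energy t v w\<bar> \<le> sqrt (energy t v v) * sqrt (energy t w w)" by (rule e.Cauchy_Schwarz[OF v w])
  also have "\<dots> \<le> sqrt (energy_const * gip v v) * sqrt (energy_const * gip w w)"
    by (intro mult_mono real_sqrt_le_mono energy_upper t v w) (auto intro: c gip_nonneg e.B_nonneg v w mult_nonneg_nonneg)
  also have "\<dots> = energy_const * nrm v * nrm w"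
    using c by (simp add: real_sqrt_mult fnorm_H10)
  finally show ?thesis .
qed

section \<open>The solution operator\<close>

definition solves :: "real^'t \<Rightarrow> ((real^'d \<Rightarrow> real) \<Rightarrow> real) \<Rightarrow> (real^'d \<Rightarrow> real) \<Rightarrow> bool" where
  "solves t F w \<longleftrightarrow> w \<in> V \<and> (\<forall>v\<in>V. energy t w v = F v)"

text \<open>The value zero outside \<open>H10\<close> makes the functional depend linearly on \<open>w\<close> as a function on all arguments.\<close>

definition mult_functional :: "'t \<Rightarrow> (real^'d \<Rightarrow> real) \<Rightarrow> (real^'d \<Rightarrow> real) \<Rightarrow> real" where
  "mult_functional i w = (\<lambda>v. if v \<in> V then ip (\<lambda>x. \<mu> i x * w x) v else 0)"

lemma L2_functional_bound:
  assumes g: "g \<in> L2 \<Omega>" and v: "v \<in> V"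
  shows "\<bar>ip g v\<bar> \<le> sqrt (ip g g) * poincare_const * nrm v"
  using L2.Cauchy_Schwarz[OF g v[THEN H10_L2]] mult_left_mono[OF poincare_const(2)[OF v], of "sqrt (ip g g)"]
    L2.B_nonneg[OF g] by (simp add: mult.assoc)

lemma L2_functional_mem:
  assumes g: "g \<in> L2 \<Omega>"
  shows "(\<lambda>v. if v \<in> V then ip g v else 0) \<in> V'"
  by (rule Hminus1I[where C = "sqrt (ip g g) * poincare_const"])
     (use L2_functional_bound[OF g] in \<open>auto simp: L2.B_add_right L2.B_cmult_right H10_L2 H10_add H10_cmult g\<close>)

text \<open>The solution operator is the Riesz isomorphism of the energy form.  Its norm is at most one because
the energy dominates the square of the norm of the gradient.\<close>

theorem param_solver_H10: "\<exists>C'. param_solver (H10 \<Omega>) (Hminus1 \<Omega>) solves mult_functional 1 C'"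
proof -
  have "\<exists>c\<ge>0. \<forall>v\<in>L2 \<Omega>. sqrt (ip (\<lambda>x. \<mu> i x * v x) (\<lambda>x. \<mu> i x * v x)) \<le> c * sqrt (ip v v)" for i
    using Linf_mult_bound[OF mui[of i]] by metis
  then obtain c where c: "\<And>i. 0 \<le> c i"
    "\<And>i v. v \<in> L2 \<Omega> \<Longrightarrow> sqrt (ip (\<lambda>x. \<mu> i x * v x) (\<lambda>x. \<mu> i x * v x)) \<le> c i * sqrt (ip v v)" by metis
  define C' where "C' = (\<Sum>i\<in>UNIV. c i) * poincare_const\<^sup>2"
  have C'0: "0 \<le> C'" using c(1) by (simp add: C'_def sum_nonneg)
  have P: "\<bar>ip (\<lambda>x. \<mu> i x * w x) v\<bar> \<le> C' * nrm w * nrm v"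
    if w: "w \<in> V" and v: "v \<in> V" for w v i
  proof -
    note wL = w[THEN H10_L2]
    have "sqrt (ip (\<lambda>x. \<mu> i x * w x) (\<lambda>x. \<mu> i x * w x)) \<le> c i * sqrt (ip w w)" by (rule c(2)[OF wL])
    also have "\<dots> \<le> (\<Sum>i\<in>UNIV. c i) * (poincare_const * nrm w)"
      using c(1) L2.B_nonneg[OF wL] by (intro mult_mono poincare_const w member_le_sum) (auto simp: sum_nonneg)
    finally have 1: "sqrt (ip (\<lambda>x. \<mu> i x * w x) (\<lambda>x. \<mu> i x * w x)) \<le> (\<Sum>i\<in>UNIV. c i) * (poincare_const * nrm w)" .
    have "0 \<le> poincare_const * nrm v" using poincare_const(1) by (simp add: fnorm_H10 gip_nonneg)
    from mult_right_mono[OF 1 this] show ?thesis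
      using L2_functional_bound[OF mu_times_L2(1)[OF wL, of i] v] by (simp add: C'_def power2_eq_square mult_ac)
  qed
  have mm: "mult_functional i w \<in> V'" if "w \<in> V" for w i
    unfolding mult_functional_def by (rule L2_functional_mem[OF mu_times_L2(1)[OF that[THEN H10_L2]]])
  interpret XX: fspace "H10 \<Omega>" by (rule fspace_H10)
  interpret YY: fspace "Hminus1 \<Omega>" by (rule fspace_Hminus1)
  have "param_solver (H10 \<Omega>) (Hminus1 \<Omega>) solves mult_functional 1 C'"
  proof unfold_locales
    show "0 \<le> C'" by (rule C'0)
    fix s t :: "real^'t" and y z and w v assume t: "t \<in> param_box"
    interpret e: semi_hilbert "V" "energy t" by (rule semi_hilbert_energy[OF t])
    {
      assume w: "solves t y w"
      then have wH: "w \<in> V" and eq: "\<And>v. v \<in> V \<Longrightarrow> energy t w v = y v"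
        by (auto simp: solves_def)
      show "w \<in> V" by (rule wH)
      show "solves t (\<lambda>x. y x + z x) (\<lambda>x. w x + v x)" if v: "solves t z v"
        using w v by (auto simp: solves_def e.B_add H10_add)
      show "solves t (\<lambda>x. c * y x) (\<lambda>x. c * w x)" for c
        using w by (auto simp: solves_def e.B_cmult H10_cmult)
      show "nrm w \<le> 1 * nrm' y"
      proof -
        have yH: "y \<in> V'"
        proof (rule Hminus1I)
          show "\<bar>y v\<bar> \<le> (energy_const * nrm w) * nrm v" if v: "v \<in> V" for v
            using energy_bound[OF t wH v] eq[OF v] by simp
        qed (simp_all add: eq[symmetric] H10_add H10_cmult e.B_add_right e.B_cmult_right wH)
        have "gip w w \<le> energy t w w" by (rule gip_le_energy[OF t wH])
        also have "\<dots> \<le> nrm' y * nrm w"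
          using Hminus1_le[OF yH wH] eq[OF wH] by simp
        finally have "nrm w * nrm w \<le> nrm' y * nrm w"
          using gip_nonneg[of w] by (simp add: fnorm_H10)
        moreover have "0 \<le> nrm w" "0 \<le> nrm' y"
          using XX.fnorm_nonneg[OF wH] YY.fnorm_nonneg[OF yH] by auto
        ultimately show ?thesis by (cases "nrm w = 0") auto
      qed
      show "solves s (\<lambda>x. y x + (\<Sum>i\<in>UNIV. (s $ i - t $ i) * mult_functional i w x)) w"
        unfolding solves_def
      proof (intro conjI ballI wH)
        fix v assume v: "v \<in> V"
        show "energy s w v = y v + (\<Sum>i\<in>UNIV. (s $ i - t $ i) * mult_functional i w v)"
          using energy_shift[OF wH v, of s t] eq[OF v] v by (simp add: mult_functional_def)
      qed
    }
    show "\<exists>w. solves t y w" if y: "y \<in> V'"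
    proof -
      have "\<exists>w\<in>V. \<forall>v\<in>V. energy t w v = y v"
      proof (rule e.Riesz_representation)
        fix u assume u: "u \<in> V"
        have "nrm u \<le> sqrt (energy t u u)" using gip_le_energy[OF t u] by (simp add: fnorm_H10)
        from mult_left_mono[OF this YY.fnorm_nonneg[OF y]]
        show "\<bar>y u\<bar> \<le> nrm' y * sqrt (energy t u u)" using Hminus1_le[OF y u] by linarith
      qed (auto simp: Hminus1_add[OF y] Hminus1_cmult[OF y])
      then show ?thesis by (auto simp: solves_def)
    qed
  next
    fix i and w v :: "real^'d \<Rightarrow> real" and c :: real assume w: "w \<in> V"
    show "mult_functional i w \<in> V'" by (rule mm[OF w])
    show "nrm' (mult_functional i w) \<le> C' * nrm w"
      using P[OF w] C'0 XX.fnorm_nonneg[OF w] by (intro Hminus1_norm_leI) (auto simp: mult_functional_def)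
    show "mult_functional i (\<lambda>x. c * w x) = (\<lambda>x. c * mult_functional i w x)"
      using L2.B_cmult[OF mu_times_L2(1)[OF w[THEN H10_L2], of i], of _ c]
      by (auto simp: mult_functional_def fun_eq_iff H10_L2 mult.left_commute)
  next
    fix i and w v :: "real^'d \<Rightarrow> real" assume v: "v \<in> V" and w: "w \<in> V"
    show "mult_functional i (\<lambda>x. v x + w x) = (\<lambda>x. mult_functional i v x + mult_functional i w x)"
      using L2.B_add[OF mu_times_L2(1)[OF v[THEN H10_L2], of i] mu_times_L2(1)[OF w[THEN H10_L2], of i]]
      by (auto simp: mult_functional_def fun_eq_iff H10_L2 distrib_left)
  qed simp
  then show ?thesis by blast
qed

section \<open>The weak form over the parameter box\<close>

interpretation XX: fspace "H10 \<Omega>" by (rule fspace_H10)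
interpretation YY: fspace "Hminus1 \<Omega>" by (rule fspace_Hminus1)

lemma W_space_mem: "u \<in> W_space \<Omega> \<Longrightarrow> AE t in TM. u t \<in> V"
  and W_space_sm: "u \<in> W_space \<Omega> \<Longrightarrow> strongly_measurable TM (H10 \<Omega>) u"
  and W_space_int: "u \<in> W_space \<Omega> \<Longrightarrow> integrable TM (\<lambda>t. (nrm (u t))\<^sup>2)"
  by (auto simp: W_space_def bochner_L2_def strongly_measurable_def)

text \<open>Measurability comes from continuity of the form, integrability from the estimate
\<open>p q \<le> p\<^sup>2 + q\<^sup>2\<close> for the two norms.\<close>

lemma bilinear_integrable:
  fixes u v :: "real^'t \<Rightarrow> real^'d \<Rightarrow> real"
  assumes u: "u \<in> W_space \<Omega>" and v: "v \<in> W_space \<Omega>"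
    and add: "\<And>x y z. x \<in> V \<Longrightarrow> y \<in> V \<Longrightarrow> z \<in> V \<Longrightarrow> b (\<lambda>a. x a - y a) z = b x z - b y z"
      "\<And>x y z. x \<in> V \<Longrightarrow> y \<in> V \<Longrightarrow> z \<in> V \<Longrightarrow> b z (\<lambda>a. x a - y a) = b z x - b z y"
    and bd: "\<And>x y. x \<in> V \<Longrightarrow> y \<in> V \<Longrightarrow> \<bar>b x y\<bar> \<le> c * nrm x * nrm y"
    and c: "0 \<le> c"
  shows "integrable TM (\<lambda>t. b (u t) (v t) :: real)"
proof (rule Bochner_Integration.integrable_bound)
  show "integrable TM (\<lambda>t. c * ((nrm (u t))\<^sup>2 + (nrm (v t))\<^sup>2))"
    using W_space_int[OF u] W_space_int[OF v] by simp
  show "(\<lambda>t. b (u t) (v t)) \<in> borel_measurable TM"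
  proof (rule strongly_measurable_compose2[OF W_space_sm[OF u] W_space_sm[OF v]])
    fix xs x ys y
    assume m: "\<And>n. xs n \<in> V" "x \<in> V" "\<And>n. ys n \<in> V" "y \<in> V"
      and l: "(\<lambda>n::nat. nrm (\<lambda>z. xs n z - x z)) \<longlonglongrightarrow> 0" "(\<lambda>n. nrm (\<lambda>z. ys n z - y z)) \<longlonglongrightarrow> 0"
    have le: "\<bar>b (xs n) (ys n) - b x y\<bar> \<le> c * nrm (\<lambda>z. xs n z - x z) * nrm (ys n)
        + c * nrm x * nrm (\<lambda>z. ys n z - y z)" for n
      using bd[OF XX.diff_mem[OF m(1)[of n] m(2)] m(3)[of n]] bd[OF m(2) XX.diff_mem[OF m(3)[of n] m(4)]]
        add(1)[OF m(1)[of n] m(2) m(3)[of n]] add(2)[OF m(3)[of n] m(4) m(2)] by linarith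
    have lim: "(\<lambda>n. c * nrm (\<lambda>z. xs n z - x z) * nrm (ys n)
        + c * nrm x * nrm (\<lambda>z. ys n z - y z)) \<longlonglongrightarrow> c * 0 * nrm y + c * nrm x * 0"
      by (intro tendsto_intros l XX.fnorm_tendsto m)
    have "(\<lambda>n. b (xs n) (ys n) - b x y) \<longlonglongrightarrow> 0"
      by (rule Lim_null_comparison[OF always_eventually]) (use le lim in simp_all)
    then show "(\<lambda>n. b (xs n) (ys n)) \<longlonglongrightarrow> b x y" by (rule LIM_zero_cancel)
  qed
  show "AE t in TM. norm (b (u t) (v t)) \<le> norm (c * ((nrm (u t))\<^sup>2 + (nrm (v t))\<^sup>2))"
    using W_space_mem[OF u] W_space_mem[OF v]
  proof eventually_elim
    case (elim t)
    let ?p = "nrm (u t)" and ?q = "nrm (v t)"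
    have "?p * ?q \<le> ?p\<^sup>2 + ?q\<^sup>2"
      using sum_squares_bound[of ?p ?q] XX.fnorm_nonneg[OF elim(1)] XX.fnorm_nonneg[OF elim(2)]
        mult_nonneg_nonneg[of ?p ?q] by linarith
    then have "c * (?p * ?q) \<le> c * (?p\<^sup>2 + ?q\<^sup>2)" using c by (rule mult_left_mono)
    then show ?case using bd[OF elim] by (simp add: mult.assoc)
  qed
qed

lemma functional_integrable:
  fixes v :: "real^'t \<Rightarrow> real^'d \<Rightarrow> real"
  assumes F: "F \<in> V'" and v: "v \<in> W_space \<Omega>"
  shows "integrable TM (\<lambda>t. F (v t))"
proof (rule Bochner_Integration.integrable_bound)
  let ?c = "nrm' F"
  have c: "0 \<le> ?c" by (rule YY.fnorm_nonneg[OF F])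
  show "integrable TM (\<lambda>t. ?c * (1 + (nrm (v t))\<^sup>2))"
    by (rule integrable_mult_right[OF Bochner_Integration.integrable_add[OF TM_integrable_const W_space_int[OF v]]])
  show "(\<lambda>t. F (v t)) \<in> borel_measurable TM"
  proof (rule XX.strongly_measurable_functional[OF W_space_sm[OF v], where C = ?c])
    fix x y assume m: "x \<in> V" "y \<in> V"
    have "F (\<lambda>z. x z - y z) = F x - F y"
      using Hminus1_add[OF F m(1) H10_cmult[OF m(2), of "- 1"]] Hminus1_cmult[OF F m(2), of "- 1"] by simp
    then show "\<bar>F x - F y\<bar> \<le> ?c * nrm (\<lambda>z. x z - y z)"
      using Hminus1_le[OF F XX.diff_mem[OF m]] by simp
  qed
  show "AE t in TM. norm (F (v t)) \<le> norm (?c * (1 + (nrm (v t))\<^sup>2))"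
    using W_space_mem[OF v]
  proof eventually_elim
    case (elim t)
    let ?q = "nrm (v t)"
    have "?q \<le> 1 + ?q\<^sup>2" using sum_squares_bound[of 1 ?q] XX.fnorm_nonneg[OF elim] zero_le_power2[of ?q] by simp
    then have "?c * ?q \<le> ?c * (1 + ?q\<^sup>2)" using c by (rule mult_left_mono)
    then show ?case using Hminus1_le[OF F elim] c by simp
  qed
qed

lemma component_times_integrable:
  fixes h :: "real^'t \<Rightarrow> real"
  assumes h: "integrable TM h" shows "integrable TM (\<lambda>t. t $ i * h t)"
proof (rule Bochner_Integration.integrable_bound[OF h])
  have "(\<lambda>t::real^'t. t $ i) \<in> borel_measurable TM"
    by (intro measurable_restrict_space1 measurable_completion) simp
  then show "(\<lambda>t. t $ i * h t) \<in> borel_measurable TM" using h by measurable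
  show "AE t in TM. norm (t $ i * h t) \<le> norm (h t)"
  proof (rule AE_I2)
    fix t :: "real^'t" assume "t \<in> space TM"
    then have "\<bar>t $ i\<bar> \<le> 1" by (auto simp: param_box_def)
    then show "norm (t $ i * h t) \<le> norm (h t)"
      using mult_right_mono[of "\<bar>t $ i\<bar>" 1 "\<bar>h t\<bar>"] by (simp add: abs_mult)
  qed
qed

lemma load_integrable:
  fixes v :: "real^'t \<Rightarrow> real^'d \<Rightarrow> real"
  assumes "f0 \<in> V'" "\<And>i. f i \<in> V'" "v \<in> W_space \<Omega>"
  shows "integrable TM (\<lambda>t. affine_param f0 f t (v t))"
  unfolding affine_param_def
  by (intro Bochner_Integration.integrable_add Bochner_Integration.integrable_sum
      component_times_integrable functional_integrable assms)

lemma gip_integrable: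
  fixes u v :: "real^'t \<Rightarrow> real^'d \<Rightarrow> real"
  assumes "u \<in> W_space \<Omega>" "v \<in> W_space \<Omega>"
  shows "integrable TM (\<lambda>t. gip (u t) (v t))"
  by (rule bilinear_integrable[OF assms, of gip 1])
     (auto simp: H10.B_diff H10.B_diff_right fnorm_H10 H10.Cauchy_Schwarz)

lemma ip_Linf_integrable:
  fixes u v :: "real^'t \<Rightarrow> real^'d \<Rightarrow> real"
  assumes u: "u \<in> W_space \<Omega>" and v: "v \<in> W_space \<Omega>" and a: "a \<in> Linf \<Omega>"
  shows "integrable TM (\<lambda>t. ip (\<lambda>x. a x * u t x) (v t))"
proof -
  obtain c0 where c0: "0 \<le> c0"
    "\<And>v. v \<in> L2 \<Omega> \<Longrightarrow> sqrt (ip (\<lambda>x. a x * v x) (\<lambda>x. a x * v x)) \<le> c0 * sqrt (ip v v)"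
    using Linf_mult_bound[OF a] by blast
  let ?b = "\<lambda>x y. ip (\<lambda>z. a z * x z) y"
  show ?thesis
  proof (rule bilinear_integrable[OF u v, of ?b "c0 * poincare_const\<^sup>2"])
    fix x y z assume m: "x \<in> V" "y \<in> V" "z \<in> V"
    note L = m[THEN H10_L2]
    show "?b (\<lambda>a. x a - y a) z = ?b x z - ?b y z"
      using L2.B_diff[OF L2_Linf_mult[OF a L(1)] L2_Linf_mult[OF a L(2)] L(3)] by (simp add: right_diff_distrib)
    show "?b z (\<lambda>a. x a - y a) = ?b z x - ?b z y"
      by (rule L2.B_diff_right[OF L(1,2) L2_Linf_mult[OF a L(3)]])
  next
    fix x y assume m: "x \<in> V" "y \<in> V"
    note L = m[THEN H10_L2]
    have "sqrt (ip (\<lambda>z. a z * x z) (\<lambda>z. a z * x z)) \<le> c0 * sqrt (ip x x)"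
      by (rule c0(2)[OF L(1)])
    also have "\<dots> \<le> c0 * (poincare_const * nrm x)" by (intro mult_left_mono poincare_const m c0)
    finally have 1: "sqrt (ip (\<lambda>z. a z * x z) (\<lambda>z. a z * x z)) \<le> c0 * (poincare_const * nrm x)" .
    have "0 \<le> poincare_const * nrm y" using poincare_const(1) by (simp add: fnorm_H10 gip_nonneg)
    from mult_right_mono[OF 1 this]
    show "\<bar>?b x y\<bar> \<le> c0 * poincare_const\<^sup>2 * nrm x * nrm y"
      using L2_functional_bound[OF L2_Linf_mult[OF a L(1)] m(2)] by (simp add: power2_eq_square mult_ac)
  qed (use c0 in simp)
qed

lemma reaction_integrable:
  fixes u v :: "real^'t \<Rightarrow> real^'d \<Rightarrow> real"
  assumes u: "u \<in> W_space \<Omega>" and v: "v \<in> W_space \<Omega>"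
  shows "integrable TM (\<lambda>t. ip (\<lambda>x. mu t x * u t x) (v t))"
proof -
  let ?h = "\<lambda>t. ip (\<lambda>x. \<mu>0 x * u t x) (v t) + (\<Sum>i\<in>UNIV. t $ i * ip (\<lambda>x. \<mu> i x * u t x) (v t))"
  have i: "integrable TM ?h"
    by (intro Bochner_Integration.integrable_add Bochner_Integration.integrable_sum
        component_times_integrable ip_Linf_integrable u v mu0 mui)
  have ae: "AE t in TM. ?h t = ip (\<lambda>x. mu t x * u t x) (v t)"
    using W_space_mem[OF u] W_space_mem[OF v] by eventually_elim (simp add: ip_mu H10_L2)
  have "(\<lambda>t. ip (\<lambda>x. mu t x * u t x) (v t)) \<in> borel_measurable TM"
    by (rule lebesgue_on_measurable_AE_cong[OF param_box_sets borel_measurable_integrable[OF i] ae])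
  from integrable_cong_AE_imp[OF i this ae] show ?thesis .
qed

lemma energy_integrable:
  fixes u v :: "real^'t \<Rightarrow> real^'d \<Rightarrow> real"
  assumes "u \<in> W_space \<Omega>" "v \<in> W_space \<Omega>" shows "integrable TM (\<lambda>t. energy t (u t) (v t))"
  unfolding energy_def by (intro Bochner_Integration.integrable_add gip_integrable reaction_integrable assms)

lemma weak_solution_iff:
  "weak_solution \<Omega> mu f u \<longleftrightarrow> u \<in> W_space \<Omega> \<and>
    (\<forall>v\<in>W_space \<Omega>. (LINT t|TM. energy t (u t) (v t)) = (LINT t|TM. f t (v t)))"
proof -
  have "(LINT t|TM. LINT x|M. weak_grad \<Omega> (u t) x \<bullet> weak_grad \<Omega> (v t) x) +
      (LINT t|TM. LINT x|M. mu t x * u t x * v t x) = (LINT t|TM. energy t (u t) (v t))"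
    if "u \<in> W_space \<Omega>" "v \<in> W_space \<Omega>" for v
    unfolding energy_def using gip_integrable[OF that] reaction_integrable[OF that]
    by (simp add: gip_def ip_def)
  then show ?thesis unfolding weak_solution_def by auto
qed

context
  fixes f0 :: "(real^'d \<Rightarrow> real) \<Rightarrow> real" and f :: "'t \<Rightarrow> (real^'d \<Rightarrow> real) \<Rightarrow> real"
  assumes f0: "f0 \<in> V'" and f: "\<And>i. f i \<in> V'"
begin

abbreviation "F \<equiv> affine_param f0 f"

lemma load_mem: "F t \<in> V'"
  by (rule YY.affine_param_mem[OF f0]) (use f in auto)

text \<open>A pointwise solution depends on \<open>t\<close> in a Lipschitz continuous way, which makes it strongly measurable
and bounded, whichever solution is chosen for each \<open>t\<close>.\<close>

lemma pointwise_solution_exists: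
  "\<exists>w. weak_solution \<Omega> mu F w \<and> (\<forall>t\<in>param_box. solves t (F t) (w t))"
proof -
  obtain C' where "param_solver (H10 \<Omega>) (Hminus1 \<Omega>) solves mult_functional 1 C'"
    using param_solver_H10 by blast
  then interpret ps: param_solver "H10 \<Omega>" "Hminus1 \<Omega>" solves mult_functional 1 C' .
  define w where "w t = (SOME w. solves t (F t) w)" for t
  have w: "solves t (F t) (w t)" if "t \<in> param_box" for t
    unfolding w_def using ps.S_ex[OF that load_mem] by (rule someI_ex)
  have r: "range f \<subseteq> V'" using f by auto
  have sc: "XX.smooth_curve 0 (ps.growth 0 * YY.affine_bound f0 f) w"
    by (rule ps.solution_smooth_curve[OF YY.smooth_curve_affine_param[OF f0 r] YY.affine_bound_ge(2)[OF f0 r] w])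
  have wW: "w \<in> W_space \<Omega>" unfolding W_space_def by (rule XX.lipschitz_curve_bochner_L2[OF XX.smooth_curveD[OF sc]])
  have "(LINT t|TM. energy t (w t) (v t)) = (LINT t|TM. F t (v t))" if v: "v \<in> W_space \<Omega>" for v
  proof (rule integral_cong_AE)
    show "(\<lambda>t. energy t (w t) (v t)) \<in> borel_measurable TM" using energy_integrable[OF wW v] by auto
    show "(\<lambda>t. F t (v t)) \<in> borel_measurable TM" using load_integrable[OF f0 f v] by auto
    show "AE t in TM. energy t (w t) (v t) = F t (v t)"
      using W_space_mem[OF v] AE_space
    proof eventually_elim
      case (elim t)
      then show ?case using w[of t] by (simp add: solves_def)
    qed
  qed
  then show ?thesis using w wW unfolding weak_solution_iff by blast
qed

text \<open>Testing with the difference of the two solutions shows that its energy, which is nonnegative, has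
integral zero.\<close>

lemma weak_solution_unique:
  assumes u: "weak_solution \<Omega> mu F u" and w: "weak_solution \<Omega> mu F w"
  shows "AE t in TM. u t \<in> V \<and> w t \<in> V \<and>
    energy t (\<lambda>x. u t x - w t x) (\<lambda>x. u t x - w t x) = 0 \<and> (AE x in M. u t x = w t x)"
proof -
  have uW: "u \<in> W_space \<Omega>" and wW: "w \<in> W_space \<Omega>" using u w by (auto simp: weak_solution_iff)
  define d where "d t x = u t x - w t x" for t x
  have dW: "d \<in> W_space \<Omega>"
    using XX.bochner_L2_diff[of u w] uW wW by (simp add: W_space_def d_def[abs_def])
  have mem: "AE t in TM. u t \<in> V \<and> w t \<in> V"
    using W_space_mem[OF uW] W_space_mem[OF wW] by eventually_elim simp
  have nn: "AE t in TM. 0 \<le> energy t (d t) (d t)"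
    using W_space_mem[OF dW] AE_space
    by eventually_elim (auto intro: semi_inner.B_nonneg[OF semi_inner_energy])
  have split: "AE t in TM. energy t (d t) (d t) = energy t (u t) (d t) - energy t (w t) (d t)"
    using mem AE_space
  proof eventually_elim
    case (elim t)
    then have t: "t \<in> param_box" by simp
    interpret e: semi_inner "V" "energy t" by (rule semi_inner_energy[OF t])
    show ?case using elim e.B_diff[of "u t" "w t" "d t"] e.diff_mem[of "u t" "w t"] by (simp add: d_def[abs_def])
  qed
  have "(LINT t|TM. energy t (d t) (d t)) = (LINT t|TM. energy t (u t) (d t) - energy t (w t) (d t))"
    by (rule integral_cong_AE) (use split energy_integrable[OF dW dW] energy_integrable[OF uW dW] energy_integrable[OF wW dW] in auto)
  also have "\<dots> = (LINT t|TM. energy t (u t) (d t)) - (LINT t|TM. energy t (w t) (d t))"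
    using energy_integrable[OF uW dW] energy_integrable[OF wW dW] by simp
  also have "\<dots> = 0" using u w dW by (simp add: weak_solution_iff)
  finally have "AE t in TM. energy t (d t) (d t) = 0"
    using integral_nonneg_eq_0_iff_AE[OF energy_integrable[OF dW dW] nn] by simp
  then show ?thesis
    using mem W_space_mem[OF dW] AE_space
  proof eventually_elim
    case (elim t)
    then have t: "t \<in> param_box" by simp
    have "\<mu>min * ip (d t) (d t) \<le> 0" using energy_lower[OF t elim(3)] elim(1) gip_nonneg[of "d t"] by linarith
    then have "ip (d t) (d t) = 0"
      using mu_pos L2.B_nonneg[OF elim(3)[THEN H10_L2]] by (simp add: mult_le_0_iff)
    then have "AE x in M. d t x = 0" using ip_self_0_iff[OF elim(3)[THEN H10_L2]] by simp
    then show ?case using elim by (simp add: d_def[abs_def])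
  qed
qed

text \<open>The difference to the pointwise solution has energy zero, so that it is invisible to the energy form.\<close>

lemma weak_solution_pointwise:
  assumes u: "weak_solution \<Omega> mu F u" shows "AE t in TM. solves t (F t) (u t)"
proof -
  obtain w where w: "weak_solution \<Omega> mu F w" "\<And>t. t \<in> param_box \<Longrightarrow> solves t (F t) (w t)"
    using pointwise_solution_exists by blast
  show ?thesis
    using weak_solution_unique[OF u w(1)] AE_space
  proof eventually_elim
    case (elim t)
    then have t: "t \<in> param_box" by simp
    interpret e: semi_inner "V" "energy t" by (rule semi_inner_energy[OF t])
    let ?d = "\<lambda>x. u t x - w t x"
    have m: "u t \<in> V" "w t \<in> V" using elim by auto
    have "energy t (u t) v = F t v" if v: "v \<in> V" for v
    proof -
      have "\<bar>energy t ?d v\<bar> \<le> sqrt (energy t ?d ?d) * sqrt (energy t v v)"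
        by (rule e.Cauchy_Schwarz[OF e.diff_mem[OF m] v])
      then have "energy t ?d v = 0" using elim by simp
      then show ?thesis using e.B_diff[OF m v] w(2)[OF t] v by (simp add: solves_def)
    qed
    then show ?case using m by (simp add: solves_def)
  qed
qed

end

section \<open>Regularity in higher Sobolev spaces\<close>

lemma fnorm_Hm_mono:
  assumes w: "w \<in> \<H> m" and n: "n \<le> m"
  shows "fnorm (Hm n \<Omega>) w \<le> fnorm (Hm m \<Omega>) w"
  unfolding fnorm_Hm ipH_def
  by (intro real_sqrt_le_mono sum_mono2 finite_multi_indices multi_indices_mono[OF n] L2.B_nonneg Hm_weak_deriv[OF w]) auto

lemma fnorm_Hm_AE_zero:
  assumes w: "w \<in> \<H> m" and z: "AE x in M. w x = 0" shows "fnorm (Hm m \<Omega>) w = 0"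
proof -
  have "ip (weak_deriv \<Omega> \<alpha> w) (weak_deriv \<Omega> \<alpha> w) = 0" if \<alpha>: "\<alpha> \<in> multi_indices m" for \<alpha>
    using weak_deriv_of_AE_zero[OF Hm_weak_deriv(1)[OF w \<alpha>] z] ip_self_0_iff[OF Hm_weak_deriv(2)[OF w \<alpha>]] by simp
  then show ?thesis by (simp add: fnorm_Hm ipH_def)
qed

lemma solves_at_iff:
  "solves_at \<Omega> (mu t) g w \<longleftrightarrow> w \<in> V \<and> (\<forall>v\<in>V. energy t w v = ip g v)"
  by (simp add: solves_at_def energy_def gip_def ip_def)

lemma zero_if_annihilates_H10:
  assumes g: "g \<in> L2 \<Omega>" and z: "\<And>v. v \<in> V \<Longrightarrow> ip g v = 0"
  shows "AE x in M. g x = 0"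
  by (rule fundamental_lemma[OF L2_locally_integrable[OF g] open_dom])
     (use z[OF test_function_H10] in \<open>simp add: ip_def\<close>)

definition solves_Hm :: "nat \<Rightarrow> real^'t \<Rightarrow> (real^'d \<Rightarrow> real) \<Rightarrow> (real^'d \<Rightarrow> real) \<Rightarrow> bool" where
  "solves_Hm n t g w \<longleftrightarrow> g \<in> \<H> n \<and> solves_at \<Omega> (mu t) g w"

lemma solves_at_exists:
  assumes t: "t \<in> param_box" and g: "g \<in> L2 \<Omega>" shows "\<exists>w. solves_at \<Omega> (mu t) g w"
proof -
  obtain C' where "param_solver (H10 \<Omega>) (Hminus1 \<Omega>) solves mult_functional 1 C'" using param_solver_H10 by blast
  then interpret ps: param_solver "H10 \<Omega>" "Hminus1 \<Omega>" solves mult_functional 1 C' .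
  show ?thesis using ps.S_ex[OF t L2_functional_mem[OF g]] by (auto simp: solves_def solves_at_iff)
qed

text \<open>The estimate for the solution operator is the shift property; solutions themselves are those in
\<open>H10\<close>.\<close>

theorem param_solver_Hm:
  assumes muW: "\<And>i. \<mu> i \<in> Winf (m - 2) \<Omega>"
    and shift: "uniform_elliptic_shift m \<Omega> mu"
  shows "\<exists>C C'. param_solver (Hm m \<Omega>) (Hm (m - 2) \<Omega>) (solves_Hm (m - 2)) (\<lambda>i w x. \<mu> i x * w x) C C'"
proof -
  obtain C where C: "0 < C" "\<And>t g w. t \<in> param_box \<Longrightarrow> g \<in> \<H> (m - 2) \<Longrightarrow> solves_at \<Omega> (mu t) g w \<Longrightarrow>
       w \<in> \<H> m \<and> fnorm (Hm m \<Omega>) w \<le> C * fnorm (Hm (m - 2) \<Omega>) g"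
    using shift unfolding uniform_elliptic_shift_def by blast
  obtain c where "\<And>i. multiplier (m - 2) (\<mu> i) (c i)" using Winf_multiplier[OF muW] by metis
  then have c: "\<And>i. 0 \<le> c i" "\<And>i w. w \<in> \<H> (m - 2) \<Longrightarrow> (\<lambda>x. \<mu> i x * w x) \<in> \<H> (m - 2) \<and>
     fnorm (Hm (m - 2) \<Omega>) (\<lambda>x. \<mu> i x * w x) \<le> c i * fnorm (Hm (m - 2) \<Omega>) w" unfolding multiplier_def by blast+
  interpret A: fspace "Hm m \<Omega>" by (rule fspace_Hm)
  interpret B: fspace "Hm (m - 2) \<Omega>" by (rule fspace_Hm)
  have low: "w \<in> \<H> (m - 2)" "fnorm (Hm (m - 2) \<Omega>) w \<le> fnorm (Hm m \<Omega>) w" if "w \<in> \<H> m" for w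
    using Hm_mono[OF that] fnorm_Hm_mono[OF that] by auto
  have "param_solver (Hm m \<Omega>) (Hm (m - 2) \<Omega>) (solves_Hm (m - 2)) (\<lambda>i w x. \<mu> i x * w x) C (\<Sum>i\<in>UNIV. c i)"
  proof unfold_locales
    show "0 \<le> C" "0 \<le> (\<Sum>i\<in>UNIV. c i)" using C(1) c(1) by (auto simp: sum_nonneg)
    fix s t :: "real^'t" and y z and w v assume t: "t \<in> param_box"
    interpret e: semi_inner "V" "energy t" by (rule semi_inner_energy[OF t])
    {
      assume w: "solves_Hm (m - 2) t y w"
      then have yH: "y \<in> \<H> (m - 2)" and sw: "solves_at \<Omega> (mu t) y w" by (auto simp: solves_Hm_def)
      then have wH: "w \<in> V" and eq: "\<And>v. v \<in> V \<Longrightarrow> energy t w v = ip y v"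
        by (auto simp: solves_at_iff)
      show wm: "w \<in> \<H> m" and "fnorm (Hm m \<Omega>) w \<le> C * fnorm (Hm (m - 2) \<Omega>) y"
        using C(2)[OF t yH sw] by auto
      show "solves_Hm (m - 2) t (\<lambda>x. y x + z x) (\<lambda>x. w x + v x)" if v: "solves_Hm (m - 2) t z v"
        using w v by (auto simp: solves_Hm_def solves_at_iff e.B_add H10_add B.add_mem L2.B_add Hm_L2 H10_L2)
      show "solves_Hm (m - 2) t (\<lambda>x. c * y x) (\<lambda>x. c * w x)" for c
        using w by (auto simp: solves_Hm_def solves_at_iff e.B_cmult H10_cmult B.cmult_mem L2.B_cmult Hm_L2 H10_L2)
      show "solves_Hm (m - 2) s (\<lambda>x. y x + (\<Sum>i\<in>UNIV. (s $ i - t $ i) * (\<mu> i x * w x))) w"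
        unfolding solves_Hm_def solves_at_iff
      proof (intro conjI ballI)
        have mm: "(\<lambda>x. \<mu> i x * w x) \<in> \<H> (m - 2)" for i using c(2)[OF low(1)[OF wm]] by blast
        show "(\<lambda>x. y x + (\<Sum>i\<in>UNIV. (s $ i - t $ i) * (\<mu> i x * w x))) \<in> \<H> (m - 2)"
          by (intro B.add_mem B.sum_mem B.cmult_mem yH mm)
        fix v assume v: "v \<in> V"
        have i: "integrable M (\<lambda>x. y x * v x)" "integrable M (\<lambda>x. (s $ i - t $ i) * (\<mu> i x * w x * v x))" for i
          using L2_integrable_mult[OF Hm_L2[OF yH] H10_L2[OF v]]
            integrable_mult_right[OF L2_integrable_mult[OF Hm_L2[OF mm[of i]] H10_L2[OF v]], of "s $ i - t $ i"] by auto
        have "ip (\<lambda>x. y x + (\<Sum>i\<in>UNIV. (s $ i - t $ i) * (\<mu> i x * w x))) v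
            = (LINT x|M. y x * v x + (\<Sum>i\<in>UNIV. (s $ i - t $ i) * (\<mu> i x * w x * v x)))"
          unfolding ip_def by (simp add: distrib_right sum_distrib_right mult.assoc)
        also have "\<dots> = (LINT x|M. y x * v x) + (\<Sum>i\<in>UNIV. LINT x|M. (s $ i - t $ i) * (\<mu> i x * w x * v x))"
          using i by (subst Bochner_Integration.integral_add) (auto simp: Bochner_Integration.integral_sum)
        also have "\<dots> = energy s w v" using energy_shift[OF wH v, of s t] eq[OF v] by (simp add: ip_def)
        finally show "energy s w v = ip (\<lambda>x. y x + (\<Sum>i\<in>UNIV. (s $ i - t $ i) * (\<mu> i x * w x))) v" by simp
      qed (rule wH)
    }
    show "\<exists>w. solves_Hm (m - 2) t y w" if y: "y \<in> \<H> (m - 2)"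
      using solves_at_exists[OF t Hm_L2[OF y]] y by (auto simp: solves_Hm_def)
  next
    fix i and w :: "real^'d \<Rightarrow> real" assume w: "w \<in> \<H> m"
    show "(\<lambda>x. \<mu> i x * w x) \<in> \<H> (m - 2)" using c(2)[OF low(1)[OF w]] by blast
    have "c i * fnorm (Hm (m - 2) \<Omega>) w \<le> (\<Sum>i\<in>UNIV. c i) * fnorm (Hm m \<Omega>) w"
      using c(1) low[OF w] B.fnorm_nonneg by (intro mult_mono member_le_sum) (auto simp: sum_nonneg)
    then show "fnorm (Hm (m - 2) \<Omega>) (\<lambda>x. \<mu> i x * w x) \<le> (\<Sum>i\<in>UNIV. c i) * fnorm (Hm m \<Omega>) w"
      using c(2)[OF low(1)[OF w], of i] by linarith
  qed (auto simp: distrib_left mult.left_commute)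
  then show ?thesis by blast
qed

lemma negligible_avoid_shift:
  assumes N: "negligible (N :: (real^'t) set)"
  obtains t where "t \<in> param_box" "t + axis i (1/2) \<in> param_box" "t \<notin> N" "t + axis i (1/2) \<notin> N"
proof -
  \<comment> \<open>The lower half of the box in every direction, which leaves room for the shift.\<close>
  let ?V = "box (0 :: real^'t) (\<chi> i. 1/2)"
  let ?a = "axis i (1/2 :: real) :: real^'t"
  have "(\<chi> i. 1/4) \<in> ?V" by (simp add: mem_box_cart)
  then have "\<not> negligible ?V" by (intro open_not_negligible open_box) blast
  moreover have "negligible (N \<union> (\<lambda>x. - ?a + x) ` N)" by (intro negligible_Un N negligible_translation)
  ultimately have "\<not> ?V \<subseteq> N \<union> (\<lambda>x. - ?a + x) ` N" using negligible_subset by blast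
  then obtain t where t: "t \<in> ?V" "t \<notin> N" "t \<notin> (\<lambda>x. - ?a + x) ` N" by blast
  have "t + ?a \<notin> N"
  proof
    assume "t + ?a \<in> N"
    then have "- ?a + (t + ?a) \<in> (\<lambda>x. - ?a + x) ` N" by blast
    then show False using t(3) by simp
  qed
  moreover have "t \<in> param_box" "t + ?a \<in> param_box"
  proof -
    have b: "0 < t $ j" "t $ j < 1/2" for j using t(1) by (auto simp: mem_box_cart)
    have "0 \<le> t $ j \<and> t $ j \<le> 1" for j using b[of j] by linarith
    then show "t \<in> param_box" by (simp add: param_box_def)
    have "0 \<le> (t + ?a) $ j \<and> (t + ?a) $ j \<le> 1" for j using b[of j] by (cases "j = i") (auto simp: axis_def)
    then show "t + ?a \<in> param_box" unfolding param_box_def by blast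
  qed
  ultimately show ?thesis using that[of t] t(2) by blast
qed

text \<open>The coefficient \<open>f i\<close> is a difference quotient of \<open>f\<close>, hence represented by the difference quotient of \<open>g\<close> between
two points at which \<open>g\<close> represents \<open>f\<close>.  The points at distance \<open>1/2\<close> along the \<open>i\<close>-th axis are chosen so that
both lie in the box and outside a given null set.  Since representing functions are unique up to null
sets, \<open>g\<close> is affine almost everywhere.\<close>

lemma represented_affine:
  fixes g :: "real^'t \<Rightarrow> real^'d \<Rightarrow> real"
  assumes g: "AE t in TM. g t \<in> \<H> n"
    and r: "AE t in TM. represents \<Omega> (g t) (affine_param f0 f t)"
  shows "\<exists>a0 a. a0 \<in> \<H> n \<and> (\<forall>i. a i \<in> \<H> n) \<and>
    (\<forall>t. represents \<Omega> (affine_param a0 a t) (affine_param f0 f t)) \<and>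
    (AE t in TM. g t \<in> \<H> n \<and> fnorm (Hm n \<Omega>) (\<lambda>x. g t x - affine_param a0 a t x) = 0)"
proof -
  interpret B: fspace "Hm n \<Omega>" by (rule fspace_Hm)
  have rip: "represents \<Omega> h G \<longleftrightarrow> (\<forall>v\<in>V. G v = ip h v)" for h G
    by (simp add: represents_def ip_def)
  have good: "AE t in TM. g t \<in> \<H> n \<and> represents \<Omega> (g t) (affine_param f0 f t)"
    using g r by eventually_elim simp
  then obtain N where N: "N \<in> null_sets lebesgue"
    "\<And>t. t \<in> param_box \<Longrightarrow> t \<notin> N \<Longrightarrow> g t \<in> \<H> n \<and> represents \<Omega> (g t) (affine_param f0 f t)"
    unfolding AE_TM_lebesgue by (auto elim!: AE_E3)
  then have nN: "negligible N" by (simp add: negligible_iff_null_sets)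
  have "\<exists>a. a \<in> \<H> n \<and> represents \<Omega> a (f i)" for i
  proof -
    obtain t where t: "t \<in> param_box" "t + axis i (1/2) \<in> param_box" "t \<notin> N" "t + axis i (1/2) \<notin> N"
      using negligible_avoid_shift[OF nN] by blast
    let ?s = "t + axis i (1/2)"
    let ?a = "\<lambda>x. 2 * (g ?s x - g t x)"
    have gs: "g ?s \<in> \<H> n" "represents \<Omega> (g ?s) (affine_param f0 f ?s)" using N(2)[OF t(2,4)] by auto
    have gt: "g t \<in> \<H> n" "represents \<Omega> (g t) (affine_param f0 f t)" using N(2)[OF t(1,3)] by auto
    have "f i v = ip ?a v" if v: "v \<in> V" for v
    proof -
      note vL = H10_L2[OF v]
      have "affine_param f0 f ?s v - affine_param f0 f t v = (\<Sum>j\<in>UNIV. (?s $ j - t $ j) * f j v)"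
        by (simp only: affine_param_def left_diff_distrib sum_subtractf)
      also have "\<dots> = (\<Sum>j\<in>UNIV. if j = i then (1/2) * f j v else 0)"
        by (intro sum.cong refl) (auto simp: axis_def)
      also have "\<dots> = (1/2) * f i v" by simp
      finally have "(1/2) * f i v = ip (g ?s) v - ip (g t) v" using gs(2) gt(2) v unfolding rip by simp
      moreover have "ip ?a v = 2 * (ip (g ?s) v - ip (g t) v)"
        using L2.B_cmult[OF L2.diff_mem[OF Hm_L2[OF gs(1)] Hm_L2[OF gt(1)]] vL, of 2]
          L2.B_diff[OF Hm_L2[OF gs(1)] Hm_L2[OF gt(1)] vL] by simp
      ultimately show ?thesis by simp
    qed
    moreover have "?a \<in> \<H> n" by (intro B.cmult_mem B.diff_mem gs gt)
    ultimately show ?thesis unfolding rip by blast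
  qed
  then obtain a where a: "\<And>i. a i \<in> \<H> n" "\<And>i. represents \<Omega> (a i) (f i)" by metis
  have ip_sum: "ip (\<lambda>x. \<Sum>i\<in>UNIV. t $ i * a i x) v = (\<Sum>i\<in>UNIV. t $ i * f i v)" if v: "v \<in> V" for t v
  proof -
    have i: "integrable M (\<lambda>x. t $ i * (a i x * v x))" for i
      by (rule integrable_mult_right[OF L2_integrable_mult[OF Hm_L2[OF a(1)] H10_L2[OF v]]])
    have "ip (\<lambda>x. \<Sum>i\<in>UNIV. t $ i * a i x) v = (LINT x|M. (\<Sum>i\<in>UNIV. t $ i * (a i x * v x)))"
      unfolding ip_def by (simp add: sum_distrib_right mult.assoc)
    also have "\<dots> = (\<Sum>i\<in>UNIV. LINT x|M. t $ i * (a i x * v x))" by (rule Bochner_Integration.integral_sum[OF i])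
    also have "\<dots> = (\<Sum>i\<in>UNIV. t $ i * f i v)" using a(2) v by (simp add: represents_def)
    finally show ?thesis .
  qed
  have sm: "(\<lambda>x. \<Sum>i\<in>UNIV. t $ i * a i x) \<in> \<H> n" for t by (intro B.sum_mem B.cmult_mem a)
  obtain t where t: "t \<in> param_box" "t \<notin> N" using negligible_avoid_shift[OF nN] by blast
  define a0 where "a0 = (\<lambda>x. g t x - (\<Sum>i\<in>UNIV. t $ i * a i x))"
  have gt: "g t \<in> \<H> n" "represents \<Omega> (g t) (affine_param f0 f t)" using N(2)[OF t] by auto
  have a0: "a0 \<in> \<H> n" unfolding a0_def by (intro B.diff_mem gt sm)
  have f0: "f0 v = ip a0 v" if v: "v \<in> V" for v
  proof -
    have "affine_param f0 f t v = ip (g t) v" using gt(2) v unfolding rip by blast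
    then show ?thesis
      using L2.B_diff[OF Hm_L2[OF gt(1)] Hm_L2[OF sm[of t]] H10_L2[OF v]] ip_sum[OF v, of t]
      unfolding a0_def affine_param_def by linarith
  qed
  have rep: "represents \<Omega> (affine_param a0 a s) (affine_param f0 f s)" for s
    unfolding rip
  proof
    fix v assume v: "v \<in> V"
    show "affine_param f0 f s v = ip (affine_param a0 a s) v"
      using L2.B_add[OF Hm_L2[OF a0] Hm_L2[OF sm[of s]] H10_L2[OF v]] ip_sum[OF v, of s] f0[OF v]
      unfolding affine_param_def by linarith
  qed
  have ra: "range a \<subseteq> \<H> n" using a(1) by auto
  have "AE t in TM. g t \<in> \<H> n \<and> fnorm (Hm n \<Omega>) (\<lambda>x. g t x - affine_param a0 a t x) = 0"
    using good
  proof eventually_elim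
    case (elim s)
    have h: "affine_param a0 a s \<in> \<H> n" by (rule B.affine_param_mem[OF a0 ra])
    have d: "(\<lambda>x. g s x - affine_param a0 a s x) \<in> \<H> n" using elim h by (intro B.diff_mem) auto
    have "AE x in M. g s x - affine_param a0 a s x = 0"
    proof (rule zero_if_annihilates_H10[OF Hm_L2[OF d]])
      fix v assume v: "v \<in> V"
      have gL: "g s \<in> L2 \<Omega>" using elim Hm_L2 by blast
      show "ip (\<lambda>x. g s x - affine_param a0 a s x) v = 0"
        using L2.B_diff[OF gL Hm_L2[OF h] H10_L2[OF v]] elim rep[of s] v unfolding rip by simp
    qed
    then show ?case using elim fnorm_Hm_AE_zero[OF d] by simp
  qed
  then show ?thesis using a0 a(1) rep by blast
qed

theorem weak_solution_ex_unique:
  fixes f :: "'t \<Rightarrow> (real^'d \<Rightarrow> real) \<Rightarrow> real"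
  assumes f: "f0 \<in> V'" "\<forall>i. f i \<in> V'"
  shows "\<exists>u. weak_solution \<Omega> mu (affine_param f0 f) u \<and>
    (\<forall>u'. weak_solution \<Omega> mu (affine_param f0 f) u' \<longrightarrow> (AE t in TM. AE x in M. u' t x = u t x))"
proof -
  obtain u where u: "weak_solution \<Omega> mu (affine_param f0 f) u"
    using pointwise_solution_exists[of f0 f] f by auto
  have "AE t in TM. AE x in M. u' t x = u t x" if "weak_solution \<Omega> mu (affine_param f0 f) u'" for u'
    using weak_solution_unique[OF f(1) _ that u] f(2) by auto
  then show ?thesis using u by blast
qed

theorem regularity_H10:
  "\<exists>C>0. \<forall>f0 \<in> V'. \<forall>f :: 't \<Rightarrow> (real^'d \<Rightarrow> real) \<Rightarrow> real. \<forall>u.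
     (\<forall>i. f i \<in> V') \<longrightarrow> weak_solution \<Omega> mu (affine_param f0 f) u \<longrightarrow>
       u \<in> bochner_Hk k (H10 \<Omega>) \<and>
       bochner_deriv_sum k (H10 \<Omega>) u \<le> C * bochner_deriv_sum (min k 1) (Hminus1 \<Omega>) (affine_param f0 f)"
proof -
  obtain C' where "param_solver (H10 \<Omega>) (Hminus1 \<Omega>) solves mult_functional 1 C'"
    using param_solver_H10 by blast
  then interpret ps: param_solver "H10 \<Omega>" "Hminus1 \<Omega>" solves mult_functional 1 C' .
  obtain c where c: "0 < c" "\<And>a0 a g u. a0 \<in> V' \<Longrightarrow> (\<forall>i. a i \<in> V') \<Longrightarrow>
     (AE t in TM. g t \<in> V' \<and> nrm' (\<lambda>x. g t x - affine_param a0 a t x) = 0) \<Longrightarrow>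
     (AE t in TM. solves t (affine_param a0 a t) (u t)) \<Longrightarrow>
     u \<in> bochner_Hk k (H10 \<Omega>) \<and> bochner_deriv_sum k (H10 \<Omega>) u \<le> c * bochner_deriv_sum (min k 1) (Hminus1 \<Omega>) g"
    using ps.parametric_regularity[of k] by blast
  show ?thesis
  proof (intro exI[of _ c] conjI c(1) ballI allI impI)
    fix f0 u and f :: "'t \<Rightarrow> (real^'d \<Rightarrow> real) \<Rightarrow> real"
    assume f: "f0 \<in> V'" "\<forall>i. f i \<in> V'"
      and u: "weak_solution \<Omega> mu (affine_param f0 f) u"
    have fi: "\<And>i. f i \<in> V'" using f(2) by blast
    have "AE t in TM. affine_param f0 f t \<in> V' \<and>
        nrm' (\<lambda>x. affine_param f0 f t x - affine_param f0 f t x) = 0"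
      using load_mem[OF f(1) fi] by (simp add: YY.fnorm_zero)
    from c(2)[OF f this weak_solution_pointwise[OF f(1) fi u]]
    show "u \<in> bochner_Hk k (H10 \<Omega>)"
      "bochner_deriv_sum k (H10 \<Omega>) u \<le> c * bochner_deriv_sum (min k 1) (Hminus1 \<Omega>) (affine_param f0 f)"
      by auto
  qed
qed

theorem regularity_Hm:
  assumes muW: "\<forall>i. \<mu> i \<in> Winf (m - 2) \<Omega>" and shift: "uniform_elliptic_shift m \<Omega> mu"
  shows "\<exists>C>0. \<forall>f0 \<in> V'. \<forall>f :: 't \<Rightarrow> (real^'d \<Rightarrow> real) \<Rightarrow> real. \<forall>g u.
    (\<forall>i. f i \<in> V') \<longrightarrow> g \<in> bochner_Hk k (Hm (m - 2) \<Omega>) \<longrightarrow>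
    (AE t in TM. represents \<Omega> (g t) (affine_param f0 f t)) \<longrightarrow> weak_solution \<Omega> mu (affine_param f0 f) u \<longrightarrow>
      u \<in> bochner_Hk k (Hm m \<Omega>) \<and>
      bochner_deriv_sum k (Hm m \<Omega>) u \<le> C * bochner_deriv_sum (min k 1) (Hm (m - 2) \<Omega>) g"
proof -
  obtain C C' where "param_solver (Hm m \<Omega>) (Hm (m - 2) \<Omega>) (solves_Hm (m - 2)) (\<lambda>i w x. \<mu> i x * w x) C C'"
    using param_solver_Hm[OF _ shift] muW by blast
  then interpret ps: param_solver "Hm m \<Omega>" "Hm (m - 2) \<Omega>" "solves_Hm (m - 2)" "\<lambda>i w x. \<mu> i x * w x" C C' .
  obtain c where c: "0 < c" "\<And>a0 a g u. a0 \<in> \<H> (m - 2) \<Longrightarrow> (\<forall>i. a i \<in> \<H> (m - 2)) \<Longrightarrow>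
     (AE t in TM. g t \<in> \<H> (m - 2) \<and> fnorm (Hm (m - 2) \<Omega>) (\<lambda>x. g t x - affine_param a0 a t x) = 0) \<Longrightarrow>
     (AE t in TM. solves_Hm (m - 2) t (affine_param a0 a t) (u t)) \<Longrightarrow>
     u \<in> bochner_Hk k (Hm m \<Omega>) \<and> bochner_deriv_sum k (Hm m \<Omega>) u \<le> c * bochner_deriv_sum (min k 1) (Hm (m - 2) \<Omega>) g"
    using ps.parametric_regularity[of k] by blast
  show ?thesis
  proof (intro exI[of _ c] conjI c(1) ballI allI impI)
    fix f0 g u and f :: "'t \<Rightarrow> (real^'d \<Rightarrow> real) \<Rightarrow> real"
    assume f: "f0 \<in> V'" "\<forall>i. f i \<in> V'"
      and g: "g \<in> bochner_Hk k (Hm (m - 2) \<Omega>)"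
      and r: "AE t in TM. represents \<Omega> (g t) (affine_param f0 f t)"
      and u: "weak_solution \<Omega> mu (affine_param f0 f) u"
    have fi: "\<And>i. f i \<in> V'" using f(2) by blast
    have gm: "AE t in TM. g t \<in> \<H> (m - 2)"
      using g by (auto simp: bochner_Hk_def bochner_L2_def strongly_measurable_def)
    obtain a0 a where a: "a0 \<in> \<H> (m - 2)" "\<forall>i. a i \<in> \<H> (m - 2)"
      "\<And>t. represents \<Omega> (affine_param a0 a t) (affine_param f0 f t)"
      "AE t in TM. g t \<in> \<H> (m - 2) \<and> fnorm (Hm (m - 2) \<Omega>) (\<lambda>x. g t x - affine_param a0 a t x) = 0"
      using represented_affine[OF gm r] by blast
    have am: "affine_param a0 a t \<in> \<H> (m - 2)" for t
      by (rule ps.Y.affine_param_mem[OF a(1)]) (use a(2) in auto)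
    have "AE t in TM. solves_Hm (m - 2) t (affine_param a0 a t) (u t)"
      using weak_solution_pointwise[OF f(1) fi u]
    proof eventually_elim
      case (elim t)
      then show ?case
        using am[of t] a(3)[of t] by (simp add: solves_Hm_def solves_def solves_at_iff represents_def ip_def)
    qed
    from c(2)[OF a(1,2,4) this]
    show "u \<in> bochner_Hk k (Hm m \<Omega>)"
      "bochner_deriv_sum k (Hm m \<Omega>) u \<le> c * bochner_deriv_sum (min k 1) (Hm (m - 2) \<Omega>) g"
      by auto
  qed
qed

end

theorem theorem2p1:
  fixes \<Omega> :: "(real^'d::finite) set"
    and \<mu>0 :: "real^'d \<Rightarrow> real"
    and \<mu> :: "'t::finite \<Rightarrow> real^'d \<Rightarrow> real"
    and \<mu>min \<mu>max :: real
  assumes dim: "CARD('d) = 2 \<or> CARD('d) = 3"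
    and dom: "convex_polyhedral_domain \<Omega> \<or> C11_domain \<Omega>"
    and mu0: "\<mu>0 \<in> Linf \<Omega>"
    and mui: "\<And>i. \<mu> i \<in> Linf \<Omega>"
    and mu_pos: "0 < \<mu>min" "\<mu>min \<le> \<mu>max"
    and mu_bounds: "AE (x, t) in lebesgue_on (\<Omega> \<times> param_box).
        \<mu>min \<le> affine_param \<mu>0 \<mu> t x \<and> affine_param \<mu>0 \<mu> t x \<le> \<mu>max"
  shows
    "(\<forall>f0 \<in> elems (Hminus1 \<Omega>). \<forall>f :: 't \<Rightarrow> (real^'d \<Rightarrow> real) \<Rightarrow> real.
       (\<forall>i. f i \<in> elems (Hminus1 \<Omega>)) \<longrightarrow>
       (\<exists>u. weak_solution \<Omega> (affine_param \<mu>0 \<mu>) (affine_param f0 f) u \<and>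
          (\<forall>u'. weak_solution \<Omega> (affine_param \<mu>0 \<mu>) (affine_param f0 f) u' \<longrightarrow>
             (AE t in lebesgue_on param_box. AE x in lebesgue_on \<Omega>. u' t x = u t x)))) \<and>
     (\<forall>k. \<exists>C>0. \<forall>f0 \<in> elems (Hminus1 \<Omega>). \<forall>f :: 't \<Rightarrow> (real^'d \<Rightarrow> real) \<Rightarrow> real. \<forall>u.
       (\<forall>i. f i \<in> elems (Hminus1 \<Omega>)) \<longrightarrow>
       weak_solution \<Omega> (affine_param \<mu>0 \<mu>) (affine_param f0 f) u \<longrightarrow>
         u \<in> bochner_Hk k (H10 \<Omega>) \<and>
         bochner_deriv_sum k (H10 \<Omega>) u
           \<le> C * bochner_deriv_sum (min k 1) (Hminus1 \<Omega>) (affine_param f0 f)) \<and>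
     (\<forall>m\<ge>2. \<mu>0 \<in> Winf (m - 2) \<Omega> \<longrightarrow> (\<forall>i. \<mu> i \<in> Winf (m - 2) \<Omega>) \<longrightarrow>
       uniform_elliptic_shift m \<Omega> (affine_param \<mu>0 \<mu>) \<longrightarrow>
       (\<forall>k. \<exists>C>0. \<forall>f0 \<in> elems (Hminus1 \<Omega>). \<forall>f :: 't \<Rightarrow> (real^'d \<Rightarrow> real) \<Rightarrow> real. \<forall>g u.
          (\<forall>i. f i \<in> elems (Hminus1 \<Omega>)) \<longrightarrow>
          g \<in> bochner_Hk k (Hm (m - 2) \<Omega>) \<longrightarrow>
          (AE t in lebesgue_on param_box. represents \<Omega> (g t) (affine_param f0 f t)) \<longrightarrow>
          weak_solution \<Omega> (affine_param \<mu>0 \<mu>) (affine_param f0 f) u \<longrightarrow>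
            u \<in> bochner_Hk k (Hm m \<Omega>) \<and>
            bochner_deriv_sum k (Hm m \<Omega>) u
              \<le> C * bochner_deriv_sum (min k 1) (Hm (m - 2) \<Omega>) g))"
proof -
  have "open \<Omega> \<and> bounded \<Omega>"
    using dom polytope_imp_bounded bounded_interior
    by (auto simp: convex_polyhedral_domain_def C11_domain_def)
  then interpret parametric_problem \<Omega> \<mu>0 \<mu> \<mu>min \<mu>max
    using mu0 mui mu_pos mu_bounds by unfold_locales auto
  show ?thesis
    by (intro conjI ballI allI impI)
       (rule weak_solution_ex_unique regularity_H10 regularity_Hm; assumption)+
qed

end
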